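(* Consider the Sinus flow $U(y)=(1+\cos(\pi y))/2$ on $[-1,1]$, $\beta\in\mathbb{R}$, $U_\beta=\frac12-\frac\beta{\pi^2}$, and let $\alpha>0$ be an unstable wave number. Consider the linearized equation $\partial_t\omega=JL\omega$, i.e. $\partial_t\omega+(U-U_\beta)\partial_x\omega-(\beta-U'')\partial_x\psi=0$ with $\psi=(-\Delta)^{-1}\omega$, $\vec u=(\partial_y\psi,-\partial_x\psi)$, on $S_{2\pi/\alpha}\times[-1,1]$. (i) If $|\alpha l|\ne\sqrt3\pi/2$ for all $l\in\mathbb{Z}$, then $\frac1T\int_0^T\|\vec u(t)\|_{L^2}^2\,dt\to0$ as $T\to\infty$ for every solution with $\omega(0)\in E^c$. (ii) If $|\alpha l|=\sqrt3\pi/2$ for some $l\in\mathbb{Z}$, then $\frac1T\int_0^T\|\vec u_1(t)\|_{L^2}^2\,dt\to0$ as $T\to\infty$, where $\vec u_1(t)$ is the velocity corresponding to $(I-P_1)\omega(t)$ with $\omega(0)\in E^c$, and $P_1$ is the ($L^2$-orthogonal) projection of $X$ onto $\ker L=\mathrm{span}\{e^{\pm i\frac{\sqrt3\pi}{2}x}\cos(\pi y/2)\}$.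
   Context: $\alpha$ is an unstable wave number if there is a nontrivial solution of $-\phi''+\alpha^2\phi-\frac{\beta-U''}{U-c}\phi=0$ on $(-1,1)$, $\phi(\pm1)=0$, with $\operatorname{Im}c>0$. $S_{2\pi/\alpha}$ is the circle of length $2\pi/\alpha$ in $x$; $(-\Delta)^{-1}$ uses Dirichlet conditions at $y=\pm1$. $X=\{\omega\in L^2(S_{2\pi/\alpha}\times[-1,1])$ with zero $x$-average$\}$, $J=-(\beta-U'')\partial_x$, $L=\frac1{\pi^2}-(-\Delta)^{-1}$, $\langle f,g\rangle$ the $L^2$ inner product. $E^s$, $E^u\subset X$ are the stable and unstable eigenspaces of $JL$ (spans of generalized eigenvectors for eigenvalues with negative, resp. positive, real part), and the center space is $E^c=\{\omega\in X:\langle L\omega,\omega_1\rangle=0\ \forall\,\omega_1\in E^s\oplus E^u\}$. *)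

theory Defs
  imports "HOL-Analysis.Analysis"
begin

definition U :: "real \<Rightarrow> real" where
  "U y = (1 + cos (pi * y)) / 2"

definition Upp :: "real \<Rightarrow> real" where
  "Upp y = deriv (deriv U) y"

text \<open>Unstable wave number: nontrivial classical solution of the Rayleigh-Kuo type
  boundary value problem on (-1,1) with Dirichlet data and Im c > 0.\<close>
definition unstable_wn :: "real \<Rightarrow> real \<Rightarrow> bool" where
  "unstable_wn \<beta> \<alpha> \<longleftrightarrow>
     (\<exists>(c::complex) (\<phi>::real \<Rightarrow> complex) \<phi>' \<phi>''. Im c > 0 \<and>
        continuous_on {-1..1} \<phi> \<and> \<phi> (-1) = 0 \<and> \<phi> 1 = 0 \<and>
        (\<exists>y\<in>{-1<..<1}. \<phi> y \<noteq> 0) \<and>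
        (\<forall>y\<in>{-1<..<1}. (\<phi> has_vector_derivative \<phi>' y) (at y) \<and>
            (\<phi>' has_vector_derivative \<phi>'' y) (at y) \<and>
            - \<phi>'' y + complex_of_real (\<alpha>\<^sup>2) * \<phi> y
              - (complex_of_real (\<beta> - Upp y) / (complex_of_real (U y) - c)) * \<phi> y = 0))"

definition Omega :: "real \<Rightarrow> (real \<times> real) set" where
  "Omega p = {0..p} \<times> {-1..1}"

definition in_L2 :: "real \<Rightarrow> (real \<times> real \<Rightarrow> 'a::{banach,second_countable_topology}) \<Rightarrow> bool" where
  "in_L2 p f \<longleftrightarrow> set_borel_measurable lborel (Omega p) f \<and>
     set_integrable lborel (Omega p) (\<lambda>z. (norm (f z))\<^sup>2)"

text \<open>The space X (and its complexification when 'a = complex): L^2 with zero x-average.\<close>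
definition inX :: "real \<Rightarrow> (real \<times> real \<Rightarrow> 'a::{banach,second_countable_topology}) \<Rightarrow> bool" where
  "inX p f \<longleftrightarrow> in_L2 p f \<and>
     (AE y in lborel. y \<in> {-1..1} \<longrightarrow> (LINT x:{0..p}|lborel. f (x, y)) = 0)"

definition ae_eq :: "real \<Rightarrow> (real \<times> real \<Rightarrow> 'a) \<Rightarrow> (real \<times> real \<Rightarrow> 'a) \<Rightarrow> bool" where
  "ae_eq p f g \<longleftrightarrow> (AE z in lborel. z \<in> Omega p \<longrightarrow> f z = g z)"

definition ip :: "real \<Rightarrow> (real \<times> real \<Rightarrow> real) \<Rightarrow> (real \<times> real \<Rightarrow> real) \<Rightarrow> real" where
  "ip p f g = (LINT z:Omega p|lborel. f z * g z)"

definition px :: "(real \<times> real \<Rightarrow> real) \<Rightarrow> real \<times> real \<Rightarrow> real" where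
  "px f = (\<lambda>(x, y). deriv (\<lambda>s. f (s, y)) x)"

definition py :: "(real \<times> real \<Rightarrow> real) \<Rightarrow> real \<times> real \<Rightarrow> real" where
  "py f = (\<lambda>(x, y). deriv (\<lambda>s. f (x, s)) y)"

definition lap :: "(real \<times> real \<Rightarrow> real) \<Rightarrow> real \<times> real \<Rightarrow> real" where
  "lap f = (\<lambda>z. px (px f) z + py (py f) z)"

definition C2 :: "(real \<times> real \<Rightarrow> real) \<Rightarrow> bool" where
  "C2 f \<longleftrightarrow> continuous_on UNIV f \<and>
     (\<forall>g\<in>{f, px f, py f}. \<forall>x y. (\<lambda>s. g (s, y)) differentiable (at x) \<and>
                                   (\<lambda>s. g (x, s)) differentiable (at y)) \<and>
     (\<forall>g\<in>{px f, py f, px (px f), px (py f), py (px f), py (py f)}. continuous_on UNIV g)"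

definition test :: "real \<Rightarrow> (real \<times> real \<Rightarrow> real) \<Rightarrow> bool" where
  "test p \<phi> \<longleftrightarrow> C2 \<phi> \<and> (\<forall>x y. \<phi> (x + p, y) = \<phi> (x, y))"

definition test0 :: "real \<Rightarrow> (real \<times> real \<Rightarrow> real) \<Rightarrow> bool" where
  "test0 p \<phi> \<longleftrightarrow> test p \<phi> \<and> (\<forall>x. \<phi> (x, -1) = 0 \<and> \<phi> (x, 1) = 0)"

text \<open>psi = (-Delta)^{-1} omega with Dirichlet conditions at y = -1, 1 (weak formulation;
  the Dirichlet condition on psi is encoded by testing against functions vanishing on the boundary).\<close>
definition inv_lap :: "real \<Rightarrow> (real \<times> real \<Rightarrow> 'a::{banach,second_countable_topology})
    \<Rightarrow> (real \<times> real \<Rightarrow> 'a) \<Rightarrow> bool" where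
  "inv_lap p \<omega> \<psi> \<longleftrightarrow> in_L2 p \<psi> \<and>
     (\<forall>\<phi>. test0 p \<phi> \<longrightarrow>
        (LINT z:Omega p|lborel. (- lap \<phi> z) *\<^sub>R \<psi> z) = (LINT z:Omega p|lborel. \<phi> z *\<^sub>R \<omega> z))"

definition invlap :: "real \<Rightarrow> (real \<times> real \<Rightarrow> real) \<Rightarrow> real \<times> real \<Rightarrow> real" where
  "invlap p \<omega> = (SOME \<psi>. inv_lap p \<omega> \<psi>)"

definition weak_dx :: "real \<Rightarrow> (real \<times> real \<Rightarrow> real) \<Rightarrow> (real \<times> real \<Rightarrow> real) \<Rightarrow> bool" where
  "weak_dx p f g \<longleftrightarrow> in_L2 p g \<and>
     (\<forall>\<phi>. test p \<phi> \<longrightarrow> ip p \<phi> g = - ip p (px \<phi>) f)"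

definition weak_dy :: "real \<Rightarrow> (real \<times> real \<Rightarrow> real) \<Rightarrow> (real \<times> real \<Rightarrow> real) \<Rightarrow> bool" where
  "weak_dy p f g \<longleftrightarrow> in_L2 p g \<and>
     (\<forall>\<phi>. test0 p \<phi> \<longrightarrow> ip p \<phi> g = - ip p (py \<phi>) f)"

definition wdx :: "real \<Rightarrow> (real \<times> real \<Rightarrow> real) \<Rightarrow> real \<times> real \<Rightarrow> real" where
  "wdx p f = (SOME g. weak_dx p f g)"

definition wdy :: "real \<Rightarrow> (real \<times> real \<Rightarrow> real) \<Rightarrow> real \<times> real \<Rightarrow> real" where
  "wdy p f = (SOME g. weak_dy p f g)"

definition vel_sq :: "real \<Rightarrow> (real \<times> real \<Rightarrow> real) \<Rightarrow> real" where
  "vel_sq p \<omega> = (let \<psi> = invlap p \<omega> in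
      LINT z:Omega p|lborel. (wdy p \<psi> z)\<^sup>2 + (- wdx p \<psi> z)\<^sup>2)"

definition Lop :: "real \<Rightarrow> (real \<times> real \<Rightarrow> real) \<Rightarrow> real \<times> real \<Rightarrow> real" where
  "Lop p \<omega> = (\<lambda>z. \<omega> z / pi\<^sup>2 - invlap p \<omega> z)"

text \<open>JL omega = eta, where J = -(beta - U'') d_x (weak / distributional sense in x):
  for all test functions phi,  <eta, phi> = <(beta - U'') L omega, d_x phi>.\<close>
definition JL_rel :: "real \<Rightarrow> real \<Rightarrow> (real \<times> real \<Rightarrow> 'a::{banach,second_countable_topology})
    \<Rightarrow> (real \<times> real \<Rightarrow> 'a) \<Rightarrow> bool" where
  "JL_rel \<beta> p \<omega> \<eta> \<longleftrightarrow> in_L2 p \<omega> \<and> in_L2 p \<eta> \<and>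
     (\<exists>\<psi>. inv_lap p \<omega> \<psi> \<and>
       (\<forall>\<phi>. test p \<phi> \<longrightarrow>
          (LINT z:Omega p|lborel. \<phi> z *\<^sub>R \<eta> z) =
          (LINT z:Omega p|lborel. ((\<beta> - Upp (snd z)) * px \<phi> z) *\<^sub>R ((1 / pi\<^sup>2) *\<^sub>R \<omega> z - \<psi> z))))"

text \<open>Generalized eigenvector of JL (on the complexification of X) for eigenvalue lam:
  v nonzero and (JL - lam)^k v = 0 for some k.\<close>
definition gen_eig :: "real \<Rightarrow> real \<Rightarrow> complex \<Rightarrow> (real \<times> real \<Rightarrow> complex) \<Rightarrow> bool" where
  "gen_eig \<beta> p lam v \<longleftrightarrow> inX p v \<and> \<not> ae_eq p v (\<lambda>_. 0) \<and>
     (\<exists>k (vs :: nat \<Rightarrow> real \<times> real \<Rightarrow> complex). vs 0 = v \<and>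
        (\<forall>j<k. inX p (vs j) \<and> JL_rel \<beta> p (vs j) (\<lambda>z. vs (Suc j) z + lam * vs j z)) \<and>
        ae_eq p (vs k) (\<lambda>_. 0))"

definition Espace :: "real \<Rightarrow> real \<Rightarrow> (complex \<Rightarrow> bool) \<Rightarrow> (real \<times> real \<Rightarrow> real) set" where
  "Espace \<beta> p P = {\<omega>. inX p \<omega> \<and>
     (\<exists>n (ls :: nat \<Rightarrow> complex) (vs :: nat \<Rightarrow> real \<times> real \<Rightarrow> complex) (cs :: nat \<Rightarrow> complex). (\<forall>j<n. P (ls j) \<and> gen_eig \<beta> p (ls j) (vs j)) \<and>
        ae_eq p (\<lambda>z. complex_of_real (\<omega> z)) (\<lambda>z. \<Sum>j<n. cs j * vs j z))}"

definition Es :: "real \<Rightarrow> real \<Rightarrow> (real \<times> real \<Rightarrow> real) set" where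
  "Es \<beta> p = Espace \<beta> p (\<lambda>lam. Re lam < 0)"

definition Eu :: "real \<Rightarrow> real \<Rightarrow> (real \<times> real \<Rightarrow> real) set" where
  "Eu \<beta> p = Espace \<beta> p (\<lambda>lam. Re lam > 0)"

definition Ec :: "real \<Rightarrow> real \<Rightarrow> (real \<times> real \<Rightarrow> real) set" where
  "Ec \<beta> p = {\<omega>. inX p \<omega> \<and>
     (\<forall>\<omega>1 \<in> {(\<lambda>z. a z + b z) | a b. a \<in> Es \<beta> p \<and> b \<in> Eu \<beta> p}. ip p (Lop p \<omega>) \<omega>1 = 0)}"

text \<open>Weak (= mild) solutions on t >= 0: continuous in L^2 with values in X, satisfying the
  equation tested against test functions in integrated form.\<close>
definition weak_sol :: "real \<Rightarrow> real \<Rightarrow> (real \<Rightarrow> real \<times> real \<Rightarrow> real) \<Rightarrow> bool" where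
  "weak_sol \<beta> p \<omega> \<longleftrightarrow>
     (\<forall>t\<ge>0. inX p (\<omega> t)) \<and>
     (\<forall>t\<ge>0. ((\<lambda>s. LINT z:Omega p|lborel. (\<omega> s z - \<omega> t z)\<^sup>2) \<longlongrightarrow> 0) (at t within {0..})) \<and>
     (\<forall>\<phi> t. test p \<phi> \<and> t \<ge> 0 \<longrightarrow>
        ip p (\<omega> t) \<phi> - ip p (\<omega> 0) \<phi> =
        integral {0..t} (\<lambda>s. LINT z:Omega p|lborel. (\<beta> - Upp (snd z)) * px \<phi> z * Lop p (\<omega> s) z))"

definition ekc :: "real \<times> real \<Rightarrow> real" where
  "ekc = (\<lambda>(x, y). cos (sqrt 3 * pi / 2 * x) * cos (pi * y / 2))"

definition eks :: "real \<times> real \<Rightarrow> real" where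
  "eks = (\<lambda>(x, y). sin (sqrt 3 * pi / 2 * x) * cos (pi * y / 2))"

text \<open>L^2-orthogonal projection onto span{ekc, eks} (an orthogonal pair on the cylinder when
  sqrt 3 pi / 2 is an integer multiple of alpha).\<close>
definition P1 :: "real \<Rightarrow> (real \<times> real \<Rightarrow> real) \<Rightarrow> real \<times> real \<Rightarrow> real" where
  "P1 p \<omega> = (\<lambda>z. (ip p \<omega> ekc / ip p ekc ekc) * ekc z + (ip p \<omega> eks / ip p eks eks) * eks z)"

end

theory Submission
  imports Defs "HOL-Complex_Analysis.Great_Picard"
begin

text \<open>In the orthonormal basis \<open>eb (l, n)\<close> of trigonometric functions in \<open>x\<close> times Dirichlet sines in \<open>y\<close>,
  a solution splits into pairs \<open>(P, Q)\<close> of \<open>\<ell>\<^sup>2\<close> vectors with \<open>P' = - a A Q\<close>, \<open>Q' = a A P\<close>,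
  \<open>a = \<alpha> l\<close>, where \<open>A = K L\<close> is multiplication by \<open>\<beta> - U''\<close> composed with a diagonal operator whose entries
  are positive except possibly the first one. The relation \<open>\<pi>\<^sup>2 (U - U\<^sub>\<beta>) = \<beta> - U''\<close> turns an unstable mode
  into a complex eigenpair of \<open>A\<close>, and such a pair is isotropic for the energy \<open>\<langle>L x, x\<rangle>\<close>. Since the energy has at
  most one negative direction, it is coercive on the complement of the eigenpair. If the first entry is negative for some
  wave number \<open>a \<ge> \<alpha>\<close>, an eigenpair for \<open>a\<close> exists: the eigenvalue problem is a three-term recurrence, whose
  truncations are solved by Brouwer's theorem. The complement is invariant, the operator is
  self-adjoint there for the energy inner product, and it has no eigenvectors (no neutral modes other than \<open>ker L\<close>).
  Hence the time averages of \<open>P \<otimes> P + Q \<otimes> Q\<close> can only accumulate at positive trace class forms commuting with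
  \<open>A\<close>, and a nonzero one would have an eigenvector of \<open>A\<close> (the RAGE theorem). Conservation of energy
  bounds the vorticity uniformly in time, which controls the high modes of the velocity.\<close>

section \<open>Square-integrable functions and orthonormal systems\<close>

text \<open>The center space is cut out only by eigenvectors that exist. If the first entry of L is
  negative at a wave number a and A had no non-real eigenvalue there, that mode would carry no
  condition, and an indefinite energy bounds nothing. Hence instability, assumed at alpha alone,
  must be carried to every such a >= alpha; the link is the absence of neutral modes. A real
  eigenvalue kappa of A corresponds to a wave speed c. If c lies in the open range of U, the
  eigenvalue equation is a recurrence whose solutions oscillate without decay. Otherwise the form <G
  v, v> - <K v, v> / kappa, with G the inverse of L, has the eigenvector in its kernel and is
  positive on a complementary hyperplane, hence is nonnegative; it can only grow when a decreases to
  alpha, where the isotropic eigenpair contradicts its sign. So the eigenvalue which a single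
  negative direction forces at a (Pontryagin) must be non-real. The bounds must also be uniform over
  infinitely many modes: all but finitely many have a positive first entry, bounded below, which is
  itself the coercivity constant.\<close>

definition L2 :: "'a measure \<Rightarrow> ('a \<Rightarrow> real) \<Rightarrow> bool" where
  "L2 M f \<longleftrightarrow> f \<in> borel_measurable M \<and> integrable M (\<lambda>x. (f x)\<^sup>2)"

lemma L2_measurable: "L2 M f \<Longrightarrow> f \<in> borel_measurable M"
  and L2_sq: "L2 M f \<Longrightarrow> integrable M (\<lambda>x. (f x)\<^sup>2)"
  by (auto simp: L2_def)

lemma L2_mult:
  assumes "L2 M f" "L2 M g"
  shows "integrable M (\<lambda>x. f x * g x)"
proof (rule Bochner_Integration.integrable_bound)
  show "integrable M (\<lambda>x. (f x)\<^sup>2 + (g x)\<^sup>2)" using assms by (intro Bochner_Integration.integrable_add L2_sq)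
  show "AE x in M. norm (f x * g x) \<le> norm ((f x)\<^sup>2 + (g x)\<^sup>2)"
  proof (rule AE_I2)
    fix x
    have "2 * (\<bar>f x\<bar> * \<bar>g x\<bar>) \<le> (f x)\<^sup>2 + (g x)\<^sup>2" using sum_squares_bound[of "\<bar>f x\<bar>" "\<bar>g x\<bar>"] by (simp add: mult.assoc)
    moreover have "0 \<le> \<bar>f x\<bar> * \<bar>g x\<bar>" by simp
    ultimately have "\<bar>f x\<bar> * \<bar>g x\<bar> \<le> (f x)\<^sup>2 + (g x)\<^sup>2" by linarith
    then show "norm (f x * g x) \<le> norm ((f x)\<^sup>2 + (g x)\<^sup>2)" by (simp add: abs_mult)
  qed
qed (use assms in \<open>auto simp: L2_def\<close>)

lemma L2_add:
  assumes "L2 M f" "L2 M g"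
  shows "L2 M (\<lambda>x. f x + g x)"
proof -
  have "integrable M (\<lambda>x. (f x)\<^sup>2 + (g x)\<^sup>2 + 2 * (f x * g x))"
    using assms by (intro Bochner_Integration.integrable_add integrable_mult_right L2_sq L2_mult)
  then show ?thesis using assms by (auto simp: L2_def power2_sum algebra_simps)
qed

lemma L2_cmult: "L2 M f \<Longrightarrow> L2 M (\<lambda>x. c * f x)"
  by (auto simp: L2_def power_mult_distrib)

lemma L2_zero: "L2 M (\<lambda>x. 0)"
  by (simp add: L2_def)

lemma L2_diff: "L2 M f \<Longrightarrow> L2 M g \<Longrightarrow> L2 M (\<lambda>x. f x - g x)"
  using L2_add[of M f "\<lambda>x. - 1 * g x"] L2_cmult[of M g "- 1"] by simp

lemma L2_sum: "(\<And>i. i \<in> F \<Longrightarrow> L2 M (f i)) \<Longrightarrow> L2 M (\<lambda>x. \<Sum>i\<in>F. f i x)"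
  by (induction F rule: infinite_finite_induct) (auto intro: L2_zero L2_add)

lemma L2_bounded_mult:
  assumes f: "L2 M f" and g: "g \<in> borel_measurable M" "\<And>x. x \<in> space M \<Longrightarrow> \<bar>g x\<bar> \<le> C"
  shows "L2 M (\<lambda>x. g x * f x)"
proof -
  have "integrable M (\<lambda>x. (g x * f x)\<^sup>2)"
  proof (rule Bochner_Integration.integrable_bound)
    show "integrable M (\<lambda>x. C\<^sup>2 * (f x)\<^sup>2)" using f by (intro integrable_mult_right L2_sq)
    show "AE x in M. norm ((g x * f x)\<^sup>2) \<le> norm (C\<^sup>2 * (f x)\<^sup>2)"
    proof (rule AE_I2)
      fix x assume "x \<in> space M"
      then have "\<bar>g x\<bar>\<^sup>2 \<le> C\<^sup>2" using g(2) by (intro power_mono) auto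
      then show "norm ((g x * f x)\<^sup>2) \<le> norm (C\<^sup>2 * (f x)\<^sup>2)"
        by (simp add: power_mult_distrib abs_mult mult_right_mono)
    qed
  qed (use f g in \<open>auto simp: L2_def\<close>)
  then show ?thesis using f g by (auto simp: L2_def)
qed

definition ips :: "'a measure \<Rightarrow> ('a \<Rightarrow> real) \<Rightarrow> ('a \<Rightarrow> real) \<Rightarrow> real" where
  "ips M f g = integral\<^sup>L M (\<lambda>x. f x * g x)"

lemma ips_commute: "ips M f g = ips M g f"
  by (simp add: ips_def mult.commute)

lemma ips_add: "L2 M f \<Longrightarrow> L2 M g \<Longrightarrow> L2 M h \<Longrightarrow> ips M (\<lambda>x. f x + g x) h = ips M f h + ips M g h"
  unfolding ips_def by (simp add: distrib_right L2_mult)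

lemma ips_diff: "L2 M f \<Longrightarrow> L2 M g \<Longrightarrow> L2 M h \<Longrightarrow> ips M (\<lambda>x. f x - g x) h = ips M f h - ips M g h"
  unfolding ips_def by (simp add: left_diff_distrib L2_mult)

lemma ips_cmult: "ips M (\<lambda>x. c * f x) h = c * ips M f h"
  unfolding ips_def by (simp add: mult.assoc)

lemma ips_sum:
  assumes "\<And>i. i \<in> F \<Longrightarrow> L2 M (f i)" "L2 M h"
  shows "ips M (\<lambda>x. \<Sum>i\<in>F. f i x) h = (\<Sum>i\<in>F. ips M (f i) h)"
  unfolding ips_def sum_distrib_right using assms by (intro Bochner_Integration.integral_sum L2_mult) auto

lemma ips_nonneg: "ips M f f \<ge> 0"
  unfolding ips_def by simp

lemma ips_cong_AE:
  assumes "L2 M f" "L2 M g" "L2 M h" "AE x in M. f x = g x"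
  shows "ips M f h = ips M g h"
  unfolding ips_def using assms by (intro integral_cong_AE) (auto simp: L2_def)

lemma ips_cauchy_schwarz:
  assumes f: "L2 M f" and g: "L2 M g"
  shows "(ips M f g)\<^sup>2 \<le> ips M f f * ips M g g"
proof -
  have q: "0 \<le> ips M f f + 2 * t * ips M f g + t\<^sup>2 * ips M g g" for t
  proof -
    have tg: "L2 M (\<lambda>x. t * g x)" by (intro L2_cmult g)
    have h: "L2 M (\<lambda>x. f x + t * g x)" by (intro L2_add f tg)
    have "ips M (\<lambda>x. f x + t * g x) (\<lambda>x. f x + t * g x) = ips M f (\<lambda>x. f x + t * g x) + t * ips M g (\<lambda>x. f x + t * g x)"
      by (simp add: ips_add[OF f tg h] ips_cmult)
    also have "ips M f (\<lambda>x. f x + t * g x) = ips M f f + t * ips M f g"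
      unfolding ips_commute[of M f "\<lambda>x. f x + t * g x"] ips_add[OF f tg f] ips_cmult ips_commute[of M g f] ..
    also have "ips M g (\<lambda>x. f x + t * g x) = ips M f g + t * ips M g g"
      unfolding ips_commute[of M g "\<lambda>x. f x + t * g x"] ips_add[OF f tg g] ips_cmult ..
    finally show ?thesis using ips_nonneg[of M "\<lambda>x. f x + t * g x"] by (simp add: power2_eq_square algebra_simps)
  qed
  show ?thesis
  proof (cases "ips M g g = 0")
    case True
    have "ips M f g = 0"
    proof (rule ccontr)
      assume "ips M f g \<noteq> 0"
      \<comment> \<open>At this t the right-hand side of \<open>q\<close> equals -1.\<close>
      then show False using q[of "- (ips M f f + 1) / (2 * ips M f g)"] True by (simp add: field_simps)
    qed
    then show ?thesis using True by simp
  next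
    case False
    then have "ips M g g > 0" using ips_nonneg[of M g] by simp
    then show ?thesis using q[of "- ips M f g / ips M g g"] by (simp add: field_simps power2_eq_square)
  qed
qed

section \<open>Orthonormal sequences: Bessel, Riesz-Fischer, Parseval\<close>

locale orthonormal_seq =
  fixes M :: "'a measure" and e :: "nat \<Rightarrow> 'a \<Rightarrow> real"
  assumes fin: "finite_measure M" and eL2: "\<And>i. L2 M (e i)"
    and orth: "\<And>i j. ips M (e i) (e j) = (if i = j then 1 else 0)"
begin

definition psum :: "(nat \<Rightarrow> real) \<Rightarrow> nat \<Rightarrow> 'a \<Rightarrow> real" where
  "psum c n x = (\<Sum>i<n. c i * e i x)"

lemma psum_L2: "L2 M (psum c n)"
  unfolding psum_def[abs_def] by (intro L2_sum L2_cmult eL2)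

lemma ips_psum: "L2 M f \<Longrightarrow> ips M (psum c n) f = (\<Sum>i<n. c i * ips M (e i) f)"
  unfolding psum_def[abs_def] by (subst ips_sum) (auto intro!: L2_cmult eL2 simp: ips_cmult)

lemma ips_psum_e: "ips M (psum c n) (e j) = (if j < n then c j else 0)"
  by (simp add: ips_psum eL2 orth if_distrib cong: if_cong)

lemma psum_diff_norm:
  assumes "m \<le> n"
  shows "ips M (\<lambda>x. psum c n x - psum c m x) (\<lambda>x. psum c n x - psum c m x) = (\<Sum>i\<in>{m..<n}. (c i)\<^sup>2)"
proof -
  have eq: "psum c n x - psum c m x = (\<Sum>i\<in>{m..<n}. c i * e i x)" for x
    unfolding psum_def using sum_diff_nat_ivl[of 0 m n "\<lambda>i. c i * e i x"] assms by (simp add: atLeast0LessThan)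
  have L: "L2 M (\<lambda>x. \<Sum>i\<in>{m..<n}. c i * e i x)" by (intro L2_sum L2_cmult eL2)
  have "ips M (\<lambda>x. \<Sum>i\<in>{m..<n}. c i * e i x) (\<lambda>x. \<Sum>i\<in>{m..<n}. c i * e i x)
      = (\<Sum>i\<in>{m..<n}. c i * ips M (e i) (\<lambda>x. \<Sum>i\<in>{m..<n}. c i * e i x))"
    by (subst ips_sum) (auto intro!: L2_cmult eL2 L simp: ips_cmult)
  also have "\<dots> = (\<Sum>i\<in>{m..<n}. c i * (\<Sum>j\<in>{m..<n}. c j * ips M (e j) (e i)))"
    by (subst ips_commute, subst ips_sum) (auto intro!: L2_cmult eL2 simp: ips_cmult)
  also have "\<dots> = (\<Sum>i\<in>{m..<n}. (c i)\<^sup>2)"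
    by (intro sum.cong) (simp_all add: orth power2_eq_square if_distrib cong: if_cong)
  finally show ?thesis unfolding eq .
qed

lemma bessel:
  assumes f: "L2 M f"
  shows "(\<Sum>i<n. (ips M f (e i))\<^sup>2) \<le> ips M f f"
proof -
  define c where "c i = ips M f (e i)" for i
  define d where "d x = f x - psum c n x" for x
  have d: "L2 M d" unfolding d_def[abs_def] by (intro L2_diff f psum_L2)
  have pp: "ips M (psum c n) (psum c n) = (\<Sum>i<n. (c i)\<^sup>2)"
    using psum_diff_norm[of 0 n c] by (simp add: psum_def[abs_def] atLeast0LessThan)
  have pf: "ips M (psum c n) f = (\<Sum>i<n. (c i)\<^sup>2)"
    unfolding ips_psum[OF f] c_def power2_eq_square ips_commute[of M f] ..
  have "ips M d d = ips M f d - ips M (psum c n) d"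
    unfolding d_def[abs_def] by (rule ips_diff) (intro f psum_L2 L2_diff)+
  also have "ips M f d = ips M f f - ips M (psum c n) f"
    by (subst ips_commute) (simp add: d_def[abs_def] ips_diff f psum_L2)
  also have "ips M (psum c n) d = ips M f (psum c n) - ips M (psum c n) (psum c n)"
    by (subst ips_commute) (simp add: d_def[abs_def] ips_diff f psum_L2)
  finally have "ips M d d = ips M f f - (\<Sum>i<n. (c i)\<^sup>2)"
    by (simp add: pp pf ips_commute[of M f "psum c n"])
  then show ?thesis using ips_nonneg[of M d] by (simp add: c_def)
qed

lemma summable_coeffs: "L2 M f \<Longrightarrow> summable (\<lambda>i. (ips M f (e i))\<^sup>2)"
  using bessel by (intro summableI_nonneg_bounded) auto

text \<open>The partial sums are Cauchy in L^2, hence in L^1 because the measure is finite. An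
  almost everywhere convergent subsequence supplies the limit function, and Fatou's lemma bounds its
  L^2 distance to each partial sum by a tail of the series of squares.\<close>

lemma riesz_fischer:
  assumes c: "summable (\<lambda>i. (c i)\<^sup>2)"
  obtains f where "L2 M f" "\<And>g. L2 M g \<Longrightarrow> (\<lambda>n. ips M (psum c n) g) \<longlonglongrightarrow> ips M f g"
    "\<And>i. ips M f (e i) = c i" "ips M f f = (\<Sum>i. (c i)\<^sup>2)"
proof -
  interpret finite_measure M by (rule fin)
  define tail where "tail m = (\<Sum>i. (c (i + m))\<^sup>2)" for m
  have tail0: "tail \<longlonglongrightarrow> 0" unfolding tail_def[abs_def] using suminf_exist_split2[OF c] .
  have tail_nonneg: "tail m \<ge> 0" for m
    unfolding tail_def using c by (intro suminf_nonneg) (simp_all add: summable_iff_shift[of "\<lambda>i. (c i)\<^sup>2" m])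
  have tl: "ips M (\<lambda>x. psum c n x - psum c m x) (\<lambda>x. psum c n x - psum c m x) \<le> tail m" if "m \<le> n" for m n
  proof -
    have s: "summable (\<lambda>i. (c (i + m))\<^sup>2)" using c by (simp add: summable_iff_shift[of "\<lambda>i. (c i)\<^sup>2" m])
    have "(\<Sum>i\<in>{m..<n}. (c i)\<^sup>2) = (\<Sum>i<n - m. (c (i + m))\<^sup>2)"
      using sum.shift_bounds_nat_ivl[of "\<lambda>i. (c i)\<^sup>2" 0 m "n - m"] that by (simp add: atLeast0LessThan)
    also have "\<dots> \<le> tail m" unfolding tail_def by (intro sum_le_suminf s) auto
    finally show ?thesis by (simp add: psum_diff_norm[OF that])
  qed
  have one: "L2 M (\<lambda>_. 1)" by (simp add: L2_def)
  define m1 where "m1 = measure M (space M)"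
  have L1: "(LINT x|M. norm (psum c n x - psum c m x)) \<le> sqrt (tail m * m1)" if "m \<le> n" for m n
  proof -
    have a: "L2 M (\<lambda>x. \<bar>psum c n x - psum c m x\<bar>)"
      using L2_diff[OF psum_L2[of c n] psum_L2[of c m]] by (auto simp: L2_def)
    have "(ips M (\<lambda>x. \<bar>psum c n x - psum c m x\<bar>) (\<lambda>_. 1))\<^sup>2
      \<le> ips M (\<lambda>x. \<bar>psum c n x - psum c m x\<bar>) (\<lambda>x. \<bar>psum c n x - psum c m x\<bar>) * ips M (\<lambda>_. 1) (\<lambda>_. 1)"
      by (rule ips_cauchy_schwarz[OF a one])
    also have "\<dots> \<le> tail m * m1"
      using tl[OF that] tail_nonneg[of m] by (intro mult_mono) (auto simp: ips_def m1_def)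
    finally show ?thesis by (intro real_le_rsqrt) (simp add: ips_def)
  qed
  have int: "integrable M (psum c n)" for n
    using L2_mult[OF psum_L2 one] by simp
  obtain r where r: "strict_mono r" "AE x in M. Cauchy (\<lambda>i. psum c (r i) x)"
  proof (rule cauchy_L1_AE_cauchy_subseq[of M "psum c", OF int])
    fix d :: real assume d: "d > 0"
    have "(\<lambda>m. sqrt (tail m * m1)) \<longlonglongrightarrow> sqrt (0 * m1)" by (intro tendsto_intros tail0)
    then have "\<forall>\<^sub>F m in sequentially. sqrt (tail m * m1) < d" using d by (intro order_tendstoD(2)) auto
    then obtain N where N: "\<And>m. m \<ge> N \<Longrightarrow> sqrt (tail m * m1) < d" by (auto simp: eventually_sequentially)
    have "(LINT x|M. norm (psum c i x - psum c j x)) < d" if "i \<ge> N" "j \<ge> N" for i j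
    proof (cases "j \<le> i")
      case True then show ?thesis using L1[OF True] N[of j] that by simp
    next
      case False
      then have "(LINT x|M. norm (psum c j x - psum c i x)) < d" using L1[of i j] N[of i] that by simp
      then show ?thesis by (simp add: abs_minus_commute)
    qed
    then show "\<exists>N. \<forall>i\<ge>N. \<forall>j\<ge>N. (LINT x|M. norm (psum c i x - psum c j x)) < d" by blast
  qed blast
  define f where "f x = lim (\<lambda>i. psum c (r i) x)" for x
  have [measurable]: "psum c n \<in> borel_measurable M" for n using psum_L2[of c n] by (rule L2_measurable)
  have fm[measurable]: "f \<in> borel_measurable M" unfolding f_def[abs_def] by measurable
  have conv: "AE x in M. (\<lambda>i. psum c (r i) x) \<longlonglongrightarrow> f x"
    using r(2) by eventually_elim (simp add: f_def Cauchy_convergent_iff convergent_LIMSEQ_iff)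
  have fatou: "(\<integral>\<^sup>+x. ennreal ((f x - psum c m x)\<^sup>2) \<partial>M) \<le> ennreal (tail m)" for m
  proof -
    have "(\<integral>\<^sup>+x. ennreal ((f x - psum c m x)\<^sup>2) \<partial>M) = (\<integral>\<^sup>+x. liminf (\<lambda>i. ennreal ((psum c (r i) x - psum c m x)\<^sup>2)) \<partial>M)"
    proof (rule nn_integral_cong_AE)
      show "AE x in M. ennreal ((f x - psum c m x)\<^sup>2) = liminf (\<lambda>i. ennreal ((psum c (r i) x - psum c m x)\<^sup>2))"
        using conv
      proof eventually_elim
        case (elim x)
        have "(\<lambda>i. ennreal ((psum c (r i) x - psum c m x)\<^sup>2)) \<longlonglongrightarrow> ennreal ((f x - psum c m x)\<^sup>2)"
          by (intro tendsto_ennrealI tendsto_intros elim)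
        from lim_imp_Liminf[OF sequentially_bot this] show ?case by simp
      qed
    qed
    also have "\<dots> \<le> liminf (\<lambda>i. \<integral>\<^sup>+x. ennreal ((psum c (r i) x - psum c m x)\<^sup>2) \<partial>M)"
      by (rule nn_integral_liminf) measurable
    also have "\<dots> \<le> ennreal (tail m)"
    proof (rule Liminf_le)
      show "\<forall>\<^sub>F i in sequentially. (\<integral>\<^sup>+x. ennreal ((psum c (r i) x - psum c m x)\<^sup>2) \<partial>M) \<le> ennreal (tail m)"
        using eventually_ge_at_top[of m]
      proof eventually_elim
        case (elim i)
        then have "m \<le> r i" using seq_suble[OF r(1), of i] by simp
        have "(\<integral>\<^sup>+x. ennreal ((psum c (r i) x - psum c m x)\<^sup>2) \<partial>M)
            = ennreal (ips M (\<lambda>x. psum c (r i) x - psum c m x) (\<lambda>x. psum c (r i) x - psum c m x))"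
          unfolding ips_def power2_eq_square[symmetric]
          by (intro nn_integral_eq_integral L2_sq L2_diff psum_L2) auto
        then show ?case using tl[OF \<open>m \<le> r i\<close>] by (simp add: ennreal_leI)
      qed
    qed simp
    finally show ?thesis .
  qed
  have dL2: "L2 M (\<lambda>x. f x - psum c m x)" for m
    unfolding L2_def using fatou[of m]
    by (auto intro!: integrableI_bounded simp: less_top[symmetric] top_unique neq_top_trans[OF ennreal_neq_top])
  have fL2: "L2 M f" using L2_add[OF dL2[of 0] psum_L2[of c 0]] by simp
  have dn: "ips M (\<lambda>x. f x - psum c m x) (\<lambda>x. f x - psum c m x) \<le> tail m" for m
  proof -
    have "(\<integral>\<^sup>+x. ennreal ((f x - psum c m x)\<^sup>2) \<partial>M) = ennreal (ips M (\<lambda>x. f x - psum c m x) (\<lambda>x. f x - psum c m x))"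
      unfolding ips_def power2_eq_square[symmetric] by (intro nn_integral_eq_integral L2_sq dL2) auto
    then show ?thesis using fatou[of m] tail_nonneg[of m] by (simp add: ennreal_le_iff)
  qed
  have wk: "(\<lambda>n. ips M (psum c n) g) \<longlonglongrightarrow> ips M f g" if g: "L2 M g" for g
  proof -
    have b: "\<bar>ips M (psum c n) g - ips M f g\<bar> \<le> sqrt (tail n * ips M g g)" for n
    proof -
      have "\<bar>ips M (\<lambda>x. f x - psum c n x) g\<bar>\<^sup>2 \<le> tail n * ips M g g"
        using order_trans[OF ips_cauchy_schwarz[OF dL2 g] mult_right_mono[OF dn ips_nonneg], of n] by simp
      then have "\<bar>ips M (\<lambda>x. f x - psum c n x) g\<bar> \<le> sqrt (tail n * ips M g g)" by (rule real_le_rsqrt)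
      then show ?thesis by (simp add: ips_diff[OF fL2 psum_L2 g] abs_minus_commute)
    qed
    have "(\<lambda>n. sqrt (tail n * ips M g g)) \<longlonglongrightarrow> sqrt (0 * ips M g g)" by (intro tendsto_intros tail0)
    then have l0: "(\<lambda>n. sqrt (tail n * ips M g g)) \<longlonglongrightarrow> 0" by simp
    have "(\<lambda>n. ips M (psum c n) g - ips M f g) \<longlonglongrightarrow> 0"
      by (rule Lim_null_comparison[OF _ l0]) (use b in simp)
    then show ?thesis by (simp add: LIM_zero_iff)
  qed
  have co: "ips M f (e i) = c i" for i
  proof (rule LIMSEQ_unique[OF wk[OF eL2]])
    have "\<forall>\<^sub>F n in sequentially. c i = ips M (psum c n) (e i)"
      using eventually_gt_at_top[of i] by eventually_elim (simp add: ips_psum_e)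
    then show "(\<lambda>n. ips M (psum c n) (e i)) \<longlonglongrightarrow> c i" using tendsto_eventually[of "\<lambda>n. ips M (psum c n) (e i)" "c i"] 
      by (simp add: eq_commute)
  qed
  have "(\<lambda>n. ips M (psum c n) f) \<longlonglongrightarrow> ips M f f" by (rule wk[OF fL2])
  moreover have "ips M (psum c n) f = (\<Sum>i<n. (c i)\<^sup>2)" for n
    by (simp add: ips_psum fL2 ips_commute[of M "e _" f] co power2_eq_square)
  ultimately have "(\<lambda>n. \<Sum>i<n. (c i)\<^sup>2) \<longlonglongrightarrow> ips M f f" by simp
  then have "ips M f f = (\<Sum>i. (c i)\<^sup>2)" using summable_LIMSEQ[OF c] LIMSEQ_unique by blast
  with that[of f] fL2 wk co show thesis by blast
qed

end

locale complete_orthonormal_seq = orthonormal_seq +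
  assumes complete: "L2 M f \<Longrightarrow> (\<And>i. ips M f (e i) = 0) \<Longrightarrow> AE x in M. f x = 0"
begin

lemma eq_of_coeffs:
  assumes "L2 M f" "L2 M g" "\<And>i. ips M f (e i) = ips M g (e i)"
  shows "AE x in M. f x = g x"
proof -
  have "AE x in M. f x - g x = 0"
    by (rule complete) (use assms in \<open>auto intro: L2_diff simp: ips_diff eL2\<close>)
  then show ?thesis by simp
qed

lemma expansion:
  assumes f: "L2 M f" and g: "L2 M g"
  shows "(\<lambda>i. ips M f (e i) * ips M g (e i)) sums ips M f g"
proof -
  obtain f' where f': "L2 M f'" "\<And>g. L2 M g \<Longrightarrow> (\<lambda>n. ips M (psum (\<lambda>i. ips M f (e i)) n) g) \<longlonglongrightarrow> ips M f' g"
    "\<And>i. ips M f' (e i) = ips M f (e i)"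
    by (rule riesz_fischer[OF summable_coeffs[OF f]]) blast
  have ae: "AE x in M. f' x = f x" by (rule eq_of_coeffs[OF f'(1) f f'(3)])
  have "ips M f' g = ips M f g" by (rule ips_cong_AE[OF f'(1) f g ae])
  with f'(2)[OF g] show ?thesis by (simp add: sums_def ips_psum g ips_commute[of M "e _" g])
qed

lemma parseval:
  assumes f: "L2 M f"
  shows "(\<lambda>i. (ips M f (e i))\<^sup>2) sums ips M f f"
  using expansion[OF f f] by (simp add: power2_eq_square)

end

text \<open>Orthogonality to polynomials in u passes by Stone-Weierstrass to continuous functions of
  u, and by cut-offs to indicators of open sets. The hypothesis \<open>sep\<close> makes each open
  subinterval the preimage of an open set within [a, b]; it still allows u a = u b, as happens for
  periodic functions. Intervals form an intersection-stable generator, so all Borel sets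
  follow.\<close>

lemma vanishing_criterion:
  fixes u :: "real \<Rightarrow> 'b::euclidean_space" and F :: "real \<Rightarrow> real"
  assumes F: "integrable lborel F" and supp: "\<And>x. x \<notin> {a..b} \<Longrightarrow> F x = 0"
    and u: "continuous_on UNIV u"
    and poly: "\<And>q. real_polynomial_function q \<Longrightarrow> (LINT x|lborel. F x * q (u x)) = 0"
    and sep: "\<And>c d. a \<le> c \<Longrightarrow> c < d \<Longrightarrow> d \<le> b \<Longrightarrow> u ` {c<..<d} \<inter> u ` ({a..c} \<union> {d..b}) = {}"
  shows "AE x in lborel. F x = 0"
proof -
  have [measurable]: "F \<in> borel_measurable lborel" "u \<in> borel_measurable borel"
    using F u by (auto intro: borel_measurable_continuous_onI)
  have intF: "integrable lborel (\<lambda>x. F x * g x)"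
    if "g \<in> borel_measurable borel" "\<And>x. x \<in> {a..b} \<Longrightarrow> \<bar>g x\<bar> \<le> C" for g C
  proof (rule Bochner_Integration.integrable_bound)
    show "integrable lborel (\<lambda>x. C * F x)" using F by simp
    show "AE x in lborel. norm (F x * g x) \<le> norm (C * F x)"
    proof (rule AE_I2)
      fix x show "norm (F x * g x) \<le> norm (C * F x)"
        using that(2)[of x] supp[of x] by (cases "x \<in> {a..b}") (auto simp: abs_mult mult.commute[of "\<bar>F x\<bar>"] intro!: mult_right_mono)
    qed
  qed (use that in measurable)
  have cont: "(LINT x|lborel. F x * h (u x)) = 0" if h: "continuous_on UNIV h" for h :: "'b \<Rightarrow> real"
  proof (rule ccontr)
    assume nz: "(LINT x|lborel. F x * h (u x)) \<noteq> 0"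
    define I where "I = (LINT x|lborel. \<bar>F x\<bar>)"
    have I0: "I \<ge> 0" unfolding I_def by simp
    define \<epsilon> where "\<epsilon> = \<bar>LINT x|lborel. F x * h (u x)\<bar> / (I + 1)"
    have eps: "\<epsilon> > 0" using nz I0 by (simp add: \<epsilon>_def)
    have K: "compact (u ` {a..b})" by (intro compact_continuous_image continuous_on_subset[OF u]) auto
    obtain q where q: "real_polynomial_function q" "\<And>z. z \<in> u ` {a..b} \<Longrightarrow> \<bar>h z - q z\<bar> < \<epsilon>"
      by (rule Stone_Weierstrass_real_polynomial_function[OF K continuous_on_subset[OF h] eps]) auto
    have qc: "continuous_on UNIV q" using q(1) by (simp add: continuous_on_polymonial_function real_polynomial_function_eq)
    have [measurable]: "h \<in> borel_measurable borel" "q \<in> borel_measurable borel"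
      using h qc by (auto intro: borel_measurable_continuous_onI)
    have bd: "\<exists>C. \<forall>x\<in>{a..b}. \<bar>g (u x)\<bar> \<le> C" if "continuous_on UNIV g" for g :: "'b \<Rightarrow> real"
    proof -
      have "compact ((\<lambda>x. g (u x)) ` {a..b})"
        by (intro compact_continuous_image continuous_on_compose2[OF that] continuous_on_subset[OF u]) auto
      then show ?thesis by (auto dest!: compact_imp_bounded simp: bounded_iff)
    qed
    obtain C1 where C1: "\<And>x. x \<in> {a..b} \<Longrightarrow> \<bar>h (u x)\<bar> \<le> C1" using bd[OF h] by blast
    obtain C2 where C2: "\<And>x. x \<in> {a..b} \<Longrightarrow> \<bar>q (u x)\<bar> \<le> C2" using bd[OF qc] by blast
    have i1: "integrable lborel (\<lambda>x. F x * h (u x))" by (rule intF[OF _ C1]) measurable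
    have i2: "integrable lborel (\<lambda>x. F x * q (u x))" by (rule intF[OF _ C2]) measurable
    have "(LINT x|lborel. F x * h (u x)) = (LINT x|lborel. F x * h (u x) - F x * q (u x))"
      using i1 i2 poly[OF q(1)] by simp
    also have "\<bar>\<dots>\<bar> \<le> (LINT x|lborel. \<bar>F x * h (u x) - F x * q (u x)\<bar>)" by (rule integral_abs_bound)
    also have "\<dots> \<le> (LINT x|lborel. \<epsilon> * \<bar>F x\<bar>)"
    proof (intro integral_mono)
      fix x show "\<bar>F x * h (u x) - F x * q (u x)\<bar> \<le> \<epsilon> * \<bar>F x\<bar>"
        using supp[of x] q(2)[of "u x"] unfolding right_diff_distrib[symmetric] abs_mult
        by (cases "x \<in> {a..b}") (auto simp: mult.commute[of "\<bar>F x\<bar>"] intro!: mult_right_mono)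
    qed (use i1 i2 F in auto)
    also have "\<dots> = \<epsilon> * I" by (simp add: I_def)
    also have "\<dots> < \<epsilon> * (I + 1)" using eps by simp
    also have "\<dots> = \<bar>LINT x|lborel. F x * h (u x)\<bar>" using I0 by (simp add: \<epsilon>_def)
    finally show False by simp
  qed
  have opn: "(LINT x|lborel. F x * indicator W (u x)) = 0" if W: "open W" "W \<noteq> UNIV" for W
  proof -
    \<comment> \<open>These cut-offs increase to the indicator of W. Since \<open>infdist\<close> to
      the empty set is 0 by convention, they would vanish identically for W = UNIV, which is why W
      \<noteq> UNIV is assumed.\<close>
    define h where "h n z = min 1 (real n * infdist z (- W))" for n z
    have hc: "continuous_on UNIV (h n)" for n unfolding h_def
      by (intro continuous_intros continuous_on_infdist) 
    have [measurable]: "h n \<in> borel_measurable borel" for n using hc by (rule borel_measurable_continuous_onI)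
    have [measurable]: "W \<in> sets borel" using W by simp
    have lim: "(\<lambda>n. h n z) \<longlonglongrightarrow> indicator W z" for z
    proof (cases "z \<in> W")
      case True
      have cl: "closed (- W)" "- W \<noteq> {}" using W by auto
      then have d: "infdist z (- W) > 0"
        using True infdist_pos_not_in_closed[OF cl(1), of z] cl(2) by auto
      obtain N where N: "real N * infdist z (- W) \<ge> 1"
        using reals_Archimedean3[OF d] by (meson less_imp_le)
      have "\<forall>\<^sub>F n in sequentially. h n z = 1"
        using eventually_ge_at_top[of N]
      proof eventually_elim
        case (elim n)
        have "real N * infdist z (- W) \<le> real n * infdist z (- W)" using elim d by (intro mult_right_mono) auto
        then show ?case using N by (simp add: h_def)
      qed
      then show ?thesis using True by (simp add: tendsto_eventually)
    next
      case False
      then have "h n z = 0" for n using infdist_zero[of z "- W"] by (simp add: h_def)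
      then show ?thesis using False by simp
    qed
    have "(\<lambda>n. LINT x|lborel. F x * h n (u x)) \<longlonglongrightarrow> (LINT x|lborel. F x * indicator W (u x))"
    proof (rule integral_dominated_convergence[where w = "\<lambda>x. \<bar>F x\<bar>"])
      show "AE x in lborel. (\<lambda>n. F x * h n (u x)) \<longlonglongrightarrow> F x * indicator W (u x)"
        by (intro AE_I2 tendsto_mult_left lim)
      show "AE x in lborel. norm (F x * h n (u x)) \<le> \<bar>F x\<bar>" for n
        by (intro AE_I2) (auto simp: h_def abs_mult infdist_nonneg intro!: mult_left_le)
    qed (use F in auto)
    moreover have "(LINT x|lborel. F x * h n (u x)) = 0" for n by (rule cont[OF hc])
    ultimately show ?thesis by (simp add: LIMSEQ_const_iff)
  qed
  have ivl: "(LINT x:{c<..<d}|lborel. F x) = 0" if cd: "a \<le> c" "c < d" "d \<le> b" for c d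
  proof -
    define W where "W = - u ` ({a..c} \<union> {d..b})"
    have "compact ({a..c} \<union> {d..b})" by (intro compact_Un compact_Icc)
    then have "compact (u ` ({a..c} \<union> {d..b}))"
      by (intro compact_continuous_image continuous_on_subset[OF u]) auto
    then have "open W" unfolding W_def by (intro open_Compl compact_imp_closed)
    moreover have "u a \<notin> W" using cd by (auto simp: W_def)
    then have "W \<noteq> UNIV" by blast
    ultimately have "(LINT x|lborel. F x * indicator W (u x)) = 0" by (rule opn)
    also have "(LINT x|lborel. F x * indicator W (u x)) = (LINT x|lborel. indicator {c<..<d} x *\<^sub>R F x)"
    proof (intro Bochner_Integration.integral_cong refl)
      fix x
      show "F x * indicator W (u x) = indicator {c<..<d} x *\<^sub>R F x"
      proof (cases "x \<in> {a..b}")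
        case True
        then have "u x \<in> W \<longleftrightarrow> x \<in> {c<..<d}" using sep[OF cd] by (force simp: W_def)
        then show ?thesis by (simp add: indicator_def)
      qed (simp add: supp)
    qed
    finally show ?thesis by (simp add: set_lebesgue_integral_def)
  qed
  have any: "(LINT x:{c<..<d}|lborel. F x) = 0" for c d
  proof (cases "max a c < min b d")
    case True
    have "(LINT x:{c<..<d}|lborel. F x) = (LINT x:{max a c<..<min b d}|lborel. F x)"
      unfolding set_lebesgue_integral_def
    proof (rule integral_cong_AE)
      show "AE x in lborel. indicator {c<..<d} x *\<^sub>R F x = indicator {max a c<..<min b d} x *\<^sub>R F x"
        using AE_lborel_singleton[of a] AE_lborel_singleton[of b]
      proof eventually_elim
        case (elim x)
        then show ?case using supp[of x] by (auto simp: indicator_def)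
      qed
    qed measurable
    then show ?thesis using ivl[of "max a c" "min b d"] True by simp
  next
    case False
    have "(LINT x:{c<..<d}|lborel. F x) = (LINT x:{}|lborel. F x)"
      unfolding set_lebesgue_integral_def
    proof (rule integral_cong_AE)
      show "AE x in lborel. indicator {c<..<d} x *\<^sub>R F x = indicator {} x *\<^sub>R F x"
        using AE_lborel_singleton[of a] AE_lborel_singleton[of b]
      proof eventually_elim
        case (elim x)
        then show ?case using supp[of x] False by (auto simp: indicator_def)
      qed
    qed measurable
    then show ?thesis by (simp add: set_lebesgue_integral_def)
  qed
  have tot: "(LINT x|lborel. F x) = 0" using cont[of "\<lambda>_. 1"] by simp
  have si: "set_integrable lborel A F" if "A \<in> sets borel" for A
    unfolding set_integrable_def by (rule integrable_mult_indicator) (use F that in auto)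
  have beq: "sets borel = sigma_sets UNIV (range (\<lambda>(a, b). {a<..<b::real}))"
  proof -
    have "(\<lambda>(a, b). box a b) = (\<lambda>(a, b). {a<..<b::real})" by (auto simp: fun_eq_iff box_real)
    from borel_eq_box[where 'a = real, unfolded this]
    have "sets borel = sets (sigma UNIV (range (\<lambda>(a, b). {a<..<b::real})))" by (rule arg_cong)
    then show ?thesis by (subst (asm) sets_measure_of) auto
  qed
  show ?thesis
  proof (rule sigma_finite_measure.density_zero[OF sigma_finite_lborel F])
    fix A :: "real set" assume "A \<in> sets lborel"
    then have A: "A \<in> sigma_sets UNIV (range (\<lambda>(a, b). {a<..<b}))"
      by (simp add: beq)
    have st: "Int_stable (range (\<lambda>(a::real, b). {a<..<b}))"
    proof (rule Int_stableI, clarify)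
      fix a b c d :: real
      have "{a<..<b} \<inter> {c<..<d} = (\<lambda>(a, b). {a<..<b}) (max a c, min b d)" by auto
      then show "{a<..<b} \<inter> {c<..<d} \<in> range (\<lambda>(a, b). {a<..<b})" by blast
    qed
    have bor: "B \<in> sets borel" if "B \<in> sigma_sets UNIV (range (\<lambda>(a, b). {a<..<b}))" for B :: "real set"
      using that by (simp add: beq)
    have sub: "range (\<lambda>(a, b). {a<..<b::real}) \<subseteq> Pow UNIV" by simp
    show "(LINT x:A|lborel. F x) = 0"
      using st sub A
    proof (induction rule: sigma_sets_induct_disjoint)
      case (basic B) then show ?case using any by auto
    next
      case empty show ?case by (simp add: set_lebesgue_integral_def)
    next
      case (compl B)
      have "(LINT x:UNIV|lborel. F x) = (LINT x:B|lborel. F x) + (LINT x:UNIV - B|lborel. F x)"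
        using set_integral_Un[of B "UNIV - B" lborel F] si bor[OF compl(1)] by (auto simp: Un_absorb1)
      then show ?case using compl tot by (simp add: set_lebesgue_integral_def)
    next
      case (union B)
      have Bb: "B i \<in> sets borel" for i using union(2) by (intro bor) auto
      have "(LINT x:(\<Union>i. B i)|lborel. F x) = (\<Sum>i. LINT x:B i|lborel. F x)"
        using union(1) Bb by (intro lebesgue_integral_countable_add si) (auto simp: disjoint_family_on_def)
      then show ?case using union by simp
    qed
  qed
qed

lemma integrable_mult_continuous:
  fixes F g :: "real \<Rightarrow> real"
  assumes F: "integrable lborel F" and supp: "\<And>x. x \<notin> {a..b} \<Longrightarrow> F x = 0" and g: "continuous_on UNIV g"
  shows "integrable lborel (\<lambda>x. F x * g x)"
proof -
  have "compact (g ` {a..b})" by (intro compact_continuous_image continuous_on_subset[OF g]) auto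
  then have "\<exists>C. \<forall>x\<in>{a..b}. \<bar>g x\<bar> \<le> C" by (auto dest!: compact_imp_bounded simp: bounded_iff)
  then obtain C where C: "\<And>x. x \<in> {a..b} \<Longrightarrow> \<bar>g x\<bar> \<le> C" by blast
  show ?thesis
  proof (rule Bochner_Integration.integrable_bound)
    show "integrable lborel (\<lambda>x. C * F x)" using F by simp
    show "AE x in lborel. norm (F x * g x) \<le> norm (C * F x)"
    proof (rule AE_I2)
      fix x show "norm (F x * g x) \<le> norm (C * F x)"
        using C[of x] supp[of x] by (cases "x \<in> {a..b}") (auto simp: abs_mult mult.commute[of "\<bar>F x\<bar>"] intro!: mult_right_mono)
    qed
  qed (use F borel_measurable_continuous_onI[OF g] in auto)
qed

text \<open>Dirichlet eigenfunctions of the interval [-1, 1]; the frequencies start at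
  \<open>Suc 0\<close>. They already have norm one, because the interval has length 2.\<close>

definition sn :: "nat \<Rightarrow> real \<Rightarrow> real" where
  "sn n y = sin (real (Suc n) * (pi * (y + 1) / 2))"

text \<open>V collects the multipliers g for which F g is orthogonal to every sin (k theta). It is
  closed under multiplication by cos theta, since sin (k theta) cos theta is the mean of sin ((k+1)
  theta) and sin ((k-1) theta), and hence under polynomials in cos theta. For k = 1 this says that F
  sin theta is orthogonal to all polynomials in cos theta, which is injective on the interval; sin
  theta vanishes only at the two endpoints.\<close>

lemma sine_complete:
  fixes F :: "real \<Rightarrow> real"
  assumes F: "integrable lborel F" and supp: "\<And>y. y \<notin> {-1..1} \<Longrightarrow> F y = 0"
    and zero: "\<And>n. (LINT y|lborel. F y * sn n y) = 0"
  shows "AE y in lborel. F y = 0"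
proof -
  define \<theta> where "\<theta> y = pi * (y + 1) / 2" for y :: real
  have th: "continuous_on UNIV \<theta>" unfolding \<theta>_def by (intro continuous_intros) auto
  define V where "V = {g :: real \<Rightarrow> real. continuous_on UNIV g \<and> (\<forall>k::nat. (LINT y|lborel. F y * (g y * sin (real k * \<theta> y))) = 0)}"
  have int: "integrable lborel (\<lambda>y. F y * (g y * sin (real k * \<theta> y)))" if "continuous_on UNIV g" for g k
    by (intro integrable_mult_continuous[OF F supp] continuous_intros that th)
  have V_add: "(\<lambda>y. g y + h y) \<in> V" if "g \<in> V" "h \<in> V" for g h
    using that int[of g] int[of h] by (auto simp: V_def distrib_left distrib_right intro!: continuous_intros)
  have V_scale: "(\<lambda>y. c * g y) \<in> V" if "g \<in> V" for g c
    using that by (auto simp: V_def mult.left_commute[of _ c] mult.assoc intro!: continuous_intros)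
  have V_cos: "(\<lambda>y. cos (\<theta> y) * g y) \<in> V" if g: "g \<in> V" for g
  proof -
    have gc: "continuous_on UNIV g" using g by (simp add: V_def)
    have "(LINT y|lborel. F y * (cos (\<theta> y) * g y * sin (real k * \<theta> y))) = 0" for k :: nat
    proof (cases k)
      case (Suc j)
      have eq: "F y * (cos (\<theta> y) * g y * sin (real k * \<theta> y))
        = 1 / 2 * (F y * (g y * sin (real (Suc k) * \<theta> y)) + F y * (g y * sin (real j * \<theta> y)))" for y
      proof -
        have "real (Suc k) * \<theta> y = real k * \<theta> y + \<theta> y" "real j * \<theta> y = real k * \<theta> y - \<theta> y"
          by (simp_all add: Suc algebra_simps)
        then have "sin (real (Suc k) * \<theta> y) + sin (real j * \<theta> y) = 2 * (sin (real k * \<theta> y) * cos (\<theta> y))"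
          by (simp only: sin_add sin_diff)
        then have "sin (real k * \<theta> y) * cos (\<theta> y) = 1 / 2 * (sin (real (Suc k) * \<theta> y) + sin (real j * \<theta> y))" by simp
        then show ?thesis by (metis (no_types, lifting) distrib_left mult.assoc mult.commute)
      qed
      show ?thesis unfolding eq using g int[OF gc] by (simp add: V_def del: of_nat_Suc)
    qed simp
    then show ?thesis using gc by (auto simp: V_def intro!: continuous_intros th)
  qed
  have V_poly: "\<forall>g\<in>V. (\<lambda>y. q (cos (\<theta> y)) * g y) \<in> V" if "real_polynomial_function q" for q
    using that
  proof (induction rule: real_polynomial_function.induct)
    case (linear f)
    have "f t * s = f 1 * (t * s)" for s t
      using linear_scale[OF bounded_linear.linear[OF linear], of t 1] by simp
    then have "(\<lambda>y. f (cos (\<theta> y)) * g y) = (\<lambda>y. f 1 * (cos (\<theta> y) * g y))" for g by (rule ext)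
    then show ?case using V_cos V_scale by (simp only:) blast
  next
    case (const c) then show ?case using V_scale by auto
  next
    case (add f g) then show ?case using V_add by (auto simp: distrib_right)
  next
    case (mult f g) then show ?case by (auto simp: mult.assoc)
  qed
  have one: "(\<lambda>_. 1) \<in> V"
  proof -
    have "(LINT y|lborel. F y * (1 * sin (real k * \<theta> y))) = 0" for k
      using zero[of "k - 1"] by (cases k) (simp_all add: sn_def \<theta>_def)
    then show ?thesis by (simp add: V_def)
  qed
  have V_D: "(LINT y|lborel. F y * (g y * sin (real k * \<theta> y))) = 0" if "g \<in> V" for g k
    using that by (simp add: V_def)
  have "AE y in lborel. F y * sin (\<theta> y) = 0"
  proof (rule vanishing_criterion[where u = "\<lambda>y. cos (\<theta> y)" and a = "-1" and b = 1])
    show "integrable lborel (\<lambda>y. F y * sin (\<theta> y))"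
      by (intro integrable_mult_continuous[OF F supp] continuous_intros th)
    show "continuous_on UNIV (\<lambda>y. cos (\<theta> y))" by (intro continuous_intros th)
    fix q :: "real \<Rightarrow> real" assume rq: "real_polynomial_function q"
    have "(\<lambda>y. q (cos (\<theta> y)) * 1) \<in> V" by (rule bspec[OF V_poly[OF rq] one])
    from V_D[OF this, of 1] show "(LINT y|lborel. F y * sin (\<theta> y) * q (cos (\<theta> y))) = 0" by (simp add: mult_ac)
  next
    fix c d :: real assume cd: "-1 \<le> c" "c < d" "d \<le> 1"
    have "y = y'" if "cos (\<theta> y) = cos (\<theta> y')" "y \<in> {-1..1}" "y' \<in> {-1..1}" for y y'
    proof -
      have "\<theta> y = \<theta> y'"
      proof (rule cos_inj_pi)
        have "0 \<le> \<theta> t \<and> \<theta> t \<le> pi" if "t \<in> {-1..1}" for t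
          using that mult_left_le[of "(t + 1) / 2" pi] by (simp add: \<theta>_def)
        then show "0 \<le> \<theta> y" "\<theta> y \<le> pi" "0 \<le> \<theta> y'" "\<theta> y' \<le> pi" using that(2,3) by blast+
      qed (rule that(1))
      then show ?thesis by (simp add: \<theta>_def)
    qed
    then show "(\<lambda>y. cos (\<theta> y)) ` {c<..<d} \<inter> (\<lambda>y. cos (\<theta> y)) ` ({-1..c} \<union> {d..1}) = {}"
      using cd by fastforce
  qed (simp add: supp)
  then show ?thesis using AE_lborel_singleton[of 1] AE_lborel_singleton[of "-1"]
  proof eventually_elim
    case (elim y)
    show ?case
    proof (cases "y \<in> {-1..1}")
      case True
      then have "0 < (y + 1) / 2" "(y + 1) / 2 < 1" using elim by auto
      then have "sin (pi * ((y + 1) / 2)) > 0" by (intro sin_gt_zero mult_pos_pos) auto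
      then have "sin (\<theta> y) > 0" by (simp add: \<theta>_def)
      then show ?thesis using elim by simp
    qed (rule supp)
  qed
qed

text \<open>The closure argument for sines is repeated with cosines and sines together, and with
  multiplication by both cos theta and sin theta. The separating map is \<open>cis\<close>, which on
  one period only glues the endpoints 0 and p.\<close>

lemma fourier_complete:
  fixes F :: "real \<Rightarrow> real"
  assumes p: "p > 0" and F: "integrable lborel F" and supp: "\<And>x. x \<notin> {0..p} \<Longrightarrow> F x = 0"
    and zc: "\<And>l::nat. (LINT x|lborel. F x * cos (real l * (2 * pi / p * x))) = 0"
    and zs: "\<And>l::nat. (LINT x|lborel. F x * sin (real l * (2 * pi / p * x))) = 0"
  shows "AE x in lborel. F x = 0"
proof -
  define \<theta> where "\<theta> x = 2 * pi / p * x" for x :: real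
  have th: "continuous_on UNIV \<theta>" unfolding \<theta>_def by (intro continuous_intros)
  define V where "V = {g :: real \<Rightarrow> real. continuous_on UNIV g \<and>
     (\<forall>l::nat. (LINT x|lborel. F x * (g x * cos (real l * \<theta> x))) = 0 \<and> (LINT x|lborel. F x * (g x * sin (real l * \<theta> x))) = 0)}"
  have ints: "integrable lborel (\<lambda>x. F x * (g x * sin (real k * \<theta> x)))" if "continuous_on UNIV g" for g k
    by (intro integrable_mult_continuous[OF F supp] continuous_intros that th)
  have intc: "integrable lborel (\<lambda>x. F x * (g x * cos (real k * \<theta> x)))" if "continuous_on UNIV g" for g k
    by (intro integrable_mult_continuous[OF F supp] continuous_intros that th)
  have V_add: "(\<lambda>y. g y + h y) \<in> V" if "g \<in> V" "h \<in> V" for g h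
    using that ints[of g] ints[of h] intc[of g] intc[of h]
    by (auto simp: V_def distrib_left distrib_right intro!: continuous_intros)
  have V_scale: "(\<lambda>y. c * g y) \<in> V" if "g \<in> V" for g c
    using that by (auto simp: V_def mult.left_commute[of _ c] mult.assoc intro!: continuous_intros)
  have suc: "real (Suc l) * \<theta> x = real l * \<theta> x + \<theta> x" for l x by (simp add: algebra_simps)
  have V_cos: "(\<lambda>x. cos (\<theta> x) * g x) \<in> V" if g: "g \<in> V" for g
  proof -
    have gc: "continuous_on UNIV g" using g by (simp add: V_def)
    have "(LINT x|lborel. F x * (cos (\<theta> x) * g x * cos (real l * \<theta> x))) = 0 \<and>
          (LINT x|lborel. F x * (cos (\<theta> x) * g x * sin (real l * \<theta> x))) = 0" for l :: nat
    proof (cases l)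
      case 0
      have "(LINT x|lborel. F x * (g x * cos (real 1 * \<theta> x))) = 0" using g unfolding V_def by blast
      then show ?thesis using 0 by (simp add: mult_ac)
    next
      case (Suc j)
      have j: "real j * \<theta> x = real l * \<theta> x - \<theta> x" for x by (simp add: Suc algebra_simps)
      have eq1: "F x * (cos (\<theta> x) * g x * cos (real l * \<theta> x))
        = 1 / 2 * (F x * (g x * cos (real (Suc l) * \<theta> x)) + F x * (g x * cos (real j * \<theta> x)))" for x
        unfolding j suc cos_add cos_diff by (simp add: algebra_simps)
      have eq2: "F x * (cos (\<theta> x) * g x * sin (real l * \<theta> x))
        = 1 / 2 * (F x * (g x * sin (real (Suc l) * \<theta> x)) + F x * (g x * sin (real j * \<theta> x)))" for x
        unfolding j suc sin_add sin_diff by (simp add: algebra_simps)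
      show ?thesis unfolding eq1 eq2 using g ints[OF gc] intc[OF gc] by (simp add: V_def del: of_nat_Suc)
    qed
    then show ?thesis using gc by (auto simp: V_def intro!: continuous_intros th)
  qed
  have V_sin: "(\<lambda>x. sin (\<theta> x) * g x) \<in> V" if g: "g \<in> V" for g
  proof -
    have gc: "continuous_on UNIV g" using g by (simp add: V_def)
    have "(LINT x|lborel. F x * (sin (\<theta> x) * g x * cos (real l * \<theta> x))) = 0 \<and>
          (LINT x|lborel. F x * (sin (\<theta> x) * g x * sin (real l * \<theta> x))) = 0" for l :: nat
    proof (cases l)
      case 0
      have "(LINT x|lborel. F x * (g x * sin (real 1 * \<theta> x))) = 0" using g unfolding V_def by blast
      then show ?thesis using 0 by (simp add: mult_ac)
    next
      case (Suc j)
      have j: "real j * \<theta> x = real l * \<theta> x - \<theta> x" for x by (simp add: Suc algebra_simps)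
      have eq1: "F x * (sin (\<theta> x) * g x * cos (real l * \<theta> x))
        = 1 / 2 * (F x * (g x * sin (real (Suc l) * \<theta> x)) - F x * (g x * sin (real j * \<theta> x)))" for x
        unfolding j suc sin_add sin_diff by (simp add: algebra_simps)
      have eq2: "F x * (sin (\<theta> x) * g x * sin (real l * \<theta> x))
        = 1 / 2 * (F x * (g x * cos (real j * \<theta> x)) - F x * (g x * cos (real (Suc l) * \<theta> x)))" for x
        unfolding j suc cos_add cos_diff by (simp add: algebra_simps)
      show ?thesis unfolding eq1 eq2 using g ints[OF gc] intc[OF gc] by (simp add: V_def del: of_nat_Suc)
    qed
    then show ?thesis using gc by (auto simp: V_def intro!: continuous_intros th)
  qed
  have V_poly: "\<forall>g\<in>V. (\<lambda>x. q (cis (\<theta> x)) * g x) \<in> V" if "real_polynomial_function q" for q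
    using that
  proof (induction rule: real_polynomial_function.induct)
    case (linear f)
    have "f (cis t) = f 1 * cos t + f \<i> * sin t" for t
    proof -
      have "cis t = cos t *\<^sub>R 1 + sin t *\<^sub>R \<i>" by (simp add: complex_eq_iff)
      then show ?thesis using bounded_linear.linear[OF linear] by (simp add: linear_add linear_scale)
    qed
    then have "(\<lambda>x. f (cis (\<theta> x)) * g x) = (\<lambda>x. f 1 * (cos (\<theta> x) * g x) + f \<i> * (sin (\<theta> x) * g x))" for g
      by (simp add: fun_eq_iff algebra_simps)
    then show ?case using V_add V_scale V_cos V_sin by simp
  next
    case (const c) then show ?case using V_scale by auto
  next
    case (add f g) then show ?case using V_add by (auto simp: distrib_right)
  next
    case (mult f g) then show ?case by (auto simp: mult.assoc)
  qed
  have one: "(\<lambda>_. 1) \<in> V" using zc zs by (simp add: V_def \<theta>_def)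
  have V_D: "(LINT x|lborel. F x * (g x * cos (real l * \<theta> x))) = 0" if "g \<in> V" for g l
    using that by (simp add: V_def)
  show ?thesis
  proof (rule vanishing_criterion[OF F supp, where u = "\<lambda>x. cis (\<theta> x)"])
    show "continuous_on UNIV (\<lambda>x. cis (\<theta> x))" by (intro continuous_intros th)
    fix q :: "complex \<Rightarrow> real" assume rq: "real_polynomial_function q"
    have "(\<lambda>x. q (cis (\<theta> x)) * 1) \<in> V" by (rule bspec[OF V_poly[OF rq] one])
    from V_D[OF this, of 0] show "(LINT x|lborel. F x * q (cis (\<theta> x))) = 0" by simp
  next
    fix c d :: real assume cd: "0 \<le> c" "c < d" "d \<le> p"
    have False if eq: "cis (\<theta> x) = cis (\<theta> x')" and x: "x \<in> {c<..<d}" and x': "x' \<in> {0..c} \<union> {d..p}" for x x'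
    proof -
      have "cos (\<theta> x) = cos (\<theta> x')" "sin (\<theta> x) = sin (\<theta> x')"
        using arg_cong[OF eq, of Re] arg_cong[OF eq, of Im] by simp_all
      then obtain n :: int where n: "\<theta> x = \<theta> x' + 2 * pi * n" using sin_cos_eq_iff by blast
      have "2 * pi * x = 2 * pi * x' + 2 * pi * (p * n)" using n p by (simp add: \<theta>_def field_simps)
      then have "2 * pi * (x - x') = 2 * pi * (p * n)" by (simp add: right_diff_distrib)
      then have xn: "x - x' = p * n" by simp
      have "\<bar>x - x'\<bar> < p" "x \<noteq> x'" using x x' cd by auto
      then have "p * \<bar>real_of_int n\<bar> < p" "n \<noteq> 0" using xn p by (auto simp: abs_mult)
      then have "\<bar>real_of_int n\<bar> < 1" using p by simp
      then show False using \<open>n \<noteq> 0\<close> by linarith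
    qed
    then show "(\<lambda>x. cis (\<theta> x)) ` {c<..<d} \<inter> (\<lambda>x. cis (\<theta> x)) ` ({0..c} \<union> {d..p}) = {}" by blast
  qed
qed

section \<open>The sequence space\<close>

text \<open>One vector of this space holds the sine coefficients in y of a single Fourier mode in x.
  Making it a type gives access to vector-valued derivatives and integrals in t.\<close>

typedef ell2 = "{f :: nat \<Rightarrow> real. summable (\<lambda>n. (f n)\<^sup>2)}"
  morphisms cf Ell2
  by (rule exI[of _ "\<lambda>_. 0"]) simp

setup_lifting type_definition_ell2

lemma summable_mult_of_squares:
  fixes f g :: "nat \<Rightarrow> real"
  assumes "summable (\<lambda>n. (f n)\<^sup>2)" "summable (\<lambda>n. (g n)\<^sup>2)"
  shows "summable (\<lambda>n. f n * g n)"
proof (rule summable_comparison_test')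
  show "summable (\<lambda>n. (f n)\<^sup>2 + (g n)\<^sup>2)" using assms by (rule summable_add)
  show "norm (f n * g n) \<le> (f n)\<^sup>2 + (g n)\<^sup>2" if "n \<ge> 0" for n
  proof -
    have "0 \<le> \<bar>f n\<bar> * \<bar>g n\<bar>" by simp
    then show ?thesis
      using sum_squares_bound[of "\<bar>f n\<bar>" "\<bar>g n\<bar>"] unfolding real_norm_def abs_mult power2_abs by linarith
  qed
qed

lemma summable_cf_sq: "summable (\<lambda>n. (cf x n)\<^sup>2)"
  using cf[of x] by simp

lemma summable_cf_mult: "summable (\<lambda>n. cf x n * cf y n)"
  by (intro summable_mult_of_squares summable_cf_sq)

lemma summable_add_sq:
  fixes f g :: "nat \<Rightarrow> real"
  assumes "summable (\<lambda>n. (f n)\<^sup>2)" "summable (\<lambda>n. (g n)\<^sup>2)"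
  shows "summable (\<lambda>n. (f n + g n)\<^sup>2)"
proof -
  have "summable (\<lambda>n. (f n)\<^sup>2 + (g n)\<^sup>2 + 2 * (f n * g n))"
    by (intro summable_add summable_mult summable_mult_of_squares assms)
  then show ?thesis by (simp add: power2_sum algebra_simps)
qed

instantiation ell2 :: real_vector
begin

lift_definition zero_ell2 :: ell2 is "\<lambda>_. 0" by simp
lift_definition plus_ell2 :: "ell2 \<Rightarrow> ell2 \<Rightarrow> ell2" is "\<lambda>f g n. f n + g n"
  by (rule summable_add_sq)
lift_definition uminus_ell2 :: "ell2 \<Rightarrow> ell2" is "\<lambda>f n. - f n" by simp
lift_definition minus_ell2 :: "ell2 \<Rightarrow> ell2 \<Rightarrow> ell2" is "\<lambda>f g n. f n - g n"
  subgoal for f g using summable_add_sq[of f "\<lambda>n. - g n"] by simp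
  done
lift_definition scaleR_ell2 :: "real \<Rightarrow> ell2 \<Rightarrow> ell2" is "\<lambda>c f n. c * f n"
  by (simp add: power_mult_distrib summable_mult)

instance
  by standard (transfer; force simp: algebra_simps)+

end

lemma cf_simps [simp]:
  "cf 0 n = 0" "cf (x + y) n = cf x n + cf y n" "cf (- x) n = - cf x n"
  "cf (x - y) n = cf x n - cf y n" "cf (c *\<^sub>R x) n = c * cf x n"
  by (transfer, simp)+

lemma cf_Ell2: "summable (\<lambda>n. (f n)\<^sup>2) \<Longrightarrow> cf (Ell2 f) = f"
  by (simp add: Ell2_inverse)

lemma ell2_eqI: "(\<And>n. cf x n = cf y n) \<Longrightarrow> x = y"
  by (metis cf_inject ext)

instantiation ell2 :: real_inner
begin

definition inner_ell2 :: "ell2 \<Rightarrow> ell2 \<Rightarrow> real" where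
  "inner_ell2 x y = (\<Sum>n. cf x n * cf y n)"
definition norm_ell2 :: "ell2 \<Rightarrow> real" where
  "norm_ell2 x = sqrt (inner x x)"
definition dist_ell2 :: "ell2 \<Rightarrow> ell2 \<Rightarrow> real" where
  "dist_ell2 x y = norm (x - y)"
definition sgn_ell2 :: "ell2 \<Rightarrow> ell2" where
  "sgn_ell2 x = x /\<^sub>R norm x"
definition uniformity_ell2 :: "(ell2 \<times> ell2) filter" where
  "uniformity_ell2 = (INF e\<in>{0<..}. principal {(x, y). dist x y < e})"
definition open_ell2 :: "ell2 set \<Rightarrow> bool" where
  "open_ell2 S = (\<forall>x\<in>S. \<forall>\<^sub>F (x', y) in uniformity. x' = x \<longrightarrow> y \<in> S)"

instance
proof
  fix x y z :: ell2 and r :: real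
  show "inner x y = inner y x"
    by (simp add: inner_ell2_def mult.commute)
  show "inner (x + y) z = inner x z + inner y z"
    by (simp add: inner_ell2_def distrib_right suminf_add[symmetric] summable_cf_mult)
  show "inner (r *\<^sub>R x) y = r * inner x y"
    by (simp add: inner_ell2_def mult.assoc suminf_mult summable_cf_mult)
  show "0 \<le> inner x x"
    unfolding inner_ell2_def by (intro suminf_nonneg summable_cf_mult) simp
  show "inner x x = 0 \<longleftrightarrow> x = 0"
    using suminf_eq_zero_iff[OF summable_cf_mult[of x x]]
    by (auto simp: inner_ell2_def intro!: ell2_eqI)
qed (simp_all add: norm_ell2_def dist_ell2_def sgn_ell2_def uniformity_ell2_def open_ell2_def)

end

lemma norm_ell2_sq: "(norm x)\<^sup>2 = (\<Sum>n. (cf x n)\<^sup>2)"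
  unfolding power2_norm_eq_inner inner_ell2_def by (simp add: power2_eq_square)

lemma sum_sq_le_norm: "(\<Sum>n<N. (cf x n)\<^sup>2) \<le> (norm x)\<^sup>2"
  unfolding norm_ell2_sq by (intro sum_le_suminf summable_cf_sq) auto

lemma cf_le_norm: "\<bar>cf x n\<bar> \<le> norm x"
proof -
  have "(cf x n)\<^sup>2 \<le> (\<Sum>k<Suc n. (cf x k)\<^sup>2)"
    by (simp add: sum_nonneg)
  also have "\<dots> \<le> (norm x)\<^sup>2" by (rule sum_sq_le_norm)
  finally show ?thesis using abs_le_square_iff[of "cf x n" "norm x"] by simp
qed

lemma bounded_linear_cf: "bounded_linear (\<lambda>x. cf x n)"
  by (rule bounded_linear_intro[of _ 1]) (auto simp: cf_le_norm)

lemma norm_le_of_partial_sums: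
  assumes "\<And>N. (\<Sum>n<N. (f n)\<^sup>2) \<le> C\<^sup>2" "0 \<le> C"
  shows "summable (\<lambda>n. (f n)\<^sup>2)" "norm (Ell2 f) \<le> C"
proof -
  show s: "summable (\<lambda>n. (f n)\<^sup>2)"
    using assms(1) by (intro summableI_nonneg_bounded) auto
  have "(norm (Ell2 f))\<^sup>2 \<le> C\<^sup>2"
    unfolding norm_ell2_sq cf_Ell2[OF s] using assms(1) s by (intro suminf_le_const) auto
  then show "norm (Ell2 f) \<le> C" using assms(2) power2_le_imp_le by blast
qed

instance ell2 :: complete_space
proof
  fix X :: "nat \<Rightarrow> ell2"
  assume X: "Cauchy X"
  have "Cauchy (\<lambda>i. cf (X i) n)" for n
    using bounded_linear.Cauchy[OF bounded_linear_cf X] .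
  then have "(\<lambda>i. cf (X i) n) \<longlonglongrightarrow> lim (\<lambda>i. cf (X i) n)" for n
    by (simp add: Cauchy_convergent_iff convergent_LIMSEQ_iff)
  then obtain l where l: "\<And>n. (\<lambda>i. cf (X i) n) \<longlonglongrightarrow> l n"
    using that[of "\<lambda>n. lim (\<lambda>i. cf (X i) n)"] by blast
  have tail: "\<exists>M. \<forall>m\<ge>M. \<forall>N. (\<Sum>n<N. (cf (X m) n - l n)\<^sup>2) \<le> e\<^sup>2" if e: "e > 0" for e
  proof -
    obtain M where M: "\<And>i m. i \<ge> M \<Longrightarrow> m \<ge> M \<Longrightarrow> dist (X i) (X m) < e"
      using metric_CauchyD[OF X e] by blast
    have "(\<Sum>n<N. (cf (X m) n - l n)\<^sup>2) \<le> e\<^sup>2" if m: "m \<ge> M" for m N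
    proof (rule LIMSEQ_le_const2)
      show "(\<lambda>i. \<Sum>n<N. (cf (X m) n - cf (X i) n)\<^sup>2) \<longlonglongrightarrow> (\<Sum>n<N. (cf (X m) n - l n)\<^sup>2)"
        by (intro tendsto_intros l)
      show "\<exists>K. \<forall>i\<ge>K. (\<Sum>n<N. (cf (X m) n - cf (X i) n)\<^sup>2) \<le> e\<^sup>2"
      proof (intro exI allI impI)
        fix i assume "i \<ge> M"
        have "(\<Sum>n<N. (cf (X m) n - cf (X i) n)\<^sup>2) \<le> (norm (X m - X i))\<^sup>2"
          using sum_sq_le_norm[of "X m - X i" N] by simp
        also have "\<dots> \<le> e\<^sup>2"
          using M[OF m \<open>i \<ge> M\<close>] by (intro power_mono) (auto simp: dist_norm)
        finally show "(\<Sum>n<N. (cf (X m) n - cf (X i) n)\<^sup>2) \<le> e\<^sup>2" .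
      qed
    qed
    then show ?thesis by blast
  qed
  have sl: "summable (\<lambda>n. (l n)\<^sup>2)"
  proof -
    obtain M where "\<And>N. (\<Sum>n<N. (cf (X M) n - l n)\<^sup>2) \<le> 1\<^sup>2"
      using tail[of 1] by auto
    from norm_le_of_partial_sums(1)[of "\<lambda>n. cf (X M) n - l n", OF this zero_le_one]
    have "summable (\<lambda>n. (- (cf (X M) n - l n))\<^sup>2)" unfolding power2_minus .
    from summable_add_sq[OF this summable_cf_sq[of "X M"]] show ?thesis by simp
  qed
  have "X \<longlonglongrightarrow> Ell2 l"
  proof (rule metric_LIMSEQ_I)
    fix r :: real assume "r > 0"
    then have "r/2 > 0" by simp
    from tail[OF this] obtain M where
      M: "\<And>m N. m \<ge> M \<Longrightarrow> (\<Sum>n<N. (cf (X m) n - l n)\<^sup>2) \<le> (r/2)\<^sup>2" by blast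
    have "dist (X m) (Ell2 l) < r" if "m \<ge> M" for m
    proof -
      have "X m - Ell2 l = Ell2 (\<lambda>n. cf (X m) n - l n)"
        by (rule ell2_eqI, subst cf_Ell2)
          (use norm_le_of_partial_sums(1)[OF M[OF that]] \<open>r > 0\<close> in \<open>auto simp: cf_Ell2[OF sl]\<close>)
      then show ?thesis
        using norm_le_of_partial_sums(2)[OF M[OF that]] \<open>r > 0\<close> by (simp add: dist_norm)
    qed
    then show "\<exists>M. \<forall>m\<ge>M. dist (X m) (Ell2 l) < r" by blast
  qed
  then show "convergent X" by (auto simp: convergent_def)
qed

instance ell2 :: banach ..

lift_definition unitv :: "nat \<Rightarrow> ell2" is "\<lambda>n k. if k = n then 1 else 0"
  by (rule summable_finite[of "{n}" for n]) auto

lemma cf_unitv: "cf (unitv n) k = (if k = n then 1 else 0)"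
  by transfer simp

lemma inner_unitv [simp]: "inner x (unitv n) = cf x n" "inner (unitv n) x = cf x n"
proof -
  have "(\<Sum>k. cf x k * cf (unitv n) k) = (\<Sum>k\<in>{n}. cf x k * cf (unitv n) k)"
    by (rule suminf_finite) (auto simp: cf_unitv)
  then show "inner x (unitv n) = cf x n" by (simp add: inner_ell2_def cf_unitv)
  then show "inner (unitv n) x = cf x n" by (simp add: inner_commute)
qed

lemma norm_unitv: "norm (unitv n) = 1"
  by (simp add: norm_eq_1 cf_unitv)

definition trunc :: "nat \<Rightarrow> ell2 \<Rightarrow> ell2" where
  "trunc N x = (\<Sum>n<N. cf x n *\<^sub>R unitv n)"

lemma cf_sum: "cf (sum f A) n = (\<Sum>i\<in>A. cf (f i) n)"
  by (induction A rule: infinite_finite_induct) auto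

lemma cf_trunc: "cf (trunc N x) n = (if n < N then cf x n else 0)"
  by (simp add: trunc_def cf_sum cf_unitv if_distrib cong: if_cong)

lemma norm_diff_trunc_sq: "(norm (x - trunc N x))\<^sup>2 = (norm x)\<^sup>2 - (\<Sum>n<N. (cf x n)\<^sup>2)"
proof -
  have "(norm (x - trunc N x))\<^sup>2 = (\<Sum>n. (cf (x - trunc N x) (n + N))\<^sup>2) + (\<Sum>n<N. (cf (x - trunc N x) n)\<^sup>2)"
    unfolding norm_ell2_sq by (intro suminf_split_initial_segment summable_cf_sq)
  also have "(\<Sum>n<N. (cf (x - trunc N x) n)\<^sup>2) = 0" by (simp add: cf_trunc)
  also have "(\<Sum>n. (cf (x - trunc N x) (n + N))\<^sup>2) = (\<Sum>n. (cf x (n + N))\<^sup>2)" by (simp add: cf_trunc)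
  finally show ?thesis
    unfolding norm_ell2_sq using suminf_split_initial_segment[OF summable_cf_sq[of x], of N] by simp
qed

lemma trunc_tendsto: "(\<lambda>N. trunc N x) \<longlonglongrightarrow> x"
proof -
  have "(\<lambda>N. (norm x)\<^sup>2 - (\<Sum>n<N. (cf x n)\<^sup>2)) \<longlonglongrightarrow> (norm x)\<^sup>2 - (norm x)\<^sup>2"
    using summable_LIMSEQ[OF summable_cf_sq[of x]] by (intro tendsto_intros) (simp add: norm_ell2_sq)
  then have "(\<lambda>N. (norm (x - trunc N x))\<^sup>2) \<longlonglongrightarrow> 0" by (simp add: norm_diff_trunc_sq)
  then have "(\<lambda>N. sqrt ((norm (x - trunc N x))\<^sup>2)) \<longlonglongrightarrow> sqrt 0" by (intro tendsto_real_sqrt)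
  then have "(\<lambda>N. x - trunc N x) \<longlonglongrightarrow> 0" by (simp add: tendsto_norm_zero_iff)
  from tendsto_diff[OF tendsto_const[of x] this] show ?thesis by simp
qed

section \<open>Weak convergence and weak compactness\<close>

definition wlim :: "(nat \<Rightarrow> ell2) \<Rightarrow> ell2 \<Rightarrow> bool" where
  "wlim X x \<longleftrightarrow> (\<forall>y. (\<lambda>i. inner (X i) y) \<longlonglongrightarrow> inner x y)"

text \<open>Finite combinations of basis vectors are dense and the functionals are uniformly
  bounded, so the error made by truncating x is small uniformly in i.\<close>

lemma convergent_linear_functionals:
  fixes f :: "nat \<Rightarrow> ell2 \<Rightarrow> real"
  assumes lin: "\<And>i. bounded_linear (f i)" and bd: "\<And>i x. \<bar>f i x\<bar> \<le> C * norm x"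
    and cv: "\<And>n. convergent (\<lambda>i. f i (unitv n))"
  shows "convergent (\<lambda>i. f i x)"
proof -
  have C0: "C \<ge> 0" using bd[of 0 "unitv 0"] by (simp add: norm_unitv)
  have tr: "convergent (\<lambda>i. f i (trunc N x))" for N
  proof -
    have "f i (trunc N x) = (\<Sum>n<N. cf x n * f i (unitv n))" for i
    proof -
      interpret bounded_linear "f i" by (rule lin)
      show ?thesis by (simp add: trunc_def sum scaleR)
    qed
    then show ?thesis by (simp only:) (intro convergent_sum convergent_mult convergent_const cv)
  qed
  have "Cauchy (\<lambda>i. f i x)"
  proof (rule metric_CauchyI)
    fix e :: real assume e: "e > 0"
    define d where "d = e / (4 * (C + 1))"
    have d: "d > 0" "C * d \<le> e / 4" using e C0 by (auto simp: d_def field_simps)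
    obtain N where N: "norm (trunc N x - x) < d"
      using LIMSEQ_D[OF trunc_tendsto d(1)] by blast
    obtain M where M: "\<And>i j. i \<ge> M \<Longrightarrow> j \<ge> M \<Longrightarrow> dist (f i (trunc N x)) (f j (trunc N x)) < e / 4"
      using metric_CauchyD[OF convergent_Cauchy[OF tr[of N]], of "e/4"] e by auto
    have app: "\<bar>f i x - f i (trunc N x)\<bar> \<le> e / 4" for i
    proof -
      interpret bounded_linear "f i" by (rule lin)
      have "\<bar>f i x - f i (trunc N x)\<bar> \<le> C * norm (x - trunc N x)"
        using bd[of i "x - trunc N x"] by (simp add: diff)
      also have "\<dots> \<le> C * d" using N C0 by (intro mult_left_mono) (auto simp: norm_minus_commute)
      finally show ?thesis using d by simp
    qed
    have "dist (f i x) (f j x) < e" if "i \<ge> M" "j \<ge> M" for i j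
      using M[OF that] app[of i] app[of j] unfolding dist_real_def by linarith
    then show "\<exists>M. \<forall>i\<ge>M. \<forall>j\<ge>M. dist (f i x) (f j x) < e" by blast
  qed
  then show ?thesis by (simp add: Cauchy_convergent)
qed

text \<open>Square summability of l follows by passing to the limit in each partial sum. Testing
  against a truncation of y involves finitely many components, and the error is at most 2 C times
  the norm of the discarded tail of y.\<close>

lemma wlim_of_components:
  assumes bd: "\<And>i. norm (X i) \<le> C" and cv: "\<And>n. (\<lambda>i. cf (X i) n) \<longlonglongrightarrow> l n"
  obtains x where "wlim X x" "norm x \<le> C" "\<And>n. cf x n = l n"
proof -
  have C: "C \<ge> 0" using bd[of 0] norm_ge_zero order_trans by blast
  have "(\<Sum>n<N. (l n)\<^sup>2) \<le> C\<^sup>2" for N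
  proof (rule LIMSEQ_le_const2)
    show "(\<lambda>i. \<Sum>n<N. (cf (X i) n)\<^sup>2) \<longlonglongrightarrow> (\<Sum>n<N. (l n)\<^sup>2)" by (intro tendsto_intros cv)
    show "\<exists>K. \<forall>i\<ge>K. (\<Sum>n<N. (cf (X i) n)\<^sup>2) \<le> C\<^sup>2"
      using order_trans[OF sum_sq_le_norm power_mono[OF bd]] by auto
  qed
  note b = norm_le_of_partial_sums[of l, OF this C]
  define x where "x = Ell2 l"
  have cx: "cf x n = l n" for n using b(1) by (simp add: x_def cf_Ell2)
  have "(\<lambda>i. inner (X i - x) y) \<longlonglongrightarrow> 0" for y
  proof -
    have conv0: "(\<lambda>i. inner (X i - x) (trunc N y)) \<longlonglongrightarrow> 0" for N
    proof -
      have "(\<lambda>i. \<Sum>n<N. cf y n * (cf (X i) n - l n)) \<longlonglongrightarrow> (\<Sum>n<N. cf y n * (l n - l n))"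
        by (intro tendsto_intros cv)
      then show ?thesis by (simp add: trunc_def inner_sum_right inner_diff_left cx algebra_simps)
    qed
    have nb: "norm (X i - x) \<le> 2 * C" for i
      using norm_triangle_ineq4[of "X i" x] bd[of i] b(2) by (simp add: x_def)
    have "convergent (\<lambda>i. inner (X i - x) y)"
    proof (rule convergent_linear_functionals[where C = "2 * C"])
      show "bounded_linear (inner (X i - x))" for i by (rule bounded_linear_inner_right)
      show "\<bar>inner (X i - x) z\<bar> \<le> 2 * C * norm z" for i z
        by (rule order_trans[OF Cauchy_Schwarz_ineq2]) (intro mult_right_mono nb norm_ge_zero)
      show "convergent (\<lambda>i. inner (X i - x) (unitv n))" for n
        using cv[of n] by (auto simp: inner_diff_left cx convergent_def intro!: exI tendsto_diff)
    qed
    then obtain L where L: "(\<lambda>i. inner (X i - x) y) \<longlonglongrightarrow> L" by (auto simp: convergent_def)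
    have "\<bar>L\<bar> \<le> 2 * C * norm (y - trunc N y)" for N
    proof (rule LIMSEQ_le_const2)
      show "(\<lambda>i. \<bar>inner (X i - x) y - inner (X i - x) (trunc N y)\<bar>) \<longlonglongrightarrow> \<bar>L\<bar>"
        using tendsto_rabs[OF tendsto_diff[OF L conv0[of N]]] by simp
      show "\<exists>K. \<forall>i\<ge>K. \<bar>inner (X i - x) y - inner (X i - x) (trunc N y)\<bar> \<le> 2 * C * norm (y - trunc N y)"
        unfolding inner_diff_right[symmetric]
        by (intro exI allI impI order_trans[OF Cauchy_Schwarz_ineq2] mult_right_mono nb norm_ge_zero)
    qed
    moreover have "(\<lambda>N. 2 * C * norm (y - trunc N y)) \<longlonglongrightarrow> 2 * C * norm (y - y)"
      by (intro tendsto_intros trunc_tendsto)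
    ultimately have "\<bar>L\<bar> \<le> 2 * C * norm (y - y)" by (intro LIMSEQ_le_const[where a = "\<bar>L\<bar>"]) auto
    then show ?thesis using L by simp
  qed
  then have "wlim X x"
    by (simp add: wlim_def inner_diff_left LIM_zero_iff)
  then show ?thesis using that[of x] b(2) cx by (simp add: x_def)
qed

lemma weakly_convergent_subsequence:
  fixes X :: "nat \<Rightarrow> ell2"
  assumes "\<And>i. norm (X i) \<le> C"
  obtains r x where "strict_mono (r :: nat \<Rightarrow> nat)" "wlim (X \<circ> r) x" "norm x \<le> C"
proof -
  obtain r where r: "strict_mono (r :: nat \<Rightarrow> nat)"
    and "\<And>n. n \<in> UNIV \<Longrightarrow> \<exists>l. (\<lambda>i. cf (X (r i)) n) \<longlonglongrightarrow> l"
    by (rule function_convergent_subsequence[of "UNIV :: nat set" "\<lambda>i n. cf (X i) n" C])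
      (use order_trans[OF cf_le_norm assms] in auto)
  then obtain l where "\<And>n. (\<lambda>i. cf ((X \<circ> r) i) n) \<longlonglongrightarrow> l n" unfolding o_def by (metis UNIV_I)
  moreover have "norm ((X \<circ> r) i) \<le> C" for i by (simp add: assms)
  ultimately obtain x where "wlim (X \<circ> r) x" "norm x \<le> C" using wlim_of_components by blast
  with r that show thesis by blast
qed

lemma wlim_inner: "wlim X x \<Longrightarrow> (\<lambda>i. inner (X i) y) \<longlonglongrightarrow> inner x y"
  by (simp add: wlim_def)

lemma wlim_cf: "wlim X x \<Longrightarrow> (\<lambda>i. cf (X i) n) \<longlonglongrightarrow> cf x n"
  using wlim_inner[of X x "unitv n"] by simp

text \<open>Set to zero for an unbounded multiplier, so that \<open>diagop f\<close> is a bounded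
  operator whatever f is and can be lifted as a total function.\<close>

lift_definition diagop :: "(nat \<Rightarrow> real) \<Rightarrow> ell2 \<Rightarrow> ell2" is
  "\<lambda>f x n. if bounded (range f) then f n * x n else 0"
proof -
  fix f x :: "nat \<Rightarrow> real" assume x: "summable (\<lambda>n. (x n)\<^sup>2)"
  show "summable (\<lambda>n. (if bounded (range f) then f n * x n else 0)\<^sup>2)"
  proof (cases "bounded (range f)")
    case True
    then obtain C where C: "\<And>n. \<bar>f n\<bar> \<le> C" by (auto simp: bounded_iff)
    have "(f n * x n)\<^sup>2 \<le> C\<^sup>2 * (x n)\<^sup>2" for n
      using power_mono[OF C[of n], of 2] by (simp add: power_mult_distrib mult_right_mono)
    then have "summable (\<lambda>n. (f n * x n)\<^sup>2)"
      by (intro summable_comparison_test'[OF summable_mult[OF x, of "C\<^sup>2"]]) auto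
    then show ?thesis using True by simp
  qed simp
qed

lemma cf_diagop: "bounded (range f) \<Longrightarrow> cf (diagop f x) n = f n * cf x n"
  by transfer simp

lemma norm_ell2_mono:
  assumes "\<And>n. \<bar>cf x n\<bar> \<le> C * \<bar>cf y n\<bar>" "0 \<le> C"
  shows "norm x \<le> C * norm y"
proof -
  have "(\<Sum>n<N. (cf x n)\<^sup>2) \<le> (C * norm y)\<^sup>2" for N
  proof -
    have "(cf x n)\<^sup>2 \<le> C\<^sup>2 * (cf y n)\<^sup>2" for n
      using power_mono[OF assms(1)[of n], of 2] by (simp add: power_mult_distrib)
    then have "(\<Sum>n<N. (cf x n)\<^sup>2) \<le> C\<^sup>2 * (\<Sum>n<N. (cf y n)\<^sup>2)"
      by (simp add: sum_distrib_left sum_mono)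
    also have "\<dots> \<le> C\<^sup>2 * (norm y)\<^sup>2" by (intro mult_left_mono sum_sq_le_norm) auto
    finally show ?thesis by (simp add: power_mult_distrib)
  qed
  from norm_le_of_partial_sums(2)[OF this] assms(2) show ?thesis
    by (simp add: cf_inverse)
qed

lemma bounded_linear_diagop: "bounded_linear (diagop f)"
proof (cases "bounded (range f)")
  case True
  then obtain C where C: "\<And>n. \<bar>f n\<bar> \<le> C" by (auto simp: bounded_iff)
  show ?thesis
  proof (rule bounded_linear_intro[of _ C])
    show "norm (diagop f x) \<le> norm x * C" for x
      using norm_ell2_mono[of "diagop f x" C x] C order_trans[OF abs_ge_zero C]
      by (simp add: cf_diagop True abs_mult mult_right_mono mult.commute)
  qed (auto intro!: ell2_eqI simp: cf_diagop True algebra_simps)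
next
  case False
  then have "diagop f = (\<lambda>_. 0)" by (intro ext ell2_eqI) (transfer, simp)
  then show ?thesis by simp
qed

lemma inner_diagop:
  assumes "bounded (range f)"
  shows "inner (diagop f x) y = (\<Sum>n. f n * cf x n * cf y n)"
    and "summable (\<lambda>n. f n * cf x n * cf y n)"
    and "inner (diagop f x) y = inner x (diagop f y)"
  using summable_cf_mult[of "diagop f x" y] assms
  by (simp_all add: inner_ell2_def cf_diagop algebra_simps)

section \<open>The vorticity operator on a Fourier mode\<close>

text \<open>E is a conserved quadratic form of the unperturbed recurrence, positive definite because
  the absolute value of tau is below 2. The summable perturbation V changes E only by a relative
  amount, so beyond some J every upper bound G of E improves to G / 2, using that E tends to 0. Thus
  y vanishes from J on, and running the recurrence backwards gives the remaining values.\<close>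

lemma oscillating_recurrence_zero:
  fixes y V :: "nat \<Rightarrow> real"
  assumes tau: "\<bar>\<tau>\<bar> < 2" and V: "summable (\<lambda>j. \<bar>V j\<bar>)"
    and rec: "\<And>j. y (j + 2) + y j + (\<tau> + V j) * y (j + 1) = 0"
    and lim: "y \<longlonglongrightarrow> 0"
  shows "y j = 0"
proof -
  \<comment> \<open>The smallest eigenvalue of the quadratic form p^2 + q^2 + tau p q.\<close>
  define \<eta> where "\<eta> = 1 - \<bar>\<tau>\<bar> / 2"
  have \<eta>: "\<eta> > 0" using tau by (simp add: \<eta>_def)
  define E where "E j = (y (j + 1))\<^sup>2 + (y j)\<^sup>2 + \<tau> * (y (j + 1) * y j)" for j
  have low: "\<eta> * (p\<^sup>2 + q\<^sup>2) \<le> p\<^sup>2 + q\<^sup>2 + \<tau> * (p * q)" for p q :: real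
  proof -
    have "2 * \<bar>p\<bar> * \<bar>q\<bar> \<le> p\<^sup>2 + q\<^sup>2" using sum_squares_bound[of "\<bar>p\<bar>" "\<bar>q\<bar>"] by simp
    then have "\<bar>\<tau>\<bar> * (2 * \<bar>p\<bar> * \<bar>q\<bar>) \<le> \<bar>\<tau>\<bar> * (p\<^sup>2 + q\<^sup>2)" by (intro mult_left_mono) auto
    moreover have "- (\<tau> * (p * q)) \<le> \<bar>\<tau>\<bar> * (\<bar>p\<bar> * \<bar>q\<bar>)"
      using abs_ge_minus_self[of "\<tau> * (p * q)"] by (simp add: abs_mult)
    ultimately show ?thesis by (simp add: \<eta>_def algebra_simps)
  qed
  have Elow: "\<eta> * ((y (j + 1))\<^sup>2 + (y j)\<^sup>2) \<le> E j" for j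
    unfolding E_def by (rule low)
  have E0: "E j \<ge> 0" for j
    using Elow[of j] \<eta> by (smt (verit) mult_nonneg_nonneg zero_le_power2)
  have Elim: "E \<longlonglongrightarrow> 0"
  proof -
    have "(\<lambda>j. (y (j + 1))\<^sup>2 + (y j)\<^sup>2 + \<tau> * (y (j + 1) * y j)) \<longlonglongrightarrow> 0\<^sup>2 + 0\<^sup>2 + \<tau> * (0 * 0)"
      by (intro tendsto_intros lim LIMSEQ_ignore_initial_segment)
    then show ?thesis by (simp add: E_def[abs_def])
  qed
  have prod: "\<bar>y (j + 2) * y (j + 1)\<bar> + \<bar>y j * y (j + 1)\<bar> \<le> (E (j + 1) + E j) / (2 * \<eta>)" for j
  proof -
    have a: "2 * \<bar>p * q\<bar> \<le> p\<^sup>2 + q\<^sup>2" for p q :: real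
      using sum_squares_bound[of "\<bar>p\<bar>" "\<bar>q\<bar>"] by (simp add: abs_mult)
    have "\<eta> * (2 * (\<bar>y (j + 2) * y (j + 1)\<bar> + \<bar>y j * y (j + 1)\<bar>))
        \<le> \<eta> * (((y (j + 2))\<^sup>2 + (y (j + 1))\<^sup>2) + ((y (j + 1))\<^sup>2 + (y j)\<^sup>2))"
      using a[of "y (j + 2)" "y (j + 1)"] a[of "y j" "y (j + 1)"] \<eta>
      by (intro mult_left_mono) auto
    also have "\<dots> \<le> E (j + 1) + E j"
      using Elow[of "j + 1"] Elow[of j] by (simp add: algebra_simps)
    finally show ?thesis using \<eta> by (simp add: field_simps)
  qed
  have step: "\<bar>E (j + 1) - E j\<bar> \<le> \<bar>V j\<bar> * ((E (j + 1) + E j) / (2 * \<eta>))" for j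
  proof -
    have r: "y (j + 2) + y j + \<tau> * y (j + 1) = - V j * y (j + 1)"
      using rec[of j] by (simp add: algebra_simps)
    have "E (j + 1) - E j = (y (j + 2) - y j) * (y (j + 2) + y j + \<tau> * y (j + 1))"
      by (simp add: E_def power2_eq_square algebra_simps)
    also have "\<dots> = - V j * (y (j + 2) * y (j + 1) - y j * y (j + 1))"
      unfolding r by (simp add: algebra_simps)
    finally have "\<bar>E (j + 1) - E j\<bar> = \<bar>V j\<bar> * \<bar>y (j + 2) * y (j + 1) - y j * y (j + 1)\<bar>"
      by (simp add: abs_mult)
    also have "\<dots> \<le> \<bar>V j\<bar> * ((E (j + 1) + E j) / (2 * \<eta>))"
      using prod[of j] by (intro mult_left_mono) linarith+
    finally show ?thesis .
  qed
  \<comment> \<open>Beyond J the tail of V has mass at most eta / 2. Each unit of V costs at most G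
    / eta in E, so the total loss is G / 2.\<close>
  have "\<eta> / 2 > 0" using \<eta> by simp
  from suminf_exist_split[OF this V] obtain J where J: "norm (\<Sum>i. \<bar>V (i + J)\<bar>) < \<eta> / 2" by blast
  have tailV: "(\<Sum>i<n. \<bar>V (j + i)\<bar>) \<le> \<eta> / 2" if "j \<ge> J" for j n
  proof -
    have s: "summable (\<lambda>i. \<bar>V (i + J)\<bar>)" using V summable_iff_shift[of "\<lambda>i. \<bar>V i\<bar>" J] by simp
    have "(\<Sum>i<n. \<bar>V (j + i)\<bar>) = (\<Sum>i\<in>{j - J..<j - J + n}. \<bar>V (i + J)\<bar>)"
      by (rule sum.reindex_bij_witness[of _ "\<lambda>i. i - (j - J)" "\<lambda>i. i + (j - J)"])
        (use that in \<open>auto simp: algebra_simps\<close>)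
    also have "\<dots> \<le> (\<Sum>i. \<bar>V (i + J)\<bar>)" by (intro sum_le_suminf s) auto
    finally show ?thesis using J by simp
  qed
  have halve: "\<forall>i\<ge>J. E i \<le> G / 2" if G: "\<forall>i\<ge>J. E i \<le> G" for G
  proof (intro allI impI)
    fix j assume j: "j \<ge> J"
    have G0: "G \<ge> 0" using G E0[of J] by force
    have bd: "E j \<le> E (j + n) + G / 2" for n
    proof -
      have "E j \<le> E (j + n) + (\<Sum>i<n. \<bar>V (j + i)\<bar>) * (G / \<eta>)"
      proof (induction n)
        case (Suc n)
        have s1: "E (j + n) \<le> E (j + Suc n) + \<bar>V (j + n)\<bar> * ((E (j + n + 1) + E (j + n)) / (2 * \<eta>))"
          using step[of "j + n"] by simp
        have "(E (j + n + 1) + E (j + n)) / (2 * \<eta>) \<le> (2 * G) / (2 * \<eta>)"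
        proof (rule divide_right_mono)
          have "E (j + n + 1) \<le> G" "E (j + n) \<le> G" using G j by (simp_all del: One_nat_def)
          then show "E (j + n + 1) + E (j + n) \<le> 2 * G" by linarith
        qed (use \<eta> in simp)
        then have Vle: "\<bar>V (j + n)\<bar> * ((E (j + n + 1) + E (j + n)) / (2 * \<eta>)) \<le> \<bar>V (j + n)\<bar> * (G / \<eta>)"
          by (intro mult_left_mono) auto
        show ?case using Suc order_trans[OF s1 add_left_mono[OF Vle]] by (simp add: distrib_right add_divide_distrib)
      qed simp
      also have "(\<Sum>i<n. \<bar>V (j + i)\<bar>) * (G / \<eta>) \<le> \<eta> / 2 * (G / \<eta>)"
        using tailV[OF j] G0 \<eta> by (intro mult_right_mono) auto
      finally show ?thesis using \<eta> by simp
    qed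
    have "(\<lambda>n. E (j + n) + G / 2) \<longlonglongrightarrow> 0 + G / 2"
      using LIMSEQ_ignore_initial_segment[OF Elim, of j] by (intro tendsto_intros) (simp add: add.commute)
    then show "E j \<le> G / 2" using bd by (intro LIMSEQ_le_const[where X = "\<lambda>n. E (j + n) + G / 2"]) auto
  qed
  obtain C where C: "\<And>i. \<bar>E i\<bar> \<le> C"
    using convergent_imp_Bseq[of E] Elim by (auto simp: convergent_def Bseq_def)
  have pw: "\<forall>i\<ge>J. E i \<le> C / 2 ^ n" for n
  proof (induction n)
    case 0 then show ?case using C abs_le_D1 by auto
  next
    case (Suc n) then show ?case using halve[OF Suc] by (simp add: field_simps)
  qed
  have EJ: "E i = 0" if "i \<ge> J" for i
  proof -
    have "(\<lambda>n. C * (1 / 2) ^ n) \<longlonglongrightarrow> C * 0"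
      by (intro tendsto_intros LIMSEQ_power_zero) simp
    moreover have "E i \<le> C * (1 / 2) ^ n" for n using pw[of n] that by (simp add: power_divide)
    ultimately have "E i \<le> 0" by (intro LIMSEQ_le_const[where X = "\<lambda>n. C * (1 / 2) ^ n"]) auto
    then show ?thesis using E0[of i] by simp
  qed
  have yJ: "y i = 0" if "i \<ge> J" for i
    using Elow[of i] EJ[OF that] \<eta> by (simp add: mult_le_0_iff) (smt (verit) zero_le_power2 power2_eq_iff_nonneg zero_power2 power_eq_0_iff)
  have "y (J - k) = 0 \<and> y (J - k + 1) = 0" for k
  proof (induction k)
    case 0 then show ?case using yJ by simp
  next
    case (Suc k)
    show ?case
    proof (cases "k < J")
      case True
      then have "J - k = J - Suc k + 1" by simp
      moreover from this have "J - k + 1 = J - Suc k + 2" by simp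
      ultimately show ?thesis using Suc rec[of "J - Suc k"] by simp
    qed (use Suc in simp)
  qed
  from this[of "J - j"] yJ[of j] show ?thesis by (cases "j \<ge> J") auto
qed

text \<open>The shifts go by two places because multiplication by cos (pi y) couples sines whose
  frequencies differ by two.\<close>

lift_definition shl2 :: "ell2 \<Rightarrow> ell2" is "\<lambda>x n. x (n + 2)"
  subgoal for x using summable_iff_shift[of "\<lambda>n. (x n)\<^sup>2" 2] by simp
  done

lift_definition shr2 :: "ell2 \<Rightarrow> ell2" is "\<lambda>x n. if n \<ge> 2 then x (n - 2) else 0"
  by (subst summable_iff_shift[of _ 2, symmetric]) simp

lemma cf_shl2 [simp]: "cf (shl2 x) n = cf x (n + 2)"
  by transfer simp

lemma cf_shr2 [simp]: "cf (shr2 x) n = (if n \<ge> 2 then cf x (n - 2) else 0)"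
  by transfer simp

lemma inner_shr2: "inner (shr2 x) y = inner x (shl2 y)"
  unfolding inner_ell2_def
  using suminf_split_initial_segment[OF summable_cf_mult[of "shr2 x" y], of 2]
  by (simp add: numeral_2_eq_2)

lemma norm_shl2_sq: "(norm (shl2 x))\<^sup>2 = (norm x)\<^sup>2 - (cf x 0)\<^sup>2 - (cf x 1)\<^sup>2"
  unfolding norm_ell2_sq
  using suminf_split_initial_segment[OF summable_cf_sq[of x], of 2] by (simp add: numeral_2_eq_2)

lemma norm_shl2: "norm (shl2 x) \<le> norm x"
proof (rule power2_le_imp_le)
  show "(norm (shl2 x))\<^sup>2 \<le> (norm x)\<^sup>2"
    using norm_shl2_sq[of x] zero_le_power2[of "cf x 0"] zero_le_power2[of "cf x 1"] by linarith
qed simp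

lemma norm_shr2: "norm (shr2 x) = norm x"
proof -
  have "(norm (shr2 x))\<^sup>2 = inner x (shl2 (shr2 x))" by (simp add: power2_norm_eq_inner inner_shr2)
  also have "shl2 (shr2 x) = x" by (rule ell2_eqI) simp
  finally show ?thesis by (simp add: norm_eq_sqrt_inner)
qed

lemma bounded_linear_shl2: "bounded_linear shl2"
  by (rule bounded_linear_intro[of _ 1]) (auto intro!: ell2_eqI simp: norm_shl2)

lemma bounded_linear_shr2: "bounded_linear shr2"
  by (rule bounded_linear_intro[of _ 1]) (auto intro!: ell2_eqI simp: norm_shr2)

text \<open>Twice the operator of multiplication by \<open>- cos (\<pi> y)\<close> in the basis
  \<open>sin ((n + 1) \<pi> (y + 1) / 2)\<close>; the corner term comes from \<open>sin (- \<theta>) = - sin \<theta>\<close>.\<close>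
definition Cop :: "ell2 \<Rightarrow> ell2" where
  "Cop x = shl2 x + shr2 x - cf x 0 *\<^sub>R unitv 0"

lemma cf_Cop: "cf (Cop x) n = cf x (n + 2) + (if n \<ge> 2 then cf x (n - 2) else if n = 0 then - cf x 0 else 0)"
  by (simp add: Cop_def cf_unitv)

lemma bounded_linear_Cop: "bounded_linear Cop"
  unfolding Cop_def[abs_def]
  by (intro bounded_linear_intros bounded_linear_shl2 bounded_linear_shr2 bounded_linear_add
      bounded_linear_sub bounded_linear_scaleR_const bounded_linear_cf)

lemma inner_Cop_sym: "inner (Cop x) y = inner x (Cop y)"
proof -
  have "inner (shl2 x) y = inner x (shr2 y)" by (metis inner_commute inner_shr2)
  then show ?thesis by (simp add: Cop_def inner_add_left inner_add_right inner_diff_left inner_diff_right inner_shr2)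
qed

text \<open>\<open>Cop\<close> represents multiplication by a function with values in [-2, 2]. For
  the lower bound, expand the square of the norm of \<open>shl2 x + x\<close>: the square of
  \<open>cf x 0\<close> that is lost in \<open>norm_shl2_sq\<close> is exactly the corner term of
  \<open>Cop\<close>.\<close>

lemma inner_Cop_bound: "\<bar>inner (Cop x) x\<bar> \<le> 2 * (norm x)\<^sup>2"
proof -
  have eq: "inner (Cop x) x = 2 * inner (shl2 x) x - (cf x 0)\<^sup>2"
    unfolding Cop_def inner_diff_left inner_add_left inner_shr2 inner_commute[of x "shl2 x"]
    by (simp add: power2_eq_square)
  have "0 \<le> (norm (shl2 x + x))\<^sup>2" by simp
  also have "\<dots> = (norm (shl2 x))\<^sup>2 + 2 * inner (shl2 x) x + (norm x)\<^sup>2"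
    by (simp add: power2_norm_eq_inner inner_add_left inner_add_right inner_commute)
  finally have "- 2 * (norm x)\<^sup>2 \<le> inner (Cop x) x"
    using eq norm_shl2_sq[of x] zero_le_power2[of "cf x 1"] by linarith
  moreover have "inner (shl2 x) x \<le> (norm x)\<^sup>2"
  proof -
    have "inner (shl2 x) x \<le> norm (shl2 x) * norm x" by (rule norm_cauchy_schwarz)
    also have "\<dots> \<le> norm x * norm x" by (intro mult_right_mono norm_shl2) simp
    finally show ?thesis by (simp add: power2_eq_square)
  qed
  then have "inner (Cop x) x \<le> 2 * (norm x)\<^sup>2" using eq zero_le_power2[of "cf x 0"] by linarith
  ultimately show ?thesis by linarith
qed

text \<open>Multiplication by beta - U'' = beta + (pi^2 / 2) cos (pi y) in the sine basis;
  \<open>row_Kf\<close> below makes this precise.\<close>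

definition Kop :: "real \<Rightarrow> ell2 \<Rightarrow> ell2" where
  "Kop \<beta> x = \<beta> *\<^sub>R x - (pi\<^sup>2 / 4) *\<^sub>R Cop x"

lemma cf_Kop: "cf (Kop \<beta> x) n = \<beta> * cf x n - pi\<^sup>2 / 4 * cf (Cop x) n"
  by (simp add: Kop_def)

lemma bounded_linear_Kop: "bounded_linear (Kop \<beta>)"
  unfolding Kop_def[abs_def]
  by (intro bounded_linear_intros bounded_linear_sub bounded_linear_const_scaleR bounded_linear_Cop)

lemma inner_Kop_sym: "inner (Kop \<beta> x) y = inner x (Kop \<beta> y)"
  by (simp add: Kop_def inner_diff_left inner_diff_right inner_Cop_sym)

lemma inner_Kop_comm: "inner (Kop \<beta> x) y = inner (Kop \<beta> y) x"
  by (subst inner_Kop_sym) (rule inner_commute)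

text \<open>\<open>mm a n\<close> is the eigenvalue of a^2 - d^2/dy^2 on \<open>sn n\<close>, and
  \<open>dd a n\<close> is the resulting diagonal entry of L. Only n = 0 can give a nonpositive
  entry when a > 0.\<close>

definition mm :: "real \<Rightarrow> nat \<Rightarrow> real" where
  "mm a n = a\<^sup>2 + (real (Suc n))\<^sup>2 * pi\<^sup>2 / 4"

definition dd :: "real \<Rightarrow> nat \<Rightarrow> real" where
  "dd a n = 1 / pi\<^sup>2 - 1 / mm a n"

text \<open>Since \<open>inverse 0 = 0\<close>, the resonant coefficient is simply dropped.\<close>
definition gg :: "real \<Rightarrow> nat \<Rightarrow> real" where
  "gg a n = inverse (dd a n)"

lemma mm_pos: "mm a n > 0"
  unfolding mm_def by (intro add_nonneg_pos) auto

lemma mm_mono: "m \<le> n \<Longrightarrow> mm a m \<le> mm a n"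
  unfolding mm_def by (auto intro!: divide_right_mono mult_right_mono power_mono)

lemma mm_ge: "mm a n - pi\<^sup>2 \<ge> a\<^sup>2 + pi\<^sup>2 / 4 * ((real (Suc n))\<^sup>2 - 4)"
  by (simp add: mm_def algebra_simps)

lemma mm_gt: "a > 0 \<Longrightarrow> n \<ge> 1 \<Longrightarrow> mm a n > pi\<^sup>2"
proof -
  assume "a > 0" "n \<ge> 1"
  have "2\<^sup>2 \<le> (real (Suc n))\<^sup>2" using \<open>n \<ge> 1\<close> by (intro power_mono) auto
  then have "pi\<^sup>2 / 4 * ((real (Suc n))\<^sup>2 - 4) \<ge> 0" by simp
  moreover have "a\<^sup>2 > 0" using \<open>a > 0\<close> by simp
  ultimately show ?thesis using mm_ge[of a n] by linarith
qed

lemma dd_eq: "dd a n = (mm a n - pi\<^sup>2) / (pi\<^sup>2 * mm a n)"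
  using mm_pos[of a n] by (simp add: dd_def field_simps)

lemma dd_le: "dd a n \<le> 1 / pi\<^sup>2" "\<bar>dd a n\<bar> \<le> 1 / pi\<^sup>2 + 4 / pi\<^sup>2"
proof -
  have "mm a n \<ge> pi\<^sup>2 / 4"
  proof -
    have "1 * pi\<^sup>2 \<le> (real (Suc n))\<^sup>2 * pi\<^sup>2" by (intro mult_right_mono) auto
    then show ?thesis by (simp add: mm_def add_increasing)
  qed
  then have "1 / mm a n \<le> 4 / pi\<^sup>2" using mm_pos[of a n] by (simp add: field_simps)
  moreover have "0 \<le> 1 / mm a n" using mm_pos[of a n] by simp
  moreover have "0 \<le> 1 / pi\<^sup>2" "0 \<le> 4 / pi\<^sup>2" by auto
  ultimately show "dd a n \<le> 1 / pi\<^sup>2" "\<bar>dd a n\<bar> \<le> 1 / pi\<^sup>2 + 4 / pi\<^sup>2" unfolding dd_def by linarith+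
qed

lemma dd_mono: "m \<le> n \<Longrightarrow> dd a m \<le> dd a n"
  using mm_mono[of m n a] mm_pos[of a m] by (simp add: dd_def frac_le)

lemma dd_pos_iff: "dd a n > 0 \<longleftrightarrow> mm a n > pi\<^sup>2" "dd a n = 0 \<longleftrightarrow> mm a n = pi\<^sup>2"
proof -
  have p: "pi\<^sup>2 * mm a n > 0" using mm_pos[of a n] by simp
  then show "dd a n > 0 \<longleftrightarrow> mm a n > pi\<^sup>2" unfolding dd_eq zero_less_divide_iff by linarith
  show "dd a n = 0 \<longleftrightarrow> mm a n = pi\<^sup>2" using p unfolding dd_eq divide_eq_0_iff by linarith
qed

lemma bounded_dd: "bounded (range (dd a))"
  using dd_le(2) by (auto simp: bounded_iff intro!: exI)

text \<open>The constant pi^2 combines with \<open>Kop\<close> into multiplication by pi^2 (U - c),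
  while the remainder is of order 1 / n^2. The recurrence argument treats that remainder as a
  summable perturbation, and the form argument uses its sign.\<close>

lemma gg_eq: "mm a n \<noteq> pi\<^sup>2 \<Longrightarrow> gg a n = pi\<^sup>2 + pi ^ 4 / (mm a n - pi\<^sup>2)"
  using mm_pos[of a n] by (simp add: gg_def dd_eq field_simps power4_eq_xxxx power2_eq_square)

lemma bounded_gg: "bounded (range (gg a))"
proof -
  have "\<bar>gg a n\<bar> \<le> \<bar>gg a 0\<bar> + \<bar>gg a 1\<bar> + (pi\<^sup>2 + pi ^ 4 / (pi\<^sup>2 / 4))" for n
  proof (cases "n \<le> 1")
    case True
    then have "n = 0 \<or> n = 1" by auto
    moreover have "0 \<le> pi\<^sup>2 + pi ^ 4 / (pi\<^sup>2 / 4)" by simp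
    ultimately show ?thesis by auto
  next
    case False
    then have "3\<^sup>2 \<le> (real (Suc n))\<^sup>2" by (intro power_mono) auto
    then have "pi\<^sup>2 / 4 * 1 \<le> pi\<^sup>2 / 4 * ((real (Suc n))\<^sup>2 - 4)" by (intro mult_left_mono) auto
    then have *: "pi\<^sup>2 / 4 \<le> mm a n - pi\<^sup>2" using mm_ge[of a n] zero_le_power2[of a] by linarith
    have p: "pi\<^sup>2 / 4 > 0" by simp
    have **: "mm a n - pi\<^sup>2 > 0" using * p by linarith
    have "pi ^ 4 / (mm a n - pi\<^sup>2) \<le> pi ^ 4 / (pi\<^sup>2 / 4)"
      using * p ** by (intro divide_left_mono mult_pos_pos) auto
    moreover have "0 \<le> pi ^ 4 / (mm a n - pi\<^sup>2)" using ** by simp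
    ultimately show ?thesis using ** by (subst gg_eq) auto
  qed
  then show ?thesis by (auto simp: bounded_iff intro!: exI)
qed

definition Lo :: "real \<Rightarrow> ell2 \<Rightarrow> ell2" where "Lo a = diagop (dd a)"
definition Go :: "real \<Rightarrow> ell2 \<Rightarrow> ell2" where "Go a = diagop (gg a)"
definition Aop :: "real \<Rightarrow> real \<Rightarrow> ell2 \<Rightarrow> ell2" where "Aop \<beta> a x = Kop \<beta> (Lo a x)"

lemma cf_Lo: "cf (Lo a x) n = dd a n * cf x n" and cf_Go: "cf (Go a x) n = gg a n * cf x n"
  by (simp_all add: Lo_def Go_def cf_diagop bounded_dd bounded_gg)

lemma bounded_linear_Lo: "bounded_linear (Lo a)" and bounded_linear_Go: "bounded_linear (Go a)"
  by (simp_all add: Lo_def Go_def bounded_linear_diagop)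

lemma bounded_linear_Aop: "bounded_linear (Aop \<beta> a)"
  unfolding Aop_def[abs_def] by (rule bounded_linear_compose[OF bounded_linear_Kop bounded_linear_Lo])

lemma inner_Lo_sym: "inner (Lo a x) y = inner x (Lo a y)"
  and inner_Go_sym: "inner (Go a x) y = inner x (Go a y)"
  by (simp_all add: Lo_def Go_def inner_diagop(3) bounded_dd bounded_gg)

lemma inner_Lo_comm: "inner (Lo a x) y = inner (Lo a y) x"
  by (subst inner_Lo_sym) (rule inner_commute)

lemma inner_Aop_sym: "inner (Lo a (Aop \<beta> a x)) y = inner (Lo a x) (Aop \<beta> a y)"
  by (simp add: Aop_def inner_Lo_sym inner_Kop_sym)

lemma Go_Lo: "mm a 0 \<noteq> pi\<^sup>2 \<Longrightarrow> a > 0 \<Longrightarrow> Go a (Lo a x) = x" and Lo_Go: "mm a 0 \<noteq> pi\<^sup>2 \<Longrightarrow> a > 0 \<Longrightarrow> Lo a (Go a x) = x"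
proof -
  assume "mm a 0 \<noteq> pi\<^sup>2" "a > 0"
  then have "dd a n \<noteq> 0" for n
    using mm_gt[of a n] dd_pos_iff(2)[of a n] by (cases n) fastforce+
  then show "Go a (Lo a x) = x" "Lo a (Go a x) = x"
    by (auto intro!: ell2_eqI simp: cf_Lo cf_Go gg_def)
qed

text \<open>The entries \<open>dd a k\<close> increase with k, so the first one that x can meet is a
  lower bound. The case n = 1 gives positivity on the hyperplane of vectors with first component 0
  when \<open>dd a 0\<close> is not positive.\<close>

lemma inner_Lo_lower:
  assumes "a > 0" "cf x 0 = 0 \<or> n = 0" "n \<le> 1"
  shows "dd a n * (norm x)\<^sup>2 \<le> inner (Lo a x) x"
proof -
  have "(\<Sum>k. dd a n * (cf x k)\<^sup>2) \<le> (\<Sum>k. dd a k * cf x k * cf x k)"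
  proof (rule suminf_le)
    show "summable (\<lambda>k. dd a n * (cf x k)\<^sup>2)" by (intro summable_mult summable_cf_sq)
    show "summable (\<lambda>k. dd a k * cf x k * cf x k)" by (rule inner_diagop(2)[OF bounded_dd])
    show "dd a n * (cf x k)\<^sup>2 \<le> dd a k * cf x k * cf x k" for k
    proof (cases "n \<le> k")
      case True
      then show ?thesis using dd_mono[OF True, of a] by (simp add: power2_eq_square mult_right_mono mult.assoc)
    next
      case False
      then have "k = 0" "n \<noteq> 0" using assms(3) by auto
      then show ?thesis using assms(2) by simp
    qed
  qed
  then show ?thesis
    by (simp add: Lo_def inner_diagop(1) bounded_dd norm_ell2_sq suminf_mult summable_cf_sq)
qed

text \<open>With \<open>c = \<kappa> + 1/2 - \<beta>/\<pi>\<^sup>2\<close>, the hypothesis on \<open>\<kappa>\<close> says that \<open>c\<close> lies in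
  the open range of \<open>U\<close>.\<close>
lemma no_embedded_neutral_mode:
  assumes "a > 0" and kap: "\<bar>\<kappa> - \<beta> / pi\<^sup>2\<bar> < 1 / 2"
    and row: "\<And>n. n \<ge> 1 \<Longrightarrow> cf (Kop \<beta> v) n = \<kappa> * (gg a n * cf v n)"
  shows "v = 0"
proof -
  \<comment> \<open>Dividing row n by pi^2 / 4 turns it into \<open>Cop v\<close> + (tau + W n) v =
    0. Here tau comes from the constant part of \<open>gg\<close> and from beta, and W n from the
    decaying part of \<open>gg\<close>.\<close>
  define W where "W n = 4 * \<kappa> * pi\<^sup>2 / (mm a n - pi\<^sup>2)" for n
  define \<tau> where "\<tau> = 4 * \<kappa> - 4 * \<beta> / pi\<^sup>2"
  have "\<tau> = 4 * (\<kappa> - \<beta> / pi\<^sup>2)" by (simp add: \<tau>_def)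
  then have "\<bar>\<tau>\<bar> = 4 * \<bar>\<kappa> - \<beta> / pi\<^sup>2\<bar>" by (simp only: abs_mult)
  moreover have "4 * k < 2" if "k < 1 / 2" for k :: real using that by simp
  ultimately have tau: "\<bar>\<tau>\<bar> < 2" using kap by (simp only:)
  have r: "cf (Cop v) n + (\<tau> + W n) * cf v n = 0" if "n \<ge> 1" for n
  proof -
    have "mm a n > pi\<^sup>2" by (rule mm_gt[OF \<open>a > 0\<close> that])
    then have g: "gg a n = pi\<^sup>2 + pi ^ 4 / (mm a n - pi\<^sup>2)" by (intro gg_eq) simp
    have W': "\<tau> + W n = 4 / pi\<^sup>2 * (\<kappa> * gg a n - \<beta>)"
      by (simp add: g \<tau>_def W_def power2_eq_square power4_eq_xxxx divide_simps) (simp add: algebra_simps)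
    have "\<beta> * cf v n - pi\<^sup>2 / 4 * cf (Cop v) n = \<kappa> * gg a n * cf v n"
      using row[OF that] by (simp add: cf_Kop algebra_simps)
    then have "(\<kappa> * gg a n - \<beta>) * cf v n = - (pi\<^sup>2 / 4 * cf (Cop v) n)" by (simp add: algebra_simps)
    then have "(\<tau> + W n) * cf v n = 4 / pi\<^sup>2 * - (pi\<^sup>2 / 4 * cf (Cop v) n)"
      unfolding W' by (simp only: mult.assoc)
    then show ?thesis by (simp add: field_simps)
  qed
  have Wbound: "\<bar>W n\<bar> \<le> 16 * \<bar>\<kappa>\<bar> * (1 / (real j)\<^sup>2)" if "j \<ge> 1" "n \<ge> 2 * j + 1" for j n
  proof -
    have "real (Suc n) \<ge> 2 * real j + 2" using that(2) by simp
    then have "(2 * real j + 2)\<^sup>2 \<le> (real (Suc n))\<^sup>2" by (intro power_mono) auto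
    then have "(real j)\<^sup>2 \<le> (real (Suc n))\<^sup>2 - 4" by (simp add: power2_sum power_mult_distrib)
       (smt (verit) zero_le_power2 of_nat_0_le_iff)
    then have "pi\<^sup>2 / 4 * (real j)\<^sup>2 \<le> pi\<^sup>2 / 4 * ((real (Suc n))\<^sup>2 - 4)" by (intro mult_left_mono) auto
    then have *: "pi\<^sup>2 / 4 * (real j)\<^sup>2 \<le> mm a n - pi\<^sup>2" using mm_ge[of a n] zero_le_power2[of a] by linarith
    have p: "pi\<^sup>2 / 4 * (real j)\<^sup>2 > 0" using that(1) by simp
    have **: "mm a n - pi\<^sup>2 > 0" by (rule less_le_trans[OF p *])
    then have "\<bar>W n\<bar> = 4 * \<bar>\<kappa>\<bar> * pi\<^sup>2 / (mm a n - pi\<^sup>2)" by (simp add: W_def abs_mult)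
    also have "\<dots> \<le> 4 * \<bar>\<kappa>\<bar> * pi\<^sup>2 / (pi\<^sup>2 / 4 * (real j)\<^sup>2)"
      by (rule divide_left_mono[OF * _ mult_pos_pos[OF ** p]]) simp
    also have "\<dots> = 16 * \<bar>\<kappa>\<bar> * (1 / (real j)\<^sup>2)" by simp
    finally show ?thesis .
  qed
  have sumW: "summable (\<lambda>j. \<bar>W (f j)\<bar>)" if "\<And>j. f j \<ge> 2 * j + 1" for f
  proof (rule summable_comparison_test')
    show "summable (\<lambda>j. 16 * \<bar>\<kappa>\<bar> * (1 / (real j)\<^sup>2))"
      using inverse_power_summable[of 2, where 'a = real] by (intro summable_mult) (simp add: inverse_eq_divide)
    show "norm \<bar>W (f j)\<bar> \<le> 16 * \<bar>\<kappa>\<bar> * (1 / (real j)\<^sup>2)" if "j \<ge> 1" for j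
      using Wbound[OF that \<open>f j \<ge> 2 * j + 1\<close>] by simp
  qed
  have v0: "(\<lambda>n. cf v n) \<longlonglongrightarrow> 0"
    using summable_LIMSEQ_zero[OF summable_cf_sq[of v]] tendsto_real_sqrt by fastforce
  \<comment> \<open>Even components are linked by the rows 2 j + 2 and odd ones by the rows 2 j + 1.
    Working with rows n >= 1 lets the lemma serve the resonant mode as well, where row 0 is
    projected away.\<close>
  have even: "cf v (2 * j) = 0" for j
  proof (rule oscillating_recurrence_zero[OF tau, of "\<lambda>j. W (2 * j + 2)" "\<lambda>j. cf v (2 * j)"])
    show "summable (\<lambda>j. \<bar>W (2 * j + 2)\<bar>)" by (rule sumW) simp
    show "cf v (2 * (j + 2)) + cf v (2 * j) + (\<tau> + W (2 * j + 2)) * cf v (2 * (j + 1)) = 0" for j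
      using r[of "2 * j + 2"] by (simp add: cf_Cop algebra_simps)
    show "(\<lambda>j. cf v (2 * j)) \<longlonglongrightarrow> 0"
      by (rule LIMSEQ_subseq_LIMSEQ[OF v0, of "\<lambda>j. 2 * j", unfolded o_def]) (simp add: strict_mono_def)
  qed
  \<comment> \<open>Row 1 of \<open>Cop\<close> has no lower neighbour; a fictitious component y 0 =
    0 restores the three-term form there.\<close>
  define y where "y j = (if j = 0 then 0 else cf v (2 * j - 1))" for j
  have y: "y j = 0" for j
  proof (rule oscillating_recurrence_zero[OF tau, of "\<lambda>j. W (2 * j + 1)" y])
    show "summable (\<lambda>j. \<bar>W (2 * j + 1)\<bar>)" by (rule sumW) simp
    show "y (j + 2) + y j + (\<tau> + W (2 * j + 1)) * y (j + 1) = 0" for j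
      using r[of "2 * j + 1"] by (cases j) (simp_all add: cf_Cop y_def algebra_simps)
    have "(\<lambda>j. cf v (2 * j + 1)) \<longlonglongrightarrow> 0"
      by (rule LIMSEQ_subseq_LIMSEQ[OF v0, of "\<lambda>j. 2 * j + 1", unfolded o_def]) (simp add: strict_mono_def)
    then have "(\<lambda>j. y (Suc j)) \<longlonglongrightarrow> 0" by (simp add: y_def)
    then show "y \<longlonglongrightarrow> 0" by (simp add: filterlim_sequentially_Suc)
  qed
  have odd: "cf v (2 * j + 1) = 0" for j using y[of "Suc j"] by (simp add: y_def)
  show ?thesis
  proof (rule ell2_eqI)
    fix n show "cf v n = cf 0 n"
      using even[of "n div 2"] odd[of "n div 2"] by (cases "even n") (auto simp: odd_two_times_div_two_succ)
  qed
qed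

text \<open>For s = -1 / kappa, a vector v lies in the kernel of this form exactly when K v = kappa
  G v, which is the eigenvalue equation of A for x = G v.\<close>

definition hf :: "real \<Rightarrow> real \<Rightarrow> real \<Rightarrow> ell2 \<Rightarrow> ell2 \<Rightarrow> real" where
  "hf \<beta> a s v w = inner (Go a v) w + s * inner (Kop \<beta> v) w"

lemma hf_bilinear:
  "hf \<beta> a s (v + v') w = hf \<beta> a s v w + hf \<beta> a s v' w" "hf \<beta> a s (v - v') w = hf \<beta> a s v w - hf \<beta> a s v' w"
  "hf \<beta> a s (c *\<^sub>R v) w = c * hf \<beta> a s v w" "hf \<beta> a s v w = hf \<beta> a s w v"
proof -
  interpret G: bounded_linear "Go a" by (rule bounded_linear_Go)
  interpret K: bounded_linear "Kop \<beta>" by (rule bounded_linear_Kop)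
  show "hf \<beta> a s (v + v') w = hf \<beta> a s v w + hf \<beta> a s v' w" "hf \<beta> a s (v - v') w = hf \<beta> a s v w - hf \<beta> a s v' w"
    "hf \<beta> a s (c *\<^sub>R v) w = c * hf \<beta> a s v w"
    by (simp_all add: hf_def G.add K.add G.diff K.diff G.scaleR K.scaleR inner_add_left inner_diff_left algebra_simps)
  show "hf \<beta> a s v w = hf \<beta> a s w v"
    unfolding hf_def by (metis inner_Go_sym inner_Kop_sym inner_commute)
qed

text \<open>This is the operator inequality \<open>\<pi>\<^sup>2 (c - U) / (c - U\<^sub>\<beta>) \<ge> 0\<close>, valid for \<open>c\<close> outside the range of \<open>U\<close>.\<close>
lemma outside_range_nonneg:
  assumes beta: "\<bar>\<beta>\<bar> < pi\<^sup>2 / 2" and kap: "\<bar>\<kappa> - \<beta> / pi\<^sup>2\<bar> \<ge> 1 / 2"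
  shows "0 \<le> pi\<^sup>2 * (norm v)\<^sup>2 + (- 1 / \<kappa>) * inner (Kop \<beta> v) v"
proof -
  define s where "s = - 1 / \<kappa>"
  have c: "\<bar>inner (Cop v) v\<bar> \<le> 2 * (norm v)\<^sup>2" by (rule inner_Cop_bound)
  have q: "\<bar>s * (pi\<^sup>2 / 4) * inner (Cop v) v\<bar> \<le> \<bar>s\<bar> * (pi\<^sup>2 / 4) * (2 * (norm v)\<^sup>2)"
    unfolding abs_mult by (intro mult_mono c) auto
  have "\<bar>s\<bar> * (pi\<^sup>2 / 2) \<le> pi\<^sup>2 + s * \<beta>"
  proof -
    have "\<kappa> \<ge> \<beta> / pi\<^sup>2 + 1 / 2 \<or> \<kappa> \<le> \<beta> / pi\<^sup>2 - 1 / 2" using kap by linarith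
    then show ?thesis
    proof
      assume k: "\<kappa> \<ge> \<beta> / pi\<^sup>2 + 1 / 2"
      have "\<beta> / pi\<^sup>2 + 1 / 2 > 0" using beta by (simp add: field_simps abs_less_iff)
      then have "\<kappa> > 0" using k by linarith
      moreover have "\<beta> + pi\<^sup>2 / 2 \<le> pi\<^sup>2 * \<kappa>"
        using mult_left_mono[OF k, of "pi\<^sup>2"] by (simp add: algebra_simps)
      ultimately show ?thesis by (simp add: s_def field_simps)
    next
      assume k: "\<kappa> \<le> \<beta> / pi\<^sup>2 - 1 / 2"
      have "\<beta> / pi\<^sup>2 - 1 / 2 < 0" using beta by (simp add: field_simps abs_less_iff)
      then have "\<kappa> < 0" using k by linarith
      moreover have "pi\<^sup>2 * \<kappa> \<le> \<beta> - pi\<^sup>2 / 2"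
        using mult_left_mono[OF k, of "pi\<^sup>2"] by (simp add: algebra_simps)
      ultimately show ?thesis by (simp add: s_def field_simps)
    qed
  qed
  then have "0 \<le> (norm v)\<^sup>2 * (pi\<^sup>2 + s * \<beta> - \<bar>s\<bar> * (pi\<^sup>2 / 2))" by simp
  moreover have "inner (Kop \<beta> v) v = \<beta> * (norm v)\<^sup>2 - pi\<^sup>2 / 4 * inner (Cop v) v"
    by (simp add: Kop_def inner_diff_left power2_norm_eq_inner)
  then have "pi\<^sup>2 * (norm v)\<^sup>2 + s * inner (Kop \<beta> v) v
    = (norm v)\<^sup>2 * (pi\<^sup>2 + s * \<beta>) - s * (pi\<^sup>2 / 4) * inner (Cop v) v" unfolding \<open>inner (Kop \<beta> v) v = _\<close> by algebra
  moreover have "s * (pi\<^sup>2 / 4) * inner (Cop v) v \<le> (norm v)\<^sup>2 * (\<bar>s\<bar> * (pi\<^sup>2 / 2))"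
    using abs_le_D1[OF q] by (simp add: mult_ac)
  ultimately show ?thesis unfolding s_def[symmetric] right_diff_distrib by linarith
qed

text \<open>Split G into pi^2 plus the diagonal operator with entries \<open>gg a n\<close> - pi^2.
  The first part together with K is nonnegative by \<open>outside_range_nonneg\<close>; the second
  has positive entries at every index where v does not vanish, which gives definiteness.\<close>

lemma hf_definite:
  assumes "a > 0" "\<bar>\<beta>\<bar> < pi\<^sup>2 / 2" "\<bar>\<kappa> - \<beta> / pi\<^sup>2\<bar> \<ge> 1 / 2" "mm a 0 > pi\<^sup>2 \<or> cf v 0 = 0"
  shows "hf \<beta> a (- 1 / \<kappa>) v v \<ge> 0" "hf \<beta> a (- 1 / \<kappa>) v v = 0 \<Longrightarrow> v = 0"
proof -
  have s1: "summable (\<lambda>n. gg a n * cf v n * cf v n)" by (rule inner_diagop(2)[OF bounded_gg])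
  have s2: "summable (\<lambda>n. pi\<^sup>2 * (cf v n)\<^sup>2)" by (intro summable_mult summable_cf_sq)
  define t where "t n = (gg a n - pi\<^sup>2) * (cf v n)\<^sup>2" for n
  have t: "t = (\<lambda>n. gg a n * cf v n * cf v n - pi\<^sup>2 * (cf v n)\<^sup>2)"
    by (simp add: t_def fun_eq_iff power2_eq_square algebra_simps)
  have st: "summable t" unfolding t by (intro summable_diff s1 s2)
  have "suminf t = inner (Go a v) v - pi\<^sup>2 * (norm v)\<^sup>2"
    unfolding t suminf_diff[OF s1 s2, symmetric]
    by (simp add: Go_def inner_diagop(1)[OF bounded_gg] norm_ell2_sq suminf_mult summable_cf_sq)
  then have h: "hf \<beta> a (- 1 / \<kappa>) v v = suminf t + (pi\<^sup>2 * (norm v)\<^sup>2 + (- 1 / \<kappa>) * inner (Kop \<beta> v) v)"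
    by (simp add: hf_def)
  have pos: "cf v n = 0 \<or> gg a n - pi\<^sup>2 > 0" for n
  proof (cases "cf v n = 0")
    case False
    then have "mm a n > pi\<^sup>2" using assms(1,4) mm_gt[of a n] by (cases n) auto
    then show ?thesis by (simp add: gg_eq)
  qed simp
  have t0: "t n \<ge> 0" for n using pos[of n] by (auto simp: t_def)
  have "suminf t \<ge> 0" by (rule suminf_nonneg[OF st t0])
  with h outside_range_nonneg[OF assms(2,3), of v] show "hf \<beta> a (- 1 / \<kappa>) v v \<ge> 0" by linarith
  assume "hf \<beta> a (- 1 / \<kappa>) v v = 0"
  with h \<open>suminf t \<ge> 0\<close> outside_range_nonneg[OF assms(2,3), of v] have "suminf t = 0" by linarith
  then have "t n = 0" for n using suminf_eq_zero_iff[OF st t0] by simp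
  then show "v = 0" using pos by (intro ell2_eqI) (force simp: t_def)
qed

text \<open>The real form of the equation A u = (cr + i ci) u for u = u1 + i u2 in the
  complexification, with a non-real eigenvalue.\<close>

definition upair :: "real \<Rightarrow> real \<Rightarrow> real \<Rightarrow> real \<Rightarrow> ell2 \<Rightarrow> ell2 \<Rightarrow> bool" where
  "upair \<beta> a cr ci u1 u2 \<longleftrightarrow> ci \<noteq> 0 \<and> (u1 \<noteq> 0 \<or> u2 \<noteq> 0) \<and>
     Aop \<beta> a u1 = cr *\<^sub>R u1 - ci *\<^sub>R u2 \<and> Aop \<beta> a u2 = ci *\<^sub>R u1 + cr *\<^sub>R u2"

text \<open>A is symmetric for the energy pairing, so an eigenvector with non-real eigenvalue has
  zero Hermitian energy. Since <K L u, L u> = <A u, L u> is the eigenvalue times that energy, it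
  vanishes as well.\<close>

lemma upair_isotropic:
  assumes "upair \<beta> a cr ci u1 u2"
  shows "inner (Lo a u1) u1 + inner (Lo a u2) u2 = 0"
    and "inner (Kop \<beta> (Lo a u1)) (Lo a u1) + inner (Kop \<beta> (Lo a u2)) (Lo a u2) = 0"
proof -
  have A: "Aop \<beta> a u1 = cr *\<^sub>R u1 - ci *\<^sub>R u2" "Aop \<beta> a u2 = ci *\<^sub>R u1 + cr *\<^sub>R u2" "ci \<noteq> 0"
    using assms by (auto simp: upair_def)
  have c: "inner (Lo a u1) u2 = inner (Lo a u2) u1" by (metis inner_Lo_sym inner_commute)
  have "inner (Aop \<beta> a u1) (Lo a u2) = inner (Lo a u1) (Aop \<beta> a u2)"
    by (simp add: Aop_def inner_Kop_sym)
  then have "ci * (inner (Lo a u1) u1 + inner (Lo a u2) u2) = 0"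
    unfolding A using c
    by (simp add: inner_diff_left inner_add_right inner_commute algebra_simps)
  then show 1: "inner (Lo a u1) u1 + inner (Lo a u2) u2 = 0" using A(3) by simp
  have "inner (Aop \<beta> a u1) (Lo a u1) + inner (Aop \<beta> a u2) (Lo a u2)
     = cr * (inner (Lo a u1) u1 + inner (Lo a u2) u2)"
    unfolding A using c by (simp add: inner_diff_left inner_add_left inner_commute algebra_simps)
  then show "inner (Kop \<beta> (Lo a u1)) (Lo a u1) + inner (Kop \<beta> (Lo a u2)) (Lo a u2) = 0"
    using 1 by (simp add: Aop_def)
qed

text \<open>If b v w were nonzero, b (t v + w) (t v + w) = 2 t b v w + b w w would be a nonconstant
  affine function of t and would take negative values.\<close>

lemma semidefinite_null_vector:
  fixes b :: "ell2 \<Rightarrow> ell2 \<Rightarrow> real"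
  assumes add: "\<And>u v w. b (u + v) w = b u w + b v w" and scale: "\<And>c v w. b (c *\<^sub>R v) w = c * b v w"
    and sym: "\<And>v w. b v w = b w v" and nonneg: "\<And>v. b v v \<ge> 0" and null: "b v v = 0"
  shows "b v w = 0"
proof (rule ccontr)
  assume nz: "b v w \<noteq> 0"
  have q: "0 \<le> 2 * t * b v w + b w w" for t
  proof -
    have "b (t *\<^sub>R v + w) (t *\<^sub>R v + w) = t * b v (t *\<^sub>R v + w) + b w (t *\<^sub>R v + w)"
      by (simp add: add scale)
    also have "\<dots> = t * b (t *\<^sub>R v + w) v + b (t *\<^sub>R v + w) w" by (simp only: sym)
    also have "\<dots> = t * (t * b v v + b w v) + (t * b v w + b w w)" by (simp only: add scale)
    also have "\<dots> = 2 * t * b v w + b w w" using null sym[of w v] by (simp add: algebra_simps)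
    finally show ?thesis using nonneg[of "t *\<^sub>R v + w"] by simp
  qed
  from q[of "- (b w w + 1) / (2 * b v w)"] nz show False by (simp add: field_simps)
qed

text \<open>By isotropy the values of the form at L u1 and L u2 add up to 0, so nonnegativity puts
  both vectors in its kernel. Then u1 + s A u1 = 0 and u2 + s A u2 = 0, so A has the real eigenvalue
  -1 / s on the pair, against ci \<noteq> 0.\<close>

lemma upair_no_semidefinite_form:
  assumes u: "upair \<beta> a cr ci u1 u2" and a: "a > 0" "mm a 0 \<noteq> pi\<^sup>2" and "s \<noteq> 0"
    and nonneg: "\<And>v. hf \<beta> a s v v \<ge> 0"
  shows False
proof -
  define v1 v2 where "v1 = Lo a u1" and "v2 = Lo a u2"
  have A: "Kop \<beta> v1 = cr *\<^sub>R u1 - ci *\<^sub>R u2" "Kop \<beta> v2 = ci *\<^sub>R u1 + cr *\<^sub>R u2" "ci \<noteq> 0"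
    using u by (auto simp: upair_def Aop_def v1_def v2_def)
  have G: "Go a v1 = u1" "Go a v2 = u2" using a by (simp_all add: v1_def v2_def Go_Lo)
  have sum0: "hf \<beta> a s v1 v1 + hf \<beta> a s v2 v2 = 0"
  proof -
    have "s * inner (Kop \<beta> v1) v1 + s * inner (Kop \<beta> v2) v2 = s * 0"
      using upair_isotropic(2)[OF u] by (simp only: v1_def v2_def distrib_left[symmetric])
    then show ?thesis using upair_isotropic(1)[OF u]
      unfolding hf_def G by (simp add: v1_def v2_def inner_commute algebra_simps)
  qed
  then have n: "hf \<beta> a s v1 v1 = 0" "hf \<beta> a s v2 v2 = 0" using nonneg[of v1] nonneg[of v2] by linarith+
  have ker: "Go a v + s *\<^sub>R Kop \<beta> v = 0" if "hf \<beta> a s v v = 0" for v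
  proof -
    have "hf \<beta> a s v w = 0" for w
      by (rule semidefinite_null_vector[of "hf \<beta> a s"]) (use that nonneg in \<open>auto intro: hf_bilinear\<close>)
    from this[of "Go a v + s *\<^sub>R Kop \<beta> v"] show ?thesis
      by (simp add: hf_def inner_add_left[symmetric] inner_scaleR_left[symmetric] del: inner_scaleR_left)
  qed
  have k1: "(1 + s * cr) *\<^sub>R u1 = (s * ci) *\<^sub>R u2" and k2: "(1 + s * cr) *\<^sub>R u2 = (- s * ci) *\<^sub>R u1"
    using ker[OF n(1)] ker[OF n(2)] unfolding G A by (simp_all add: algebra_simps add_eq_0_iff2)
  define p q where "p = 1 + s * cr" and "q = s * ci"
  have "q \<noteq> 0" using A(3) \<open>s \<noteq> 0\<close> by (simp add: q_def)
  have kk: "p *\<^sub>R u1 = q *\<^sub>R u2" "p *\<^sub>R u2 = (- q) *\<^sub>R u1" using k1 k2 by (simp_all add: p_def q_def)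
  have "(p * p) *\<^sub>R u1 = (- q * q) *\<^sub>R u1"
    using arg_cong[OF kk(1), of "\<lambda>x. p *\<^sub>R x"] arg_cong[OF kk(2), of "\<lambda>x. q *\<^sub>R x"] by (simp add: mult.commute)
  then have "(p\<^sup>2 + q\<^sup>2) *\<^sub>R u1 = 0" by (simp add: scaleR_left_distrib power2_eq_square)
  moreover have "p\<^sup>2 + q\<^sup>2 \<noteq> 0" using \<open>q \<noteq> 0\<close> by (simp add: sum_power2_eq_zero_iff)
  ultimately have "u1 = 0" by (metis scaleR_eq_0_iff)
  then have "u2 = 0" using kk \<open>q \<noteq> 0\<close> by simp
  with \<open>u1 = 0\<close> u show False by (simp add: upair_def)
qed

text \<open>Otherwise all entries of L are nonnegative, and isotropy puts u1 and u2 in the kernel of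
  L. Then A u1 = A u2 = 0, which a nonzero eigenvalue forbids.\<close>

lemma upair_wave_number:
  assumes u: "upair \<beta> a cr ci u1 u2" and a: "a > 0"
  shows "mm a 0 < pi\<^sup>2"
proof (rule ccontr)
  assume "\<not> mm a 0 < pi\<^sup>2"
  then have m: "mm a 0 \<ge> pi\<^sup>2" by simp
  then have d0: "dd a 0 \<ge> 0" using dd_pos_iff[of a 0] by (cases "mm a 0 = pi\<^sup>2") auto
  have n: "inner (Lo a v) v \<ge> 0" for v
    using inner_Lo_lower[OF a, of v 0] d0 by (smt (verit) mult_nonneg_nonneg zero_le_power2 zero_le_one)
  have z: "Lo a v = 0" if "inner (Lo a v) v = 0" for v
  proof -
    interpret bounded_linear "Lo a" by (rule bounded_linear_Lo)
    have "inner (Lo a v) w = 0" for w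
      by (rule semidefinite_null_vector[of "\<lambda>v w. inner (Lo a v) w"])
        (use n that in \<open>auto simp: add scaleR inner_add_left intro: inner_Lo_comm\<close>)
    from this[of "Lo a v"] show ?thesis by simp
  qed
  have 0: "inner (Lo a u1) u1 = 0" "inner (Lo a u2) u2 = 0"
    using upair_isotropic(1)[OF u] n[of u1] n[of u2] by linarith+
  have "Aop \<beta> a u1 = 0" "Aop \<beta> a u2 = 0"
    using z[OF 0(1)] z[OF 0(2)] linear_0[OF bounded_linear.linear[OF bounded_linear_Kop]] by (simp_all add: Aop_def)
  then have k: "cr *\<^sub>R u1 = ci *\<^sub>R u2" "cr *\<^sub>R u2 = (- ci) *\<^sub>R u1" "ci \<noteq> 0"
    using u by (auto simp: upair_def add_eq_0_iff)
  have "(cr * cr) *\<^sub>R u1 = (- ci * ci) *\<^sub>R u1"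
    using arg_cong[OF k(1), of "\<lambda>x. cr *\<^sub>R x"] arg_cong[OF k(2), of "\<lambda>x. ci *\<^sub>R x"] by (simp add: mult.commute)
  then have "(cr\<^sup>2 + ci\<^sup>2) *\<^sub>R u1 = 0" by (simp add: scaleR_left_distrib power2_eq_square)
  then have "u1 = 0" using k(3) by (simp add: sum_power2_eq_zero_iff)
  moreover from this have "u2 = 0" using k by simp
  ultimately show False using u by (simp add: upair_def)
qed

text \<open>This is Rayleigh's criterion: beta - U'' must change sign. Otherwise K is semidefinite
  with sign s, the second isotropy relation puts L u1 and L u2 in the kernel of K, and A annihilates
  the pair.\<close>

lemma upair_beta:
  assumes u: "upair \<beta> a cr ci u1 u2" and a: "a > 0"
  shows "\<bar>\<beta>\<bar> < pi\<^sup>2 / 2"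
proof (rule ccontr)
  assume "\<not> \<bar>\<beta>\<bar> < pi\<^sup>2 / 2"
  define s where "s = (if \<beta> \<ge> 0 then 1 else - 1 :: real)"
  have s: "s * \<beta> \<ge> pi\<^sup>2 / 2" using \<open>\<not> _\<close> by (auto simp: s_def)
  have n: "s * inner (Kop \<beta> v) v \<ge> 0" for v
  proof -
    have "\<bar>s * (pi\<^sup>2 / 4 * inner (Cop v) v)\<bar> \<le> pi\<^sup>2 / 4 * (2 * (norm v)\<^sup>2)"
      using inner_Cop_bound[of v] by (auto simp: s_def abs_mult)
    moreover have "pi\<^sup>2 / 2 * (norm v)\<^sup>2 \<le> s * \<beta> * (norm v)\<^sup>2" by (intro mult_right_mono s) simp
    moreover have "s * inner (Kop \<beta> v) v = s * \<beta> * (norm v)\<^sup>2 - s * (pi\<^sup>2 / 4 * inner (Cop v) v)"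
      by (simp add: Kop_def inner_diff_left power2_norm_eq_inner algebra_simps)
    ultimately show ?thesis by linarith
  qed
  have z: "Kop \<beta> v = 0" if "s * inner (Kop \<beta> v) v = 0" for v
  proof -
    interpret bounded_linear "Kop \<beta>" by (rule bounded_linear_Kop)
    have "s * inner (Kop \<beta> v) w = 0" for w
      by (rule semidefinite_null_vector[of "\<lambda>v w. s * inner (Kop \<beta> v) w"])
        (use n that in \<open>auto simp: add scaleR inner_add_left algebra_simps intro: inner_Kop_comm\<close>)
    from this[of "Kop \<beta> v"] show ?thesis by (auto simp: s_def split: if_splits)
  qed
  have "s * inner (Kop \<beta> (Lo a u1)) (Lo a u1) + s * inner (Kop \<beta> (Lo a u2)) (Lo a u2) = 0"
    using upair_isotropic(2)[OF u] by (simp add: distrib_left[symmetric])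
  then have "s * inner (Kop \<beta> (Lo a u1)) (Lo a u1) = 0" "s * inner (Kop \<beta> (Lo a u2)) (Lo a u2) = 0"
    using n[of "Lo a u1"] n[of "Lo a u2"] by linarith+
  then have "Aop \<beta> a u1 = 0" "Aop \<beta> a u2 = 0" using z by (auto simp: Aop_def)
  then have k: "cr *\<^sub>R u1 = ci *\<^sub>R u2" "cr *\<^sub>R u2 = (- ci) *\<^sub>R u1" "ci \<noteq> 0"
    using u by (auto simp: upair_def add_eq_0_iff)
  have "(cr * cr) *\<^sub>R u1 = (- ci * ci) *\<^sub>R u1"
    using arg_cong[OF k(1), of "\<lambda>x. cr *\<^sub>R x"] arg_cong[OF k(2), of "\<lambda>x. ci *\<^sub>R x"] by (simp add: mult.commute)
  then have "(cr\<^sup>2 + ci\<^sup>2) *\<^sub>R u1 = 0" by (simp add: scaleR_left_distrib power2_eq_square)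
  then have "u1 = 0" using k(3) by (simp add: sum_power2_eq_zero_iff)
  moreover from this have "u2 = 0" using k by simp
  ultimately show False using u by (simp add: upair_def)
qed

text \<open>\<open>gg\<close> decreases in \<open>mm\<close> on each side of its pole at pi^2. For n
  >= 1 both values lie above the pole; for n = 0 the hypothesis keeps both below it.\<close>

lemma gg_antimono:
  assumes "0 < \<alpha>" "\<alpha> \<le> a" "mm a 0 < pi\<^sup>2"
  shows "gg a n \<le> gg \<alpha> n"
proof -
  have le: "mm \<alpha> n \<le> mm a n" using assms by (simp add: mm_def power_mono)
  have le0: "mm \<alpha> 0 \<le> mm a 0" using assms by (simp add: mm_def power_mono)
  show ?thesis
  proof (cases "n = 0")
    case True
    have "pi ^ 4 / (mm a 0 - pi\<^sup>2) \<le> pi ^ 4 / (mm \<alpha> 0 - pi\<^sup>2)"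
      using assms le0 by (intro divide_left_mono mult_neg_neg) auto
    then show ?thesis using True assms le0 by (simp add: gg_eq)
  next
    case False
    then have "mm \<alpha> n > pi\<^sup>2" "mm a n > pi\<^sup>2" using assms mm_gt by auto
    moreover from this have "pi ^ 4 / (mm a n - pi\<^sup>2) \<le> pi ^ 4 / (mm \<alpha> n - pi\<^sup>2)"
      using le by (intro divide_left_mono mult_pos_pos) auto
    ultimately show ?thesis by (simp add: gg_eq)
  qed
qed

lemma no_neutral_mode:
  assumes u: "upair \<beta> \<alpha> cr ci u1 u2" and a: "0 < \<alpha>" "\<alpha> \<le> a" and m: "mm a 0 \<noteq> pi\<^sup>2"
    and x: "Aop \<beta> a x = \<kappa> *\<^sub>R x"
  shows "x = 0"
proof (rule ccontr)
  assume "x \<noteq> 0"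
  have "a > 0" using a by simp
  define v where "v = Lo a x"
  have xG: "x = Go a v" using m \<open>a > 0\<close> by (simp add: v_def Go_Lo)
  have "Go a 0 = 0" by (rule ell2_eqI) (simp add: cf_Go)
  have "v \<noteq> 0"
  proof
    assume "v = 0"
    then have "x = 0" using xG \<open>Go a 0 = 0\<close> by (simp only:)
    then show False using \<open>x \<noteq> 0\<close> by contradiction
  qed
  have Kv: "Kop \<beta> v = \<kappa> *\<^sub>R Go a v" using x unfolding Aop_def v_def[symmetric] xG[symmetric] .
  have "\<not> \<bar>\<kappa> - \<beta> / pi\<^sup>2\<bar> < 1 / 2"
  proof
    assume "\<bar>\<kappa> - \<beta> / pi\<^sup>2\<bar> < 1 / 2"
    from no_embedded_neutral_mode[OF \<open>a > 0\<close> this, of v] have "v = 0" by (simp add: Kv cf_Go)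
    then show False using \<open>v \<noteq> 0\<close> by contradiction
  qed
  then have kap: "\<bar>\<kappa> - \<beta> / pi\<^sup>2\<bar> \<ge> 1 / 2" by simp
  have beta: "\<bar>\<beta>\<bar> < pi\<^sup>2 / 2" by (rule upair_beta[OF u a(1)])
  have "\<bar>\<beta> / pi\<^sup>2\<bar> < 1 / 2" using beta by (simp add: abs_divide divide_less_eq)
  have "\<kappa> \<noteq> 0"
  proof
    assume "\<kappa> = 0"
    then show False using kap \<open>\<bar>\<beta> / pi\<^sup>2\<bar> < 1 / 2\<close> by simp
  qed
  then have ker: "hf \<beta> a (- 1 / \<kappa>) v w = 0" for w by (simp add: hf_def Kv)
  note pos = hf_definite[OF \<open>a > 0\<close> beta kap]
  have neg: "\<not> mm a 0 > pi\<^sup>2" and v0: "cf v 0 \<noteq> 0"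
    using pos(2)[OF _ ker[of v]] \<open>v \<noteq> 0\<close> by blast+
  \<comment> \<open>Every w is a multiple of the kernel vector v plus a vector with first component
    0. The multiple does not change the form, and on the second vector the form is
    nonnegative.\<close>
  have nonneg: "hf \<beta> a (- 1 / \<kappa>) w w \<ge> 0" for w
  proof -
    define t where "t = cf w 0 / cf v 0"
    define z where "z = w - t *\<^sub>R v"
    have "cf z 0 = 0" using v0 by (simp add: z_def t_def)
    then have "0 \<le> hf \<beta> a (- 1 / \<kappa>) z z" using pos(1) by blast
    also have "\<dots> = hf \<beta> a (- 1 / \<kappa>) w z"
      unfolding z_def hf_bilinear(2) hf_bilinear(3) ker by simp
    also have "\<dots> = hf \<beta> a (- 1 / \<kappa>) z w" by (rule hf_bilinear(4))
    also have "\<dots> = hf \<beta> a (- 1 / \<kappa>) w w"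
      unfolding z_def hf_bilinear(2) hf_bilinear(3) ker by simp
    finally show ?thesis .
  qed
  have "mm a 0 < pi\<^sup>2" using neg m by simp
  \<comment> \<open>Lowering the wave number from a to alpha enlarges G and leaves K unchanged, so
    the form at alpha is nonnegative too, and the unstable pair at alpha contradicts this.\<close>
  have "hf \<beta> \<alpha> (- 1 / \<kappa>) w w \<ge> 0" for w
  proof -
    have "inner (Go a w) w \<le> inner (Go \<alpha> w) w"
      unfolding Go_def inner_diagop(1)[OF bounded_gg]
      unfolding mult.assoc
      by (intro suminf_le mult_right_mono gg_antimono[OF a \<open>mm a 0 < pi\<^sup>2\<close>] zero_le_square
        inner_diagop(2)[OF bounded_gg, unfolded mult.assoc])
    then show ?thesis using nonneg[of w] by (simp add: hf_def)
  qed
  moreover have "mm \<alpha> 0 \<noteq> pi\<^sup>2" using upair_wave_number[OF u a(1)] by simp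
  moreover have "- 1 / \<kappa> \<noteq> 0" using \<open>\<kappa> \<noteq> 0\<close> by simp
  ultimately show False using upair_no_semidefinite_form[OF u a(1)] by blast
qed

text \<open>With the first row projected away, the eigenvalue equation holds for n >= 1, and v = L x
  has first component 0. The form \<open>hf\<close> is definite on such vectors, and for c in the
  open range of U the recurrence argument works from the rows n >= 1.\<close>

lemma no_neutral_mode_resonant:
  assumes "\<bar>\<beta>\<bar> < pi\<^sup>2 / 2" and a: "a > 0" and m: "mm a 0 = pi\<^sup>2"
    and x0: "cf x 0 = 0" and x: "\<And>n. n \<ge> 1 \<Longrightarrow> cf (Aop \<beta> a x) n = \<kappa> * cf x n"
  shows "x = 0"
proof -
  define v where "v = Lo a x"
  have dd: "dd a n \<noteq> 0" if "n \<ge> 1" for n using mm_gt[OF a that] dd_pos_iff[of a n] by simp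
  have v0: "cf v 0 = 0" using x0 by (simp add: v_def cf_Lo)
  have xG: "x = Go a v"
  proof (rule ell2_eqI)
    fix n show "cf x n = cf (Go a v) n" using x0 dd[of n] by (cases n) (auto simp: v_def cf_Go cf_Lo gg_def)
  qed
  have row: "cf (Kop \<beta> v) n = \<kappa> * (gg a n * cf v n)" if "n \<ge> 1" for n
  proof -
    have "cf x n = gg a n * cf v n" using arg_cong[OF xG, of "\<lambda>x. cf x n"] by (simp add: cf_Go)
    then show ?thesis using x[OF that] by (simp add: Aop_def v_def)
  qed
  have "v = 0"
  proof (cases "\<bar>\<kappa> - \<beta> / pi\<^sup>2\<bar> < 1 / 2")
    case True
    from no_embedded_neutral_mode[OF a this row] show ?thesis .
  next
    case False
    then have kap: "\<bar>\<kappa> - \<beta> / pi\<^sup>2\<bar> \<ge> 1 / 2" by simp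
    have "\<bar>\<beta> / pi\<^sup>2\<bar> < 1 / 2" using assms(1) by (simp add: abs_divide divide_less_eq)
    then have "\<kappa> \<noteq> 0" using kap by auto
    have "inner (Kop \<beta> v) v = \<kappa> * inner (Go a v) v"
    proof -
      have "cf (Kop \<beta> v) n * cf v n = \<kappa> * (cf (Go a v) n * cf v n)" for n
        using row[of n] v0 by (cases n) (auto simp: cf_Go)
      then show ?thesis unfolding inner_ell2_def using suminf_mult[OF summable_cf_mult[of "Go a v" v], of \<kappa>]
        by presburger
    qed
    then have "hf \<beta> a (- 1 / \<kappa>) v v = 0" using \<open>\<kappa> \<noteq> 0\<close> by (simp add: hf_def)
    then show ?thesis using hf_definite(2)[OF a assms(1) kap] v0 by blast
  qed
  moreover have "Go a 0 = 0" by (rule ell2_eqI) (simp add: cf_Go)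
  ultimately show ?thesis using xG by simp
qed

text \<open>Put u = u1 + i u2 and subtract from x the complex multiple t u that removes the first
  component. The result z1 + i z2 has the same Hermitian energy as x, because u is isotropic and
  orthogonal to x, and that energy is at least d times the square of its norm. It remains to bound x
  by z1, and for this t is recovered from the pairings of z1 with u1 and u2.\<close>

lemma coercive_on_complement:
  assumes u: "upair \<beta> a cr ci u1 u2" and a: "a > 0"
  shows "\<exists>\<delta>>0. \<forall>x. inner (Lo a u1) x = 0 \<longrightarrow> inner (Lo a u2) x = 0 \<longrightarrow> \<delta> * (norm x)\<^sup>2 \<le> inner (Lo a x) x"
proof -
  interpret L: bounded_linear "Lo a" by (rule bounded_linear_Lo)
  interpret A: bounded_linear "Aop \<beta> a" by (rule bounded_linear_Aop)
  define b where "b x y = inner (Lo a x) y" for x y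
  have bs: "b (x + y) z = b x z + b y z" "b (x - y) z = b x z - b y z" "b (c *\<^sub>R x) z = c * b x z"
    "b z (x + y) = b z x + b z y" "b z (x - y) = b z x - b z y" "b z (c *\<^sub>R x) = c * b z x" for x y z c
    by (simp_all add: b_def L.add L.diff L.scaleR inner_add_left inner_diff_left inner_add_right inner_diff_right)
  have sym: "b x y = b y x" for x y unfolding b_def by (rule inner_Lo_comm)
  define d where "d = dd a 1"
  have d: "d > 0" using mm_gt[OF a, of 1] dd_pos_iff(1)[of a 1] by (simp add: d_def)
  have low: "d * (norm x)\<^sup>2 \<le> b x x" if "cf x 0 = 0" for x
    using inner_Lo_lower[OF a, of x 1] that by (simp add: b_def d_def)
  have A: "Aop \<beta> a u1 = cr *\<^sub>R u1 - ci *\<^sub>R u2" "Aop \<beta> a u2 = ci *\<^sub>R u1 + cr *\<^sub>R u2" "ci \<noteq> 0"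
    and une: "u1 \<noteq> 0 \<or> u2 \<noteq> 0"
    using u by (auto simp: upair_def)
  define p q where "p = cf u1 0" and "q = cf u2 0"
  define B11 B12 where "B11 = b u1 u1" and "B12 = b u1 u2"
  have B22: "b u2 u2 = - B11" using upair_isotropic(1)[OF u] by (simp add: B11_def b_def)
  \<comment> \<open>If both first components vanished, the energy would be positive definite on the
    pair, against isotropy.\<close>
  have pq: "p\<^sup>2 + q\<^sup>2 > 0"
  proof (rule ccontr)
    assume "\<not> ?thesis"
    then have "p = 0" "q = 0" by (auto simp: sum_power2_gt_zero_iff)
    then have "d * (norm u1)\<^sup>2 \<le> B11" "d * (norm u2)\<^sup>2 \<le> - B11"
      using low[of u1] low[of u2] B22 by (auto simp: B11_def p_def q_def)
    then have "d * ((norm u1)\<^sup>2 + (norm u2)\<^sup>2) \<le> 0" by (simp add: distrib_left)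
    then have "(norm u1)\<^sup>2 + (norm u2)\<^sup>2 \<le> 0" using d by (simp add: mult_le_0_iff)
    then show False using une by (simp add: sum_power2_le_zero_iff)
  qed
  \<comment> \<open>The bilinear energy of u with itself is 2 (B11 + i B12). If it vanished, the
    energy would vanish on the whole span of u1 and u2; the combination w has first component 0,
    hence would be zero, and applying A to this relation kills u1 and u2.\<close>
  have BB: "B11\<^sup>2 + B12\<^sup>2 > 0"
  proof (rule ccontr)
    assume "\<not> ?thesis"
    then have B0: "B11 = 0" "B12 = 0" by (auto simp: sum_power2_gt_zero_iff)
    define w where "w = p *\<^sub>R u2 - q *\<^sub>R u1"
    have "b w w = 0" using B0 B22 sym[of u2 u1] by (simp add: w_def bs B11_def B12_def)
    moreover have "cf w 0 = 0" by (simp add: w_def p_def q_def)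
    ultimately have "d * (norm w)\<^sup>2 \<le> 0" using low[of w] by simp
    then have w0: "p *\<^sub>R u2 = q *\<^sub>R u1" using d by (simp add: mult_le_0_iff w_def)
    have "p *\<^sub>R Aop \<beta> a u2 = q *\<^sub>R Aop \<beta> a u1"
      using arg_cong[OF w0, of "Aop \<beta> a"] by (simp add: A.scaleR)
    then have e: "(p * ci) *\<^sub>R u1 + cr *\<^sub>R (p *\<^sub>R u2) = cr *\<^sub>R (q *\<^sub>R u1) - (q * ci) *\<^sub>R u2"
      unfolding A by (simp add: scaleR_add_right scaleR_diff_right mult.commute)
    then have "(p * ci) *\<^sub>R u1 = - ((q * ci) *\<^sub>R u2)" unfolding w0 by simp
    then have "ci *\<^sub>R (p *\<^sub>R u1 + q *\<^sub>R u2) = 0" by (simp add: scaleR_add_right mult.commute)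
    then have e2: "p *\<^sub>R u1 + q *\<^sub>R u2 = 0" using A(3) by simp
    have "(p\<^sup>2 + q\<^sup>2) *\<^sub>R u1 = p *\<^sub>R (p *\<^sub>R u1 + q *\<^sub>R u2) - q *\<^sub>R (p *\<^sub>R u2 - q *\<^sub>R u1)"
      by (simp add: scaleR_add_right scaleR_diff_right scaleR_left_distrib power2_eq_square mult.commute)
    then have u10: "u1 = 0" using e2 w0 pq by (auto simp: sum_power2_gt_zero_iff)
    have "(p\<^sup>2 + q\<^sup>2) *\<^sub>R u2 = q *\<^sub>R (p *\<^sub>R u1 + q *\<^sub>R u2) + p *\<^sub>R (p *\<^sub>R u2 - q *\<^sub>R u1)"
      by (simp add: scaleR_add_right scaleR_diff_right scaleR_left_distrib power2_eq_square mult.commute)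
    then have "u2 = 0" using e2 w0 pq by (auto simp: sum_power2_gt_zero_iff)
    then show False using u10 une by simp
  qed
  obtain CL where CL: "CL \<ge> 0" "\<And>x. norm (Lo a x) \<le> norm x * CL" using L.nonneg_bounded by auto
  define m where "m = norm u1 + norm u2"
  define E where "E = (2 * (CL * m)\<^sup>2) / (B11\<^sup>2 + B12\<^sup>2)"
  define C where "C = 2 + 4 * m\<^sup>2 * E"
  have m0: "m \<ge> 0" by (simp add: m_def)
  have E0: "E \<ge> 0" unfolding E_def by simp
  have C0: "C > 0" using E0 by (simp add: C_def add_pos_nonneg)
  have "(d / C) * (norm x)\<^sup>2 \<le> b x x" if x1: "b u1 x = 0" and x2: "b u2 x = 0" for x
  proof -
    define x0 where "x0 = cf x 0"
    \<comment> \<open>The real and imaginary parts of t = x0 / (p + i q).\<close>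
    define t1 t2 where "t1 = x0 * p / (p\<^sup>2 + q\<^sup>2)" and "t2 = - x0 * q / (p\<^sup>2 + q\<^sup>2)"
    have "t1 * p - t2 * q = x0 * (p\<^sup>2 + q\<^sup>2) / (p\<^sup>2 + q\<^sup>2)"
      by (simp add: t1_def t2_def power2_eq_square add_divide_distrib[symmetric] algebra_simps)
    then have t: "t1 * p - t2 * q = x0" "t1 * q + t2 * p = 0"
      using pq by (auto simp: t1_def t2_def sum_power2_gt_zero_iff split: if_splits)
    define z1 z2 where "z1 = x - (t1 *\<^sub>R u1 - t2 *\<^sub>R u2)" and "z2 = - (t1 *\<^sub>R u2 + t2 *\<^sub>R u1)"
    have "cf z1 0 = 0" "cf z2 0 = 0" using t by (simp_all add: z1_def z2_def p_def q_def x0_def)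
    then have l: "d * (norm z1)\<^sup>2 \<le> b z1 z1" "d * (norm z2)\<^sup>2 \<le> b z2 z2" using low by auto
    have x1': "b x u1 = 0" and x2': "b x u2 = 0" using x1 x2 sym by metis+
    have b21: "b u2 u1 = B12" by (simp add: B12_def sym)
    have "b z1 z1 = b x x + b (t1 *\<^sub>R u1 - t2 *\<^sub>R u2) (t1 *\<^sub>R u1 - t2 *\<^sub>R u2)"
      by (simp add: z1_def bs x1 x2 x1' x2' algebra_simps)
    also have "b (t1 *\<^sub>R u1 - t2 *\<^sub>R u2) (t1 *\<^sub>R u1 - t2 *\<^sub>R u2) = t1 * t1 * B11 - 2 * t1 * t2 * B12 - t2 * t2 * B11"
      using B22 by (simp add: bs B11_def[symmetric] B12_def[symmetric] b21 algebra_simps)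
    finally have z1z1: "b z1 z1 = b x x + (t1 * t1 * B11 - 2 * t1 * t2 * B12 - t2 * t2 * B11)" .
    have "b z2 z2 = b (t1 *\<^sub>R u2 + t2 *\<^sub>R u1) (t1 *\<^sub>R u2 + t2 *\<^sub>R u1)"
      using bs(3)[of "-1" "t1 *\<^sub>R u2 + t2 *\<^sub>R u1" z2] bs(6)[of "t1 *\<^sub>R u2 + t2 *\<^sub>R u1" "-1" "t1 *\<^sub>R u2 + t2 *\<^sub>R u1"]
      by (simp add: z2_def)
    also have "\<dots> = - (t1 * t1 * B11) + 2 * t1 * t2 * B12 + t2 * t2 * B11"
      using B22 by (simp add: bs B11_def[symmetric] B12_def[symmetric] b21 algebra_simps)
    finally have zz: "b z1 z1 + b z2 z2 = b x x" using z1z1 by simp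
    have zu1: "b z1 u1 = - t1 * B11 + t2 * B12"
      by (simp add: z1_def bs x1' B11_def[symmetric] b21)
    have zu2: "b z1 u2 = - t1 * B12 - t2 * B11"
      using B22 by (simp add: z1_def bs x2' B12_def[symmetric])
    \<comment> \<open>Since x is orthogonal to the pair, pairing z1 with u1 and u2 sees only t,
      through a matrix with determinant of absolute value B11^2 + B12^2.\<close>
    have T: "(t1\<^sup>2 + t2\<^sup>2) * (B11\<^sup>2 + B12\<^sup>2) = (b z1 u1)\<^sup>2 + (b z1 u2)\<^sup>2"
      unfolding zu1 zu2 by (simp add: power2_eq_square algebra_simps)
    have bnd: "(b z1 v)\<^sup>2 \<le> (CL * m)\<^sup>2 * (norm z1)\<^sup>2" if "norm v \<le> m" for v
    proof -
      have "\<bar>b z1 v\<bar> \<le> norm (Lo a z1) * norm v" unfolding b_def by (rule Cauchy_Schwarz_ineq2)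
      also have "\<dots> \<le> (norm z1 * CL) * m" using CL that by (intro mult_mono) auto
      finally have "\<bar>b z1 v\<bar>\<^sup>2 \<le> ((norm z1 * CL) * m)\<^sup>2" by (intro power_mono) auto
      then show ?thesis by (simp add: power_mult_distrib mult_ac)
    qed
    have "norm u1 \<le> m" "norm u2 \<le> m" by (auto simp: m_def)
    then have "(t1\<^sup>2 + t2\<^sup>2) * (B11\<^sup>2 + B12\<^sup>2) \<le> 2 * (CL * m)\<^sup>2 * (norm z1)\<^sup>2"
      using bnd[of u1] bnd[of u2] T by linarith
    then have tE: "t1\<^sup>2 + t2\<^sup>2 \<le> E * (norm z1)\<^sup>2" using BB by (simp add: E_def field_simps)
    have "norm x \<le> norm z1 + (\<bar>t1\<bar> + \<bar>t2\<bar>) * m"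
    proof -
      have "norm (t1 *\<^sub>R u1 - t2 *\<^sub>R u2) \<le> \<bar>t1\<bar> * norm u1 + \<bar>t2\<bar> * norm u2"
        using norm_triangle_ineq4[of "t1 *\<^sub>R u1" "t2 *\<^sub>R u2"] by simp
      also have "\<dots> \<le> \<bar>t1\<bar> * m + \<bar>t2\<bar> * m" using \<open>norm u1 \<le> m\<close> \<open>norm u2 \<le> m\<close> by (intro add_mono mult_left_mono) auto
      finally show ?thesis using norm_triangle_ineq[of z1 "t1 *\<^sub>R u1 - t2 *\<^sub>R u2"]
        by (simp add: z1_def distrib_right)
    qed
    then have "(norm x)\<^sup>2 \<le> (norm z1 + (\<bar>t1\<bar> + \<bar>t2\<bar>) * m)\<^sup>2" by (intro power_mono) auto
    also have "\<dots> \<le> 2 * (norm z1)\<^sup>2 + 2 * ((\<bar>t1\<bar> + \<bar>t2\<bar>) * m)\<^sup>2"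
      using sum_squares_bound[of "norm z1" "(\<bar>t1\<bar> + \<bar>t2\<bar>) * m"] by (simp add: power2_sum)
    also have "((\<bar>t1\<bar> + \<bar>t2\<bar>) * m)\<^sup>2 \<le> (2 * (t1\<^sup>2 + t2\<^sup>2)) * m\<^sup>2"
      unfolding power_mult_distrib using sum_squares_bound[of "\<bar>t1\<bar>" "\<bar>t2\<bar>"]
      by (intro mult_right_mono) (simp_all add: power2_sum)
    also have "(2 * (t1\<^sup>2 + t2\<^sup>2)) * m\<^sup>2 \<le> (2 * (E * (norm z1)\<^sup>2)) * m\<^sup>2"
      using tE by (intro mult_right_mono mult_left_mono) auto
    finally have xC: "(norm x)\<^sup>2 \<le> C * (norm z1)\<^sup>2" by (simp add: C_def algebra_simps)
    have "0 \<le> d * (norm z2)\<^sup>2" using d by simp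
    then have "d * (norm z1)\<^sup>2 \<le> b x x" using l zz by linarith
    moreover have "(d / C) * (norm x)\<^sup>2 \<le> (d / C) * (C * (norm z1)\<^sup>2)"
      using xC d C0 by (intro mult_left_mono) auto
    ultimately show ?thesis using C0 by simp
  qed
  moreover have "d / C > 0" using d C0 by simp
  ultimately show ?thesis unfolding b_def by blast
qed

text \<open>The ratio v (j + 1) / v j for the solution of (b - z / d (j + 1)) v (j + 1) = k (v (j +
  2) + v j) that is cut off to zero m steps after j. It is a discrete Weyl function.\<close>

fun cfrac :: "(nat \<Rightarrow> real) \<Rightarrow> real \<Rightarrow> real \<Rightarrow> nat \<Rightarrow> nat \<Rightarrow> complex \<Rightarrow> complex" where
  "cfrac d b k 0 j z = 0"
| "cfrac d b k (Suc m) j z = k / ((b - z / d (Suc j)) - k * cfrac d b k m (Suc j) z)"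

context
  fixes d :: "nat \<Rightarrow> real" and b k D :: real
  assumes d: "\<And>j. j \<ge> 1 \<Longrightarrow> d j > 0" and D: "\<And>j. j \<ge> 1 \<Longrightarrow> d j \<le> D" and k: "k > 0"
begin

text \<open>The term - z / d pushes the imaginary part down by at least Im z / D, and - k r pushes
  it further down. Consequently the continued fraction maps the upper half plane into its closure
  and never meets a zero denominator.\<close>

lemma cfrac_denominator:
  fixes z r :: complex
  assumes z: "Im z > 0" and r: "Im r \<ge> 0"
  shows "Im z / D \<le> - Im ((b - z / d (Suc j)) - k * r)"
proof -
  have "Im z / D \<le> Im z / d (Suc j)" using z d[of "Suc j"] D[of "Suc j"] by (intro divide_left_mono) auto
  moreover have "Im ((b - z / d (Suc j)) - k * r) = - (Im z / d (Suc j)) - k * Im r"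
    by (simp add: Im_divide_of_real)
  moreover have "k * Im r \<ge> 0" using k r by simp
  ultimately show ?thesis by simp
qed

lemma D_pos: "D > 0"
  using d[of 1] D[of 1] by simp

lemma Im_cfrac: "Im (z :: complex) > 0 \<Longrightarrow> Im (cfrac d b k m j z) \<ge> 0"
proof (induction m arbitrary: j)
  case (Suc m)
  define w where "w = (b - z / d (Suc j)) - k * cfrac d b k m (Suc j) z"
  have "Im z / D \<le> - Im w" unfolding w_def using Suc by (intro cfrac_denominator) auto
  moreover have "Im z / D > 0" using Suc(2) D_pos by simp
  ultimately have "Im w < 0" by linarith
  then have "Im (k / w) \<ge> 0" using k
    by (simp add: Im_divide) (intro divide_nonpos_nonneg mult_nonneg_nonpos; simp)
  then show ?case by (simp add: w_def)
qed simp

lemma cfrac_denominator_nz: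
  fixes z :: complex
  assumes "Im z > 0"
  shows "(b - z / d (Suc j)) - k * cfrac d b k m (Suc j) z \<noteq> 0"
    and "cmod (cfrac d b k m j z) \<le> k * D / Im z"
proof -
  have le: "Im z / D \<le> cmod ((b - z / d (Suc j)) - k * cfrac d b k m (Suc j) z)" for m j
    using cfrac_denominator[OF assms Im_cfrac[OF assms], of j m "Suc j"]
      abs_Im_le_cmod[of "(b - z / d (Suc j)) - k * cfrac d b k m (Suc j) z"] by linarith
  have pos: "Im z / D > 0" using assms D_pos by simp
  show "(b - z / d (Suc j)) - k * cfrac d b k m (Suc j) z \<noteq> 0" using le[of j m] pos by force
  show "cmod (cfrac d b k m j z) \<le> k * D / Im z"
  proof (cases m)
    case 0 then show ?thesis using assms k D_pos by simp
  next
    case (Suc m')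
    have "cmod (cfrac d b k m j z) = k / cmod ((b - z / d (Suc j)) - k * cfrac d b k m' (Suc j) z)"
      using k by (simp add: Suc norm_divide)
    also have "\<dots> \<le> k / (Im z / D)" using le[of j m'] pos k
      by (intro divide_left_mono mult_pos_pos) auto
    finally show ?thesis by simp
  qed
qed

lemma continuous_on_cfrac: "continuous_on {z. Im z > 0} (cfrac d b k m j)"
proof (induction m arbitrary: j)
  case 0 then show ?case by simp
next
  case (Suc m)
  have "d (Suc j) \<noteq> 0" using d[of "Suc j"] by simp
  then have "continuous_on {z. Im z > 0} (\<lambda>z :: complex. k / ((b - z / d (Suc j)) - k * cfrac d b k m (Suc j) z))"
    using cfrac_denominator_nz(1)[of _ j m]
    by (intro continuous_on_divide continuous_on_diff continuous_on_mult continuous_on_const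
        continuous_on_id Suc.IH) auto
  moreover have "cfrac d b k (Suc m) j = (\<lambda>z :: complex. k / ((b - z / d (Suc j)) - k * cfrac d b k m (Suc j) z))"
    by (rule ext) simp
  ultimately show ?case by (simp only:)
qed

text \<open>Brouwer's theorem applied to the truncated continued fraction gives an approximate
  eigenvector whose energy has the sign of an eigenvector in a Pontryagin space.\<close>
lemma truncated_eigenvector:
  fixes b0 d0 \<epsilon> :: real and N :: nat
  assumes d0: "d0 < 0" and eps: "0 < \<epsilon>" "\<epsilon> \<le> 1"
  obtains z :: complex and v :: "nat \<Rightarrow> complex"
  where "Im z > 0" "v 0 = 1" "b0 - k * v 1 - z / d0 = - \<i> * \<epsilon> / d0"
    "\<And>j. j < N \<Longrightarrow> (b - z / d (Suc j)) * v (Suc j) = k * (v (Suc (Suc j)) + v j)"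
    "\<And>j. j > N \<Longrightarrow> v j = 0"
    "(\<Sum>j<N. (cmod (v (Suc j)))\<^sup>2 / d (Suc j)) \<le> 1 / \<bar>d0\<bar>"
    "cmod z \<le> \<bar>d0\<bar> * (\<bar>b0\<bar> + k * cmod (v 1)) + 1"
proof -
  \<comment> \<open>For epsilon = 0, a fixed point would solve the first row, so it would be an
    eigenvalue of the truncated problem. Since d0 < 0, g raises the imaginary part, and the shift i
    epsilon keeps the iteration in the half plane Im z >= epsilon, where the continued fraction is
    continuous and bounded; R is the resulting bound for g.\<close>
  define g where "g z = d0 * (b0 - k * cfrac d b k N 0 z) + \<i> * \<epsilon>" for z
  define R where "R = \<bar>d0\<bar> * (\<bar>b0\<bar> + k * (k * D / \<epsilon>)) + 1"
  define T where "T = {z. Im z \<ge> \<epsilon>} \<inter> cball 0 R"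
  have T_pos: "Im z > 0" if "z \<in> T" for z using that eps by (auto simp: T_def)
  have "g z \<in> T" if z: "z \<in> T" for z
  proof -
    have "Im (g z) = - d0 * k * Im (cfrac d b k N 0 z) + \<epsilon>" by (simp add: g_def)
    moreover have "0 \<le> - d0 * k * Im (cfrac d b k N 0 z)"
      using d0 k Im_cfrac[OF T_pos[OF z]] by (intro mult_nonneg_nonneg) auto
    ultimately have "Im (g z) \<ge> \<epsilon>" by linarith
    moreover have "cmod (g z) \<le> R"
    proof -
      have "cmod (cfrac d b k N 0 z) \<le> k * D / Im z" by (rule cfrac_denominator_nz(2)[OF T_pos[OF z]])
      also have "\<dots> \<le> k * D / \<epsilon>" using z eps k D_pos by (intro divide_left_mono mult_pos_pos) (auto simp: T_def)
      finally have c: "cmod (cfrac d b k N 0 z) \<le> k * D / \<epsilon>" .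
      have "cmod (g z) \<le> cmod (d0 * (b0 - k * cfrac d b k N 0 z)) + cmod (\<i> * \<epsilon>)"
        unfolding g_def by (rule norm_triangle_ineq)
      also have "\<dots> = \<bar>d0\<bar> * cmod (b0 - k * cfrac d b k N 0 z) + \<epsilon>" using eps by (simp add: norm_mult)
      also have "\<dots> \<le> \<bar>d0\<bar> * (\<bar>b0\<bar> + k * cmod (cfrac d b k N 0 z)) + \<epsilon>"
        using norm_triangle_ineq4[of "complex_of_real b0" "k * cfrac d b k N 0 z"] k
        by (intro add_right_mono mult_left_mono) (auto simp: norm_mult)
      also have "\<dots> \<le> \<bar>d0\<bar> * (\<bar>b0\<bar> + k * (k * D / \<epsilon>)) + 1"
        using c k eps by (intro add_mono mult_left_mono) auto
      finally show ?thesis by (simp add: R_def)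
    qed
    ultimately show ?thesis by (simp add: T_def)
  qed
  moreover have "\<i> * \<epsilon> \<in> T"
  proof -
    have "1 \<le> R" unfolding R_def using k D_pos eps by (intro add_increasing mult_nonneg_nonneg add_nonneg_nonneg) auto
    then show ?thesis using eps by (simp add: T_def norm_mult)
  qed
  moreover have "compact T" unfolding T_def
    by (intro closed_Int_compact compact_cball closed_halfspace_Im_ge)
  moreover have "convex T" unfolding T_def by (intro convex_Int convex_cball convex_halfspace_Im_ge)
  moreover have "continuous_on T g" unfolding g_def
    by (intro continuous_intros continuous_on_subset[OF continuous_on_cfrac]) (use T_pos in auto)
  ultimately obtain z where z: "z \<in> T" "g z = z"
    using brouwer[of T g] by blast
  have zp: "Im z > 0" by (rule T_pos[OF z(1)])
  define v :: "nat \<Rightarrow> complex" where "v = rec_nat 1 (\<lambda>j w. cfrac d b k (N - j) j z * w)"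
  have v0: "v 0 = 1" and vS: "v (Suc j) = cfrac d b k (N - j) j z * v j" for j by (simp_all add: v_def)
  have row: "(b - z / d (Suc j)) * v (Suc j) = k * (v (Suc (Suc j)) + v j)" if "j < N" for j
  proof -
    define r where "r = cfrac d b k (N - Suc j) (Suc j) z"
    define w where "w = (b - z / d (Suc j)) - k * r"
    have w: "w \<noteq> 0" unfolding w_def r_def by (rule cfrac_denominator_nz(1)[OF zp])
    have "N - j = Suc (N - Suc j)" using that by simp
    then have v1: "v (Suc j) = k / w * v j" by (simp add: vS w_def r_def)
    have v2: "v (Suc (Suc j)) = r * v (Suc j)" by (simp add: vS[of "Suc j"] r_def)
    have "w * v (Suc j) = k * v j" using w by (simp add: v1)
    then show ?thesis unfolding v2 w_def by (simp add: algebra_simps)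
  qed
  have vN: "v j = 0" if "j > N" for j
  proof -
    have "v (N + Suc i) = 0" for i by (induction i) (simp_all add: vS)
    from this[of "j - N - 1"] that show ?thesis by simp
  qed
  have v1: "v 1 = cfrac d b k N 0 z" using vS[of 0] v0 by simp
  have zeq: "z = d0 * (b0 - k * v 1) + \<i> * \<epsilon>" using z(2)[symmetric] unfolding g_def v1 .
  have row0: "b0 - k * v 1 - z / d0 = - \<i> * \<epsilon> / d0"
    using d0 by (subst zeq) (simp add: field_simps)
  \<comment> \<open>The discrete Wronskian of v and its conjugate. Its decrease at each row is Im z
    times one term of the energy sum, so telescoping gives the energy inequality.\<close>
  define F where "F j = k * Im (cnj (v j) * v (Suc j))" for j
  have F: "F j - F (Suc j) = Im z * ((cmod (v (Suc j)))\<^sup>2 / d (Suc j))" if "j < N" for j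
  proof -
    have "Im (cnj (v (Suc j)) * ((b - z / d (Suc j)) * v (Suc j)))
       = Im (cnj (v (Suc j)) * (k * (v (Suc (Suc j)) + v j)))" by (simp only: row[OF that])
    moreover have "cnj (v (Suc j)) * ((b - z / d (Suc j)) * v (Suc j)) = (b - z / d (Suc j)) * of_real ((cmod (v (Suc j)))\<^sup>2)"
      by (simp only: complex_norm_square) (simp add: mult_ac)
    moreover have "Im ((b - z / d (Suc j)) * of_real ((cmod (v (Suc j)))\<^sup>2)) = - (Im z * ((cmod (v (Suc j)))\<^sup>2 / d (Suc j)))"
      by (simp add: Im_divide_of_real)
    moreover have "Im (cnj (v (Suc j)) * (k * (v (Suc (Suc j)) + v j))) = F (Suc j) - F j"
      by (simp add: F_def algebra_simps)
    ultimately show ?thesis by simp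
  qed
  have "Im z * (\<Sum>j<N. (cmod (v (Suc j)))\<^sup>2 / d (Suc j)) = (\<Sum>j<N. F j - F (Suc j))"
    using F by (simp add: sum_distrib_left)
  also have "\<dots> = F 0 - F N" by (rule sum_lessThan_telescope')
  also have "F N = 0" by (simp add: F_def vN)
  also have "F 0 = (Im z - \<epsilon>) / \<bar>d0\<bar>"
  proof -
    have "Im z = - d0 * (k * Im (v 1)) + \<epsilon>" using arg_cong[OF zeq, of Im] by simp
    then show ?thesis using d0 by (simp add: F_def v0 field_simps)
  qed
  finally have "Im z * (\<Sum>j<N. (cmod (v (Suc j)))\<^sup>2 / d (Suc j)) \<le> Im z * (1 / \<bar>d0\<bar>)"
    using eps d0 divide_right_mono[of "Im z - \<epsilon>" "Im z" "\<bar>d0\<bar>"] by simp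
  then have en: "(\<Sum>j<N. (cmod (v (Suc j)))\<^sup>2 / d (Suc j)) \<le> 1 / \<bar>d0\<bar>"
    using mult_le_cancel_left_pos[OF zp] by blast
  have "cmod z \<le> cmod (d0 * (b0 - k * v 1)) + cmod (\<i> * \<epsilon>)" by (subst zeq) (rule norm_triangle_ineq)
  also have "\<dots> \<le> \<bar>d0\<bar> * (\<bar>b0\<bar> + k * cmod (v 1)) + 1"
    using norm_triangle_ineq4[of "complex_of_real b0" "k * v 1"] k eps
    by (intro add_mono) (auto simp: norm_mult intro!: mult_left_mono)
  finally show thesis using that zp v0 row0 row vN en by blast
qed

text \<open>The energy inequality bounds z and the square sum of v independently of the truncation,
  and v 0 = 1 keeps the limit nonzero. With epsilon = 1 / (N + 1) the defect in the first row
  disappears. The limiting z may be real; that case is excluded afterwards by the absence of neutral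
  modes.\<close>

lemma limit_eigenvector:
  fixes b0 d0 :: real
  assumes d0: "d0 < 0"
  obtains z :: complex and v :: "nat \<Rightarrow> complex"
  where "v 0 = 1" "b0 - k * v 1 = z / d0"
    "\<And>j. (b - z / d (Suc j)) * v (Suc j) = k * (v (Suc (Suc j)) + v j)"
    "\<And>N. (\<Sum>j<N. (cmod (v (Suc j)))\<^sup>2) \<le> D / \<bar>d0\<bar>"
proof -
  define eps where "eps N = 1 / real (Suc N)" for N
  have ep: "0 < eps N" "eps N \<le> 1" for N by (auto simp: eps_def)
  define good where "good N z v \<longleftrightarrow> Im z > 0 \<and> v 0 = 1 \<and> b0 - k * v 1 - z / d0 = - \<i> * eps N / d0 \<and>
    (\<forall>j<N. (b - z / d (Suc j)) * v (Suc j) = k * (v (Suc (Suc j)) + v j)) \<and> (\<forall>j>N. v j = 0) \<and>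
    (\<Sum>j<N. (cmod (v (Suc j)))\<^sup>2 / d (Suc j)) \<le> 1 / \<bar>d0\<bar> \<and>
    cmod z \<le> \<bar>d0\<bar> * (\<bar>b0\<bar> + k * cmod (v 1)) + 1" for N and z :: complex and v :: "nat \<Rightarrow> complex"
  have "\<exists>z v. good N z v" for N
  proof (rule truncated_eigenvector[OF d0 ep(1)[of N] ep(2)[of N], where N = N and ?b0.0 = b0])
    fix z :: complex and v :: "nat \<Rightarrow> complex"
    assume a: "Im z > 0" "v 0 = 1" "b0 - k * v 1 - z / d0 = - \<i> * eps N / d0"
      "\<And>j. j < N \<Longrightarrow> (b - z / d (Suc j)) * v (Suc j) = k * (v (Suc (Suc j)) + v j)"
      "\<And>j. j > N \<Longrightarrow> v j = 0"
      "(\<Sum>j<N. (cmod (v (Suc j)))\<^sup>2 / d (Suc j)) \<le> 1 / \<bar>d0\<bar>"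
      "cmod z \<le> \<bar>d0\<bar> * (\<bar>b0\<bar> + k * cmod (v 1)) + 1"
    have "good N z v" unfolding good_def by (intro conjI allI impI a)
    then show ?thesis by blast
  qed
  then obtain z v where g: "\<And>N. good N (z N) (v N)" by metis
  have vsum: "(\<Sum>j<M. (cmod (v N (Suc j)))\<^sup>2) \<le> D / \<bar>d0\<bar>" for M N
  proof -
    have "(\<Sum>j<M. (cmod (v N (Suc j)))\<^sup>2) = (\<Sum>j\<in>{..<M}\<inter>{..<N}. (cmod (v N (Suc j)))\<^sup>2)"
    proof (intro sum.mono_neutral_right ballI)
      fix i assume "i \<in> {..<M} - {..<M} \<inter> {..<N}"
      then have "Suc i > N" by auto
      then show "(cmod (v N (Suc i)))\<^sup>2 = 0" using g[of N] by (simp add: good_def)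
    qed auto
    also have "\<dots> \<le> (\<Sum>j<N. (cmod (v N (Suc j)))\<^sup>2)" by (intro sum_mono2) auto
    also have "\<dots> \<le> (\<Sum>j<N. D * ((cmod (v N (Suc j)))\<^sup>2 / d (Suc j)))"
    proof (rule sum_mono)
      fix j
      have "(cmod (v N (Suc j)))\<^sup>2 * d (Suc j) \<le> (cmod (v N (Suc j)))\<^sup>2 * D" using D[of "Suc j"] by (intro mult_left_mono) auto
      then show "(cmod (v N (Suc j)))\<^sup>2 \<le> D * ((cmod (v N (Suc j)))\<^sup>2 / d (Suc j))"
        using d[of "Suc j"] by (simp add: field_simps)
    qed
    also have "\<dots> = D * (\<Sum>j<N. (cmod (v N (Suc j)))\<^sup>2 / d (Suc j))" by (simp add: sum_distrib_left)
    also have "\<dots> \<le> D * (1 / \<bar>d0\<bar>)" using g[of N] D_pos by (intro mult_left_mono) (auto simp: good_def)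
    finally show ?thesis by simp
  qed
  define Q where "Q = sqrt (D / \<bar>d0\<bar>)"
  have Q0: "Q \<ge> 0" using D_pos by (simp add: Q_def)
  have vb: "cmod (v N (Suc j)) \<le> Q" for N j
  proof -
    have "(cmod (v N (Suc j)))\<^sup>2 \<le> (\<Sum>i<Suc j. (cmod (v N (Suc i)))\<^sup>2)" by (simp add: sum_nonneg)
    then have "(cmod (v N (Suc j)))\<^sup>2 \<le> D / \<bar>d0\<bar>" using vsum[of N "Suc j"] by linarith
    then show ?thesis unfolding Q_def by (rule real_le_rsqrt)
  qed
  have zb: "cmod (z N) \<le> \<bar>d0\<bar> * (\<bar>b0\<bar> + k * Q) + 1" for N
  proof -
    have "cmod (z N) \<le> \<bar>d0\<bar> * (\<bar>b0\<bar> + k * cmod (v N 1)) + 1" using g[of N] by (simp add: good_def)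
    also have "\<dots> \<le> \<bar>d0\<bar> * (\<bar>b0\<bar> + k * Q) + 1"
      using vb[of N 0] k by (intro add_mono mult_left_mono) auto
    finally show ?thesis .
  qed
  define C where "C = \<bar>d0\<bar> * (\<bar>b0\<bar> + k * Q) + 1 + Q"
  have C: "Q \<le> C" "1 \<le> C" "\<bar>d0\<bar> * (\<bar>b0\<bar> + k * Q) + 1 \<le> C"
    using Q0 k by (simp_all add: C_def)
  define f where "f N i = (case i of 0 \<Rightarrow> z N | Suc j \<Rightarrow> v N j)" for N i
  have "cmod (f N i) \<le> C" for N i
  proof (cases i)
    case 0 then show ?thesis using zb[of N] C by (simp add: f_def)
  next
    case (Suc j)
    show ?thesis
    proof (cases j)
      case 0 then show ?thesis using g[of N] C Suc by (simp add: f_def good_def)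
    next
      case (Suc j') then show ?thesis using vb[of N j'] C \<open>i = Suc j\<close> by (simp add: f_def)
    qed
  qed
  then obtain r where r: "strict_mono (r :: nat \<Rightarrow> nat)" "\<And>i. i \<in> UNIV \<Longrightarrow> \<exists>l. (\<lambda>N. f (r N) i) \<longlonglongrightarrow> l"
    using function_convergent_subsequence[of "UNIV :: nat set" f C] by blast
  then obtain l where l: "\<And>i. (\<lambda>N. f (r N) i) \<longlonglongrightarrow> l i" by (metis UNIV_I)
  have zl: "(\<lambda>N. z (r N)) \<longlonglongrightarrow> l 0" using l[of 0] by (simp add: f_def)
  have vl: "(\<lambda>N. v (r N) j) \<longlonglongrightarrow> l (Suc j)" for j using l[of "Suc j"] by (simp add: f_def)
  have rN: "r N \<ge> N" for N by (rule seq_suble[OF r(1)])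
  show thesis
  proof (rule that[of "\<lambda>j. l (Suc j)" "l 0"])
    have "(\<lambda>N. v (r N) 0) \<longlonglongrightarrow> 1" using g by (simp add: good_def)
    then show "l (Suc 0) = 1" using LIMSEQ_unique[OF vl] by blast
    have lim1: "(\<lambda>N. b0 - k * v (r N) 1 - z (r N) / d0) \<longlonglongrightarrow> b0 - k * l (Suc 1) - l 0 / d0"
      using d0 by (intro tendsto_intros vl zl) auto
    have lim2: "(\<lambda>N. - \<i> * eps (r N) / d0) \<longlonglongrightarrow> - \<i> * of_real 0 / d0"
    proof -
      have "(\<lambda>N. eps (r N)) \<longlonglongrightarrow> 0"
        using LIMSEQ_subseq_LIMSEQ[OF LIMSEQ_Suc[OF lim_1_over_n] r(1)] by (simp add: eps_def o_def)
      then show ?thesis using d0 by (intro tendsto_intros) auto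
    qed
    have "b0 - k * v (r N) 1 - z (r N) / d0 = - \<i> * eps (r N) / d0" for N
      using g[of "r N"] by (simp add: good_def)
    with lim1 have "(\<lambda>N. - \<i> * eps (r N) / d0) \<longlonglongrightarrow> b0 - k * l (Suc 1) - l 0 / d0" by (simp only:)
    from LIMSEQ_unique[OF this lim2] have "b0 - k * l (Suc 1) - l 0 / d0 = - \<i> * of_real 0 / d0" .
    then show "b0 - k * l (Suc 1) = l 0 / d0" by simp
    show "(b - l 0 / d (Suc j)) * l (Suc (Suc j)) = k * (l (Suc (Suc (Suc j))) + l (Suc j))" for j
    proof (rule LIMSEQ_unique)
      show "(\<lambda>N. (b - z (r N) / d (Suc j)) * v (r N) (Suc j)) \<longlonglongrightarrow> (b - l 0 / d (Suc j)) * l (Suc (Suc j))"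
        using d[of "Suc j"] by (intro tendsto_intros vl zl) auto
      have "(\<lambda>N. k * (v (r N) (Suc (Suc j)) + v (r N) j)) \<longlonglongrightarrow> k * (l (Suc (Suc (Suc j))) + l (Suc j))"
        by (intro tendsto_intros vl)
      moreover have "\<forall>\<^sub>F N in sequentially. k * (v (r N) (Suc (Suc j)) + v (r N) j) = (b - z (r N) / d (Suc j)) * v (r N) (Suc j)"
        using eventually_gt_at_top[of j]
      proof eventually_elim
        case (elim N)
        then have "j < r N" using rN[of N] by simp
        then show ?case using g[of "r N"] by (simp add: good_def)
      qed
      ultimately show "(\<lambda>N. (b - z (r N) / d (Suc j)) * v (r N) (Suc j)) \<longlonglongrightarrow> k * (l (Suc (Suc (Suc j))) + l (Suc j))"
        using tendsto_cong by fast
    qed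
    show "(\<Sum>j<N. (cmod (l (Suc (Suc j))))\<^sup>2) \<le> D / \<bar>d0\<bar>" for N
    proof (rule LIMSEQ_le_const2)
      show "(\<lambda>n. \<Sum>j<N. (cmod (v (r n) (Suc j)))\<^sup>2) \<longlonglongrightarrow> (\<Sum>j<N. (cmod (l (Suc (Suc j))))\<^sup>2)"
        by (intro tendsto_intros vl)
    qed (use vsum in auto)
  qed
qed

end

text \<open>\<open>Cop\<close> couples n with n + 2 and n - 2, so the even components form a closed
  problem containing the negative entry. Its corner term turns beta into beta + k in the first row.
  The unknown v is L w rather than w, which is why z appears divided by d.\<close>

lemma exists_upair:
  assumes u: "upair \<beta> \<alpha> cr ci u1 u2" and a: "0 < \<alpha>" "\<alpha> \<le> a" and m: "mm a 0 < pi\<^sup>2"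
  shows "\<exists>cr ci u1 u2. upair \<beta> a cr ci u1 u2 \<and> ci > 0"
proof -
  have a0: "a > 0" using a by simp
  define k where "k = pi\<^sup>2 / 4"
  have k: "k > 0" by (simp add: k_def)
  define d where "d j = dd a (2 * j)" for j
  have dpos: "d j > 0" if "j \<ge> 1" for j using mm_gt[OF a0, of "2 * j"] that dd_pos_iff[of a "2 * j"] by (simp add: d_def)
  have dD: "d j \<le> 1 / pi\<^sup>2" for j by (simp add: d_def dd_le)
  have d0: "d 0 < 0"
  proof -
    have "dd a 0 \<le> 0" "dd a 0 \<noteq> 0" using m dd_pos_iff[of a 0] by (auto simp: not_less[symmetric])
    then show ?thesis by (simp add: d_def)
  qed
  obtain z :: complex and v :: "nat \<Rightarrow> complex" where v: "v 0 = 1" "(\<beta> + k) - k * v 1 = z / d 0"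
    "\<And>j. (\<beta> - z / d (Suc j)) * v (Suc j) = k * (v (Suc (Suc j)) + v j)"
    "\<And>N. (\<Sum>j<N. (cmod (v (Suc j)))\<^sup>2) \<le> (1 / pi\<^sup>2) / \<bar>d 0\<bar>"
  proof (rule limit_eigenvector[of d "1 / pi\<^sup>2" k "d 0" "\<beta> + k" \<beta>, OF dpos dD k d0])
    fix z :: complex and v :: "nat \<Rightarrow> complex"
    assume a: "v 0 = 1" "(\<beta> + k) - k * v 1 = z / d 0"
      "\<And>j. (\<beta> - z / d (Suc j)) * v (Suc j) = k * (v (Suc (Suc j)) + v j)"
      "\<And>N. (\<Sum>j<N. (cmod (v (Suc j)))\<^sup>2) \<le> (1 / pi\<^sup>2) / \<bar>d 0\<bar>"
    show thesis by (rule that[OF a])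
  qed
  define ext where "ext f n = (if even n then f (n div 2) else (0 :: real))" for f and n :: nat
  have sv: "summable (\<lambda>j. (cmod (v j))\<^sup>2)"
  proof -
    have "summable (\<lambda>j. (cmod (v (Suc j)))\<^sup>2)" using v(4) by (intro summableI_nonneg_bounded) auto
    then show ?thesis using summable_Suc_iff[of "\<lambda>j. (cmod (v j))\<^sup>2"] by simp
  qed
  have sq: "summable (\<lambda>n. (ext (\<lambda>j. h (v j)) n)\<^sup>2)" if h: "\<And>w. \<bar>h w\<bar> \<le> cmod w" for h
  proof -
    have 1: "summable (\<lambda>j. (h (v j))\<^sup>2)"
    proof (rule summable_comparison_test'[OF sv])
      show "norm ((h (v j))\<^sup>2) \<le> (cmod (v j))\<^sup>2" for j
        using power_mono[OF h[of "v j"], of 2] by simp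
    qed
    have inj: "strict_mono (\<lambda>j::nat. 2 * j)" by (simp add: strict_mono_def)
    have "summable (\<lambda>n. (ext (\<lambda>j. h (v j)) n)\<^sup>2) \<longleftrightarrow> summable (\<lambda>j. (ext (\<lambda>j. h (v j)) (2 * j))\<^sup>2)"
    proof (rule summable_mono_reindex[OF inj, symmetric])
      fix n :: nat assume "n \<notin> range (\<lambda>j. 2 * j)"
      then have "odd n" by (auto elim: evenE)
      then show "(ext (\<lambda>j. h (v j)) n)\<^sup>2 = 0" by (simp add: ext_def)
    qed
    then show ?thesis using 1 by (simp add: ext_def)
  qed
  define x1 x2 where "x1 = Ell2 (ext (\<lambda>j. Re (v j)))" and "x2 = Ell2 (ext (\<lambda>j. Im (v j)))"
  have c1: "cf x1 n = (if even n then Re (v (n div 2)) else 0)" and c2: "cf x2 n = (if even n then Im (v (n div 2)) else 0)" for n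
    using sq[of Re] sq[of Im] abs_Re_le_cmod abs_Im_le_cmod by (auto simp: x1_def x2_def cf_Ell2 ext_def)
  have g: "gg a (2 * j) = 1 / d j" for j by (simp add: gg_def d_def inverse_eq_divide)
  have row: "cf (Kop \<beta> x1) n = Re z * (gg a n * cf x1 n) - Im z * (gg a n * cf x2 n) \<and>
    cf (Kop \<beta> x2) n = Im z * (gg a n * cf x1 n) + Re z * (gg a n * cf x2 n)" for n
  proof (cases "even n")
    case False
    then show ?thesis by (auto simp: cf_Kop cf_Cop c1 c2)
  next
    case True
    then obtain j where n: "n = 2 * j" by (elim evenE)
    show ?thesis
    proof (cases j)
      case 0
      have e: "complex_of_real \<beta> * v 0 - k * (v 1 - v 0) = z * (1 / d 0) * v 0"
        using v(1,2) by (simp add: algebra_simps)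
      have "\<beta> * Re (v 0) - k * (Re (v 1) - Re (v 0)) = Re z * (1 / d 0 * Re (v 0)) - Im z * (1 / d 0 * Im (v 0))"
        "\<beta> * Im (v 0) - k * (Im (v 1) - Im (v 0)) = Im z * (1 / d 0 * Re (v 0)) + Re z * (1 / d 0 * Im (v 0))"
        using arg_cong[OF e, of Re] arg_cong[OF e, of Im] by (simp_all add: Re_divide_of_real Im_divide_of_real algebra_simps add_divide_distrib diff_divide_distrib)
      then show ?thesis using n 0 g[of 0] by (simp add: cf_Kop cf_Cop c1 c2 k_def)
    next
      case (Suc i)
      have e: "complex_of_real \<beta> * v (Suc i) - k * (v (Suc (Suc i)) + v i) = z * (1 / d (Suc i)) * v (Suc i)"
        using v(3)[of i] by (simp add: algebra_simps)
      have "\<beta> * Re (v j) - k * (Re (v (Suc j)) + Re (v i)) = Re z * (1 / d j * Re (v j)) - Im z * (1 / d j * Im (v j))"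
        "\<beta> * Im (v j) - k * (Im (v (Suc j)) + Im (v i)) = Im z * (1 / d j * Re (v j)) + Re z * (1 / d j * Im (v j))"
        using arg_cong[OF e, of Re] arg_cong[OF e, of Im] Suc by (simp_all add: Re_divide_of_real Im_divide_of_real algebra_simps add_divide_distrib diff_divide_distrib)
      then show ?thesis using n Suc g[of j] by (simp add: cf_Kop cf_Cop c1 c2 k_def)
    qed
  qed
  define w1 w2 where "w1 = Go a x1" and "w2 = Go a x2"
  have Lw: "Lo a w1 = x1" "Lo a w2 = x2" using m a0 by (simp_all add: w1_def w2_def Lo_Go)
  have A: "Aop \<beta> a w1 = Re z *\<^sub>R w1 - Im z *\<^sub>R w2" "Aop \<beta> a w2 = Im z *\<^sub>R w1 + Re z *\<^sub>R w2"
    unfolding Aop_def Lw using row by (auto intro!: ell2_eqI simp: w1_def w2_def cf_Go)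
  have w1: "w1 \<noteq> 0"
  proof
    assume "w1 = 0"
    then have "x1 = 0" using Lw(1) bounded_linear.linear[OF bounded_linear_Lo] linear_0 by metis
    then show False using c1[of 0] v(1) by simp
  qed
  \<comment> \<open>A real limit eigenvalue would be a neutral mode at a, which instability at alpha
    excludes.\<close>
  have "Im z \<noteq> 0"
  proof
    assume "Im z = 0"
    then have "Aop \<beta> a w1 = Re z *\<^sub>R w1" using A(1) by simp
    from no_neutral_mode[OF u a _ this] w1 m show False by simp
  qed
  then have "upair \<beta> a (Re z) (Im z) w1 w2" using A w1 by (simp add: upair_def)
  moreover have "upair \<beta> a (Re z) (- Im z) w1 (- w2)"
  proof -
    have "Aop \<beta> a (- w2) = - Aop \<beta> a w2" by (rule linear_neg[OF bounded_linear.linear[OF bounded_linear_Aop]])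
    then show ?thesis using A w1 \<open>Im z \<noteq> 0\<close> by (simp add: upair_def)
  qed
  ultimately show ?thesis using \<open>Im z \<noteq> 0\<close> by (meson neg_0_less_iff_less linorder_neqE_linordered_idom)
qed

section \<open>Time averages of coercive rotating flows\<close>

lemma riesz_ell2:
  assumes f: "bounded_linear (f :: ell2 \<Rightarrow> real)"
  obtains h where "\<And>w. f w = inner h w"
proof -
  interpret f: bounded_linear f by (rule f)
  obtain C where C: "C \<ge> 0" "\<And>x. \<bar>f x\<bar> \<le> norm x * C" using f.nonneg_bounded by auto
  define c where "c k = f (unitv k)" for k
  have "(\<Sum>k<N. (c k)\<^sup>2) \<le> C\<^sup>2" for N
  proof -
    define x where "x = (\<Sum>k<N. c k *\<^sub>R unitv k)"
    have fx: "f x = (\<Sum>k<N. (c k)\<^sup>2)" by (simp add: x_def f.sum f.scaleR c_def power2_eq_square)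
    have "cf x k = (if k < N then c k else 0)" for k
      by (simp add: x_def cf_sum cf_unitv if_distrib cong: if_cong)
    then have "inner x x = (\<Sum>k<N. (c k)\<^sup>2)"
      by (subst (1) x_def) (simp add: inner_sum_left power2_eq_square)
    then have nx: "(norm x)\<^sup>2 = (\<Sum>k<N. (c k)\<^sup>2)" by (simp add: power2_norm_eq_inner)
    have "(norm x)\<^sup>2 \<le> norm x * C" using C(2)[of x] fx nx by simp
    then have "norm x \<le> C" using C(1) by (cases "norm x = 0") (auto simp: power2_eq_square)
    then show ?thesis unfolding nx[symmetric] by (intro power_mono) auto
  qed
  note b = norm_le_of_partial_sums[OF this C(1)]
  define h where "h = Ell2 c"
  have "f w = inner h w" for w
  proof -
    have "(\<lambda>N. f (trunc N w)) \<longlonglongrightarrow> f w" by (intro f.tendsto trunc_tendsto)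
    moreover have "f (trunc N w) = inner h (trunc N w)" for N
      using b(1) by (simp add: trunc_def f.sum f.scaleR inner_sum_right h_def cf_Ell2 c_def)
    ultimately have "(\<lambda>N. inner h (trunc N w)) \<longlonglongrightarrow> f w" by simp
    moreover have "(\<lambda>N. inner h (trunc N w)) \<longlonglongrightarrow> inner h w" by (intro tendsto_intros trunc_tendsto)
    ultimately show ?thesis by (rule LIMSEQ_unique)
  qed
  then show thesis by (rule that)
qed

text \<open>Nonnegativity is asked only along the line through w in direction v, because forms built
  from the energy are nonnegative only on the subspace H.\<close>

lemma null_vector_of_nonneg_form:
  fixes b :: "'a::real_vector \<Rightarrow> 'a \<Rightarrow> real"
  assumes add: "\<And>u v w. b (u + v) w = b u w + b v w" and scale: "\<And>c v w. b (c *\<^sub>R v) w = c * b v w"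
    and sym: "\<And>v w. b v w = b w v" and nonneg: "\<And>t. b (t *\<^sub>R v + w) (t *\<^sub>R v + w) \<ge> 0" and null: "b v v = 0"
  shows "b v w = 0"
proof (rule ccontr)
  assume nz: "b v w \<noteq> 0"
  have q: "0 \<le> 2 * t * b v w + b w w" for t
  proof -
    have "b (t *\<^sub>R v + w) (t *\<^sub>R v + w) = t * b v (t *\<^sub>R v + w) + b w (t *\<^sub>R v + w)"
      by (simp add: add scale)
    also have "\<dots> = t * b (t *\<^sub>R v + w) v + b (t *\<^sub>R v + w) w" by (simp only: sym)
    also have "\<dots> = t * (t * b v v + b w v) + (t * b v w + b w w)" by (simp only: add scale)
    also have "\<dots> = 2 * t * b v w + b w w" using null sym[of w v] by (simp add: algebra_simps)
    finally show ?thesis using nonneg[of t] by simp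
  qed
  from q[of "- (b w w + 1) / (2 * b v w)"] nz show False by (simp add: field_simps)
qed

lemma cauchy_schwarz_form:
  fixes b :: "'a::real_vector \<Rightarrow> 'a \<Rightarrow> real"
  assumes add: "\<And>u v w. b (u + v) w = b u w + b v w" and scale: "\<And>c v w. b (c *\<^sub>R v) w = c * b v w"
    and sym: "\<And>v w. b v w = b w v" and nonneg: "\<And>v. b v v \<ge> 0"
  shows "\<bar>b v w\<bar> \<le> sqrt (b v v) * sqrt (b w w)"
proof (cases "b v v = 0")
  case True
  have "b v w = 0" by (rule null_vector_of_nonneg_form[of b, OF add scale sym nonneg True])
  then show ?thesis using nonneg by simp
next
  case False
  then have pos: "b v v > 0" using nonneg[of v] by simp
  define t where "t = - b v w / b v v"
  have "b (t *\<^sub>R v + w) (t *\<^sub>R v + w) = t * b v (t *\<^sub>R v + w) + b w (t *\<^sub>R v + w)"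
    by (simp add: add scale)
  also have "\<dots> = t * b (t *\<^sub>R v + w) v + b (t *\<^sub>R v + w) w" by (simp only: sym)
  also have "\<dots> = t * (t * b v v + b w v) + (t * b v w + b w w)" by (simp only: add scale)
  also have "\<dots> = b w w - (b v w)\<^sup>2 / b v v"
    using pos sym[of w v] by (simp add: t_def power2_eq_square field_simps)
  finally have "(b v w)\<^sup>2 / b v v \<le> b w w" using nonneg[of "t *\<^sub>R v + w"] by simp
  then have "(b v w)\<^sup>2 \<le> b v v * b w w" using pos by (simp add: field_simps)
  then have "sqrt ((b v w)\<^sup>2) \<le> sqrt (b v v * b w w)" by (rule real_sqrt_le_mono)
  then show ?thesis by (simp add: real_sqrt_mult)
qed

text \<open>A nonnegative trace class operator, described by its quadratic form; partial traces over
  the unit vectors are bounded by M.\<close>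

locale trace_form =
  fixes S :: "ell2 \<Rightarrow> ell2 \<Rightarrow> real" and M :: real
  assumes S_add: "S (u + v) w = S u w + S v w" and S_scale: "S (c *\<^sub>R v) w = c * S v w"
    and S_sym: "S v w = S w v" and S_nonneg: "S v v \<ge> 0"
    and S_bound: "\<bar>S v w\<bar> \<le> M * norm v * norm w"
    and S_trace: "(\<Sum>k<N. S (unitv k) (unitv k)) \<le> M"
begin

lemma S_add2: "S w (u + v) = S w u + S w v"
  unfolding S_sym[of w] by (rule S_add)

lemma S_scale2: "S w (c *\<^sub>R v) = c * S w v"
  unfolding S_sym[of w] by (rule S_scale)

lemma S_diff: "S (u - v) w = S u w - S v w"
  using S_add[of "u - v" v w] by simp

lemma S_diff2: "S w (u - v) = S w u - S w v"
  unfolding S_sym[of w] by (rule S_diff)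

lemma S_bounded_linear: "bounded_linear (S v)"
proof (rule bounded_linear_intro[of _ "M * norm v"])
  show "norm (S v x) \<le> norm x * (M * norm v)" for x using S_bound[of v x] by (simp add: mult_ac)
qed (simp_all add: S_add2 S_scale2)

lemma S_riesz: obtains h where "\<And>w. S v w = inner h w"
  using riesz_ell2[OF S_bounded_linear] by blast

lemma S_wlim:
  assumes "wlim X x"
  shows "(\<lambda>i. S v (X i)) \<longlonglongrightarrow> S v x"
proof -
  obtain h where h: "\<And>w. S v w = inner h w" using S_riesz[of v] by blast
  show ?thesis using wlim_inner[OF assms, of h] unfolding h inner_commute[of h] .
qed

text \<open>Trace class implies compact. Cauchy-Schwarz gives |S (e_j, e_k)| <= p_j p_k with p
  square summable, so S z z is at most the square of <|z|, P>. The componentwise absolute values of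
  a bounded weakly null sequence are again weakly null.\<close>

lemma S_diag_tendsto_zero:
  assumes w: "wlim Z 0" and bd: "\<And>i. norm (Z i) \<le> C"
  shows "(\<lambda>i. S (Z i) (Z i)) \<longlonglongrightarrow> 0"
proof -
  define p where "p k = sqrt (S (unitv k) (unitv k))" for k
  have "(\<Sum>k<N. (p k)\<^sup>2) \<le> (sqrt M)\<^sup>2" for N
    using S_trace[of N] S_trace[of 0] by (simp add: p_def S_nonneg)
  note pe = norm_le_of_partial_sums[OF this, simplified]
  have M0: "M \<ge> 0" using S_trace[of 0] by simp
  define P where "P = Ell2 p"
  have cP: "cf P k = p k" for k using pe(1) M0 by (simp add: P_def cf_Ell2)
  have jk: "\<bar>S (unitv j) (unitv k)\<bar> \<le> p j * p k" for j k
    unfolding p_def by (rule cauchy_schwarz_form[OF S_add S_scale S_sym S_nonneg])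
  define az where "az i = Ell2 (\<lambda>n. \<bar>cf (Z i) n\<bar>)" for i
  have caz: "cf (az i) n = \<bar>cf (Z i) n\<bar>" for i n
    using summable_cf_sq[of "Z i"] by (simp add: az_def cf_Ell2)
  have naz: "norm (az i) \<le> C" for i
    using norm_ell2_mono[of "az i" 1 "Z i"] bd[of i] by (simp add: caz)
  have "(\<lambda>i. cf (az i) n) \<longlonglongrightarrow> 0" for n
    using tendsto_rabs[OF wlim_cf[OF w, of n]] by (simp add: caz)
  then obtain y where y: "wlim az y" "\<And>n. cf y n = 0" by (rule wlim_of_components[OF naz]) blast
  have "y = 0" by (rule ell2_eqI) (simp add: y(2))
  with y(1) have "wlim az 0" by simp
  have main: "S z z \<le> (inner (Ell2 (\<lambda>n. \<bar>cf z n\<bar>)) P)\<^sup>2" for z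
  proof -
    define a where "a = Ell2 (\<lambda>n. \<bar>cf z n\<bar>)"
    have ca: "cf a n = \<bar>cf z n\<bar>" for n using summable_cf_sq[of z] by (simp add: a_def cf_Ell2)
    have fin: "S (trunc N z) (trunc N z) \<le> (inner (trunc N a) P)\<^sup>2" for N
    proof -
      have l: "S (\<Sum>j<N. c j *\<^sub>R unitv j) w = (\<Sum>j<N. c j * S (unitv j) w)" for c w
      proof (induction N)
        case 0 then show ?case using S_scale[of 0 0 w] by simp
      qed (simp add: S_add S_scale)
      have "S (trunc N z) (trunc N z) = (\<Sum>j<N. cf z j * S (unitv j) (trunc N z))"
        by (subst (1) trunc_def) (rule l)
      also have "\<dots> = (\<Sum>j<N. cf z j * (\<Sum>k<N. cf z k * S (unitv k) (unitv j)))"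
        by (simp only: S_sym[of "unitv _" "trunc N z"]) (simp only: trunc_def l)
      also have "\<dots> \<le> (\<Sum>j<N. \<Sum>k<N. (\<bar>cf z j\<bar> * p j) * (\<bar>cf z k\<bar> * p k))"
        unfolding sum_distrib_left
      proof (intro sum_mono)
        fix j k
        have "cf z j * (cf z k * S (unitv k) (unitv j)) \<le> \<bar>cf z j\<bar> * (\<bar>cf z k\<bar> * \<bar>S (unitv k) (unitv j)\<bar>)"
          by (rule order_trans[OF abs_ge_self]) (simp add: abs_mult)
        also have "\<dots> \<le> \<bar>cf z j\<bar> * (\<bar>cf z k\<bar> * (p k * p j))" by (intro mult_left_mono jk) auto
        finally show "cf z j * (cf z k * S (unitv k) (unitv j)) \<le> (\<bar>cf z j\<bar> * p j) * (\<bar>cf z k\<bar> * p k)"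
          by (simp add: mult_ac)
      qed
      also have "\<dots> = (\<Sum>j<N. \<bar>cf z j\<bar> * p j)\<^sup>2" by (simp add: sum_product power2_eq_square)
      also have "(\<Sum>j<N. \<bar>cf z j\<bar> * p j) = inner (trunc N a) P"
        by (simp add: trunc_def inner_sum_left ca cP)
      finally show ?thesis .
    qed
    have l1: "(\<lambda>N. S (trunc N z) (trunc N z)) \<longlonglongrightarrow> S z z"
    proof -
      have "bounded_bilinear S"
      proof
        show "\<exists>K. \<forall>a b. norm (S a b) \<le> norm a * norm b * K"
          using S_bound by (intro exI[of _ M]) (simp add: mult_ac)
      qed (simp_all add: S_add S_scale S_add2 S_scale2)
      then show ?thesis by (rule bounded_bilinear.tendsto[OF _ trunc_tendsto trunc_tendsto])
    qed
    have l2: "(\<lambda>N. (inner (trunc N a) P)\<^sup>2) \<longlonglongrightarrow> (inner a P)\<^sup>2"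
      by (intro tendsto_intros trunc_tendsto)
    have "S z z \<le> (inner a P)\<^sup>2" by (rule LIMSEQ_le[OF l1 l2]) (use fin in blast)
    then show ?thesis by (simp add: a_def)
  qed
  have "(\<lambda>i. (inner (az i) P)\<^sup>2) \<longlonglongrightarrow> (inner 0 P)\<^sup>2"
    by (intro tendsto_intros wlim_inner \<open>wlim az 0\<close>)
  then have "(\<lambda>i. (inner (az i) P)\<^sup>2) \<longlonglongrightarrow> 0" by simp
  then show ?thesis
    by (rule tendsto_sandwich[OF _ _ tendsto_const, rotated 2])
      (simp_all only: S_nonneg main az_def eventually_True)
qed

lemma S_diag_wlim:
  assumes w: "wlim X x" and bd: "\<And>i. norm (X i) \<le> C"
  shows "(\<lambda>i. S (X i) (X i)) \<longlonglongrightarrow> S x x"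
proof -
  have "wlim (\<lambda>i. X i - x) 0"
    using w by (simp add: wlim_def inner_diff_left LIM_zero)
  moreover have "norm (X i - x) \<le> C + norm x" for i
    using norm_triangle_ineq4[of "X i" x] bd[of i] by simp
  ultimately have "(\<lambda>i. S (X i - x) (X i - x)) \<longlonglongrightarrow> 0" by (rule S_diag_tendsto_zero)
  moreover have "(\<lambda>i. 2 * S x (X i) - S x x) \<longlonglongrightarrow> 2 * S x x - S x x"
    by (intro tendsto_intros S_wlim w)
  ultimately have "(\<lambda>i. S (X i - x) (X i - x) + (2 * S x (X i) - S x x)) \<longlonglongrightarrow> 0 + (2 * S x x - S x x)"
    by (rule tendsto_add)
  moreover have "S (X i - x) (X i - x) + (2 * S x (X i) - S x x) = S (X i) (X i)" for i
    by (simp add: S_diff S_diff2 S_sym[of "X i" x])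
  ultimately show ?thesis by simp
qed

end

text \<open>H is described by the vectors N that annihilate it, so weak limits remain in H. Three
  choices occur later: the energy complement of an eigenpair, the whole space, and the complement of
  the first basis vector at resonance.\<close>

locale coercive_pair =
  fixes Bo A :: "ell2 \<Rightarrow> ell2" and N :: "ell2 set" and H :: "ell2 set" and \<delta> :: real
  assumes blB: "bounded_linear Bo" and blA: "bounded_linear A"
    and B_sym: "inner (Bo x) y = inner x (Bo y)"
    and H_def: "H = {x. \<forall>n\<in>N. inner n x = 0}"
    and A_H: "x \<in> H \<Longrightarrow> A x \<in> H"
    and A_sym: "x \<in> H \<Longrightarrow> y \<in> H \<Longrightarrow> inner (Bo (A x)) y = inner (Bo x) (A y)"
    and delta: "\<delta> > 0" and coer: "x \<in> H \<Longrightarrow> \<delta> * (norm x)\<^sup>2 \<le> inner (Bo x) x"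
begin

sublocale B: bounded_linear Bo by (rule blB)
sublocale A: bounded_linear A by (rule blA)

definition b :: "ell2 \<Rightarrow> ell2 \<Rightarrow> real" where "b x y = inner (Bo x) y"

lemma b_simps: "b (x + y) z = b x z + b y z" "b (x - y) z = b x z - b y z" "b (c *\<^sub>R x) z = c * b x z"
  "b z (x + y) = b z x + b z y" "b z (x - y) = b z x - b z y" "b z (c *\<^sub>R x) = c * b z x"
  by (simp_all add: b_def B.add B.diff B.scaleR inner_add_left inner_diff_left inner_add_right inner_diff_right)

lemma b_minus: "b (- x) z = - b x z" "b z (- x) = - b z x"
  using b_simps(3)[of "-1" x z] b_simps(6)[of z "-1" x] by simp_all

lemma b_sym: "b x y = b y x"
  unfolding b_def by (subst B_sym) (rule inner_commute)

lemma H_closed: "x \<in> H \<Longrightarrow> y \<in> H \<Longrightarrow> x + y \<in> H" "x \<in> H \<Longrightarrow> y \<in> H \<Longrightarrow> x - y \<in> H"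
  "x \<in> H \<Longrightarrow> c *\<^sub>R x \<in> H" "0 \<in> H"
  by (auto simp: H_def inner_add_right inner_diff_right)

lemma H_wlim: "wlim X x \<Longrightarrow> (\<And>i. X i \<in> H) \<Longrightarrow> x \<in> H"
proof -
  assume w: "wlim X x" and X: "\<And>i. X i \<in> H"
  have "inner n x = 0" if "n \<in> N" for n
  proof -
    have "(\<lambda>i. inner (X i) n) \<longlonglongrightarrow> inner x n" using wlim_inner[OF w] .
    moreover have "inner (X i) n = 0" for i using X[of i] that by (simp add: H_def inner_commute)
    ultimately have "inner x n = 0" by (simp add: LIMSEQ_const_iff)
    then show ?thesis by (simp add: inner_commute)
  qed
  then show ?thesis by (simp add: H_def)
qed

lemma b_nonneg: "x \<in> H \<Longrightarrow> b x x \<ge> 0"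
  using coer[of x] delta unfolding b_def by (smt (verit) mult_nonneg_nonneg zero_le_power2)

lemma b_zero: "x \<in> H \<Longrightarrow> b x x = 0 \<Longrightarrow> x = 0"
  using coer[of x] delta unfolding b_def by (auto simp: mult_le_0_iff)

lemma norm_le_of_b: "x \<in> H \<Longrightarrow> b x x \<le> 1 \<Longrightarrow> norm x \<le> sqrt (1 / \<delta>)"
proof -
  assume "x \<in> H" "b x x \<le> 1"
  then have "\<delta> * (norm x)\<^sup>2 \<le> 1" using coer[of x] by (simp add: b_def)
  then have "(norm x)\<^sup>2 \<le> 1 / \<delta>" using delta by (simp add: field_simps)
  then show ?thesis by (simp add: real_le_rsqrt)
qed

lemma wlim_B: "wlim X x \<Longrightarrow> wlim (\<lambda>i. Bo (X i)) (Bo x)"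
  by (simp add: wlim_def B_sym)

lemma b_wlim: "wlim X x \<Longrightarrow> (\<lambda>i. b (X i) y) \<longlonglongrightarrow> b x y"
  using wlim_inner[OF wlim_B] by (simp add: b_def)

text \<open>Weak lower semicontinuity of the energy: expanding b (X i - x) (X i - x) >= 0 gives 2 b
  (X i) x - b x x <= 1, which is linear in X i and passes to the limit.\<close>

lemma wlim_unit:
  assumes w: "wlim X x" and H: "\<And>i. X i \<in> H" and b1: "\<And>i. b (X i) (X i) \<le> 1"
  shows "b x x \<le> 1"
proof -
  have x: "x \<in> H" by (rule H_wlim[OF w H])
  have "2 * b (X i) x - b x x \<le> 1" for i
    using b_nonneg[OF H_closed(2)[OF H[of i] x]] b1[of i] b_sym[of x "X i"] by (simp add: b_simps)
  moreover have "(\<lambda>i. 2 * b (X i) x - b x x) \<longlonglongrightarrow> 2 * b x x - b x x"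
    by (intro tendsto_intros b_wlim w)
  ultimately have "2 * b x x - b x x \<le> 1" by (intro LIMSEQ_le_const2) auto
  then show ?thesis by simp
qed

lemma exists_maximizing_sequence:
  fixes f :: "ell2 \<Rightarrow> real"
  assumes ne: "V \<noteq> {}" and bd: "\<And>x. x \<in> V \<Longrightarrow> f x \<le> C" and V: "V \<subseteq> H" "\<And>x. x \<in> V \<Longrightarrow> b x x \<le> 1"
  obtains X x where "\<And>i. X i \<in> V" "wlim X x" "(\<lambda>i. f (X i)) \<longlonglongrightarrow> Sup (f ` V)"
    "\<And>i. norm (X i) \<le> sqrt (1 / \<delta>)" "\<And>y. y \<in> V \<Longrightarrow> f y \<le> Sup (f ` V)"
proof -
  have bdd: "bdd_above (f ` V)" using bd by (auto simp: bdd_above_def)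
  have "\<exists>x\<in>V. f x > Sup (f ` V) - 1 / real (Suc n)" for n
    using less_cSup_iff[of "f ` V" "Sup (f ` V) - 1 / real (Suc n)"] ne bdd by auto
  then obtain Y where Y: "\<And>n. Y n \<in> V" "\<And>n. f (Y n) > Sup (f ` V) - 1 / real (Suc n)" by metis
  have up: "f y \<le> Sup (f ` V)" if "y \<in> V" for y using that bdd by (simp add: cSup_upper)
  have lim: "(\<lambda>n. f (Y n)) \<longlonglongrightarrow> Sup (f ` V)"
  proof (rule tendsto_sandwich[where h = "\<lambda>_. Sup (f ` V)"])
    show "(\<lambda>n. Sup (f ` V) - 1 / real (Suc n)) \<longlonglongrightarrow> Sup (f ` V)"
      using tendsto_diff[OF tendsto_const[of "Sup (f ` V)"] LIMSEQ_Suc[OF lim_1_over_n]] by simp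
  qed (use Y(1) up less_imp_le[OF Y(2)] in \<open>auto intro!: always_eventually\<close>)
  have n: "norm (Y n) \<le> sqrt (1 / \<delta>)" for n using norm_le_of_b V Y(1) by blast
  obtain r x where r: "strict_mono (r :: nat \<Rightarrow> nat)" "wlim (Y \<circ> r) x"
    by (rule weakly_convergent_subsequence[of Y, OF n]) blast
  show thesis
  proof (rule that[of "Y \<circ> r" x])
    show "(Y \<circ> r) i \<in> V" "norm ((Y \<circ> r) i) \<le> sqrt (1 / \<delta>)" for i using Y(1) n by simp_all
    show "(\<lambda>i. f ((Y \<circ> r) i)) \<longlonglongrightarrow> Sup (f ` V)" using LIMSEQ_subseq_LIMSEQ[OF lim r(1)] by (simp add: o_def)
  qed (use r up in auto)
qed

text \<open>The form q = S (B ., B .) is weakly continuous on bounded sets, so it attains its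
  maximum mu over the unit energy ball. The eigenspace V of q relative to b for mu is invariant
  under A by \<open>S_A\<close>, and its unit sphere is compact because q = mu b there. Maximizing
  <B A x, x> on that sphere yields an eigenvector of A.\<close>

lemma invariant_form_has_eigenvector:
  assumes "trace_form S M"
    and S_A: "\<And>x y. x \<in> H \<Longrightarrow> y \<in> H \<Longrightarrow> S (Bo (A x)) (Bo y) = S (Bo x) (Bo (A y))"
    and x0: "x0 \<in> H" "S (Bo x0) (Bo x0) > 0"
  shows "\<exists>x\<in>H. \<exists>\<kappa>. x \<noteq> 0 \<and> A x = \<kappa> *\<^sub>R x"
proof -
  interpret trace_form S M by fact
  define q where "q x y = S (Bo x) (Bo y)" for x y
  have q_simps: "q (x + y) z = q x z + q y z" "q (c *\<^sub>R x) z = c * q x z" for x y z c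
    by (simp_all add: q_def B.add B.scaleR S_add S_scale)
  have q_sym: "q x y = q y x" for x y unfolding q_def by (rule S_sym)
  have q_scale2: "q (c *\<^sub>R x) (c *\<^sub>R x) = c\<^sup>2 * q x x" for c x
    by (metis q_simps(2) q_sym mult.assoc power2_eq_square)
  have b_scale2: "b (c *\<^sub>R x) (c *\<^sub>R x) = c\<^sup>2 * b x x" for c x by (simp add: b_simps power2_eq_square)
  obtain CB where CB: "CB \<ge> 0" "\<And>x. norm (Bo x) \<le> norm x * CB" using B.nonneg_bounded by auto
  obtain CA where CA: "CA \<ge> 0" "\<And>x. norm (A x) \<le> norm x * CA" using A.nonneg_bounded by auto
  have M0: "M \<ge> 0" using S_trace[of 0] by simp
  define D where "D = sqrt (1 / \<delta>)"
  have D0: "D \<ge> 0" using delta by (simp add: D_def)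
  have qw: "(\<lambda>i. q (X i) (X i)) \<longlonglongrightarrow> q x x" if "wlim X x" "\<And>i. norm (X i) \<le> D" for X x
    unfolding q_def
  proof (rule S_diag_wlim[OF wlim_B[OF that(1)]])
    show "norm (Bo (X i)) \<le> D * CB" for i
      using order_trans[OF CB(2)[of "X i"] mult_right_mono[OF that(2)[of i] CB(1)]] .
  qed
  define V1 where "V1 = {x\<in>H. b x x \<le> 1}"
  have bdq: "q x x \<le> M * (D * CB) * (D * CB)" if "x \<in> V1" for x
  proof -
    have "norm x \<le> D" using that norm_le_of_b by (simp add: V1_def D_def)
    then have n: "norm (Bo x) \<le> D * CB" using order_trans[OF CB(2) mult_right_mono[OF _ CB(1)]] by blast
    have "q x x \<le> M * norm (Bo x) * norm (Bo x)" using S_bound[of "Bo x" "Bo x"] by (simp add: q_def)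
    also have "\<dots> \<le> M * (D * CB) * (D * CB)" using n M0 D0 CB(1) by (intro mult_mono) auto
    finally show ?thesis .
  qed
  have "0 \<in> V1" by (simp add: V1_def H_closed b_def B.zero)
  obtain X x where X: "\<And>i. X i \<in> V1" "wlim X x" "(\<lambda>i. q (X i) (X i)) \<longlonglongrightarrow> Sup ((\<lambda>x. q x x) ` V1)"
    "\<And>i. norm (X i) \<le> D" and up: "\<And>y. y \<in> V1 \<Longrightarrow> q y y \<le> Sup ((\<lambda>x. q x x) ` V1)"
    by (rule exists_maximizing_sequence[of V1 "\<lambda>x. q x x"])
      (use \<open>0 \<in> V1\<close> bdq in \<open>auto simp: V1_def D_def\<close>)
  define \<mu> where "\<mu> = Sup ((\<lambda>x. q x x) ` V1)"
  have xH: "x \<in> H" using H_wlim[OF X(2)] X(1) by (auto simp: V1_def)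
  have qx: "q x x = \<mu>" using LIMSEQ_unique[OF qw[OF X(2,4)] X(3)] by (simp add: \<mu>_def)
  have bx: "b x x \<le> 1" using wlim_unit[OF X(2)] X(1) by (auto simp: V1_def)
  have le: "q y y \<le> \<mu> * b y y" if "y \<in> H" for y
  proof (cases "y = 0")
    case True then show ?thesis by (simp add: q_def b_def B.zero S_scale[of 0 0, simplified])
  next
    case False
    then have pos: "b y y > 0" using b_zero[OF that] b_nonneg[OF that] by fastforce
    define c where "c = 1 / sqrt (b y y)"
    have c2: "c\<^sup>2 = 1 / b y y" using pos by (simp add: c_def power_divide)
    have "c *\<^sub>R y \<in> V1" using that pos by (simp add: V1_def H_closed b_scale2 c2)
    from up[OF this] show ?thesis using pos by (simp add: q_scale2 c2 \<mu>_def field_simps)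
  qed
  have mu: "\<mu> > 0" using le[OF x0(1)] x0(2) b_nonneg[OF x0(1)]
    by (simp add: q_def) (smt (verit) mult_nonpos_nonneg)
  have bx1: "b x x = 1"
  proof -
    have "\<mu> \<le> \<mu> * b x x" using le[OF xH] qx by simp
    then show ?thesis using mu bx by simp
  qed
  define V where "V = {x\<in>H. \<forall>y\<in>H. q x y = \<mu> * b x y}"
  have xV: "x \<in> V"
  proof -
    have "\<mu> * b x y - q x y = 0" if "y \<in> H" for y
    proof (rule null_vector_of_nonneg_form[of "\<lambda>x y. \<mu> * b x y - q x y"])
      show "0 \<le> \<mu> * b (t *\<^sub>R x + y) (t *\<^sub>R x + y) - q (t *\<^sub>R x + y) (t *\<^sub>R x + y)" for t
        using le[of "t *\<^sub>R x + y"] H_closed xH that by simp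
      show "\<mu> * b v w - q v w = \<mu> * b w v - q w v" for v w by (simp only: b_sym[of v w] q_sym[of v w])
    qed (use qx bx1 in \<open>auto simp: b_simps q_simps algebra_simps\<close>)
    then show ?thesis using xH by (simp add: V_def)
  qed
  have V_H: "V \<subseteq> H" by (auto simp: V_def)
  have V_closed: "v + w \<in> V" "c *\<^sub>R v \<in> V" if "v \<in> V" "w \<in> V" for v w c
    using that by (auto simp: V_def H_closed b_simps q_simps algebra_simps)
  have V_A: "A v \<in> V" if "v \<in> V" for v
  proof -
    have "q (A v) y = \<mu> * b (A v) y" if "y \<in> H" for y
      using \<open>v \<in> V\<close> S_A[of v y] A_sym[of v y] A_H[OF that] that by (simp add: V_def q_def b_def)
    then show ?thesis using that A_H by (simp add: V_def)
  qed
  define f where "f v = b (A v) v" for v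
  define V2 where "V2 = {v\<in>V. b v v = 1}"
  have fbd: "f v \<le> D * CA * CB * D" if "v \<in> V2" for v
  proof -
    have n: "norm v \<le> D" using that norm_le_of_b V_H by (auto simp: V2_def D_def)
    have "f v \<le> norm (Bo (A v)) * norm v" unfolding f_def b_def by (rule norm_cauchy_schwarz)
    also have "\<dots> \<le> (norm v * CA * CB) * norm v"
      using CB(2)[of "A v"] mult_right_mono[OF CA(2)[of v] CB(1)] by (intro mult_right_mono) auto
    also have "\<dots> \<le> D * CA * CB * D" using n CA(1) CB(1) D0 by (intro mult_mono) auto
    finally show ?thesis .
  qed
  have V2H: "V2 \<subseteq> H" using V_H by (auto simp: V2_def)
  obtain Y y where Y: "\<And>i. Y i \<in> V2" "wlim Y y" "(\<lambda>i. f (Y i)) \<longlonglongrightarrow> Sup (f ` V2)"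
    "\<And>i. norm (Y i) \<le> D" and up2: "\<And>z. z \<in> V2 \<Longrightarrow> f z \<le> Sup (f ` V2)"
    by (rule exists_maximizing_sequence[of V2 f])
      (use xV bx1 fbd V2H in \<open>auto simp: V2_def D_def\<close>)
  define \<kappa> where "\<kappa> = Sup (f ` V2)"
  have YH: "Y i \<in> H" "Y i \<in> V" "b (Y i) (Y i) = 1" for i using Y(1) V_H by (auto simp: V2_def)
  have yH: "y \<in> H" using H_wlim[OF Y(2)] YH by auto
  have yV: "y \<in> V"
  proof -
    have "q y z = \<mu> * b y z" if "z \<in> H" for z
    proof -
      have "(\<lambda>i. q (Y i) z) \<longlonglongrightarrow> q y z" unfolding q_def
        using S_wlim[OF wlim_B[OF Y(2)], of "Bo z"] by (simp add: S_sym)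
      moreover have "(\<lambda>i. \<mu> * b (Y i) z) \<longlonglongrightarrow> \<mu> * b y z" by (intro tendsto_intros b_wlim Y)
      moreover have "q (Y i) z = \<mu> * b (Y i) z" for i using YH(2) that by (simp add: V_def)
      ultimately show ?thesis using LIMSEQ_unique[of "\<lambda>i. \<mu> * b (Y i) z"] by simp
    qed
    then show ?thesis using yH by (simp add: V_def)
  qed
  \<comment> \<open>No energy is lost in the weak limit: on V the energy is q / mu, and q is weakly
    continuous. With this, weak convergence becomes strong.\<close>
  have by1: "b y y = 1"
  proof -
    have "q (Y i) (Y i) = \<mu>" for i using YH[of i] by (simp add: V_def)
    then have "q y y = \<mu>" using qw[OF Y(2,4)] by (simp add: LIMSEQ_const_iff)
    then show ?thesis using yV yH mu by (simp add: V_def)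
  qed
  have strong: "Y \<longlonglongrightarrow> y"
  proof -
    have "(\<lambda>i. (2 - 2 * b (Y i) y) / \<delta>) \<longlonglongrightarrow> (2 - 2 * b y y) / \<delta>"
      using delta by (intro tendsto_intros b_wlim Y) auto
    then have up0: "(\<lambda>i. (2 - 2 * b (Y i) y) / \<delta>) \<longlonglongrightarrow> 0" using by1 by simp
    have upn: "(norm (Y i - y))\<^sup>2 \<le> (2 - 2 * b (Y i) y) / \<delta>" for i
      using coer[OF H_closed(2)[OF YH(1)[of i] yH]] delta YH(3)[of i] by1 b_sym[of y "Y i"]
      unfolding b_def[symmetric] by (simp add: b_simps field_simps)
    have "(\<lambda>i. (norm (Y i - y))\<^sup>2) \<longlonglongrightarrow> 0"
    proof (rule tendsto_sandwich[OF _ _ tendsto_const up0])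
      show "\<forall>\<^sub>F i in sequentially. (norm (Y i - y))\<^sup>2 \<le> (2 - 2 * b (Y i) y) / \<delta>"
        by (rule always_eventually) (use upn in blast)
    qed simp
    then have "(\<lambda>i. sqrt ((norm (Y i - y))\<^sup>2)) \<longlonglongrightarrow> sqrt 0" by (intro tendsto_real_sqrt)
    then show ?thesis by (simp add: tendsto_norm_zero_iff LIM_zero_iff)
  qed
  have "(\<lambda>i. f (Y i)) \<longlonglongrightarrow> f y" unfolding f_def b_def
    by (intro tendsto_inner B.tendsto A.tendsto strong)
  then have fy: "f y = \<kappa>" using LIMSEQ_unique[OF _ Y(3)] by (simp add: \<kappa>_def)
  have le2: "b (A z) z \<le> \<kappa> * b z z" if "z \<in> V" for z
  proof (cases "z = 0")
    case True then show ?thesis by (simp add: b_def B.zero)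
  next
    case False
    have zH: "z \<in> H" using that V_H by blast
    then have pos: "b z z > 0" using b_zero[OF zH] b_nonneg[OF zH] False by fastforce
    define c where "c = 1 / sqrt (b z z)"
    have c2: "c * c = 1 / b z z" using pos by (simp add: c_def)
    have "c *\<^sub>R z \<in> V2" using that pos V_closed c2 by (simp add: V2_def b_scale2 power2_eq_square)
    from up2[OF this] have "(c * c) * b (A z) z \<le> \<kappa>" by (simp add: f_def A.scaleR b_simps \<kappa>_def)
    then show ?thesis using pos unfolding c2 by (simp add: field_simps)
  qed
  have A_bsym: "b (A v) w = b (A w) v" if "v \<in> V" "w \<in> V" for v w
  proof -
    have "v \<in> H" "w \<in> H" using that V_H by auto
    from A_sym[OF this] show ?thesis using b_sym[of v "A w"] by (simp add: b_def)
  qed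
  have ort: "\<kappa> * b y w - b (A y) w = 0" if w: "w \<in> V" for w
  proof -
    \<comment> \<open>Symmetrized by hand, since A is symmetric for b on H only, while the null
      vector lemma asks for a form that is symmetric everywhere.\<close>
    define g where "g v w = \<kappa> * b v w - (b (A v) w + b (A w) v) / 2" for v w
    have "g y w = 0"
    proof (rule null_vector_of_nonneg_form[of g])
      show "0 \<le> g (t *\<^sub>R y + w) (t *\<^sub>R y + w)" for t
        using le2[of "t *\<^sub>R y + w"] V_closed yV w by (simp add: g_def)
      show "g y y = 0" using fy by1 by (simp add: g_def f_def)
      show "g v w = g w v" for v w by (simp add: g_def b_sym add.commute)
    qed (simp_all add: g_def b_simps A.add A.scaleR field_simps)
    then show ?thesis using A_bsym[OF yV w] by (simp add: g_def)
  qed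
  have "\<kappa> *\<^sub>R y - A y \<in> V"
    using V_closed(1)[OF V_closed(2)[OF yV yV, of \<kappa>] V_closed(2)[OF V_A[OF yV] yV, of "-1"]] by simp
  from ort[OF this] have "b (\<kappa> *\<^sub>R y - A y) (\<kappa> *\<^sub>R y - A y) = 0" by (simp add: b_simps b_sym[of y "A y"])
  then have "\<kappa> *\<^sub>R y - A y = 0" using b_zero \<open>\<kappa> *\<^sub>R y - A y \<in> V\<close> V_H by blast
  moreover have "y \<noteq> 0" using by1 by (auto simp: b_def)
  ultimately show ?thesis using yH by (intro bexI[of _ y] exI[of _ \<kappa>]) simp_all
qed

end

text \<open>In complex notation, (P + i Q)' = i a A (P + i Q). With A symmetric for a coercive
  energy on H, the flow is unitary for that energy.\<close>

locale rotating_flow = coercive_pair +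
  fixes P Q :: "real \<Rightarrow> ell2" and a :: real
  assumes a_nz: "a \<noteq> 0"
    and no_eigen: "\<And>x \<kappa>. x \<in> H \<Longrightarrow> A x = \<kappa> *\<^sub>R x \<Longrightarrow> x = 0"
    and P_H: "t \<ge> 0 \<Longrightarrow> P t \<in> H" and Q_H: "t \<ge> 0 \<Longrightarrow> Q t \<in> H"
    and P_deriv: "t \<ge> 0 \<Longrightarrow> (P has_vector_derivative (- a) *\<^sub>R A (Q t)) (at t within {0..})"
    and Q_deriv: "t \<ge> 0 \<Longrightarrow> (Q has_vector_derivative a *\<^sub>R A (P t)) (at t within {0..})"
begin

lemma inner_P_deriv: "t \<ge> 0 \<Longrightarrow> ((\<lambda>t. inner v (P t)) has_real_derivative (- a) * inner v (A (Q t))) (at t within {0..})"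
  and inner_Q_deriv: "t \<ge> 0 \<Longrightarrow> ((\<lambda>t. inner v (Q t)) has_real_derivative a * inner v (A (P t))) (at t within {0..})"
  using bounded_linear.has_vector_derivative[OF bounded_linear_inner_right P_deriv, of t v]
    bounded_linear.has_vector_derivative[OF bounded_linear_inner_right Q_deriv, of t v]
  by (simp_all add: has_real_derivative_iff_has_vector_derivative)

lemma P_cont: "continuous_on {0..} P" and Q_cont: "continuous_on {0..} Q"
  using P_deriv Q_deriv by (auto simp: continuous_on_eq_continuous_within intro!: has_vector_derivative_continuous)

lemma energy_conserved:
  assumes "t \<ge> 0"
  shows "b (P t) (P t) + b (Q t) (Q t) = b (P 0) (P 0) + b (Q 0) (Q 0)"
proof -
  have bb: "bounded_bilinear b"
  proof
    obtain C where "\<And>x. norm (Bo x) \<le> norm x * C" using B.bounded by blast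
    then show "\<exists>K. \<forall>x y. norm (b x y) \<le> norm x * norm y * K"
    proof (intro exI allI)
      fix x y
      have "norm (b x y) \<le> norm (Bo x) * norm y" unfolding b_def using Cauchy_Schwarz_ineq2 by simp
      also have "\<dots> \<le> norm x * C * norm y" using \<open>\<And>x. norm (Bo x) \<le> norm x * C\<close> by (intro mult_right_mono) auto
      finally show "norm (b x y) \<le> norm x * norm y * C" by (simp add: mult_ac)
    qed
  qed (simp_all add: b_simps)
  define E where "E t = b (P t) (P t) + b (Q t) (Q t)" for t
  have "(E has_vector_derivative 0) (at s within {0..t})" if s: "s \<in> {0..t}" for s
  proof -
    have s0: "s \<ge> 0" using s by simp
    have "(E has_vector_derivative (b (P s) ((- a) *\<^sub>R A (Q s)) + b ((- a) *\<^sub>R A (Q s)) (P s))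
        + (b (Q s) (a *\<^sub>R A (P s)) + b (a *\<^sub>R A (P s)) (Q s))) (at s within {0..})"
      unfolding E_def
      by (intro has_vector_derivative_add bounded_bilinear.has_vector_derivative[OF bb] P_deriv Q_deriv s0)
    moreover have "b (A (Q s)) (P s) = b (Q s) (A (P s))" "b (A (P s)) (Q s) = b (P s) (A (Q s))"
      using A_sym[OF Q_H[OF s0] P_H[OF s0]] A_sym[OF P_H[OF s0] Q_H[OF s0]] by (simp_all add: b_def)
    moreover have "b (Q s) (A (P s)) = b (A (P s)) (Q s)" by (rule b_sym)
    ultimately have "(E has_vector_derivative 0) (at s within {0..})" by (simp add: b_simps b_minus)
    then show ?thesis by (rule has_vector_derivative_within_subset) auto
  qed
  then have "E t = E 0" using assms has_vector_derivative_zero_constant[of "{0..t}" E] 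
    by (metis atLeastAtMost_iff convex_real_interval(5) order_refl)
  then show ?thesis by (simp add: E_def)
qed

lemma flow_bound:
  assumes "t \<ge> 0"
  shows "\<delta> * ((norm (P t))\<^sup>2 + (norm (Q t))\<^sup>2) \<le> b (P 0) (P 0) + b (Q 0) (Q 0)"
  using coer[OF P_H[OF assms]] coer[OF Q_H[OF assms]] energy_conserved[OF assms]
  by (simp add: b_def distrib_left)

definition avg :: "real \<Rightarrow> ell2 \<Rightarrow> ell2 \<Rightarrow> real" where
  "avg T v w = (1 / T) * integral {0..T} (\<lambda>t. inner v (P t) * inner w (P t) + inner v (Q t) * inner w (Q t))"

definition M0 :: real where "M0 = (b (P 0) (P 0) + b (Q 0) (Q 0)) / \<delta>"

lemma norm_flow_le: "t \<ge> 0 \<Longrightarrow> (norm (P t))\<^sup>2 + (norm (Q t))\<^sup>2 \<le> M0"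
  using flow_bound[of t] delta by (simp add: M0_def field_simps)

lemma M0_nonneg: "M0 \<ge> 0"
  using norm_flow_le[of 0] zero_le_power2[of "norm (P 0)"] zero_le_power2[of "norm (Q 0)"] by linarith

lemma avg_integrable: "(\<lambda>t. inner v (P t) * inner w (P t) + inner v (Q t) * inner w (Q t)) integrable_on {0..T}"
  by (intro integrable_continuous_interval continuous_intros
      continuous_on_subset[OF P_cont] continuous_on_subset[OF Q_cont]) auto

lemma integrand_bound:
  assumes "t \<ge> 0"
  shows "\<bar>inner v (P t) * inner w (P t) + inner v (Q t) * inner w (Q t)\<bar> \<le> M0 * norm v * norm w"
proof -
  have 1: "\<bar>inner v x * inner w x\<bar> \<le> norm v * norm w * (norm x)\<^sup>2" for x :: ell2
  proof -
    have "\<bar>inner v x\<bar> * \<bar>inner w x\<bar> \<le> (norm v * norm x) * (norm w * norm x)"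
      by (intro mult_mono Cauchy_Schwarz_ineq2) auto
    then show ?thesis by (simp add: abs_mult power2_eq_square mult_ac)
  qed
  have "\<bar>inner v (P t) * inner w (P t) + inner v (Q t) * inner w (Q t)\<bar>
    \<le> norm v * norm w * ((norm (P t))\<^sup>2 + (norm (Q t))\<^sup>2)"
    using 1[of "P t"] 1[of "Q t"] abs_triangle_ineq[of "inner v (P t) * inner w (P t)" "inner v (Q t) * inner w (Q t)"]
    by (simp add: distrib_left)
  also have "\<dots> \<le> norm v * norm w * M0" by (intro mult_left_mono norm_flow_le assms) simp
  finally show ?thesis by (simp add: mult_ac)
qed

lemma avg_props:
  assumes T: "T > 0"
  shows "avg T (u + v) w = avg T u w + avg T v w" "avg T (c *\<^sub>R v) w = c * avg T v w"
    "avg T v w = avg T w v" "avg T v v \<ge> 0" "\<bar>avg T v w\<bar> \<le> M0 * norm v * norm w"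
    "(\<Sum>k<n. avg T (unitv k) (unitv k)) \<le> M0"
proof -
  show "avg T (u + v) w = avg T u w + avg T v w"
    unfolding avg_def distrib_left[symmetric] integral_add[OF avg_integrable avg_integrable, symmetric]
    by (simp add: inner_add_left algebra_simps)
  have "inner (c *\<^sub>R v) (P t) * inner w (P t) + inner (c *\<^sub>R v) (Q t) * inner w (Q t)
    = c * (inner v (P t) * inner w (P t) + inner v (Q t) * inner w (Q t))" for t
    by (simp add: algebra_simps)
  then show "avg T (c *\<^sub>R v) w = c * avg T v w" by (simp add: avg_def)
  show "avg T v w = avg T w v" by (simp add: avg_def mult.commute)
  show "avg T v v \<ge> 0" unfolding avg_def using T
    by (intro mult_nonneg_nonneg integral_nonneg avg_integrable) auto
  have "norm (integral {0..T} (\<lambda>t. inner v (P t) * inner w (P t) + inner v (Q t) * inner w (Q t)))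
     \<le> integral {0..T} (\<lambda>t. M0 * norm v * norm w)"
    by (intro integral_norm_bound_integral avg_integrable) (use integrand_bound in \<open>auto simp: integrable_const_ivl\<close>)
  then have "\<bar>integral {0..T} (\<lambda>t. inner v (P t) * inner w (P t) + inner v (Q t) * inner w (Q t))\<bar> \<le> T * (M0 * norm v * norm w)"
    using T by (simp add: mult_ac)
  then show "\<bar>avg T v w\<bar> \<le> M0 * norm v * norm w"
    using T by (simp only: avg_def abs_mult) (simp add: divide_le_eq mult_ac)
  have "(\<Sum>k<n. avg T (unitv k) (unitv k)) =
     (1 / T) * integral {0..T} (\<lambda>t. \<Sum>k<n. inner (unitv k) (P t) * inner (unitv k) (P t) + inner (unitv k) (Q t) * inner (unitv k) (Q t))"
    unfolding avg_def sum_distrib_left[symmetric] by (subst integral_sum) (auto intro: avg_integrable simp del: inner_unitv)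
  also have "\<dots> \<le> (1 / T) * integral {0..T} (\<lambda>t. M0)"
  proof (intro mult_left_mono integral_le integrable_sum avg_integrable)
    show "(\<Sum>k<n. inner (unitv k) (P t) * inner (unitv k) (P t) + inner (unitv k) (Q t) * inner (unitv k) (Q t)) \<le> M0"
      if "t \<in> {0..T}" for t
      using sum_sq_le_norm[of "P t" n] sum_sq_le_norm[of "Q t" n] norm_flow_le[of t] that
      by (simp add: sum.distrib power2_eq_square)
  qed (use T in auto)
  finally show "(\<Sum>k<n. avg T (unitv k) (unitv k)) \<le> M0" using T by simp
qed

text \<open>The antisymmetric combination f is bounded in time, and its derivative is a times the
  difference of the two integrands. Averaging this exact derivative over [0, T] leaves only boundary
  terms divided by T.\<close>

lemma avg_commute:
  assumes T: "T > 0" and x: "x \<in> H" and y: "y \<in> H"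
  shows "\<bar>avg T (Bo x) (Bo (A y)) - avg T (Bo (A x)) (Bo y)\<bar> \<le> 4 * (M0 * norm (Bo x) * norm (Bo y)) / (\<bar>a\<bar> * T)"
proof -
  define f where "f t = inner (Bo x) (P t) * inner (Bo y) (Q t) - inner (Bo x) (Q t) * inner (Bo y) (P t)" for t
  define g where "g v w t = inner v (P t) * inner w (P t) + inner v (Q t) * inner w (Q t)" for v w t
  have swap: "inner (Bo z) (A u) = inner (Bo (A z)) u" if "z \<in> H" "u \<in> H" for z u
    using A_sym[OF that] by simp
  have "(f has_real_derivative a * (g (Bo x) (Bo (A y)) t - g (Bo (A x)) (Bo y) t)) (at t within {0..T})"
    if t: "t \<in> {0..T}" for t
  proof -
    have t0: "t \<ge> 0" using t by simp
    have D1: "(f has_real_derivative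
       ((- a) * inner (Bo x) (A (Q t)) * inner (Bo y) (Q t) + (a * inner (Bo y) (A (P t))) * inner (Bo x) (P t))
     - ((a * inner (Bo x) (A (P t))) * inner (Bo y) (P t) + (- a) * inner (Bo y) (A (Q t)) * inner (Bo x) (Q t)))
       (at t within {0..})"
      unfolding f_def by (intro DERIV_diff DERIV_mult inner_P_deriv inner_Q_deriv t0)
    have "((- a) * inner (Bo x) (A (Q t)) * inner (Bo y) (Q t) + (a * inner (Bo y) (A (P t))) * inner (Bo x) (P t))
     - ((a * inner (Bo x) (A (P t))) * inner (Bo y) (P t) + (- a) * inner (Bo y) (A (Q t)) * inner (Bo x) (Q t))
     = a * (g (Bo x) (Bo (A y)) t - g (Bo (A x)) (Bo y) t)"
      unfolding swap[OF x P_H[OF t0]] swap[OF x Q_H[OF t0]] swap[OF y P_H[OF t0]] swap[OF y Q_H[OF t0]]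
      by (simp add: g_def algebra_simps)
    from D1[unfolded this] show ?thesis by (rule DERIV_subset) auto
  qed
  then have "((\<lambda>t. a * (g (Bo x) (Bo (A y)) t - g (Bo (A x)) (Bo y) t)) has_integral f T - f 0) {0..T}"
    using T by (intro fundamental_theorem_of_calculus) (auto simp: has_real_derivative_iff_has_vector_derivative)
  from integral_unique[OF this]
  have "f T - f 0 = integral {0..T} (\<lambda>t. a * (g (Bo x) (Bo (A y)) t - g (Bo (A x)) (Bo y) t))" by simp
  also have "\<dots> = a * (integral {0..T} (g (Bo x) (Bo (A y))) - integral {0..T} (g (Bo (A x)) (Bo y)))"
    unfolding integral_mult_right g_def[abs_def] by (subst integral_diff) (auto intro: avg_integrable)
  also have "\<dots> = a * T * (avg T (Bo x) (Bo (A y)) - avg T (Bo (A x)) (Bo y))"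
    using T by (simp add: avg_def g_def[abs_def] algebra_simps)
  finally have e: "a * T * (avg T (Bo x) (Bo (A y)) - avg T (Bo (A x)) (Bo y)) = f T - f 0" by simp
  have fb: "\<bar>f t\<bar> \<le> 2 * (M0 * norm (Bo x) * norm (Bo y))" if "t \<ge> 0" for t
  proof -
    have n: "norm (P t) \<le> sqrt M0" "norm (Q t) \<le> sqrt M0"
      using norm_flow_le[OF that] by (auto intro!: real_le_rsqrt simp: power2_eq_square)
        (smt (verit) zero_le_square)+
    have p: "\<bar>inner v r * inner w s\<bar> \<le> M0 * norm v * norm w" if "norm r \<le> sqrt M0" "norm s \<le> sqrt M0" for v w r s :: ell2
    proof -
      have "\<bar>inner v r * inner w s\<bar> \<le> (norm v * norm r) * (norm w * norm s)"
        unfolding abs_mult by (intro mult_mono Cauchy_Schwarz_ineq2) auto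
      also have "\<dots> \<le> (norm v * sqrt M0) * (norm w * sqrt M0)"
        using that M0_nonneg by (intro mult_mono) auto
      also have "\<dots> = M0 * norm v * norm w" using M0_nonneg by simp
      finally show ?thesis .
    qed
    show ?thesis using p[OF n, of "Bo x" "Bo y"] p[OF n(2,1), of "Bo x" "Bo y"] unfolding f_def by linarith
  qed
  have "\<bar>a\<bar> * T * \<bar>avg T (Bo x) (Bo (A y)) - avg T (Bo (A x)) (Bo y)\<bar> = \<bar>f T - f 0\<bar>"
    using e T by (metis abs_mult abs_of_pos)
  also have "\<dots> \<le> 4 * (M0 * norm (Bo x) * norm (Bo y))" using fb[of T] fb[of 0] T by linarith
  finally show ?thesis using T a_nz by (simp add: field_simps)
qed

theorem time_average_vanishes:
  "((\<lambda>T. (1 / T) * integral {0..T} (\<lambda>t. (cf (P t) k)\<^sup>2 + (cf (Q t) k)\<^sup>2)) \<longlongrightarrow> 0) at_top"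
proof (rule ccontr)
  assume "\<not> ?thesis"
  have eq: "(1 / T) * integral {0..T} (\<lambda>t. (cf (P t) k)\<^sup>2 + (cf (Q t) k)\<^sup>2) = avg T (unitv k) (unitv k)" for T
    by (simp add: avg_def power2_eq_square)
  from \<open>\<not> ?thesis\<close> obtain e where e: "e > 0" "\<not> (\<forall>\<^sub>F T in at_top. \<bar>avg T (unitv k) (unitv k)\<bar> < e)"
    unfolding eq tendsto_iff by auto
  have "\<exists>T\<ge>real (Suc n). avg T (unitv k) (unitv k) \<ge> e" for n
  proof (rule ccontr)
    assume *: "\<not> ?thesis"
    have "\<forall>\<^sub>F T in at_top. \<bar>avg T (unitv k) (unitv k)\<bar> < e"
      using eventually_ge_at_top[of "real (Suc n)"]
    proof eventually_elim
      case (elim T)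
      then have "T > 0" by simp
      then show ?case using * elim avg_props(4)[of T "unitv k"] by force
    qed
    with e(2) show False by contradiction
  qed
  then obtain T where T: "\<And>n. T n \<ge> real (Suc n)" "\<And>n. avg (T n) (unitv k) (unitv k) \<ge> e" by metis
  have T0: "T n > 0" for n using T(1)[of n] by simp
  have bd: "norm (avg (T n) (unitv (fst ij)) (unitv (snd ij))) \<le> M0" for n ij
    using avg_props(5)[OF T0[of n], of "unitv (fst ij)" "unitv (snd ij)"] by (simp add: norm_unitv)
  obtain r where r: "strict_mono (r :: nat \<Rightarrow> nat)"
    and cv: "\<And>ij. ij \<in> UNIV \<Longrightarrow> \<exists>l. (\<lambda>n. avg (T (r n)) (unitv (fst ij)) (unitv (snd ij))) \<longlonglongrightarrow> l"
    by (rule function_convergent_subsequence[of "UNIV :: (nat \<times> nat) set" "\<lambda>n ij. avg (T n) (unitv (fst ij)) (unitv (snd ij))" M0])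
      (use bd in auto)
  define R where "R n = T (r n)" for n
  have R0: "R n > 0" for n using T0 by (simp add: R_def)
  note ap = avg_props[OF R0]
  have cvij: "convergent (\<lambda>n. avg (R n) (unitv i) (unitv j))" for i j
    using cv[of "(i, j)"] by (auto simp: convergent_def R_def)
  have bl: "bounded_linear (avg (R n) v)" for n v
  proof (rule bounded_linear_intro[of _ "M0 * norm v"])
    show "norm (avg (R n) v x) \<le> norm x * (M0 * norm v)" for x using ap(5)[of n v x] by (simp add: mult_ac)
  qed (simp_all add: ap(3)[of _ v] ap(1,2))
  \<comment> \<open>Convergence on pairs of basis vectors is extended to all vectors one argument at
    a time, using the bound M0 that is uniform in n.\<close>
  have cv1: "convergent (\<lambda>n. avg (R n) v (unitv j))" for v j
  proof -
    have "convergent (\<lambda>n. avg (R n) (unitv j) v)"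
      by (rule convergent_linear_functionals[where f = "\<lambda>n. avg (R n) (unitv j)" and C = M0])
        (use bl ap(5)[of _ "unitv j"] cvij in \<open>auto simp: norm_unitv\<close>)
    then show ?thesis by (simp add: ap(3)[of _ v])
  qed
  have cvg: "convergent (\<lambda>n. avg (R n) v w)" for v w
    by (rule convergent_linear_functionals[where f = "\<lambda>n. avg (R n) v" and C = "M0 * norm v"])
      (use bl ap(5) cv1 in auto)
  define S where "S v w = lim (\<lambda>n. avg (R n) v w)" for v w
  have S: "(\<lambda>n. avg (R n) v w) \<longlonglongrightarrow> S v w" for v w
    using cvg by (simp add: S_def convergent_LIMSEQ_iff)
  have tf: "trace_form S M0"
  proof
    fix u v w :: ell2 and c :: real and N :: nat
    show "S (u + v) w = S u w + S v w"
      by (rule LIMSEQ_unique[OF S[of "u + v" w]], unfold ap(1)) (intro tendsto_add S)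
    show "S (c *\<^sub>R v) w = c * S v w"
      by (rule LIMSEQ_unique[OF S[of "c *\<^sub>R v" w]], unfold ap(2)) (intro tendsto_mult_left S)
    show "S v w = S w v" unfolding S_def by (simp add: ap(3)[of _ v w])
    show "S v v \<ge> 0" using S[of v v] by (rule LIMSEQ_le_const) (use ap(4) in auto)
    show "\<bar>S v w\<bar> \<le> M0 * norm v * norm w"
      using tendsto_rabs[OF S[of v w]] by (rule LIMSEQ_le_const2) (use ap(5) in auto)
    have "(\<lambda>n. \<Sum>k<N. avg (R n) (unitv k) (unitv k)) \<longlonglongrightarrow> (\<Sum>k<N. S (unitv k) (unitv k))"
      by (intro tendsto_sum S)
    then show "(\<Sum>k<N. S (unitv k) (unitv k)) \<le> M0" by (rule LIMSEQ_le_const2) (use ap(6) in auto)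
  qed
  interpret tr: trace_form S M0 by (rule tf)
  have S_A: "S (Bo (A x)) (Bo y) = S (Bo x) (Bo (A y))" if xy: "x \<in> H" "y \<in> H" for x y
  proof -
    define c where "c = 4 * (M0 * norm (Bo x) * norm (Bo y)) / \<bar>a\<bar>"
    have "\<bar>avg (R n) (Bo x) (Bo (A y)) - avg (R n) (Bo (A x)) (Bo y)\<bar> \<le> c * (1 / real (Suc n))" for n
    proof -
      have "real (Suc n) \<le> R n" using T(1)[of "r n"] seq_suble[OF r, of n] by (simp add: R_def)
      then have "1 / R n \<le> 1 / real (Suc n)" by (intro divide_left_mono) (auto intro: R0)
      then have "c * (1 / R n) \<le> c * (1 / real (Suc n))"
        using M0_nonneg by (intro mult_left_mono) (auto simp: c_def)
      then show ?thesis using avg_commute[OF R0 xy, of n] by (simp add: c_def)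
    qed
    note le = this
    have "(\<lambda>n. c * (1 / real (Suc n))) \<longlonglongrightarrow> c * 0"
      by (intro tendsto_mult_left LIMSEQ_Suc[OF lim_1_over_n])
    from LIMSEQ_le[OF tendsto_rabs[OF tendsto_diff[OF S S]] this] le
    have "\<bar>S (Bo x) (Bo (A y)) - S (Bo (A x)) (Bo y)\<bar> \<le> c * 0" by blast
    then show ?thesis by simp
  qed
  have ek: "S (unitv k) (unitv k) \<ge> e"
    using S[of "unitv k" "unitv k"] by (rule LIMSEQ_le_const) (use T(2) in \<open>auto simp: R_def\<close>)
  \<comment> \<open>The limit form is nonzero at e_k, but the eigenvector lemma asks for an element
    of H seen through the energy operator. The Riesz vector h of S (e_k, .) serves: S annihilates N,
    so h lies in H, and if S (B h, B h) = 0 then the energy of h vanishes, hence h = 0.\<close>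
  obtain h where h: "\<And>w. S (unitv k) w = inner h w" using tr.S_riesz by blast
  have hH: "h \<in> H"
  proof -
    have "S (unitv k) n = 0" if "n \<in> N" for n
    proof -
      have "avg (R i) (unitv k) n = 0" for i
      proof -
        have "inner n (P t) = 0 \<and> inner n (Q t) = 0" if "t \<in> {0..R i}" for t
          using P_H[of t] Q_H[of t] that \<open>n \<in> N\<close> by (auto simp: H_def)
        then have "integral {0..R i} (\<lambda>t. inner (unitv k) (P t) * inner n (P t) + inner (unitv k) (Q t) * inner n (Q t))
          = integral {0..R i} (\<lambda>t. 0)" by (intro integral_cong) simp
        then show ?thesis by (simp add: avg_def)
      qed
      then show ?thesis using S[of "unitv k" n] by (simp add: LIMSEQ_const_iff)
    qed
    then show ?thesis using h by (simp add: H_def inner_commute)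
  qed
  have "S (Bo h) (Bo h) > 0"
  proof (rule ccontr)
    assume "\<not> ?thesis"
    then have "S (Bo h) (Bo h) = 0" using tr.S_nonneg[of "Bo h"] by simp
    then have "S (Bo h) (unitv k) = 0"
      by (rule null_vector_of_nonneg_form[of S, OF tr.S_add tr.S_scale tr.S_sym tr.S_nonneg])
    then have "inner h (Bo h) = 0" using h[of "Bo h"] by (simp add: tr.S_sym[of "Bo h"])
    then have "h = 0" using b_zero[OF hH] by (simp add: b_def inner_commute)
    then show False using h[of "unitv k"] ek e(1) by simp
  qed
  from invariant_form_has_eigenvector[OF tf S_A hH this]
  obtain x \<kappa> where "x \<in> H" "x \<noteq> 0" "A x = \<kappa> *\<^sub>R x" by blast
  with no_eigen[of x \<kappa>] show False by simp
qed

end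

section \<open>Fourier basis of the channel\<close>

lemma integral_Icc_FTC:
  fixes F f :: "real \<Rightarrow> real"
  assumes "a \<le> b" "\<And>x. (F has_real_derivative f x) (at x)" "continuous_on UNIV f"
  shows "(LINT x:{a..b}|lborel. f x) = F b - F a"
proof -
  have "(LINT x|lborel. f x * indicator {a..b} x) = F b - F a"
    using assms by (intro integral_FTC_Icc_real) (auto simp: continuous_on_eq_continuous_at)
  then show ?thesis by (simp add: set_lebesgue_integral_def mult.commute)
qed

lemma set_integrable_continuous: "continuous_on UNIV f \<Longrightarrow> set_integrable lborel {a..b::real} (f :: real \<Rightarrow> real)"
  by (rule borel_integrable_atLeastAtMost', erule continuous_on_subset) simp

definition cs :: "nat \<Rightarrow> real \<Rightarrow> real" where
  "cs n y = cos (real (Suc n) * (pi * (y + 1) / 2))"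

definition om :: "nat \<Rightarrow> real" where "om n = real (Suc n) * pi / 2"

lemma om_pos: "om n > 0" by (simp add: om_def)

lemma om_inj: "om n = om m \<longleftrightarrow> n = m" by (simp add: om_def)

lemma sn_cs_continuous: "continuous_on UNIV (sn n)" "continuous_on UNIV (cs n)"
  unfolding sn_def[abs_def] cs_def[abs_def] by (auto intro!: continuous_intros)

lemma sn_cs_bound: "\<bar>sn n y\<bar> \<le> 1" "\<bar>cs n y\<bar> \<le> 1"
  by (auto simp: sn_def cs_def)

lemma sn_deriv: "(sn n has_real_derivative om n * cs n y) (at y)"
  unfolding sn_def[abs_def] cs_def om_def by (auto intro!: derivative_eq_intros)

lemma cs_deriv: "(cs n has_real_derivative - (om n * sn n y)) (at y)"
  unfolding cs_def[abs_def] sn_def om_def by (auto intro!: derivative_eq_intros)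

lemma sn_boundary: "sn n (-1) = 0" "sn n 1 = 0"
  using sin_npi[of "Suc n"] by (simp_all add: sn_def)

lemma sn_cs_sq: "(sn n y)\<^sup>2 + (cs n y)\<^sup>2 = 1"
  by (simp add: sn_def cs_def)

lemma sn_orthonormal: "(LINT y:{-1..1}|lborel. sn n y * sn m y) = (if n = m then 1 else 0)"
  and cs_orthonormal: "(LINT y:{-1..1}|lborel. cs n y * cs m y) = (if n = m then 1 else 0)"
proof -
  note c = sn_cs_continuous
  have 1: "(LINT y:{-1..1}|lborel. ((om m)\<^sup>2 - (om n)\<^sup>2) * (sn n y * sn m y)) = 0"
  proof -
    have "(LINT y:{-1..1}|lborel. ((om m)\<^sup>2 - (om n)\<^sup>2) * (sn n y * sn m y))
      = (om n * (cs n 1 * sn m 1) - om m * (sn n 1 * cs m 1)) - (om n * (cs n (-1) * sn m (-1)) - om m * (sn n (-1) * cs m (-1)))"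
      by (rule integral_Icc_FTC) (auto intro!: continuous_intros c derivative_eq_intros sn_deriv cs_deriv
          simp: power2_eq_square algebra_simps)
    then show ?thesis by (simp add: sn_boundary)
  qed
  have 2: "(LINT y:{-1..1}|lborel. ((om m)\<^sup>2 - (om n)\<^sup>2) * (cs n y * cs m y)) = 0"
  proof -
    have "(LINT y:{-1..1}|lborel. ((om m)\<^sup>2 - (om n)\<^sup>2) * (cs n y * cs m y))
      = (- om n * (sn n 1 * cs m 1) + om m * (cs n 1 * sn m 1)) - (- om n * (sn n (-1) * cs m (-1)) + om m * (cs n (-1) * sn m (-1)))"
      by (rule integral_Icc_FTC) (auto intro!: continuous_intros c derivative_eq_intros sn_deriv cs_deriv
          simp: power2_eq_square algebra_simps)
    then show ?thesis by (simp add: sn_boundary)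
  qed
  \<comment> \<open>The difference of the squares is an exact derivative with zero boundary values
    and the sum is 1, so both squares integrate to half the length of the interval.\<close>
  have 3: "(LINT y:{-1..1}|lborel. (cs n y * cs n y) - (sn n y * sn n y)) = 0"
  proof -
    have "(LINT y:{-1..1}|lborel. (cs n y * cs n y) - (sn n y * sn n y))
      = sn n 1 * cs n 1 / om n - sn n (-1) * cs n (-1) / om n"
      using om_pos[of n] by (intro integral_Icc_FTC)
        (auto intro!: continuous_intros c derivative_eq_intros sn_deriv cs_deriv simp: field_simps)
    then show ?thesis by (simp add: sn_boundary)
  qed
  have 4: "(LINT y:{-1..1}|lborel. (cs n y * cs n y) + (sn n y * sn n y)) = 2"
    using sn_cs_sq[of n] by (simp add: power2_eq_square[symmetric] add.commute set_lebesgue_integral_def)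
  have i: "set_integrable lborel {-1..1} (\<lambda>y. cs n y * cs n y)" "set_integrable lborel {-1..1} (\<lambda>y. sn n y * sn n y)"
    by (intro set_integrable_continuous continuous_intros c)+
  have nn: "(om m)\<^sup>2 - (om n)\<^sup>2 \<noteq> 0" if "n \<noteq> m"
    using that om_inj[of m n] om_pos[of n] om_pos[of m] by (auto simp: power2_eq_iff)
  show "(LINT y:{-1..1}|lborel. sn n y * sn m y) = (if n = m then 1 else 0)"
    using 1 nn 3 4 i by (cases "n = m") (auto simp: set_integral_add set_integral_diff)
  show "(LINT y:{-1..1}|lborel. cs n y * cs m y) = (if n = m then 1 else 0)"
    using 2 nn 3 4 i by (cases "n = m") (auto simp: set_integral_add set_integral_diff)
qed

section \<open>The periodic channel for a fixed wave number\<close>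

locale wave =
  fixes \<alpha> :: real
  assumes alpha: "\<alpha> > 0"
begin

definition p :: real where "p = 2 * pi / \<alpha>"

lemma p_pos: "p > 0" using alpha by (simp add: p_def)

text \<open>The real orthonormal basis of the circle, with cosines at l > 0 and sines at l < 0. This
  sign convention makes the derivative of \<open>tr l\<close> equal to - alpha l times
  \<open>tr (- l)\<close> for every l.\<close>

definition tr :: "int \<Rightarrow> real \<Rightarrow> real" where
  "tr l x = (if l = 0 then sqrt (\<alpha> / (2 * pi)) else
     sqrt (\<alpha> / pi) * (if l > 0 then cos (\<alpha> * real_of_int l * x) else sin (\<alpha> * real_of_int (- l) * x)))"

lemma tr_continuous: "continuous_on UNIV (tr l)"
  unfolding tr_def[abs_def] by (cases "l = 0"; cases "l > 0") (auto intro!: continuous_intros)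

lemma tr_deriv: "(tr l has_real_derivative - (\<alpha> * l) * tr (- l) x) (at x)"
proof -
  consider "l = 0" | "l > 0" | "l < 0" by linarith
  then show ?thesis
  proof cases
    case 1
    then show ?thesis by (simp add: tr_def[abs_def])
  next
    case 2
    then have t: "tr l = (\<lambda>x. sqrt (\<alpha> / pi) * cos (\<alpha> * real_of_int l * x))" "tr (- l) x = sqrt (\<alpha> / pi) * sin (\<alpha> * real_of_int l * x)"
      by (auto simp: tr_def)
    show ?thesis unfolding t by (auto intro!: derivative_eq_intros)
  next
    case 3
    then have t: "tr l = (\<lambda>x. sqrt (\<alpha> / pi) * sin (\<alpha> * real_of_int (- l) * x))" "tr (- l) x = sqrt (\<alpha> / pi) * cos (\<alpha> * real_of_int (- l) * x)"
      by (auto simp: tr_def)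
    show ?thesis unfolding t by (auto intro!: derivative_eq_intros)
  qed
qed

lemma tr_periodic: "tr l (x + p) = tr l x"
proof -
  have "\<alpha> * real_of_int k * (x + p) = \<alpha> * real_of_int k * x + real_of_int k * (2 * pi)" for k
    using alpha by (simp add: p_def field_simps)
  moreover have "sin (t + real_of_int k * (2 * pi)) = sin t" "cos (t + real_of_int k * (2 * pi)) = cos t" for t k
    using sin_int_2pin[of k] cos_int_2pin[of k] by (simp_all add: sin_add cos_add mult.commute)
  ultimately show ?thesis by (simp only: tr_def)
qed

lemma tr_p: "tr l p = tr l 0"
  using tr_periodic[of l 0] by simp

lemma tr_sq: "l \<noteq> 0 \<Longrightarrow> tr l x * tr l x + tr (- l) x * tr (- l) x = \<alpha> / pi"
proof -
  have *: "sqrt (\<alpha> / pi) * c * (sqrt (\<alpha> / pi) * c) + sqrt (\<alpha> / pi) * s * (sqrt (\<alpha> / pi) * s) = \<alpha> / pi" if "s\<^sup>2 + c\<^sup>2 = 1" for s c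
  proof -
    have "sqrt (\<alpha> / pi) * c * (sqrt (\<alpha> / pi) * c) + sqrt (\<alpha> / pi) * s * (sqrt (\<alpha> / pi) * s) = (sqrt (\<alpha> / pi))\<^sup>2 * (s\<^sup>2 + c\<^sup>2)"
      by (simp add: power2_eq_square algebra_simps)
    then show ?thesis using alpha that by simp
  qed
  show "l \<noteq> 0 \<Longrightarrow> ?thesis"
    using *[OF sin_cos_squared_add] *[OF sin_cos_squared_add2] by (cases "l > 0") (auto simp: tr_def)
qed

lemma tr_orthonormal: "(LINT x:{0..p}|lborel. tr l x * tr k x) = (if l = k then 1 else 0)"
proof -
  note c = tr_continuous
  have i: "set_integrable lborel {0..p} (\<lambda>x. tr l x * tr k x)" for l k
    by (intro set_integrable_continuous continuous_intros c)
  have 1: "(LINT x:{0..p}|lborel. ((\<alpha> * k)\<^sup>2 - (\<alpha> * l)\<^sup>2) * (tr l x * tr k x)) = 0"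
  proof -
    define G where "G x = - (\<alpha> * l) * (tr (- l) x * tr k x) + (\<alpha> * k) * (tr l x * tr (- k) x)" for x
    have "(LINT x:{0..p}|lborel. ((\<alpha> * k)\<^sup>2 - (\<alpha> * l)\<^sup>2) * (tr l x * tr k x)) = G p - G 0"
      unfolding G_def using p_pos by (intro integral_Icc_FTC)
        (auto intro!: continuous_intros c derivative_eq_intros tr_deriv simp: power2_eq_square algebra_simps)
    then show ?thesis by (simp add: G_def tr_p)
  qed
  have 2: "(LINT x:{0..p}|lborel. (- 2 * (\<alpha> * l)) * (tr l x * tr (- l) x)) = 0"
  proof -
    have "(LINT x:{0..p}|lborel. (- 2 * (\<alpha> * l)) * (tr l x * tr (- l) x)) = tr l p * tr l p - tr l 0 * tr l 0"
      using p_pos by (intro integral_Icc_FTC)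
        (auto intro!: continuous_intros c derivative_eq_intros tr_deriv simp: algebra_simps)
    then show ?thesis by (simp add: tr_p)
  qed
  have 3: "(LINT x:{0..p}|lborel. (\<alpha> * l) * (tr l x * tr l x - tr (- l) x * tr (- l) x)) = 0"
  proof -
    have "(LINT x:{0..p}|lborel. (\<alpha> * l) * (tr l x * tr l x - tr (- l) x * tr (- l) x)) = tr l p * tr (- l) p - tr l 0 * tr (- l) 0"
      using p_pos by (intro integral_Icc_FTC)
        (auto intro!: continuous_intros c derivative_eq_intros tr_deriv simp: algebra_simps)
    then show ?thesis by (simp add: tr_p)
  qed
  have 4: "(LINT x:{0..p}|lborel. tr l x * tr l x + tr (- l) x * tr (- l) x) = 2" if "l \<noteq> 0"
    using tr_sq[OF that] alpha p_pos by (simp add: set_lebesgue_integral_def p_def)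
  show ?thesis
  proof (cases "l = k")
    case True
    show ?thesis
    proof (cases "l = 0")
      case True
      then show ?thesis using \<open>l = k\<close> alpha p_pos by (simp add: tr_def set_lebesgue_integral_def p_def)
    next
      case False
      then have "(LINT x:{0..p}|lborel. tr l x * tr l x - tr (- l) x * tr (- l) x) = 0" using 3 alpha by simp
      then show ?thesis using 4[OF False] True i by (simp add: set_integral_add set_integral_diff)
    qed
  next
    case False
    show ?thesis
    proof (cases "k = - l")
      case True
      then have "l \<noteq> 0" using False by simp
      have "(- 2 * (\<alpha> * l)) * (LINT x:{0..p}|lborel. tr l x * tr (- l) x) = 0"
        using 2 by (simp only: set_integral_mult_right)
      then show ?thesis using True False alpha \<open>l \<noteq> 0\<close> by simp
    next
      case k: False
      have "(\<alpha> * k)\<^sup>2 - (\<alpha> * l)\<^sup>2 \<noteq> 0"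
      proof
        assume "(\<alpha> * k)\<^sup>2 - (\<alpha> * l)\<^sup>2 = 0"
        then have "(real_of_int k)\<^sup>2 = (real_of_int l)\<^sup>2" using alpha by (simp add: power_mult_distrib)
        then have "k = l \<or> k = - l" by (auto simp: power2_eq_iff)
        then show False using False k by auto
      qed
      then show ?thesis using 1 False by simp
    qed
  qed
qed

definition M :: "(real \<times> real) measure" where "M = restrict_space lborel (Omega p)"

lemma Omega_sets: "Omega q \<in> sets lborel"
proof -
  have "closed (Omega q)" unfolding Omega_def by (intro closed_Times closed_atLeastAtMost)
  then show ?thesis by simp
qed

lemma space_M: "space M = Omega p" by (simp add: M_def space_restrict_space)

lemma emeasure_Omega: "emeasure lborel (Omega p) < \<infinity>"
proof -
  have "bounded (Omega p)" unfolding Omega_def by (intro bounded_Times bounded_closed_interval)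
  then show ?thesis by (rule emeasure_bounded_finite)
qed

lemma finite_M: "finite_measure M"
  using emeasure_Omega Omega_sets[of p]
  by (intro finite_measureI) (simp add: M_def space_restrict_space emeasure_restrict_space)

lemma integral_M: "(LINT z:Omega p|lborel. f z) = integral\<^sup>L M (f :: _ \<Rightarrow> 'b::{banach,second_countable_topology})"
  unfolding M_def set_lebesgue_integral_def using Omega_sets by (subst integral_restrict_space) auto

lemma integrable_M: "integrable M f \<longleftrightarrow> integrable lborel (\<lambda>z. indicator (Omega p) z *\<^sub>R (f z :: 'b::{banach,second_countable_topology}))"
  unfolding M_def using Omega_sets by (subst integrable_restrict_space) auto

lemma measurable_M: "f \<in> borel_measurable M \<longleftrightarrow> (\<lambda>z. indicator (Omega p) z *\<^sub>R (f z :: 'b::{banach,second_countable_topology})) \<in> borel_measurable lborel"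
  unfolding M_def using Omega_sets by (subst borel_measurable_restrict_space_iff) auto

lemma AE_M: "(AE z in M. P z) \<longleftrightarrow> (AE z in lborel. z \<in> Omega p \<longrightarrow> P z)"
  unfolding M_def using Omega_sets by (subst AE_restrict_space_iff) auto

lemma in_L2_iff: "in_L2 p f \<longleftrightarrow> L2 M f"
  unfolding in_L2_def L2_def set_borel_measurable_def set_integrable_def measurable_M integrable_M
  by simp

lemma ip_eq: "ip p f g = ips M f g"
  unfolding ip_def ips_def integral_M ..

lemma continuous_L2:
  assumes "continuous_on UNIV (f :: real \<times> real \<Rightarrow> real)"
  shows "L2 M f" "\<exists>C. \<forall>z\<in>Omega p. \<bar>f z\<bar> \<le> C"
proof -
  interpret finite_measure M by (rule finite_M)
  have "compact (Omega p)" unfolding Omega_def by (intro compact_Times compact_Icc)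
  then have "compact (f ` Omega p)" by (intro compact_continuous_image continuous_on_subset[OF assms]) auto
  then obtain C where C: "\<forall>z\<in>Omega p. \<bar>f z\<bar> \<le> C" by (auto dest!: compact_imp_bounded simp: bounded_iff)
  then show "\<exists>C. \<forall>z\<in>Omega p. \<bar>f z\<bar> \<le> C" by blast
  have "f \<in> borel_measurable M"
    unfolding M_def by (intro measurable_restrict_space1) (use borel_measurable_continuous_onI[OF assms] in simp)
  moreover have "L2 M (\<lambda>_. 1)" by (simp add: L2_def)
  ultimately have "L2 M (\<lambda>x. f x * 1)" using C by (intro L2_bounded_mult) (auto simp: space_M)
  then show "L2 M f" by simp
qed

lemma L2_continuous_mult:
  assumes "continuous_on UNIV (f :: real \<times> real \<Rightarrow> real)" "L2 M g"
  shows "L2 M (\<lambda>z. f z * g z)"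
  using continuous_L2[OF assms(1)] L2_bounded_mult[OF assms(2), of f] by (auto simp: L2_def space_M)

lemma integrable_indicator_of_M:
  "integrable M f \<Longrightarrow> integrable (lborel \<Otimes>\<^sub>M lborel) (\<lambda>z. indicator (Omega p) z * (f z :: real))"
  unfolding integrable_M by (simp add: lborel_prod)

lemma fubini_xy:
  assumes f: "integrable M (f :: _ \<Rightarrow> real)"
  shows "integral\<^sup>L M f = (LINT x|lborel. LINT y|lborel. indicator (Omega p) (x, y) * f (x, y))"
  unfolding integral_M[symmetric] set_lebesgue_integral_def
  using lborel_pair.integral_fst'[OF integrable_indicator_of_M[OF f]] by (simp add: lborel_prod)

lemma fubini_yx:
  assumes f: "integrable M (f :: _ \<Rightarrow> real)"
  shows "integral\<^sup>L M f = (LINT y|lborel. LINT x|lborel. indicator (Omega p) (x, y) * f (x, y))"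
proof -
  have "integrable (lborel \<Otimes>\<^sub>M lborel) (\<lambda>(x, y). indicator (Omega p) (x, y) * f (x, y))"
    using integrable_indicator_of_M[OF f] by (simp add: case_prod_unfold)
  from lborel_pair.integral_snd[OF this] show ?thesis
    unfolding integral_M[symmetric] set_lebesgue_integral_def by (simp add: lborel_prod case_prod_unfold)
qed

lemma indicator_Omega: "indicator (Omega p) (x, y) = (indicator {0..p} x * indicator {-1..1} y :: real)"
  by (auto simp: Omega_def indicator_def)

lemma fubini_continuous:
  assumes f: "continuous_on UNIV (f :: real \<times> real \<Rightarrow> real)"
  shows "integral\<^sup>L M f = (LINT x:{0..p}|lborel. LINT y:{-1..1}|lborel. f (x, y))"
    and "integral\<^sup>L M f = (LINT y:{-1..1}|lborel. LINT x:{0..p}|lborel. f (x, y))"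
proof -
  have "L2 M (\<lambda>_. 1)" by (intro continuous_L2 continuous_on_const)
  from L2_mult[OF continuous_L2(1)[OF f] this] have i: "integrable M f" by simp
  show "integral\<^sup>L M f = (LINT x:{0..p}|lborel. LINT y:{-1..1}|lborel. f (x, y))"
    unfolding fubini_xy[OF i] set_lebesgue_integral_def indicator_Omega
    by (simp add: mult.assoc)
  show "integral\<^sup>L M f = (LINT y:{-1..1}|lborel. LINT x:{0..p}|lborel. f (x, y))"
    unfolding fubini_yx[OF i] set_lebesgue_integral_def indicator_Omega
    by (simp add: mult.assoc mult.left_commute[of "indicator {0..p} _"])
qed

lemma integral_product:
  assumes f: "continuous_on UNIV f" and g: "continuous_on UNIV g"
  shows "integral\<^sup>L M (\<lambda>z. f (fst z) * g (snd z)) = (LINT x:{0..p}|lborel. f x) * (LINT y:{-1..1}|lborel. g y :: real)"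
proof -
  have "continuous_on UNIV (\<lambda>z::real \<times> real. f (fst z) * g (snd z))"
    by (intro continuous_intros continuous_on_compose2[OF f] continuous_on_compose2[OF g]) auto
  then show ?thesis
    by (subst fubini_continuous(1)) (simp_all add: set_lebesgue_integral_def)
qed

definition eb :: "int \<times> nat \<Rightarrow> real \<times> real \<Rightarrow> real" where
  "eb i z = tr (fst i) (fst z) * sn (snd i) (snd z)"

text \<open>The y-derivatives of the basis functions \<open>eb\<close> are multiples of these. They
  are orthonormal but not complete, since functions constant in y are missing.\<close>

definition ec :: "int \<times> nat \<Rightarrow> real \<times> real \<Rightarrow> real" where
  "ec i z = tr (fst i) (fst z) * cs (snd i) (snd z)"

lemma eb_continuous: "continuous_on UNIV (eb i)" and ec_continuous: "continuous_on UNIV (ec i)"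
  unfolding eb_def[abs_def] ec_def[abs_def]
  by (intro continuous_intros continuous_on_compose2[OF tr_continuous] continuous_on_compose2[OF sn_cs_continuous(1)]
     continuous_on_compose2[OF sn_cs_continuous(2)]; simp)+

lemma eb_L2: "L2 M (eb i)" and ec_L2: "L2 M (ec i)"
  by (intro continuous_L2 eb_continuous ec_continuous)+

lemma eb_orthonormal: "ips M (eb i) (eb j) = (if i = j then 1 else 0)"
  and ec_orthonormal: "ips M (ec i) (ec j) = (if i = j then 1 else 0)"
proof -
  have "ips M (eb i) (eb j) = integral\<^sup>L M (\<lambda>z. (tr (fst i) (fst z) * tr (fst j) (fst z)) * (sn (snd i) (snd z) * sn (snd j) (snd z)))"
    unfolding ips_def eb_def by (simp add: mult_ac)
  also have "\<dots> = (LINT x:{0..p}|lborel. tr (fst i) x * tr (fst j) x) * (LINT y:{-1..1}|lborel. sn (snd i) y * sn (snd j) y)"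
    by (rule integral_product) (intro continuous_intros tr_continuous sn_cs_continuous)+
  finally show "ips M (eb i) (eb j) = (if i = j then 1 else 0)"
    by (auto simp: tr_orthonormal sn_orthonormal prod_eq_iff)
  have "ips M (ec i) (ec j) = integral\<^sup>L M (\<lambda>z. (tr (fst i) (fst z) * tr (fst j) (fst z)) * (cs (snd i) (snd z) * cs (snd j) (snd z)))"
    unfolding ips_def ec_def by (simp add: mult_ac)
  also have "\<dots> = (LINT x:{0..p}|lborel. tr (fst i) x * tr (fst j) x) * (LINT y:{-1..1}|lborel. cs (snd i) y * cs (snd j) y)"
    by (rule integral_product) (intro continuous_intros tr_continuous sn_cs_continuous)+
  finally show "ips M (ec i) (ec j) = (if i = j then 1 else 0)"
    by (auto simp: tr_orthonormal cs_orthonormal prod_eq_iff)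
qed

lemma coeff_as_iterated:
  assumes f: "L2 M f"
  shows "ips M f (eb (l, n)) = (LINT x|lborel. (LINT y|lborel. indicator (Omega p) (x, y) * f (x, y) * sn n y) * tr l x)"
    and "ips M f (eb (l, n)) = (LINT y|lborel. (LINT x|lborel. indicator (Omega p) (x, y) * f (x, y) * tr l x) * sn n y)"
proof -
  note i = L2_mult[OF f eb_L2[of "(l, n)"]]
  show "ips M f (eb (l, n)) = (LINT x|lborel. (LINT y|lborel. indicator (Omega p) (x, y) * f (x, y) * sn n y) * tr l x)"
    unfolding ips_def fubini_xy[OF i] integral_mult_left_zero[symmetric] by (simp add: eb_def mult_ac)
  show "ips M f (eb (l, n)) = (LINT y|lborel. (LINT x|lborel. indicator (Omega p) (x, y) * f (x, y) * tr l x) * sn n y)"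
    unfolding ips_def fubini_yx[OF i] integral_mult_left_zero[symmetric] by (simp add: eb_def mult_ac)
qed

lemma L2_integrable: "L2 M f \<Longrightarrow> integrable M f"
  using L2_mult[of M f "\<lambda>_. 1"] continuous_L2(1)[OF continuous_on_const[of UNIV 1]] by simp

text \<open>For fixed n, the n-th sine coefficient in y is a function of x with vanishing Fourier
  coefficients, hence zero almost everywhere. The countably many null sets can be united, and
  completeness of the sines applies on almost every slice.\<close>

lemma eb_complete:
  assumes f: "L2 M f" and zero: "\<And>i. ips M f (eb i) = 0"
  shows "AE z in M. f z = 0"
proof -
  define g where "g z = indicator (Omega p) z * f z" for z
  have g: "integrable (lborel \<Otimes>\<^sub>M lborel) g"
    unfolding g_def[abs_def] by (rule integrable_indicator_of_M[OF L2_integrable[OF f]])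
  have gm[measurable]: "g \<in> borel_measurable (lborel \<Otimes>\<^sub>M lborel)" using g by simp
  have supp: "g (x, y) = 0" if "x \<notin> {0..p} \<or> y \<notin> {-1..1}" for x y
    using that by (auto simp: g_def indicator_def Omega_def)
  define H where "H n x = (LINT y|lborel. g (x, y) * sn n y)" for n x
  have gs: "integrable (lborel \<Otimes>\<^sub>M lborel) (\<lambda>z. g z * sn n (snd z))" for n
  proof (rule Bochner_Integration.integrable_bound[OF g])
    have [measurable]: "sn n \<in> borel_measurable borel" using sn_cs_continuous(1) by (rule borel_measurable_continuous_onI)
    show "(\<lambda>z. g z * sn n (snd z)) \<in> borel_measurable (lborel \<Otimes>\<^sub>M lborel)" by measurable
    show "AE z in lborel \<Otimes>\<^sub>M lborel. norm (g z * sn n (snd z)) \<le> norm (g z)"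
      by (intro AE_I2) (auto simp: abs_mult sn_cs_bound intro!: mult_left_le)
  qed
  have H0: "AE x in lborel. H n x = 0" for n
  proof (rule fourier_complete[OF p_pos])
    show "integrable lborel (H n)" unfolding H_def[abs_def] using lborel_pair.integrable_fst'[OF gs[of n]] by simp
    show "H n x = 0" if "x \<notin> {0..p}" for x using supp[of x] that by (simp add: H_def)
    have z: "(LINT x|lborel. H n x * tr l x) = 0" for l
      using zero[of "(l, n)"] unfolding coeff_as_iterated(1)[OF f] by (simp add: H_def g_def)
    have ang: "real l * (2 * pi / p * x) = \<alpha> * real_of_int (int l) * x" for l :: nat and x
      using alpha by (simp add: p_def)
    have sq: "sqrt (\<alpha> / pi) \<noteq> 0" "sqrt (\<alpha> / (2 * pi)) \<noteq> 0" using alpha by auto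
    show "(LINT x|lborel. H n x * cos (real l * (2 * pi / p * x))) = 0" for l
    proof (cases "l = 0")
      case True
      have "(LINT x|lborel. H n x * sqrt (\<alpha> / (2 * pi))) = 0" using z[of 0] by (simp add: tr_def)
      then show ?thesis using True sq by simp
    next
      case False
      have "(LINT x|lborel. sqrt (\<alpha> / pi) * (H n x * cos (\<alpha> * real_of_int (int l) * x))) = 0"
        using z[of "int l"] False by (simp add: tr_def mult_ac)
      then show ?thesis unfolding ang using sq by simp
    qed
    show "(LINT x|lborel. H n x * sin (real l * (2 * pi / p * x))) = 0" for l
    proof (cases "l = 0")
      case False
      have "(LINT x|lborel. sqrt (\<alpha> / pi) * (H n x * sin (\<alpha> * real_of_int (int l) * x))) = 0"
        using z[of "- int l"] False by (simp add: tr_def mult_ac)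
      then show ?thesis unfolding ang using sq by simp
    qed simp
  qed
  have "AE x in lborel. \<forall>n. H n x = 0" using H0 by (simp add: AE_all_countable)
  moreover have "AE x in lborel. integrable lborel (\<lambda>y. g (x, y))" using lborel_pair.AE_integrable_fst'[OF g] .
  ultimately have "AE x in lborel. AE y in lborel. g (x, y) = 0"
  proof eventually_elim
    case (elim x)
    show ?case
      by (rule sine_complete) (use elim supp in \<open>auto simp: H_def\<close>)
  qed
  then have "AE z in lborel \<Otimes>\<^sub>M lborel. g z = 0"
  proof (rule lborel_pair.AE_pair_measure[rotated])
    show "{z \<in> space (lborel \<Otimes>\<^sub>M lborel). g z = 0} \<in> sets (lborel \<Otimes>\<^sub>M lborel)" by measurable
  qed
  then have "AE z in lborel. g z = 0" unfolding lborel_prod .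
  then show ?thesis unfolding AE_M by eventually_elim (auto simp: g_def)
qed

end

section \<open>Weak derivatives and the inverse Laplacian\<close>

text \<open>Unconditional sums allow the double index to be regrouped by rows and flipped by l -> -
  l.\<close>

lemma has_sum_of_sums_square_summable:
  fixes a b :: "nat \<Rightarrow> real"
  assumes "summable (\<lambda>n. (a n)\<^sup>2)" "summable (\<lambda>n. (b n)\<^sup>2)" "(\<lambda>n. a n * b n) sums s"
  shows "((\<lambda>n. a n * b n) has_sum s) UNIV"
proof (rule norm_summable_imp_has_sum)
  show "summable (\<lambda>n. norm (a n * b n))"
    using summable_mult_of_squares[of "\<lambda>n. \<bar>a n\<bar>" "\<lambda>n. \<bar>b n\<bar>"] assms by (simp add: abs_mult)
qed (rule assms)

context wave
begin

definition idx :: "nat \<Rightarrow> int \<times> nat" where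
  "idx n = (int_decode (fst (prod_decode n)), snd (prod_decode n))"

lemma bij_idx: "bij_betw idx UNIV UNIV"
proof -
  have "bij (map_prod int_decode (id :: nat \<Rightarrow> nat))"
    unfolding bij_def using bij_int_decode
    by (intro conjI prod.inj_map map_prod_surj inj_on_id surj_id) (simp_all add: bij_is_inj bij_is_surj)
  then have "bij (map_prod int_decode id \<circ> prod_decode)" by (intro bij_comp bij_prod_decode)
  moreover have "map_prod int_decode id \<circ> prod_decode = idx" by (auto simp: idx_def fun_eq_iff map_prod_def split: prod.split)
  ultimately show ?thesis by simp
qed

lemma idx_cases: obtains n where "i = idx n"
  using bij_is_surj[OF bij_idx] by (metis surjD)

lemma inj_idx: "idx i = idx j \<longleftrightarrow> i = j"
  using bij_idx by (auto simp: bij_betw_def inj_on_def)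

sublocale B: complete_orthonormal_seq M "\<lambda>n. eb (idx n)"
proof (intro complete_orthonormal_seq.intro orthonormal_seq.intro complete_orthonormal_seq_axioms.intro finite_M eb_L2)
  show "AE x in M. f x = 0" if "L2 M f" "\<And>i. ips M f (eb (idx i)) = 0" for f
  proof (rule eb_complete[OF that(1)])
    fix i
    obtain n where "i = idx n" by (rule idx_cases)
    then show "ips M f (eb i) = 0" using that(2) by simp
  qed
qed (simp add: eb_orthonormal inj_idx)

sublocale C: orthonormal_seq M "\<lambda>n. ec (idx n)"
  by (intro orthonormal_seq.intro finite_M ec_L2) (simp add: ec_orthonormal inj_idx)

definition co :: "(real \<times> real \<Rightarrow> real) \<Rightarrow> int \<times> nat \<Rightarrow> real" where
  "co f i = ips M f (eb i)"

lemma has_sum_idx: "((\<lambda>n. f (idx n)) has_sum s) UNIV \<longleftrightarrow> (f has_sum s) UNIV"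
  using has_sum_reindex_bij_betw[OF bij_idx] .

lemma summable_on_idx: "(\<lambda>n. f (idx n)) summable_on UNIV \<longleftrightarrow> f summable_on UNIV"
  using summable_on_reindex_bij_betw[OF bij_idx] .

lemma expansion:
  assumes "L2 M f" "L2 M g"
  shows "((\<lambda>i. co f i * co g i) has_sum ips M f g) UNIV"
proof -
  have "((\<lambda>n. co f (idx n) * co g (idx n)) has_sum ips M f g) UNIV"
    unfolding co_def
    by (rule has_sum_of_sums_square_summable[OF B.summable_coeffs[OF assms(1)] B.summable_coeffs[OF assms(2)] B.expansion[OF assms]])
  then show ?thesis by (rule has_sum_idx[THEN iffD1])
qed

lemma parseval: "L2 M f \<Longrightarrow> ((\<lambda>i. (co f i)\<^sup>2) has_sum ips M f f) UNIV"
  using expansion[of f f] by (simp add: power2_eq_square)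

lemma summable_on_nat_sq: "(\<lambda>i. (c i)\<^sup>2) summable_on UNIV \<longleftrightarrow> summable (\<lambda>n. (c (idx n))\<^sup>2 :: real)"
  using summable_on_idx[of "\<lambda>i. (c i)\<^sup>2"] summable_on_UNIV_nonneg_real_iff[of "\<lambda>n. (c (idx n))\<^sup>2"] by simp

lemma exists_with_coeffs:
  assumes "(\<lambda>i. (c i)\<^sup>2) summable_on UNIV"
  obtains f where "L2 M f" "\<And>i. co f i = c i"
proof -
  obtain f where f: "L2 M f" "\<And>n. ips M f (eb (idx n)) = c (idx n)"
    by (rule B.riesz_fischer[OF assms[unfolded summable_on_nat_sq]]) blast
  have "co f i = c i" for i
  proof -
    obtain n where "i = idx n" by (rule idx_cases)
    then show ?thesis using f(2) by (simp add: co_def)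
  qed
  with f(1) that show thesis by blast
qed

text \<open>Since the \<open>ec\<close> system is incomplete, its coefficients alone do not
  determine a function; the pairing with every h identifies the sum of the series.\<close>

lemma exists_cosine_series:
  assumes c: "(\<lambda>i. (c i)\<^sup>2) summable_on UNIV"
  obtains g where "L2 M g" "((\<lambda>i. (c i)\<^sup>2) has_sum ips M g g) UNIV"
    "\<And>h. L2 M h \<Longrightarrow> ((\<lambda>i. c i * ips M (ec i) h) has_sum ips M g h) UNIV"
proof -
  have c': "summable (\<lambda>n. (c (idx n))\<^sup>2)" using c by (simp add: summable_on_nat_sq)
  obtain g where g: "L2 M g" "\<And>h. L2 M h \<Longrightarrow> (\<lambda>n. ips M (C.psum (\<lambda>n. c (idx n)) n) h) \<longlonglongrightarrow> ips M g h"
    "ips M g g = (\<Sum>n. (c (idx n))\<^sup>2)"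
    by (rule C.riesz_fischer[OF c']) blast
  show thesis
  proof (rule that[OF g(1)])
    have "(\<lambda>n. c (idx n) * c (idx n)) sums ips M g g"
      using summable_sums[OF c'] g(3) by (simp add: power2_eq_square)
    then show "((\<lambda>i. (c i)\<^sup>2) has_sum ips M g g) UNIV"
      using has_sum_of_sums_square_summable[OF c' c'] has_sum_idx[of "\<lambda>i. (c i)\<^sup>2"] by (simp add: power2_eq_square)
    fix h assume h: "L2 M h"
    have "(\<lambda>n. c (idx n) * ips M (ec (idx n)) h) sums ips M g h"
      using g(2)[OF h] by (simp add: sums_def C.ips_psum[OF h])
    moreover have "summable (\<lambda>n. (ips M (ec (idx n)) h)\<^sup>2)"
      using C.summable_coeffs[OF h] by (simp add: ips_commute)
    ultimately have "((\<lambda>n. c (idx n) * ips M (ec (idx n)) h) has_sum ips M g h) UNIV"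
      by (intro has_sum_of_sums_square_summable[OF c'])
    then show "((\<lambda>i. c i * ips M (ec i) h) has_sum ips M g h) UNIV" by (rule has_sum_idx[THEN iffD1])
  qed
qed

lemma eq_of_coeffs:
  assumes "L2 M f" "L2 M g" "\<And>i. co f i = co g i"
  shows "AE x in M. f x = g x"
  using B.eq_of_coeffs[OF assms(1,2)] assms(3) by (simp add: co_def)

lemma pxI:
  assumes "\<And>x y. ((\<lambda>s. f (s, y)) has_real_derivative f' (x, y)) (at x)"
  shows "px f = f'"
  using DERIV_imp_deriv[OF assms] by (auto simp: px_def)

lemma pyI:
  assumes "\<And>x y. ((\<lambda>s. f (x, s)) has_real_derivative f' (x, y)) (at y)"
  shows "py f = f'"
  using DERIV_imp_deriv[OF assms] by (auto simp: py_def)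

lemma eb_dx: "((\<lambda>s. eb (l, n) (s, y)) has_real_derivative - (\<alpha> * l) * eb (- l, n) (x, y)) (at x)"
  and ec_dx: "((\<lambda>s. ec (l, n) (s, y)) has_real_derivative - (\<alpha> * l) * ec (- l, n) (x, y)) (at x)"
  and eb_dy: "((\<lambda>s. eb (l, n) (x, s)) has_real_derivative om n * ec (l, n) (x, y)) (at y)"
  and ec_dy: "((\<lambda>s. ec (l, n) (x, s)) has_real_derivative - om n * eb (l, n) (x, y)) (at y)"
  unfolding eb_def ec_def by (auto intro!: derivative_eq_intros tr_deriv sn_deriv cs_deriv)

lemma px_eb: "px (eb (l, n)) = (\<lambda>z. - (\<alpha> * l) * eb (- l, n) z)"
  and py_eb: "py (eb (l, n)) = (\<lambda>z. om n * ec (l, n) z)"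
  and px_scaled_eb: "px (\<lambda>z. c * eb (l, n) z) = (\<lambda>z. c * (- (\<alpha> * l) * eb (- l, n) z))"
  and py_scaled_eb: "py (\<lambda>z. c * eb (l, n) z) = (\<lambda>z. c * (om n * ec (l, n) z))"
  and px_scaled_ec: "px (\<lambda>z. c * ec (l, n) z) = (\<lambda>z. c * (- (\<alpha> * l) * ec (- l, n) z))"
  and py_scaled_ec: "py (\<lambda>z. c * ec (l, n) z) = (\<lambda>z. c * (- om n * eb (l, n) z))"
  by (rule pxI pyI; intro DERIV_cmult eb_dx eb_dy ec_dx ec_dy)+

lemma scaled_differentiable:
  "(\<lambda>s. c * eb (l, n) (s, y)) differentiable (at x)" "(\<lambda>s. c * eb (l, n) (x, s)) differentiable (at y)"
  "(\<lambda>s. c * ec (l, n) (s, y)) differentiable (at x)" "(\<lambda>s. c * ec (l, n) (x, s)) differentiable (at y)"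
  by (rule differentiableI, rule DERIV_cmult[unfolded has_field_derivative_def],
      rule eb_dx[unfolded has_field_derivative_def] eb_dy[unfolded has_field_derivative_def]
        ec_dx[unfolded has_field_derivative_def] ec_dy[unfolded has_field_derivative_def])+

definition m :: "int \<times> nat \<Rightarrow> real" where "m i = mm (\<alpha> * real_of_int (fst i)) (snd i)"

lemma m_eq: "m (l, n) = (\<alpha> * l)\<^sup>2 + (om n)\<^sup>2"
  by (simp add: m_def mm_def om_def power_mult_distrib power_divide)

lemma m_pos: "m i > 0" by (simp add: m_def mm_pos)

lemma m_ge: "m i \<ge> pi\<^sup>2 / 4"
proof -
  have "1 * pi\<^sup>2 \<le> (real (Suc n))\<^sup>2 * pi\<^sup>2" for n by (intro mult_right_mono) auto
  then show ?thesis by (simp add: m_def mm_def add_increasing)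
qed

lemma lap_eb: "lap (eb i) = (\<lambda>z. - (m i * eb i z))"
proof -
  obtain l n where i: "i = (l, n)" by (cases i)
  show ?thesis unfolding i lap_def px_eb py_eb px_scaled_eb py_scaled_ec
    by (simp add: m_eq fun_eq_iff power2_eq_square algebra_simps)
qed

text \<open>The basis functions are themselves admissible test functions, so every weak identity can
  be read off coefficient by coefficient.\<close>

lemma test0_eb: "test0 p (eb i)"
proof -
  obtain l n where i: "i = (l, n)" by (cases i)
  have d: "(\<lambda>s. eb (l, n) (s, y)) differentiable (at x)" "(\<lambda>s. eb (l, n) (x, s)) differentiable (at y)" for x y
    using scaled_differentiable[of 1] by simp_all
  have diff: "\<forall>g\<in>{eb (l, n), px (eb (l, n)), py (eb (l, n))}. \<forall>x y. (\<lambda>s. g (s, y)) differentiable (at x) \<and>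
      (\<lambda>s. g (x, s)) differentiable (at y)"
  proof (intro ballI allI)
    fix g x y assume "g \<in> {eb (l, n), px (eb (l, n)), py (eb (l, n))}"
    then consider "g = eb (l, n)" | "g = (\<lambda>z. - (\<alpha> * l) * eb (- l, n) z)" | "g = (\<lambda>z. om n * ec (l, n) z)"
      unfolding px_eb py_eb by blast
    then show "(\<lambda>s. g (s, y)) differentiable (at x) \<and> (\<lambda>s. g (x, s)) differentiable (at y)"
      by cases (simp_all only: d scaled_differentiable simp_thms)
  qed
  have "C2 (eb (l, n))"
    unfolding C2_def
    by (rule conjI[OF eb_continuous conjI[OF diff]],
        unfold px_eb py_eb px_scaled_eb py_scaled_eb px_scaled_ec py_scaled_ec)
      (auto intro!: continuous_intros eb_continuous ec_continuous)
  moreover have "eb (l, n) (x + p, y) = eb (l, n) (x, y)" for x y by (simp add: eb_def tr_periodic)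
  moreover have "eb (l, n) (x, -1) = 0" "eb (l, n) (x, 1) = 0" for x by (simp_all add: eb_def sn_boundary)
  ultimately show ?thesis by (simp add: i test0_def test_def)
qed

lemma test_eb: "test p (eb i)" using test0_eb by (simp add: test0_def)

lemma ibp_x:
  assumes u: "continuous_on UNIV u" "continuous_on UNIV u'" "\<And>x y. ((\<lambda>s. u (s, y)) has_real_derivative u' (x, y)) (at x)"
    and v: "continuous_on UNIV v" "continuous_on UNIV v'" "\<And>x y. ((\<lambda>s. v (s, y)) has_real_derivative v' (x, y)) (at x)"
    and bd: "\<And>y. u (p, y) * v (p, y) = u (0, y) * v (0, y)"
  shows "ips M u' v = - ips M u v'"
proof -
  have "ips M u' v + ips M u v' = integral\<^sup>L M (\<lambda>z. u' z * v z + u z * v' z)"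
    unfolding ips_def using u v by (intro Bochner_Integration.integral_add[symmetric] L2_mult continuous_L2)
  also have "\<dots> = (LINT y:{-1..1}|lborel. LINT x:{0..p}|lborel. u' (x, y) * v (x, y) + u (x, y) * v' (x, y))"
    by (rule fubini_continuous(2)) (intro continuous_intros u v)
  also have "\<dots> = (LINT y:{-1..1}|lborel. u (p, y) * v (p, y) - u (0, y) * v (0, y))"
  proof -
    have "(LINT x:{0..p}|lborel. u' (x, y) * v (x, y) + u (x, y) * v' (x, y)) = u (p, y) * v (p, y) - u (0, y) * v (0, y)" for y
    proof (rule integral_Icc_FTC)
      show "((\<lambda>s. u (s, y) * v (s, y)) has_real_derivative u' (x, y) * v (x, y) + u (x, y) * v' (x, y)) (at x)" for x
        using DERIV_mult[OF u(3) v(3)] by (simp add: algebra_simps)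
      show "continuous_on UNIV (\<lambda>x. u' (x, y) * v (x, y) + u (x, y) * v' (x, y))"
        by (intro continuous_intros continuous_on_compose2[OF u(1)] continuous_on_compose2[OF u(2)]
            continuous_on_compose2[OF v(1)] continuous_on_compose2[OF v(2)]) auto
    qed (use p_pos in simp)
    then show ?thesis by simp
  qed
  finally show ?thesis by (simp add: bd set_lebesgue_integral_def)
qed

lemma ibp_y:
  assumes u: "continuous_on UNIV u" "continuous_on UNIV u'" "\<And>x y. ((\<lambda>s. u (x, s)) has_real_derivative u' (x, y)) (at y)"
    and v: "continuous_on UNIV v" "continuous_on UNIV v'" "\<And>x y. ((\<lambda>s. v (x, s)) has_real_derivative v' (x, y)) (at y)"
    and bd: "\<And>x. u (x, 1) * v (x, 1) = 0" "\<And>x. u (x, -1) * v (x, -1) = 0"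
  shows "ips M u' v = - ips M u v'"
proof -
  have "ips M u' v + ips M u v' = integral\<^sup>L M (\<lambda>z. u' z * v z + u z * v' z)"
    unfolding ips_def using u v by (intro Bochner_Integration.integral_add[symmetric] L2_mult continuous_L2)
  also have "\<dots> = (LINT x:{0..p}|lborel. LINT y:{-1..1}|lborel. u' (x, y) * v (x, y) + u (x, y) * v' (x, y))"
    by (rule fubini_continuous(1)) (intro continuous_intros u v)
  also have "\<dots> = (LINT x:{0..p}|lborel. u (x, 1) * v (x, 1) - u (x, -1) * v (x, -1))"
  proof -
    have "(LINT y:{-1..1}|lborel. u' (x, y) * v (x, y) + u (x, y) * v' (x, y)) = u (x, 1) * v (x, 1) - u (x, -1) * v (x, -1)" for x
    proof (rule integral_Icc_FTC)
      show "((\<lambda>s. u (x, s) * v (x, s)) has_real_derivative u' (x, y) * v (x, y) + u (x, y) * v' (x, y)) (at y)" for y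
        using DERIV_mult[OF u(3) v(3)] by (simp add: algebra_simps)
      show "continuous_on UNIV (\<lambda>y. u' (x, y) * v (x, y) + u (x, y) * v' (x, y))"
        by (intro continuous_intros continuous_on_compose2[OF u(1)] continuous_on_compose2[OF u(2)]
            continuous_on_compose2[OF v(1)] continuous_on_compose2[OF v(2)]) auto
    qed simp
    then show ?thesis by simp
  qed
  finally show ?thesis by (simp add: bd set_lebesgue_integral_def)
qed

lemma C2_D:
  assumes "C2 f"
  shows "continuous_on UNIV f" "continuous_on UNIV (px f)" "continuous_on UNIV (py f)"
    "continuous_on UNIV (px (px f))" "continuous_on UNIV (py (py f))"
    "((\<lambda>s. f (s, y)) has_real_derivative px f (x, y)) (at x)"
    "((\<lambda>s. f (x, s)) has_real_derivative py f (x, y)) (at y)"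
    "((\<lambda>s. px f (s, y)) has_real_derivative px (px f) (x, y)) (at x)"
    "((\<lambda>s. py f (x, s)) has_real_derivative py (py f) (x, y)) (at y)"
proof -
  have D: "((\<lambda>s. g (s, y)) has_real_derivative px g (x, y)) (at x)" "((\<lambda>s. g (x, s)) has_real_derivative py g (x, y)) (at y)"
    if "g \<in> {f, px f, py f}" for g
    using assms that unfolding C2_def px_def py_def
    by (auto simp: DERIV_deriv_iff_real_differentiable)
  show "((\<lambda>s. f (s, y)) has_real_derivative px f (x, y)) (at x)" "((\<lambda>s. f (x, s)) has_real_derivative py f (x, y)) (at y)"
    "((\<lambda>s. px f (s, y)) has_real_derivative px (px f) (x, y)) (at x)"
    "((\<lambda>s. py f (x, s)) has_real_derivative py (py f) (x, y)) (at y)"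
    by (intro D; simp)+
qed (use assms in \<open>auto simp: C2_def\<close>)

lemma test_px_periodic:
  assumes "test p \<phi>"
  shows "px \<phi> (x + p, y) = px \<phi> (x, y)"
proof -
  have "((\<lambda>s. \<phi> (s, y)) has_real_derivative px \<phi> (x + p, y)) (at (x + p))"
    using assms by (intro C2_D) (simp add: test_def)
  then have "((\<lambda>s. \<phi> (s + p, y)) has_real_derivative px \<phi> (x + p, y)) (at x)" by (simp add: DERIV_shift)
  then have "((\<lambda>s. \<phi> (s, y)) has_real_derivative px \<phi> (x + p, y)) (at x)" using assms by (simp add: test_def)
  from DERIV_unique[OF this C2_D(6)] show ?thesis using assms by (simp add: test_def)
qed

lemma co_px:
  assumes "test p \<phi>"
  shows "co (px \<phi>) (l, n) = \<alpha> * l * co \<phi> (- l, n)"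
proof -
  have C: "C2 \<phi>" using assms by (simp add: test_def)
  have "ips M (px \<phi>) (eb (l, n)) = - ips M \<phi> (\<lambda>z. - (\<alpha> * l) * eb (- l, n) z)"
  proof (rule ibp_x)
    show "\<phi> (p, y) * eb (l, n) (p, y) = \<phi> (0, y) * eb (l, n) (0, y)" for y
      using assms tr_p[of l] unfolding test_def eb_def by (metis add_0 fst_conv snd_conv)
  qed (intro C2_D C eb_dx eb_continuous continuous_intros)+
  also have "ips M \<phi> (\<lambda>z. - (\<alpha> * l) * eb (- l, n) z) = - (\<alpha> * l) * ips M \<phi> (eb (- l, n))"
    unfolding ips_commute[of M \<phi>] ips_cmult ..
  finally show ?thesis by (simp add: co_def)
qed

lemma ips_cmult_right: "ips M f (\<lambda>z. c * g z) = c * ips M f g"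
  unfolding ips_commute[of M f] by (rule ips_cmult)

text \<open>In y the first boundary term vanishes through \<open>sn\<close>, the second through the
  Dirichlet condition on the test function; in x everything cancels by periodicity.\<close>

lemma green:
  assumes "test0 p \<phi>"
  shows "co (lap \<phi>) i = - (m i * co \<phi> i)" and "L2 M (lap \<phi>)"
proof -
  obtain l n where i: "i = (l, n)" by (cases i)
  have t: "test p \<phi>" and bd: "\<phi> (x, 1) = 0" "\<phi> (x, -1) = 0" for x using assms by (auto simp: test0_def)
  then have C: "C2 \<phi>" by (simp add: test_def)
  have "ips M (px (px \<phi>)) (eb (l, n)) = - ips M (px \<phi>) (\<lambda>z. - (\<alpha> * l) * eb (- l, n) z)"
  proof (rule ibp_x)
    show "px \<phi> (p, y) * eb (l, n) (p, y) = px \<phi> (0, y) * eb (l, n) (0, y)" for y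
      using test_px_periodic[OF t, of 0 y] tr_p[of l] by (simp add: eb_def)
  qed (intro C2_D C eb_dx eb_continuous continuous_intros)+
  also have "\<dots> = \<alpha> * l * co (px \<phi>) (- l, n)" by (simp only: ips_cmult_right co_def) simp
  also have "\<dots> = - (\<alpha> * l)\<^sup>2 * co \<phi> (l, n)" by (simp add: co_px[OF t] power2_eq_square)
  finally have xx: "co (px (px \<phi>)) (l, n) = - (\<alpha> * l)\<^sup>2 * co \<phi> (l, n)" by (simp add: co_def)
  have "ips M (py (py \<phi>)) (eb (l, n)) = - ips M (py \<phi>) (\<lambda>z. om n * ec (l, n) z)"
    by (rule ibp_y[OF C2_D(3)[OF C] C2_D(5)[OF C] C2_D(9)[OF C] eb_continuous _ eb_dy])
      (intro continuous_intros ec_continuous, simp_all add: eb_def sn_boundary)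
  also have "\<dots> = - om n * ips M (py \<phi>) (ec (l, n))" by (simp add: ips_cmult_right)
  also have "ips M (py \<phi>) (ec (l, n)) = - ips M \<phi> (\<lambda>z. - om n * eb (l, n) z)"
    by (rule ibp_y[OF C2_D(1)[OF C] C2_D(3)[OF C] C2_D(7)[OF C] ec_continuous _ ec_dy])
      (intro continuous_intros eb_continuous, simp_all add: bd)
  also have "\<dots> = om n * co \<phi> (l, n)" by (simp only: ips_cmult_right co_def)
  finally have yy: "co (py (py \<phi>)) (l, n) = - (om n)\<^sup>2 * co \<phi> (l, n)" by (simp add: co_def power2_eq_square)
  have L: "L2 M (px (px \<phi>))" "L2 M (py (py \<phi>))" by (intro continuous_L2 C2_D C)+
  show "L2 M (lap \<phi>)" unfolding lap_def[abs_def] by (intro L2_add L)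
  have "co (lap \<phi>) (l, n) = co (px (px \<phi>)) (l, n) + co (py (py \<phi>)) (l, n)"
    unfolding co_def lap_def[abs_def] by (intro ips_add L eb_L2)
  then show "co (lap \<phi>) i = - (m i * co \<phi> i)" by (simp add: i xx yy m_eq algebra_simps)
qed

lemma test_L2: "test p \<phi> \<Longrightarrow> L2 M \<phi>" "test p \<phi> \<Longrightarrow> L2 M (px \<phi>)" "test p \<phi> \<Longrightarrow> L2 M (py \<phi>)"
  by (intro continuous_L2 C2_D; simp add: test_def)+

text \<open>Testing with \<open>eb i\<close> gives the coefficient relation. Conversely,
  \<open>green\<close> moves the Laplacian onto the coefficients of the test function, and Parseval
  sums up.\<close>

lemma inv_lap_iff:
  assumes w: "L2 M \<omega>"
  shows "inv_lap p \<omega> \<psi> \<longleftrightarrow> L2 M \<psi> \<and> (\<forall>i. m i * co \<psi> i = co \<omega> i)"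
proof
  assume "inv_lap p \<omega> \<psi>"
  then have L: "L2 M \<psi>" and e: "\<And>\<phi>. test0 p \<phi> \<Longrightarrow> integral\<^sup>L M (\<lambda>z. - lap \<phi> z * \<psi> z) = integral\<^sup>L M (\<lambda>z. \<phi> z * \<omega> z)"
    by (simp_all add: inv_lap_def in_L2_iff integral_M)
  have "m i * co \<psi> i = co \<omega> i" for i
  proof -
    have "(\<lambda>z. - (- (m i * eb i z)) * \<psi> z) = (\<lambda>z. m i * (\<psi> z * eb i z))" by (simp add: fun_eq_iff)
    with e[OF test0_eb[of i]] have "integral\<^sup>L M (\<lambda>z. m i * (\<psi> z * eb i z)) = integral\<^sup>L M (\<lambda>z. eb i z * \<omega> z)"
      unfolding lap_eb by (simp only:)
    then show ?thesis by (simp add: co_def ips_def mult.commute)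
  qed
  then show "L2 M \<psi> \<and> (\<forall>i. m i * co \<psi> i = co \<omega> i)" using L by simp
next
  assume a: "L2 M \<psi> \<and> (\<forall>i. m i * co \<psi> i = co \<omega> i)"
  have "integral\<^sup>L M (\<lambda>z. - lap \<phi> z * \<psi> z) = integral\<^sup>L M (\<lambda>z. \<phi> z * \<omega> z)" if t: "test0 p \<phi>" for \<phi>
  proof -
    have p1: "((\<lambda>i. co (lap \<phi>) i * co \<psi> i) has_sum ips M (lap \<phi>) \<psi>) UNIV"
      using a by (intro expansion green t) simp
    have p2: "((\<lambda>i. co \<phi> i * co \<omega> i) has_sum ips M \<phi> \<omega>) UNIV"
      using t by (intro expansion w test_L2) (simp add: test0_def)
    have "co (lap \<phi>) i * co \<psi> i = - (co \<phi> i * co \<omega> i)" for i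
      using a green(1)[OF t, of i] by (metis (no_types, lifting) minus_mult_left mult.assoc mult.commute)
    then have "((\<lambda>i. - (co \<phi> i * co \<omega> i)) has_sum ips M (lap \<phi>) \<psi>) UNIV" using p1 by simp
    moreover have "((\<lambda>i. - (co \<phi> i * co \<omega> i)) has_sum - ips M \<phi> \<omega>) UNIV" using p2 by (simp add: has_sum_uminus)
    ultimately have "ips M (lap \<phi>) \<psi> = - ips M \<phi> \<omega>" by (rule has_sum_unique)
    then show ?thesis by (simp add: ips_def)
  qed
  then show "inv_lap p \<omega> \<psi>" using a by (simp add: inv_lap_def in_L2_iff integral_M)
qed

lemma summable_on_scaled:
  assumes f: "L2 M f" and c: "\<And>i. \<bar>c i\<bar> \<le> C"
  shows "(\<lambda>i. (c i * co f i)\<^sup>2) summable_on UNIV"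
proof (rule summable_on_comparison_test)
  show "(\<lambda>i. C\<^sup>2 * (co f i)\<^sup>2) summable_on UNIV"
    using has_sum_imp_summable[OF parseval[OF f]] by (rule summable_on_cmult_right)
  show "(c i * co f i)\<^sup>2 \<le> C\<^sup>2 * (co f i)\<^sup>2" for i
    using power_mono[OF c[of i], of 2] by (simp add: power_mult_distrib mult_right_mono)
qed auto

lemma inv_m_le: "\<bar>1 / m i\<bar> \<le> 4 / pi\<^sup>2"
  using m_ge[of i] m_pos[of i] by (simp add: field_simps)

text \<open>The weak solution exists because 1 / m is bounded, so the choice operator returns one.
  Its coefficients, and hence its class modulo null sets, do not depend on the choice.\<close>

lemma invlap_spec:
  assumes w: "L2 M \<omega>"
  shows "L2 M (invlap p \<omega>)" "co (invlap p \<omega>) i = co \<omega> i / m i" "inv_lap p \<omega> (invlap p \<omega>)"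
proof -
  obtain \<psi> where "L2 M \<psi>" "\<And>i. co \<psi> i = 1 / m i * co \<omega> i"
    by (rule exists_with_coeffs[OF summable_on_scaled[OF w, of "\<lambda>i. 1 / m i", OF inv_m_le]]) blast
  then have "inv_lap p \<omega> \<psi>" using m_pos by (simp add: inv_lap_iff[OF w] less_imp_neq[THEN not_sym])
  then show s: "inv_lap p \<omega> (invlap p \<omega>)" unfolding invlap_def by (rule someI[where P = "inv_lap p \<omega>"])
  then show "L2 M (invlap p \<omega>)" by (simp add: inv_lap_iff[OF w])
  have "m i * co (invlap p \<omega>) i = co \<omega> i" using s[unfolded inv_lap_iff[OF w]] by blast
  then show "co (invlap p \<omega>) i = co \<omega> i / m i" using m_pos[of i] by (simp add: field_simps)
qed

lemma bij_flip: "bij_betw (\<lambda>i::int \<times> nat. (- fst i, snd i)) UNIV UNIV"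
  by (rule bij_betwI[where g = "\<lambda>i. (- fst i, snd i)"]) auto

lemma has_sum_flip: "((\<lambda>i. f (- fst i, snd i)) has_sum s) UNIV \<longleftrightarrow> (f has_sum s) (UNIV :: (int \<times> nat) set)"
  using has_sum_reindex_bij_betw[OF bij_flip, of f s] .

text \<open>Since d/dx exchanges the indices l and - l, the converse compares the two Parseval sums
  after the flip of the first index.\<close>

lemma weak_dx_iff:
  assumes psi: "L2 M \<psi>"
  shows "weak_dx p \<psi> g \<longleftrightarrow> L2 M g \<and> (\<forall>l n. co g (l, n) = \<alpha> * l * co \<psi> (- l, n))"
proof
  assume a: "weak_dx p \<psi> g"
  have "co g (l, n) = \<alpha> * l * co \<psi> (- l, n)" for l n
  proof -
    have "ips M (eb (l, n)) g = - ips M (px (eb (l, n))) \<psi>" using a test_eb by (simp add: weak_dx_def ip_eq)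
    also have "\<dots> = \<alpha> * l * ips M (eb (- l, n)) \<psi>" unfolding px_eb ips_cmult by simp
    finally show ?thesis by (simp add: co_def ips_commute[of M "eb _"])
  qed
  then show "L2 M g \<and> (\<forall>l n. co g (l, n) = \<alpha> * l * co \<psi> (- l, n))" using a by (simp add: weak_dx_def in_L2_iff)
next
  assume a: "L2 M g \<and> (\<forall>l n. co g (l, n) = \<alpha> * l * co \<psi> (- l, n))"
  have "ips M \<phi> g = - ips M (px \<phi>) \<psi>" if t: "test p \<phi>" for \<phi>
  proof -
    have "((\<lambda>i. co \<phi> i * co g i) has_sum ips M \<phi> g) UNIV" by (rule expansion[OF test_L2(1)[OF t]]) (use a in simp)
    moreover have "((\<lambda>i. co (px \<phi>) i * co \<psi> i) has_sum ips M (px \<phi>) \<psi>) UNIV" by (rule expansion[OF test_L2(2)[OF t] psi])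
    then have "((\<lambda>i. co (px \<phi>) (- fst i, snd i) * co \<psi> (- fst i, snd i)) has_sum ips M (px \<phi>) \<psi>) UNIV"
      using has_sum_flip[of "\<lambda>i. co (px \<phi>) i * co \<psi> i"] by simp
    then have "((\<lambda>i. - (co (px \<phi>) (- fst i, snd i) * co \<psi> (- fst i, snd i))) has_sum - ips M (px \<phi>) \<psi>) UNIV"
      by (simp add: has_sum_uminus)
    moreover have "- (co (px \<phi>) (- fst i, snd i) * co \<psi> (- fst i, snd i)) = co \<phi> i * co g i" for i
      using a by (cases i) (simp add: co_px[OF t])
    ultimately show ?thesis using has_sum_unique by simp
  qed
  then show "weak_dx p \<psi> g" using a by (simp add: weak_dx_def in_L2_iff ip_eq)
qed

lemma m_parts: "(\<alpha> * l)\<^sup>2 \<le> m (l, n)" "(om n)\<^sup>2 \<le> m (l, n)"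
  by (simp_all add: m_eq)

lemma quotient_bounds: "\<bar>\<alpha> * l / m (l, n)\<bar> \<le> 2 / pi" "\<bar>om n / m (l, n)\<bar> \<le> 2 / pi"
proof -
  have *: "\<bar>t / m (l, n)\<bar> \<le> 2 / pi" if "t\<^sup>2 \<le> m (l, n)" for t
  proof -
    have "(t / m (l, n))\<^sup>2 \<le> 1 / m (l, n)"
      using that m_pos[of "(l, n)"] by (simp add: power2_eq_square field_simps)
    also have "\<dots> \<le> (2 / pi)\<^sup>2" using inv_m_le[of "(l, n)"] m_pos[of "(l, n)"] by (simp add: power_divide)
    finally show ?thesis using abs_le_square_iff[of "t / m (l, n)" "2 / pi"] by simp
  qed
  show "\<bar>\<alpha> * l / m (l, n)\<bar> \<le> 2 / pi" "\<bar>om n / m (l, n)\<bar> \<le> 2 / pi"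
    by (intro * m_parts)+
qed

text \<open>The two derivatives of psi contribute ((alpha l)^2 + (om n)^2) times its squared
  coefficient, that is m times (co / m)^2. The y-derivative is built as a cosine series, since it
  need not vanish at the walls.\<close>

lemma vel_sq_eq:
  assumes w: "L2 M \<omega>"
  shows "((\<lambda>i. (co \<omega> i)\<^sup>2 / m i) has_sum vel_sq p \<omega>) UNIV"
proof -
  define \<psi> where "\<psi> = invlap p \<omega>"
  have psi: "L2 M \<psi>" and cp: "\<And>i. co \<psi> i = co \<omega> i / m i" using invlap_spec[OF w] by (simp_all add: \<psi>_def)
  have qb: "\<bar>\<alpha> * real_of_int (fst i) / m i\<bar> \<le> 2 / pi" "\<bar>om (snd i) / m i\<bar> \<le> 2 / pi" for i
    using quotient_bounds[where l = "fst i" and n = "snd i"] by simp_all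
  define dx where "dx i = \<alpha> * real_of_int (fst i) * co \<psi> i" for i
  have dxs: "(\<lambda>i. (dx i)\<^sup>2) summable_on UNIV"
    using summable_on_scaled[OF w, of "\<lambda>i. \<alpha> * real_of_int (fst i) / m i" "2 / pi", OF qb(1)] by (simp add: dx_def cp)
  define dy where "dy i = om (snd i) * co \<psi> i" for i
  have dys: "(\<lambda>i. (dy i)\<^sup>2) summable_on UNIV"
    using summable_on_scaled[OF w, of "\<lambda>i. om (snd i) / m i" "2 / pi", OF qb(2)] by (simp add: dy_def cp)
  have "(\<lambda>i. (\<alpha> * real_of_int (fst i) * co \<psi> (- fst i, snd i))\<^sup>2) summable_on UNIV"
  proof -
    have "(\<lambda>i. (dx (- fst i, snd i))\<^sup>2) summable_on UNIV"
      using dxs summable_on_reindex_bij_betw[OF bij_flip, of "\<lambda>i. (dx i)\<^sup>2"] by simp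
    then show ?thesis by (simp add: dx_def)
  qed
  then obtain g0 where "L2 M g0" "\<And>i. co g0 i = \<alpha> * real_of_int (fst i) * co \<psi> (- fst i, snd i)" by (rule exists_with_coeffs) blast
  then have "weak_dx p \<psi> g0" by (simp add: weak_dx_iff[OF psi])
  then have "weak_dx p \<psi> (wdx p \<psi>)" unfolding wdx_def by (rule someI[where P = "weak_dx p \<psi>"])
  then have g: "L2 M (wdx p \<psi>)" "\<And>l n. co (wdx p \<psi>) (l, n) = \<alpha> * l * co \<psi> (- l, n)" by (simp_all add: weak_dx_iff[OF psi])
  have gx: "((\<lambda>i. (dx i)\<^sup>2) has_sum ips M (wdx p \<psi>) (wdx p \<psi>)) UNIV"
  proof -
    have "(co (wdx p \<psi>) i)\<^sup>2 = (dx (- fst i, snd i))\<^sup>2" for i using g(2)[of "fst i" "snd i"] by (simp add: dx_def)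
    then show ?thesis using parseval[OF g(1)] has_sum_flip[of "\<lambda>i. (dx i)\<^sup>2"] by simp
  qed
  obtain h0 where h0: "L2 M h0" "((\<lambda>i. (dy i)\<^sup>2) has_sum ips M h0 h0) UNIV"
    "\<And>h. L2 M h \<Longrightarrow> ((\<lambda>i. dy i * ips M (ec i) h) has_sum ips M h0 h) UNIV"
    by (rule exists_cosine_series[OF dys]) blast
  have hw: "weak_dy p \<psi> h0"
    unfolding weak_dy_def in_L2_iff ip_eq
  proof (intro conjI allI impI h0(1))
    fix \<phi> assume t0: "test0 p \<phi>"
    then have t: "test p \<phi>" and bd: "\<phi> (x, 1) = 0" "\<phi> (x, -1) = 0" for x by (auto simp: test0_def)
    then have C: "C2 \<phi>" by (simp add: test_def)
    have cpy: "co (py \<phi>) i = - om (snd i) * ips M \<phi> (ec i)" for i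
    proof -
      obtain l n where i: "i = (l, n)" by (cases i)
      have "ips M (py \<phi>) (eb (l, n)) = - ips M \<phi> (\<lambda>z. om n * ec (l, n) z)"
        by (rule ibp_y[OF C2_D(1)[OF C] C2_D(3)[OF C] C2_D(7)[OF C] eb_continuous _ eb_dy])
          (intro continuous_intros ec_continuous, simp_all add: bd)
      then show ?thesis by (simp add: i co_def ips_cmult_right)
    qed
    have "((\<lambda>i. co (py \<phi>) i * co \<psi> i) has_sum ips M (py \<phi>) \<psi>) UNIV" by (rule expansion[OF test_L2(3)[OF t] psi])
    then have "((\<lambda>i. - (co (py \<phi>) i * co \<psi> i)) has_sum - ips M (py \<phi>) \<psi>) UNIV" by (simp add: has_sum_uminus)
    moreover have "- (co (py \<phi>) i * co \<psi> i) = dy i * ips M (ec i) \<phi>" for i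
      by (simp add: cpy dy_def ips_commute[of M "ec i"])
    ultimately have "ips M h0 \<phi> = - ips M (py \<phi>) \<psi>" using h0(3)[OF test_L2(1)[OF t]] has_sum_unique by simp
    then show "ips M \<phi> h0 = - ips M (py \<phi>) \<psi>" by (simp add: ips_commute)
  qed
  then have hs: "weak_dy p \<psi> (wdy p \<psi>)" unfolding wdy_def by (rule someI[where P = "weak_dy p \<psi>"])
  then have hL: "L2 M (wdy p \<psi>)" by (simp add: weak_dy_def in_L2_iff)
  \<comment> \<open>Each \<open>eb i\<close> may be used as test function, so two weak y-derivatives
    have the same sine coefficients and agree almost everywhere.\<close>
  have "co (wdy p \<psi>) i = co h0 i" for i
    using hw hs test0_eb[of i] unfolding weak_dy_def ip_eq co_def by (metis ips_commute)
  then have ae: "AE z in M. wdy p \<psi> z = h0 z" by (rule eq_of_coeffs[OF hL h0(1)])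
  have "ips M (wdy p \<psi>) (wdy p \<psi>) = ips M h0 h0"
    using ips_cong_AE[OF hL h0(1) hL ae] ips_cong_AE[OF hL h0(1) h0(1) ae] by (simp add: ips_commute)
  then have gy: "((\<lambda>i. (dy i)\<^sup>2) has_sum ips M (wdy p \<psi>) (wdy p \<psi>)) UNIV" using h0(2) by simp
  have "vel_sq p \<omega> = ips M (wdx p \<psi>) (wdx p \<psi>) + ips M (wdy p \<psi>) (wdy p \<psi>)"
    unfolding vel_sq_def Let_def integral_M \<psi>_def[symmetric] ips_def
    using L2_sq[OF hL] L2_sq[OF g(1)] by (simp add: power2_eq_square)
  then have "((\<lambda>i. (dx i)\<^sup>2 + (dy i)\<^sup>2) has_sum vel_sq p \<omega>) UNIV" using has_sum_add[OF gx gy] by simp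
  moreover have "(dx i)\<^sup>2 + (dy i)\<^sup>2 = (co \<omega> i)\<^sup>2 / m i" for i
  proof -
    have "(dx i)\<^sup>2 + (dy i)\<^sup>2 = m i * (co \<psi> i)\<^sup>2"
      using m_eq[of "fst i" "snd i"] by (simp add: dx_def dy_def power_mult_distrib distrib_right)
    then show ?thesis using m_pos[of i] by (simp add: cp power2_eq_square)
  qed
  ultimately show ?thesis by simp
qed

end

section \<open>The flow on Fourier modes\<close>

lemma Upp_eq: "Upp y = - (pi\<^sup>2 / 2) * cos (pi * y)"
proof -
  have d1: "(U has_real_derivative - (pi / 2) * sin (pi * y)) (at y)" for y
    unfolding U_def[abs_def] by (auto intro!: derivative_eq_intros)
  then have "deriv U = (\<lambda>y. - (pi / 2) * sin (pi * y))" by (intro ext DERIV_imp_deriv)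
  moreover have "((\<lambda>y. - (pi / 2) * sin (pi * y)) has_real_derivative - (pi\<^sup>2 / 2) * cos (pi * y)) (at y)"
    by (auto intro!: derivative_eq_intros simp: power2_eq_square)
  ultimately show ?thesis unfolding Upp_def by (simp add: DERIV_imp_deriv)
qed

definition Kf :: "real \<Rightarrow> real \<Rightarrow> real" where "Kf \<beta> y = \<beta> - Upp y"

lemma Kf_eq: "Kf \<beta> y = \<beta> + pi\<^sup>2 / 2 * cos (pi * y)"
  by (simp add: Kf_def Upp_eq)

lemma Kf_continuous: "continuous_on UNIV (Kf \<beta>)"
  unfolding Kf_eq[abs_def] by (intro continuous_intros)

text \<open>The sine of frequency \<open>Suc n\<close> - 2: this frequency is -1 for n = 0, which
  changes the sign, and 0 for n = 1.\<close>

definition lowsn :: "nat \<Rightarrow> real \<Rightarrow> real" where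
  "lowsn n y = (if n \<ge> 2 then sn (n - 2) y else if n = 0 then - sn 0 y else 0)"

lemma Kf_sn: "Kf \<beta> y * sn n y = \<beta> * sn n y - pi\<^sup>2 / 4 * (sn (n + 2) y + lowsn n y)"
proof -
  define \<theta> where "\<theta> = pi * (y + 1) / 2"
  have "2 * \<theta> - pi = pi * y" by (simp add: \<theta>_def algebra_simps)
  then have "cos (pi * y) = cos (2 * \<theta> - pi)" by simp
  then have c: "cos (pi * y) = - cos (2 * \<theta>)" by simp
  have s: "sn k y = sin (real (Suc k) * \<theta>)" for k by (simp add: sn_def \<theta>_def)
  have "sin (real (Suc n) * \<theta> - 2 * \<theta>) = lowsn n y"
  proof -
    consider "n = 0" | "n = 1" | "n \<ge> 2" by linarith
    then show ?thesis
    proof cases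
      case 1 then show ?thesis using sin_minus[of \<theta>] by (simp add: lowsn_def s)
    next
      case 2 then show ?thesis by (simp add: lowsn_def)
    next
      case 3
      then have "real (Suc n) * \<theta> - 2 * \<theta> = real (Suc (n - 2)) * \<theta>" by (simp add: algebra_simps of_nat_diff)
      then show ?thesis using 3 by (simp only: lowsn_def s if_True)
    qed
  qed
  moreover have "sin (real (Suc n) * \<theta> + 2 * \<theta>) = sn (n + 2) y" by (simp add: s algebra_simps)
  moreover have "2 * (cos (2 * \<theta>) * sin (real (Suc n) * \<theta>))
     = sin (real (Suc n) * \<theta> + 2 * \<theta>) + sin (real (Suc n) * \<theta> - 2 * \<theta>)"
    unfolding sin_add sin_diff by simp
  ultimately have h: "cos (2 * \<theta>) * sn n y = (sn (n + 2) y + lowsn n y) / 2" by (simp only: s) simp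
  have "Kf \<beta> y * sn n y = \<beta> * sn n y - pi\<^sup>2 / 2 * (cos (2 * \<theta>) * sn n y)"
    unfolding Kf_eq c by (simp add: algebra_simps)
  then show ?thesis unfolding h by (simp add: algebra_simps)
qed

context wave
begin

definition row :: "(real \<times> real \<Rightarrow> real) \<Rightarrow> int \<Rightarrow> ell2" where
  "row f l = Ell2 (\<lambda>n. co f (l, n))"

lemma row_summable:
  assumes "L2 M f"
  shows "summable (\<lambda>n. (co f (l, n))\<^sup>2)" "(\<Sum>n. (co f (l, n))\<^sup>2) \<le> ips M f f"
proof -
  note ps = parseval[OF assms]
  have "(\<lambda>i. (co f i)\<^sup>2) summable_on {l} \<times> UNIV"
    using has_sum_imp_summable[OF ps] by (rule summable_on_subset_banach) auto
  moreover have bij: "bij_betw (\<lambda>n. (l, n)) UNIV ({l} \<times> (UNIV :: nat set))" by (auto simp: bij_betw_def inj_on_def)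
  ultimately have s: "(\<lambda>n. (co f (l, n))\<^sup>2) summable_on UNIV"
    using summable_on_reindex_bij_betw[OF bij, of "\<lambda>i. (co f i)\<^sup>2"] by simp
  then show "summable (\<lambda>n. (co f (l, n))\<^sup>2)" by (simp add: summable_on_UNIV_nonneg_real_iff)
  then show "(\<Sum>n. (co f (l, n))\<^sup>2) \<le> ips M f f"
  proof (rule suminf_le_const)
    fix N
    have "(\<Sum>n<N. (co f (l, n))\<^sup>2) = (\<Sum>i\<in>(\<lambda>n. (l, n)) ` {..<N}. (co f i)\<^sup>2)"
      by (subst sum.reindex) (auto simp: inj_on_def)
    also have "\<dots> \<le> ips M f f"
      by (rule has_sum_mono_neutral[OF has_sum_finite ps]) auto
    finally show "(\<Sum>n<N. (co f (l, n))\<^sup>2) \<le> ips M f f" .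
  qed
qed

lemma cf_row: "L2 M f \<Longrightarrow> cf (row f l) n = co f (l, n)"
  by (simp add: row_def cf_Ell2 row_summable)

lemma norm_row: "L2 M f \<Longrightarrow> (norm (row f l))\<^sup>2 \<le> ips M f f"
  using row_summable(2) by (simp add: norm_ell2_sq cf_row)

lemma co_diff: "L2 M f \<Longrightarrow> L2 M g \<Longrightarrow> co (\<lambda>z. f z - g z) i = co f i - co g i"
  unfolding co_def by (intro ips_diff eb_L2)

lemma co_add: "L2 M f \<Longrightarrow> L2 M g \<Longrightarrow> co (\<lambda>z. f z + g z) i = co f i + co g i"
  unfolding co_def by (intro ips_add eb_L2)

lemma co_cmult: "co (\<lambda>z. c * f z) i = c * co f i"
  unfolding co_def by (rule ips_cmult)

lemma co_eb: "co (eb j) i = (if i = j then 1 else 0)"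
  by (auto simp: co_def eb_orthonormal)

lemma row_diff: "L2 M f \<Longrightarrow> L2 M g \<Longrightarrow> row (\<lambda>z. f z - g z) l = row f l - row g l"
  by (rule ell2_eqI) (simp add: cf_row L2_diff co_diff)

lemma Kf_L2: "L2 M f \<Longrightarrow> L2 M (\<lambda>z. Kf \<beta> (snd z) * f z)"
  by (rule L2_continuous_mult) (intro continuous_on_compose2[OF Kf_continuous] continuous_intros, auto)

text \<open>The multiplier depends on y only, so different rows do not mix, and on one row
  \<open>Kf_sn\<close> supplies the matrix of \<open>Kop\<close>.\<close>

lemma row_Kf:
  assumes f: "L2 M f"
  shows "row (\<lambda>z. Kf \<beta> (snd z) * f z) l = Kop \<beta> (row f l)"
proof (rule ell2_eqI)
  fix n
  define lw where "lw z = (if n \<ge> 2 then eb (l, n - 2) z else if n = 0 then - eb (l, 0) z else 0)" for z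
  have lw: "L2 M lw" "ips M lw f = (if n \<ge> 2 then co f (l, n - 2) else if n = 0 then - co f (l, 0) else 0)"
  proof -
    consider "n \<ge> 2" | "n = 0" | "n = 1" by linarith
    then have "L2 M lw \<and> ips M lw f = (if n \<ge> 2 then co f (l, n - 2) else if n = 0 then - co f (l, 0) else 0)"
    proof cases
      case 1
      then have "lw = eb (l, n - 2)" by (simp add: lw_def fun_eq_iff)
      then show ?thesis using 1 by (simp add: eb_L2 co_def ips_commute)
    next
      case 2
      then have "lw = (\<lambda>z. -1 * eb (l, 0) z)" by (simp add: lw_def fun_eq_iff)
      then show ?thesis using 2 L2_cmult[OF eb_L2, of "-1"] ips_cmult[of M "-1" "eb (l, 0)" f]
        by (simp add: co_def ips_commute)
    next
      case 3
      then have "lw = (\<lambda>z. 0)" by (simp add: lw_def fun_eq_iff)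
      then show ?thesis using 3 by (simp add: L2_zero ips_def)
    qed
    then show "L2 M lw" "ips M lw f = (if n \<ge> 2 then co f (l, n - 2) else if n = 0 then - co f (l, 0) else 0)" by auto
  qed
  have "ips M (\<lambda>z. Kf \<beta> (snd z) * f z) (eb (l, n)) = ips M (\<lambda>z. \<beta> * eb (l, n) z - pi\<^sup>2 / 4 * (eb (l, n + 2) z + lw z)) f"
  proof -
    have pointwise: "Kf \<beta> (snd z) * f z * eb (l, n) z = (\<beta> * eb (l, n) z - pi\<^sup>2 / 4 * (eb (l, n + 2) z + lw z)) * f z" for z
    proof -
      have "Kf \<beta> (snd z) * eb (l, n) z = tr l (fst z) * (Kf \<beta> (snd z) * sn n (snd z))" by (simp add: eb_def)
      also have "\<dots> = \<beta> * eb (l, n) z - pi\<^sup>2 / 4 * (eb (l, n + 2) z + lw z)"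
        unfolding Kf_sn by (auto simp: eb_def lw_def lowsn_def algebra_simps)
      finally show ?thesis by (metis mult.assoc mult.commute)
    qed
    show ?thesis unfolding ips_def pointwise ..
  qed
  also have "\<dots> = \<beta> * co f (l, n) - pi\<^sup>2 / 4 * (co f (l, n + 2) + ips M lw f)"
    unfolding ips_diff[OF L2_cmult[OF eb_L2] L2_cmult[OF L2_add[OF eb_L2 lw(1)]] f] ips_cmult
      ips_add[OF eb_L2 lw(1) f] co_def ips_commute[of M f] ..
  finally show "cf (row (\<lambda>z. Kf \<beta> (snd z) * f z) l) n = cf (Kop \<beta> (row f l)) n"
    by (simp add: cf_row Kf_L2 f cf_Kop cf_Cop lw(2) co_def[of "\<lambda>z. Kf \<beta> (snd z) * f z"])
qed

lemma Lop_L2: "L2 M \<omega> \<Longrightarrow> L2 M (Lop p \<omega>)"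
  and row_Lop: "L2 M \<omega> \<Longrightarrow> row (Lop p \<omega>) l = Lo (\<alpha> * l) (row \<omega> l)"
proof -
  assume w: "L2 M \<omega>"
  have e: "Lop p \<omega> = (\<lambda>z. 1 / pi\<^sup>2 * \<omega> z - invlap p \<omega> z)" by (simp add: Lop_def)
  show L: "L2 M (Lop p \<omega>)" unfolding e by (intro L2_diff L2_cmult w invlap_spec)
  show "row (Lop p \<omega>) l = Lo (\<alpha> * l) (row \<omega> l)"
  proof (rule ell2_eqI)
    fix n
    have "co (Lop p \<omega>) (l, n) = 1 / pi\<^sup>2 * co \<omega> (l, n) - co \<omega> (l, n) / m (l, n)"
      unfolding e co_diff[OF L2_cmult[OF w] invlap_spec(1)[OF w]] co_cmult invlap_spec(2)[OF w] ..
    also have "\<dots> = dd (\<alpha> * l) n * co \<omega> (l, n)" by (simp add: dd_def m_def left_diff_distrib)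
    finally show "cf (row (Lop p \<omega>) l) n = cf (Lo (\<alpha> * l) (row \<omega> l)) n"
      by (simp add: cf_row L w cf_Lo)
  qed
qed

lemma row_KLop: "L2 M \<omega> \<Longrightarrow> row (\<lambda>z. Kf \<beta> (snd z) * Lop p \<omega> z) l = Aop \<beta> (\<alpha> * l) (row \<omega> l)"
  by (simp add: row_Kf Lop_L2 row_Lop Aop_def)

text \<open>The symbol depends on a only through its square. Hence the rows l and - l evolve under
  the same operator and can be paired as P and Q.\<close>

lemma Aop_even: "Aop \<beta> (- a) = Aop \<beta> a" and Lo_even: "Lo (- a) = Lo a"
proof -
  have "dd (- a) = dd a" by (simp add: dd_def[abs_def] mm_def)
  then show "Aop \<beta> (- a) = Aop \<beta> a" "Lo (- a) = Lo a" by (simp_all add: Aop_def[abs_def] Lo_def)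
qed

lemma ips_px_eb:
  assumes f: "L2 M f"
  shows "ips M (px (eb (l, n))) f = - (\<alpha> * l) * cf (row f (- l)) n"
  unfolding px_eb ips_cmult cf_row[OF f] co_def by (simp add: ips_commute)

text \<open>Testing with \<open>eb (l, n)\<close> gives an integral equation for each coefficient.
  Continuity in L^2 makes the right-hand side a continuous function with values in
  \<open>ell2\<close>, so the integral is taken there and differentiated. The derivative of row l
  involves row - l because d/dx exchanges cosines and sines.\<close>

lemma flow_coefficients:
  assumes sol: "weak_sol \<beta> p \<omega>"
  shows "t \<ge> 0 \<Longrightarrow> L2 M (\<omega> t)"
    and "t \<ge> 0 \<Longrightarrow> inX p (\<omega> t)"
    and "continuous_on {0..} (\<lambda>t. row (\<omega> t) l)"
    and "t \<ge> 0 \<Longrightarrow> ((\<lambda>t. row (\<omega> t) l) has_vector_derivative (- (\<alpha> * l)) *\<^sub>R Aop \<beta> (\<alpha> * l) (row (\<omega> t) (- l))) (at t within {0..})"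
proof -
  show X: "inX p (\<omega> t)" if "t \<ge> 0" for t using sol that by (simp add: weak_sol_def)
  then show L: "L2 M (\<omega> t)" if "t \<ge> 0" for t using that by (simp add: inX_def in_L2_iff)
  show cont: "continuous_on {0..} (\<lambda>t. row (\<omega> t) l)" for l
    unfolding continuous_on_def
  proof
    fix t :: real assume t: "t \<in> {0..}"
    have "((\<lambda>s. LINT z:Omega p|lborel. (\<omega> s z - \<omega> t z)\<^sup>2) \<longlongrightarrow> 0) (at t within {0..})"
      using sol t by (simp add: weak_sol_def)
    from tendsto_real_sqrt[OF this]
    have lim: "((\<lambda>s. sqrt (ips M (\<lambda>z. \<omega> s z - \<omega> t z) (\<lambda>z. \<omega> s z - \<omega> t z))) \<longlongrightarrow> 0) (at t within {0..})"
      unfolding ips_def integral_M power2_eq_square real_sqrt_zero .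
    have "((\<lambda>s. row (\<omega> s) l - row (\<omega> t) l) \<longlongrightarrow> 0) (at t within {0..})"
    proof (rule Lim_null_comparison[OF _ lim])
      have "norm (row (\<omega> s) l - row (\<omega> t) l) \<le> sqrt (ips M (\<lambda>z. \<omega> s z - \<omega> t z) (\<lambda>z. \<omega> s z - \<omega> t z))"
        if "s \<ge> 0" for s
        using norm_row[OF L2_diff[OF L[OF that] L[of t]], of l] t
        by (simp add: row_diff[OF L[OF that] L] real_le_rsqrt)
      then show "\<forall>\<^sub>F s in at t within {0..}. norm (row (\<omega> s) l - row (\<omega> t) l)
         \<le> sqrt (ips M (\<lambda>z. \<omega> s z - \<omega> t z) (\<lambda>z. \<omega> s z - \<omega> t z))"
        by (simp add: eventually_at_filter)
    qed
    then show "((\<lambda>t. row (\<omega> t) l) \<longlongrightarrow> row (\<omega> t) l) (at t within {0..})" by (rule LIM_zero_cancel)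
  qed
  define G where "G s = (- (\<alpha> * l)) *\<^sub>R Aop \<beta> (\<alpha> * l) (row (\<omega> s) (- l))" for s
  have Gc: "continuous_on {0..} G" unfolding G_def
    by (intro continuous_intros bounded_linear.continuous_on[OF bounded_linear_Aop] cont)
  have Gi: "G integrable_on {0..t}" for t
    by (intro integrable_continuous_interval continuous_on_subset[OF Gc]) auto
  have int: "row (\<omega> t) l = row (\<omega> 0) l + integral {0..t} G" if t: "t \<ge> 0" for t
  proof (rule ell2_eqI)
    fix n
    have "ip p (\<omega> t) (eb (l, n)) - ip p (\<omega> 0) (eb (l, n)) =
        integral {0..t} (\<lambda>s. LINT z:Omega p|lborel. (\<beta> - Upp (snd z)) * px (eb (l, n)) z * Lop p (\<omega> s) z)"
      using sol t test_eb unfolding weak_sol_def by blast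
    also have "\<dots> = integral {0..t} (\<lambda>s. cf (G s) n)"
    proof (rule integral_cong)
      fix s assume "s \<in> {0..t}"
      then have w: "L2 M (\<omega> s)" using L by simp
      have "(LINT z:Omega p|lborel. (\<beta> - Upp (snd z)) * px (eb (l, n)) z * Lop p (\<omega> s) z)
        = ips M (px (eb (l, n))) (\<lambda>z. Kf \<beta> (snd z) * Lop p (\<omega> s) z)"
        unfolding integral_M ips_def Kf_def by (simp add: mult_ac)
      also have "\<dots> = cf (G s) n"
        using ips_px_eb[OF Kf_L2[OF Lop_L2[OF w]]] row_KLop[OF w, of \<beta> "- l"] by (simp add: G_def Aop_even)
      finally show "(LINT z:Omega p|lborel. (\<beta> - Upp (snd z)) * px (eb (l, n)) z * Lop p (\<omega> s) z) = cf (G s) n" .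
    qed
    also have "\<dots> = cf (integral {0..t} G) n"
      using integral_linear[OF Gi bounded_linear_cf] by (simp add: o_def)
    finally show "cf (row (\<omega> t) l) n = cf (row (\<omega> 0) l + integral {0..t} G) n"
      using L t by (simp add: cf_row ip_eq co_def)
  qed
  show "((\<lambda>t. row (\<omega> t) l) has_vector_derivative (- (\<alpha> * l)) *\<^sub>R Aop \<beta> (\<alpha> * l) (row (\<omega> t) (- l))) (at t within {0..})"
    if t: "t \<ge> 0"
  proof -
    have "((\<lambda>u. integral {0..u} G) has_vector_derivative G t) (at t within {0..t + 1})"
      using t by (intro integral_has_vector_derivative continuous_on_subset[OF Gc]) auto
    moreover have "at t within {0..t + 1} = at t within {0..}"
      using t by (intro at_within_nhd[of t "{..<t + 1}"]) auto
    ultimately have "((\<lambda>u. row (\<omega> 0) l + integral {0..u} G) has_vector_derivative 0 + G t) (at t within {0..})"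
      by (intro has_vector_derivative_add has_vector_derivative_const) simp
    then have "((\<lambda>t. row (\<omega> t) l) has_vector_derivative 0 + G t) (at t within {0..})"
    proof (rule has_vector_derivative_transform[rotated 2])
      show "t \<in> {0..}" using t by simp
      show "row (\<omega> u) l = row (\<omega> 0) l + integral {0..u} G" if "u \<in> {0..}" for u
        using int that unfolding atLeast_iff .
    qed
    then show ?thesis by (simp add: G_def)
  qed
qed

lemma slice_integrable:
  assumes f: "L2 M f"
  shows "AE y in lborel. y \<in> {-1..1} \<longrightarrow> set_integrable lborel {0..p} (\<lambda>x. f (x, y))"
    and "integrable lborel (\<lambda>y. LINT x|lborel. indicator (Omega p) (x, y) * f (x, y))"
proof -
  have i: "integrable (lborel \<Otimes>\<^sub>M lborel) (\<lambda>(x, y). indicator (Omega p) (x, y) * f (x, y))"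
    using integrable_indicator_of_M[OF L2_integrable[OF f]] by (simp add: case_prod_unfold)
  show "integrable lborel (\<lambda>y. LINT x|lborel. indicator (Omega p) (x, y) * f (x, y))"
    using lborel_pair.integrable_snd[OF i] .
  have "AE y in lborel. integrable lborel (\<lambda>x. indicator (Omega p) (x, y) * f (x, y))"
    using lborel_pair.AE_integrable_snd[OF i] .
  then show "AE y in lborel. y \<in> {-1..1} \<longrightarrow> set_integrable lborel {0..p} (\<lambda>x. f (x, y))"
    by eventually_elim (auto simp: set_integrable_def indicator_Omega)
qed

text \<open>The x-average is a function of y whose sine coefficients are, up to a nonzero factor,
  the entries of row 0.\<close>

lemma inX_iff:
  assumes f: "L2 M f"
  shows "inX p f \<longleftrightarrow> (\<forall>n. co f (0, n) = 0)"
proof -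
  define G where "G y = (LINT x|lborel. indicator (Omega p) (x, y) * f (x, y))" for y
  define c where "c = sqrt (\<alpha> / (2 * pi))"
  have c: "c \<noteq> 0" using alpha by (simp add: c_def)
  have Gi: "integrable lborel G" unfolding G_def by (rule slice_integrable[OF f])
  have Gs: "G y = 0" if "y \<notin> {-1..1}" for y using that by (auto simp: G_def indicator_Omega)
  have G1: "G y = (LINT x:{0..p}|lborel. f (x, y))" if "y \<in> {-1..1}" for y
    using that by (simp add: G_def indicator_Omega set_lebesgue_integral_def)
  have coG: "co f (0, n) = c * (LINT y|lborel. G y * sn n y)" for n
  proof -
    have "(LINT x|lborel. indicator (Omega p) (x, y) * f (x, y) * tr 0 x) = G y * c" for y
      unfolding G_def c_def by (simp add: tr_def del: mult.assoc)
    then have "co f (0, n) = (LINT y|lborel. G y * c * sn n y)" unfolding co_def coeff_as_iterated(2)[OF f] by simp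
    also have "\<dots> = (LINT y|lborel. c * (G y * sn n y))" by (simp add: mult_ac)
    finally show ?thesis by simp
  qed
  have "(AE y in lborel. y \<in> {-1..1} \<longrightarrow> (LINT x:{0..p}|lborel. f (x, y)) = 0) \<longleftrightarrow> (AE y in lborel. G y = 0)"
  proof (intro AE_cong)
    fix y show "(y \<in> {-1..1} \<longrightarrow> (LINT x:{0..p}|lborel. f (x, y)) = 0) \<longleftrightarrow> G y = 0"
      using Gs[of y] G1[of y] by (cases "y \<in> {-1..1}") simp_all
  qed
  also have "\<dots> \<longleftrightarrow> (\<forall>n. co f (0, n) = 0)"
  proof
    assume ae: "AE y in lborel. G y = 0"

    have "(LINT y|lborel. G y * sn n y) = 0" for n
      by (rule integral_eq_zero_AE) (use ae in eventually_elim, simp)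
    then show "\<forall>n. co f (0, n) = 0" by (simp add: coG)
  next
    assume "\<forall>n. co f (0, n) = 0"
    then show "AE y in lborel. G y = 0" using c by (intro sine_complete Gi Gs) (auto simp: coG)
  qed
  finally show ?thesis using f by (simp add: inX_def in_L2_iff)
qed

section \<open>Complex-valued functions assembled from real pairs\<close>

lemma Complex_as_sum: "Complex a b = of_real a + \<i> * of_real b"
  by (simp add: complex_eq_iff)

lemma integral_Complex:
  assumes "integrable N f" "integrable N g"
  shows "integral\<^sup>L N (\<lambda>z. Complex (f z) (g z)) = Complex (integral\<^sup>L N f) (integral\<^sup>L N g)"
  unfolding Complex_as_sum using assms by simp

lemma in_L2_Complex:
  assumes f: "L2 M f" and g: "L2 M g"
  shows "in_L2 p (\<lambda>z. Complex (f z) (g z))"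
proof -
  have "(\<lambda>z. Complex (f z) (g z)) \<in> borel_measurable M"
    using f g by (simp add: borel_measurable_complex_iff L2_def)
  moreover have "integrable M (\<lambda>z. (norm (Complex (f z) (g z)))\<^sup>2)"
    using L2_sq[OF f] L2_sq[OF g] by (simp add: cmod_power2)
  ultimately show ?thesis
    unfolding in_L2_def set_borel_measurable_def set_integrable_def measurable_M integrable_M by (rule conjI)
qed

lemma inX_Complex:
  assumes f: "L2 M f" "inX p f" and g: "L2 M g" "inX p g"
  shows "inX p (\<lambda>z. Complex (f z) (g z))"
proof -
  have a: "AE y in lborel. y \<in> {-1..1} \<longrightarrow> (LINT x:{0..p}|lborel. f (x, y)) = 0"
    "AE y in lborel. y \<in> {-1..1} \<longrightarrow> (LINT x:{0..p}|lborel. g (x, y)) = 0"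
    using f g by (simp_all add: inX_def)
  have "AE y in lborel. y \<in> {-1..1} \<longrightarrow> (LINT x:{0..p}|lborel. Complex (f (x, y)) (g (x, y))) = 0"
    using a slice_integrable(1)[OF f(1)] slice_integrable(1)[OF g(1)]
  proof eventually_elim
    case (elim y)
    have sc: "indicator {0..p} x *\<^sub>R Complex a b = Complex (indicator {0..p} x * a) (indicator {0..p} x * b)" for x a b
      by (simp add: complex_eq_iff)
    show ?case
    proof
      assume y: "y \<in> {-1..1}"
      have "(LINT x:{0..p}|lborel. Complex (f (x, y)) (g (x, y))) =
          Complex (LINT x:{0..p}|lborel. f (x, y)) (LINT x:{0..p}|lborel. g (x, y))"
        unfolding set_lebesgue_integral_def sc real_scaleR_def
        using elim y by (intro integral_Complex) (simp_all add: set_integrable_def)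
      then show "(LINT x:{0..p}|lborel. Complex (f (x, y)) (g (x, y))) = 0"
        using elim y by (simp add: complex_eq_iff)
    qed
  qed
  then show ?thesis using in_L2_Complex[OF f(1) g(1)] by (simp add: inX_def)
qed

lemma inv_lap_Complex:
  assumes f: "L2 M f" and g: "L2 M g"
  shows "inv_lap p (\<lambda>z. Complex (f z) (g z)) (\<lambda>z. Complex (invlap p f z) (invlap p g z))"
proof -
  note s = invlap_spec[OF f] invlap_spec[OF g]
  have sc: "r *\<^sub>R Complex a b = Complex (r * a) (r * b)" for r a b by (simp add: complex_eq_iff)
  have "(LINT z:Omega p|lborel. (- lap \<phi> z) *\<^sub>R Complex (invlap p f z) (invlap p g z)) =
        (LINT z:Omega p|lborel. \<phi> z *\<^sub>R Complex (f z) (g z))" if t0: "test0 p \<phi>" for \<phi>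
  proof -
    have L: "L2 M (\<lambda>z. - lap \<phi> z)" using L2_cmult[OF green(2)[OF t0], of "-1"] by simp
    have t: "L2 M \<phi>" using t0 by (intro test_L2) (simp add: test0_def)
    have "integral\<^sup>L M (\<lambda>z. - lap \<phi> z * invlap p f z) = integral\<^sup>L M (\<lambda>z. \<phi> z * f z)"
      "integral\<^sup>L M (\<lambda>z. - lap \<phi> z * invlap p g z) = integral\<^sup>L M (\<lambda>z. \<phi> z * g z)"
      using s(3) s(6) t0 by (simp_all add: inv_lap_def integral_M)
    then show ?thesis
      unfolding integral_M sc
      unfolding integral_Complex[OF L2_mult[OF L s(1)] L2_mult[OF L s(4)]] integral_Complex[OF L2_mult[OF t f] L2_mult[OF t g]]
      by simp
  qed
  then show ?thesis using in_L2_Complex[OF s(1) s(4)] by (simp add: inv_lap_def)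
qed

text \<open>This is the passage back from coefficients to the weak equation: Parseval for the
  derivative of the test function against (beta - U'') L omega, with the first index
  flipped.\<close>

lemma JL_real:
  assumes w: "L2 M \<omega>" and eta: "L2 M \<eta>" and t: "test p \<phi>"
    and co: "\<And>l n. co \<eta> (l, n) = - (\<alpha> * l) * cf (Aop \<beta> (\<alpha> * l) (row \<omega> (- l))) n"
  shows "integral\<^sup>L M (\<lambda>z. \<phi> z * \<eta> z) = integral\<^sup>L M (\<lambda>z. (Kf \<beta> (snd z) * px \<phi> z) * Lop p \<omega> z)"
proof -
  define k where "k z = Kf \<beta> (snd z) * Lop p \<omega> z" for z
  have k: "L2 M k" unfolding k_def by (intro Kf_L2 Lop_L2 w)
  have "((\<lambda>i. co (px \<phi>) i * co k i) has_sum ips M (px \<phi>) k) UNIV" by (rule expansion[OF test_L2(2)[OF t] k])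
  then have "((\<lambda>i. co (px \<phi>) (- fst i, snd i) * co k (- fst i, snd i)) has_sum ips M (px \<phi>) k) UNIV"
    using has_sum_flip[of "\<lambda>i. co (px \<phi>) i * co k i"] by simp
  moreover have "co (px \<phi>) (- fst i, snd i) * co k (- fst i, snd i) = co \<phi> i * co \<eta> i" for i
  proof -
    obtain l n where i: "i = (l, n)" by (cases i)
    have "co k (- l, n) = cf (Aop \<beta> (\<alpha> * l) (row \<omega> (- l))) n"
      using row_KLop[OF w, of \<beta> "- l", folded k_def] cf_row[OF k, of "- l" n] by (simp add: k_def[abs_def] Aop_even)
    then show ?thesis by (simp add: i co co_px[OF t])
  qed
  ultimately have "((\<lambda>i. co \<phi> i * co \<eta> i) has_sum ips M (px \<phi>) k) UNIV" by simp
  moreover have "((\<lambda>i. co \<phi> i * co \<eta> i) has_sum ips M \<phi> \<eta>) UNIV" by (rule expansion[OF test_L2(1)[OF t] eta])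
  ultimately have "ips M (px \<phi>) k = ips M \<phi> \<eta>" by (rule has_sum_unique)
  then show ?thesis by (simp add: ips_def k_def mult_ac)
qed

lemma JL_rel_Complex:
  assumes f: "L2 M f" and g: "L2 M g" and f': "L2 M f'" and g': "L2 M g'"
    and cof: "\<And>l n. co f' (l, n) = - (\<alpha> * l) * cf (Aop \<beta> (\<alpha> * l) (row f (- l))) n"
    and cog: "\<And>l n. co g' (l, n) = - (\<alpha> * l) * cf (Aop \<beta> (\<alpha> * l) (row g (- l))) n"
  shows "JL_rel \<beta> p (\<lambda>z. Complex (f z) (g z)) (\<lambda>z. Complex (f' z) (g' z))"
  unfolding JL_rel_def
proof (intro conjI in_L2_Complex f g f' g' exI[of _ "\<lambda>z. Complex (invlap p f z) (invlap p g z)"] inv_lap_Complex allI impI)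
  fix \<phi> assume t: "test p \<phi>"
  have sc: "r *\<^sub>R Complex a b = Complex (r * a) (r * b)" for r a b by (simp add: complex_eq_iff)
  have sc2: "r *\<^sub>R ((1 / pi\<^sup>2) *\<^sub>R Complex a b - Complex a' b') = Complex (r * (a / pi\<^sup>2 - a')) (r * (b / pi\<^sup>2 - b'))" for r a b a' b'
    by (simp add: complex_eq_iff)
  have K: "L2 M (\<lambda>z. Kf \<beta> (snd z) * px \<phi> z)" by (intro Kf_L2 test_L2 t)
  have e: "integral\<^sup>L M (\<lambda>z. \<phi> z * f' z) = integral\<^sup>L M (\<lambda>z. (Kf \<beta> (snd z) * px \<phi> z) * Lop p f z)"
    "integral\<^sup>L M (\<lambda>z. \<phi> z * g' z) = integral\<^sup>L M (\<lambda>z. (Kf \<beta> (snd z) * px \<phi> z) * Lop p g z)"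
    using JL_real[OF f f' t cof] JL_real[OF g g' t cog] by simp_all
  have "(LINT z:Omega p|lborel. \<phi> z *\<^sub>R Complex (f' z) (g' z)) = Complex (integral\<^sup>L M (\<lambda>z. \<phi> z * f' z)) (integral\<^sup>L M (\<lambda>z. \<phi> z * g' z))"
    unfolding integral_M sc by (intro integral_Complex L2_mult[OF test_L2(1)[OF t]] f' g')
  also have "\<dots> = integral\<^sup>L M (\<lambda>z. Complex ((Kf \<beta> (snd z) * px \<phi> z) * Lop p f z) ((Kf \<beta> (snd z) * px \<phi> z) * Lop p g z))"
    unfolding e by (intro integral_Complex[symmetric] L2_mult[OF K] Lop_L2 f g)
  also have "\<dots> = (LINT z:Omega p|lborel. ((\<beta> - Upp (snd z)) * px \<phi> z) *\<^sub>R
      ((1 / pi\<^sup>2) *\<^sub>R Complex (f z) (g z) - Complex (invlap p f z) (invlap p g z)))"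
    unfolding integral_M sc2 by (simp add: Kf_def Lop_def)
  finally show "(LINT z:Omega p|lborel. \<phi> z *\<^sub>R Complex (f' z) (g' z)) =
    (LINT z:Omega p|lborel. ((\<beta> - Upp (snd z)) * px \<phi> z) *\<^sub>R
      ((1 / pi\<^sup>2) *\<^sub>R Complex (f z) (g z) - Complex (invlap p f z) (invlap p g z)))" .
qed

end

section \<open>Unstable eigenfunctions and the center space\<close>

context wave
begin

lemma has_sum_row:
  assumes "L2 M f" "L2 M g"
  shows "((\<lambda>i. co f i * co g i) has_sum inner (row f l) (row g l)) ({l} \<times> UNIV)"
proof -
  have "(\<lambda>i. co f i * co g i) summable_on {l} \<times> UNIV"
    using has_sum_imp_summable[OF expansion[OF assms]] by (rule summable_on_subset_banach) auto
  then obtain s where s: "((\<lambda>i. co f i * co g i) has_sum s) ({l} \<times> UNIV)" by (auto simp: summable_on_def)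
  have bij: "bij_betw (\<lambda>n. (l, n)) UNIV ({l} \<times> (UNIV :: nat set))" by (auto simp: bij_betw_def inj_on_def)
  have "((\<lambda>n. co f (l, n) * co g (l, n)) has_sum s) UNIV"
    using s has_sum_reindex_bij_betw[OF bij, of "\<lambda>i. co f i * co g i" s] by simp
  then have "(\<lambda>n. co f (l, n) * co g (l, n)) sums s" by (rule has_sum_imp_sums)
  then have "s = inner (row f l) (row g l)" by (simp add: inner_ell2_def cf_row assms sums_iff)
  then show ?thesis using s by simp
qed

lemma ips_two_rows:
  assumes f: "L2 M f" and g: "L2 M g" and l: "l > 0" and z: "\<And>k n. k \<noteq> l \<Longrightarrow> k \<noteq> - l \<Longrightarrow> co g (k, n) = 0"
  shows "ips M f g = inner (row f l) (row g l) + inner (row f (- l)) (row g (- l))"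
proof -
  have "((\<lambda>i. co f i * co g i) has_sum inner (row f l) (row g l) + inner (row f (- l)) (row g (- l))) ({l} \<times> UNIV \<union> {- l} \<times> UNIV)"
    using l by (intro has_sum_Un_disjoint has_sum_row f g) auto
  moreover have "((\<lambda>i. co f i * co g i) has_sum ips M f g) ({l} \<times> UNIV \<union> {- l} \<times> UNIV)"
    by (rule has_sum_cong_neutral[THEN iffD1, OF _ _ _ expansion[OF f g]]) (use z in auto)
  ultimately show ?thesis by (rule has_sum_unique[rotated])
qed

lemma exists_two_rows:
  assumes l: "l > 0"
  obtains f where "L2 M f" "row f l = x" "row f (- l) = y" "\<And>k. k \<noteq> l \<Longrightarrow> k \<noteq> - l \<Longrightarrow> row f k = 0"
proof -
  define r where "r k = (if k = l then x else if k = - l then y else 0)" for k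
  have s: "(\<lambda>i. (cf (r (fst i)) (snd i))\<^sup>2) summable_on {k} \<times> UNIV" for k
  proof -
    have bij: "bij_betw (\<lambda>n. (k, n)) UNIV ({k} \<times> (UNIV :: nat set))" by (auto simp: bij_betw_def inj_on_def)
    have "(\<lambda>n. (cf (r k) n)\<^sup>2) summable_on UNIV"
      by (simp add: summable_on_UNIV_nonneg_real_iff summable_cf_sq)
    then show ?thesis using summable_on_reindex_bij_betw[OF bij, of "\<lambda>i. (cf (r (fst i)) (snd i))\<^sup>2"] by simp
  qed
  have "(\<lambda>i. (cf (r (fst i)) (snd i))\<^sup>2) summable_on ({l} \<times> UNIV \<union> {- l} \<times> UNIV)"
    using l by (intro summable_on_Un_disjoint s) auto
  then have "(\<lambda>i. (cf (r (fst i)) (snd i))\<^sup>2) summable_on UNIV"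
    by (rule summable_on_cong_neutral[THEN iffD1, rotated -1]) (auto simp: r_def)
  then obtain f where f: "L2 M f" "\<And>i. co f i = cf (r (fst i)) (snd i)" by (rule exists_with_coeffs) blast
  have "row f k = r k" for k by (rule ell2_eqI) (simp add: cf_row f)
  then show ?thesis using f(1) l by (intro that[of f]) (auto simp: r_def)
qed

lemma co_of_row: "L2 M f \<Longrightarrow> co f (k, n) = cf (row f k) n"
  by (simp add: cf_row)

lemma AE_zero_row:
  assumes "L2 M f" "AE z in M. f z = 0"
  shows "row f k = 0"
proof (rule ell2_eqI)
  fix n
  have "co f (k, n) = co (\<lambda>z. 0) (k, n)" unfolding co_def
    using assms by (intro ips_cong_AE L2_zero eb_L2)
  then show "cf (row f k) n = cf 0 n" using assms(1) by (simp add: cf_row co_def ips_def)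
qed

text \<open>The relation f' = J L f for real functions, read row by row.\<close>

definition eig_rel :: "real \<Rightarrow> (real \<times> real \<Rightarrow> real) \<Rightarrow> (real \<times> real \<Rightarrow> real) \<Rightarrow> bool" where
  "eig_rel \<beta> f f' \<longleftrightarrow> L2 M f \<and> L2 M f' \<and> (\<forall>k. row f' k = (- (\<alpha> * k)) *\<^sub>R Aop \<beta> (\<alpha> * k) (row f (- k)))"

lemma row_cmult: "L2 M f \<Longrightarrow> row (\<lambda>z. c * f z) k = c *\<^sub>R row f k"
  by (rule ell2_eqI) (simp add: cf_row L2_cmult co_cmult)

lemma row_add: "L2 M f \<Longrightarrow> L2 M g \<Longrightarrow> row (\<lambda>z. f z + g z) l = row f l + row g l"
  by (rule ell2_eqI) (simp add: cf_row L2_add co_add)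

lemma eig_rel_cmult:
  assumes "eig_rel \<beta> f f'"
  shows "eig_rel \<beta> (\<lambda>z. c * f z) (\<lambda>z. c * f' z)"
proof -
  interpret A: bounded_linear "Aop \<beta> a" for a by (rule bounded_linear_Aop)
  show ?thesis using assms by (simp add: eig_rel_def L2_cmult row_cmult A.scaleR mult_ac)
qed

text \<open>Separating real and imaginary parts of J L (f + i g) = (c + i d) (f + i g) gives the two
  hypotheses. The chain of generalized eigenvectors stops after one step.\<close>

lemma gen_eig_Complex:
  assumes r: "eig_rel \<beta> f (\<lambda>z. c * f z - d * g z)" "eig_rel \<beta> g (\<lambda>z. c * g z + d * f z)"
    and z: "row f 0 = 0" "row g 0 = 0" and nz: "row f k \<noteq> 0 \<or> row g k \<noteq> 0"
  shows "gen_eig \<beta> p (Complex c d) (\<lambda>z. Complex (f z) (g z))"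
proof -
  have f: "L2 M f" and g: "L2 M g" using r by (simp_all add: eig_rel_def)
  have X: "inX p f" "inX p g" using z f g by (simp_all add: inX_iff co_of_row)
  have iX: "inX p (\<lambda>z. Complex (f z) (g z))" by (intro inX_Complex f g X)
  have nze: "\<not> ae_eq p (\<lambda>z. Complex (f z) (g z)) (\<lambda>_. 0)"
  proof
    assume "ae_eq p (\<lambda>z. Complex (f z) (g z)) (\<lambda>_. 0)"
    then have "AE z in M. Complex (f z) (g z) = 0" by (simp add: ae_eq_def AE_M)
    then have "AE z in M. f z = 0" "AE z in M. g z = 0" by (auto simp: complex_eq_iff)
    then show False using nz AE_zero_row[OF f] AE_zero_row[OF g] by blast
  qed
  have J: "JL_rel \<beta> p (\<lambda>z. Complex (f z) (g z)) (\<lambda>z. Complex (c * f z - d * g z) (c * g z + d * f z))"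
    by (intro JL_rel_Complex) (use r in \<open>auto simp: eig_rel_def co_of_row\<close>)
  define vs where "vs j z = (if j = 0 then Complex (f z) (g z) else 0)" for j :: nat and z
  have v0: "vs 0 = (\<lambda>z. Complex (f z) (g z))" and v1: "vs (Suc 0) = (\<lambda>_. 0)" by (simp_all add: vs_def fun_eq_iff)
  have "(\<lambda>z. vs (Suc 0) z + Complex c d * vs 0 z) = (\<lambda>z. Complex (c * f z - d * g z) (c * g z + d * f z))"
    by (simp add: vs_def fun_eq_iff complex_eq_iff)
  then have "\<forall>j<Suc 0. inX p (vs j) \<and> JL_rel \<beta> p (vs j) (\<lambda>z. vs (Suc j) z + Complex c d * vs j z)"
    using J iX by (simp add: v0 less_Suc_eq)
  moreover have "ae_eq p (vs (Suc 0)) (\<lambda>_. 0)" by (simp add: ae_eq_def v1)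
  ultimately show ?thesis unfolding gen_eig_def using iX nze v0 by blast
qed

text \<open>The real and imaginary parts are combinations of the eigenfunction and its conjugate: f
  = (v + cnj v) / 2 and g = - i (v - cnj v) / 2.\<close>

lemma Espace_of_eig:
  assumes X: "inX p f" "inX p g" and e: "gen_eig \<beta> p \<mu> (\<lambda>z. Complex (f z) (g z))" "gen_eig \<beta> p (cnj \<mu>) (\<lambda>z. Complex (f z) (- g z))"
    and P: "P \<mu>" "P (cnj \<mu>)"
  shows "f \<in> Espace \<beta> p P" "g \<in> Espace \<beta> p P"
proof -
  define ls where "ls j = (if j = 0 then \<mu> else cnj \<mu>)" for j :: nat
  define vs where "vs j z = (if j = 0 then Complex (f z) (g z) else Complex (f z) (- g z))" for j :: nat and z
  have v: "vs 0 = (\<lambda>z. Complex (f z) (g z))" "vs (Suc 0) = (\<lambda>z. Complex (f z) (- g z))" by (simp_all add: vs_def fun_eq_iff)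
  have a: "\<forall>j<2. P (ls j) \<and> gen_eig \<beta> p (ls j) (vs j)"
    using e P by (auto simp: less_2_cases_iff ls_def v)
  have "h \<in> Espace \<beta> p P" if "inX p h" "\<And>z. complex_of_real (h z) = cs 0 * vs 0 z + cs 1 * vs 1 z" for h and cs :: "nat \<Rightarrow> complex"
  proof -
    have "ae_eq p (\<lambda>z. complex_of_real (h z)) (\<lambda>z. \<Sum>j<2. cs j * vs j z)"
      using that(2) by (simp add: ae_eq_def numeral_2_eq_2)
    then show ?thesis using that(1) a unfolding Espace_def by blast
  qed
  from this[OF X(1), of "\<lambda>j. 1/2"] this[OF X(2), of "\<lambda>j. if j = 0 then - \<i> / 2 else \<i> / 2"]
  show "f \<in> Espace \<beta> p P" "g \<in> Espace \<beta> p P" by (simp_all add: v complex_eq_iff)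
qed

lemma zero_in_Espace: "(\<lambda>z. 0) \<in> Espace \<beta> p P"
proof -
  have "inX p (\<lambda>z. 0 :: real)" by (simp add: inX_iff L2_zero co_def ips_def)
  then show ?thesis unfolding Espace_def by (auto simp: ae_eq_def intro!: exI[of _ "0::nat"])
qed

lemma Ec_orthogonal:
  assumes w: "\<omega> \<in> Ec \<beta> p" and h: "h \<in> Es \<beta> p \<or> h \<in> Eu \<beta> p"
  shows "ips M (Lop p \<omega>) h = 0"
proof -
  have orth: "ip p (Lop p \<omega>) (\<lambda>z. a z + b z) = 0" if "a \<in> Es \<beta> p" "b \<in> Eu \<beta> p" for a b
    using w that unfolding Ec_def by blast
  have "(\<lambda>z. 0) \<in> Es \<beta> p" "(\<lambda>z. 0) \<in> Eu \<beta> p" by (simp_all add: Es_def Eu_def zero_in_Espace)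
  then show ?thesis using orth[of h "\<lambda>z. 0"] orth[of "\<lambda>z. 0" h] h by (auto simp: ip_eq)
qed

lemma Ec_rows:
  assumes w: "\<omega> \<in> Ec \<beta> p" and l: "l > 0" and u: "upair \<beta> (\<alpha> * l) cr ci u1 u2"
  shows "inner (Lo (\<alpha> * l) u1) (row \<omega> l) = inner (Lo (\<alpha> * l) u2) (row \<omega> (- l))"
    and "inner (Lo (\<alpha> * l) u2) (row \<omega> l) = - inner (Lo (\<alpha> * l) u1) (row \<omega> (- l))"
proof -
  define a where "a = \<alpha> * l"
  have a: "a > 0" using alpha l by (simp add: a_def)
  have A: "Aop \<beta> a u1 = cr *\<^sub>R u1 - ci *\<^sub>R u2" "Aop \<beta> a u2 = ci *\<^sub>R u1 + cr *\<^sub>R u2" "ci \<noteq> 0" "u1 \<noteq> 0 \<or> u2 \<noteq> 0"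
    using u by (auto simp: upair_def a_def)
  interpret A: bounded_linear "Aop \<beta> b" for b by (rule bounded_linear_Aop)
  \<comment> \<open>Up to normalization, f + i g will be the function (u1 + i u2) e^(i a x): its
    rows at l and - l are u and i u with u = u1 + i u2.\<close>
  obtain f where f: "L2 M f" "row f l = u1" "row f (- l) = - u2" "\<And>k. k \<noteq> l \<Longrightarrow> k \<noteq> - l \<Longrightarrow> row f k = 0"
    by (rule exists_two_rows[OF l]) blast
  obtain g where g: "L2 M g" "row g l = u2" "row g (- l) = u1" "\<And>k. k \<noteq> l \<Longrightarrow> k \<noteq> - l \<Longrightarrow> row g k = 0"
    by (rule exists_two_rows[OF l]) blast
  have L: "L2 M \<omega>" using w by (simp add: Ec_def inX_def in_L2_iff)
  have z: "row f 0 = 0" "row g 0 = 0" using f(4)[of 0] g(4)[of 0] l by simp_all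
  have X: "inX p f" "inX p g" using z f(1) g(1) by (simp_all add: inX_iff co_of_row)
  have am: "\<alpha> * real_of_int (- l) = - a" "\<alpha> * real_of_int l = a" by (simp_all add: a_def)
  \<comment> \<open>On e^(i a x) the operator J L acts as - i a A, so the eigenvalue is - i a (cr +
    i ci). Its real part a ci decides between the stable and the unstable space.\<close>
  define c d where "c = a * ci" and "d = - (a * cr)"
  have r: "eig_rel \<beta> f (\<lambda>z. c * f z - d * g z)" "eig_rel \<beta> g (\<lambda>z. c * g z + d * f z)"
  proof -
    have "row (\<lambda>z. c * f z - d * g z) k = (- (\<alpha> * k)) *\<^sub>R Aop \<beta> (\<alpha> * k) (row f (- k)) \<and>
        row (\<lambda>z. c * g z + d * f z) k = (- (\<alpha> * k)) *\<^sub>R Aop \<beta> (\<alpha> * k) (row g (- k))" for k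
    proof -
      consider "k = l" | "k = - l" | "k \<noteq> l" "k \<noteq> - l" by blast
      then show ?thesis
      proof cases
        case 1
        then show ?thesis
          by (simp only: row_diff row_add row_cmult L2_cmult f(1-3) g(1-3) am A A.neg c_def d_def) (simp add: algebra_simps)
      next
        case 2
        then show ?thesis
          by (simp only: row_diff row_add row_cmult L2_cmult f(1-3) g(1-3) am A A.neg c_def d_def Aop_even minus_minus) (simp add: algebra_simps)
      next
        case 3
        then have "- k \<noteq> l" "- k \<noteq> - l" by auto
        with 3 show ?thesis by (simp add: row_diff row_add row_cmult L2_cmult f(1,4) g(1,4) A.zero)
      qed
    qed
    then show "eig_rel \<beta> f (\<lambda>z. c * f z - d * g z)" "eig_rel \<beta> g (\<lambda>z. c * g z + d * f z)"
      by (simp_all add: eig_rel_def f(1) g(1) L2_cmult L2_diff L2_add)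
  qed
  have nz: "row f l \<noteq> 0 \<or> row g l \<noteq> 0" using A(4) by (simp add: f(2) g(2))
  have e1: "gen_eig \<beta> p (Complex c d) (\<lambda>z. Complex (f z) (g z))" by (rule gen_eig_Complex[OF r z nz])
  have "eig_rel \<beta> f (\<lambda>z. c * f z - (- d) * (-1 * g z))" using r(1) by simp
  moreover have "eig_rel \<beta> (\<lambda>z. -1 * g z) (\<lambda>z. c * (-1 * g z) + (- d) * f z)"
    using eig_rel_cmult[OF r(2), of "-1"] by (simp add: algebra_simps)
  ultimately have e2: "gen_eig \<beta> p (cnj (Complex c d)) (\<lambda>z. Complex (f z) (- g z))"
    using gen_eig_Complex[of \<beta> f c "- d" "\<lambda>z. -1 * g z" l] z nz
    by (simp add: row_cmult[OF g(1), of "-1", simplified] complex_cnj)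
  have "c \<noteq> 0" using a A(3) by (simp add: c_def)
  then consider "c > 0" | "c < 0" by linarith
  then have m: "(f \<in> Es \<beta> p \<or> f \<in> Eu \<beta> p) \<and> (g \<in> Es \<beta> p \<or> g \<in> Eu \<beta> p)"
  proof cases
    case 1 then show ?thesis unfolding Eu_def using Espace_of_eig[OF X e1 e2, of "\<lambda>x. Re x > 0"] by simp
  next
    case 2 then show ?thesis unfolding Es_def using Espace_of_eig[OF X e1 e2, of "\<lambda>x. Re x < 0"] by simp
  qed
  have "ips M (Lop p \<omega>) h = inner (Lo a (row \<omega> l)) (row h l) + inner (Lo a (row \<omega> (- l))) (row h (- l))"
    if "L2 M h" "\<And>k. k \<noteq> l \<Longrightarrow> k \<noteq> - l \<Longrightarrow> row h k = 0" for h
    using ips_two_rows[OF Lop_L2[OF L] that(1) l] that by (simp only: co_of_row row_Lop[OF L] am Lo_even) simp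
  from this[OF f(1,4)] this[OF g(1,4)] Ec_orthogonal[OF w, of f] Ec_orthogonal[OF w, of g] m
  have "inner (Lo a (row \<omega> l)) u1 - inner (Lo a (row \<omega> (- l))) u2 = 0"
    "inner (Lo a (row \<omega> l)) u2 + inner (Lo a (row \<omega> (- l))) u1 = 0"
    by (simp_all add: f(2,3) g(2,3))
  then show "inner (Lo (\<alpha> * l) u1) (row \<omega> l) = inner (Lo (\<alpha> * l) u2) (row \<omega> (- l))"
    "inner (Lo (\<alpha> * l) u2) (row \<omega> l) = - inner (Lo (\<alpha> * l) u1) (row \<omega> (- l))"
    by (simp_all add: a_def[symmetric] inner_Lo_comm[of a u1] inner_Lo_comm[of a u2])
qed

text \<open>The conjugate pair (u1, - u2) is again an eigenpair, with growth rate of the opposite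
  sign. Its two relations, added to those of the original pair, separate the four pairings.\<close>

lemma Ec_rows_orthogonal:
  assumes w: "\<omega> \<in> Ec \<beta> p" and l: "l > 0" and u: "upair \<beta> (\<alpha> * l) cr ci u1 u2"
  shows "inner (Lo (\<alpha> * l) u1) (row \<omega> l) = 0" "inner (Lo (\<alpha> * l) u2) (row \<omega> l) = 0"
    "inner (Lo (\<alpha> * l) u1) (row \<omega> (- l)) = 0" "inner (Lo (\<alpha> * l) u2) (row \<omega> (- l)) = 0"
proof -
  interpret A: bounded_linear "Aop \<beta> (\<alpha> * l)" by (rule bounded_linear_Aop)
  interpret Lo: bounded_linear "Lo (\<alpha> * l)" by (rule bounded_linear_Lo)
  have "upair \<beta> (\<alpha> * l) cr (- ci) u1 (- u2)" using u by (auto simp: upair_def A.neg)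
  from Ec_rows[OF w l this] Ec_rows[OF w l u]
  show "inner (Lo (\<alpha> * l) u1) (row \<omega> l) = 0" "inner (Lo (\<alpha> * l) u2) (row \<omega> l) = 0"
    "inner (Lo (\<alpha> * l) u1) (row \<omega> (- l)) = 0" "inner (Lo (\<alpha> * l) u2) (row \<omega> (- l)) = 0"
    by (simp_all add: Lo.neg)
qed

end

section \<open>Decay of a single mode\<close>

text \<open>A is symmetric for the energy and preserves the span of u1 and u2, so the four pairings
  solve a closed linear system with zero initial data. A Gronwall argument for the sum of their
  squares finishes.\<close>

lemma invariant_complement:
  fixes P Q :: "real \<Rightarrow> ell2"
  assumes u: "upair \<beta> a cr ci u1 u2"
    and P: "\<And>t. t \<ge> 0 \<Longrightarrow> (P has_vector_derivative (- a) *\<^sub>R Aop \<beta> a (Q t)) (at t within {0..})"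
    and Q: "\<And>t. t \<ge> 0 \<Longrightarrow> (Q has_vector_derivative a *\<^sub>R Aop \<beta> a (P t)) (at t within {0..})"
    and init: "inner (Lo a u1) (P 0) = 0" "inner (Lo a u2) (P 0) = 0" "inner (Lo a u1) (Q 0) = 0" "inner (Lo a u2) (Q 0) = 0"
    and t: "t \<ge> 0"
  shows "inner (Lo a u1) (P t) = 0 \<and> inner (Lo a u2) (P t) = 0 \<and> inner (Lo a u1) (Q t) = 0 \<and> inner (Lo a u2) (Q t) = 0"
proof -
  interpret Lo: bounded_linear "Lo a" by (rule bounded_linear_Lo)
  have A: "Aop \<beta> a u1 = cr *\<^sub>R u1 - ci *\<^sub>R u2" "Aop \<beta> a u2 = ci *\<^sub>R u1 + cr *\<^sub>R u2"
    using u by (auto simp: upair_def)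
  define p1 p2 q1 q2 where "p1 t = inner (Lo a u1) (P t)" and "p2 t = inner (Lo a u2) (P t)"
    and "q1 t = inner (Lo a u1) (Q t)" and "q2 t = inner (Lo a u2) (Q t)" for t
  have m: "inner (Lo a u1) (Aop \<beta> a x) = cr * inner (Lo a u1) x - ci * inner (Lo a u2) x"
    "inner (Lo a u2) (Aop \<beta> a x) = ci * inner (Lo a u1) x + cr * inner (Lo a u2) x" for x
    unfolding inner_Aop_sym[symmetric] A by (simp_all add: Lo.diff Lo.add Lo.scaleR inner_diff_left inner_add_left)
  have d: "(p1 has_real_derivative (- a) * (cr * q1 t - ci * q2 t)) (at t within {0..})"
    "(p2 has_real_derivative (- a) * (ci * q1 t + cr * q2 t)) (at t within {0..})"
    "(q1 has_real_derivative a * (cr * p1 t - ci * p2 t)) (at t within {0..})"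
    "(q2 has_real_derivative a * (ci * p1 t + cr * p2 t)) (at t within {0..})" if "t \<ge> 0" for t
    using bounded_linear.has_vector_derivative[OF bounded_linear_inner_right P[OF that], of "Lo a u1"]
      bounded_linear.has_vector_derivative[OF bounded_linear_inner_right P[OF that], of "Lo a u2"]
      bounded_linear.has_vector_derivative[OF bounded_linear_inner_right Q[OF that], of "Lo a u1"]
      bounded_linear.has_vector_derivative[OF bounded_linear_inner_right Q[OF that], of "Lo a u2"]
    by (simp_all add: has_real_derivative_iff_has_vector_derivative m p1_def[abs_def] p2_def[abs_def] q1_def[abs_def] q2_def[abs_def])
  \<comment> \<open>In the derivative of E the terms with cr cancel and 4 a ci (p1 q2 - p2 q1)
    remains, which is at most C E.\<close>
  define C where "C = 2 * \<bar>a * ci\<bar>"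
  define E where "E t = (p1 t)\<^sup>2 + (p2 t)\<^sup>2 + (q1 t)\<^sup>2 + (q2 t)\<^sup>2" for t
  define h where "h t = exp (- C * t) * E t" for t
  have hd: "(h has_real_derivative exp (- C * t) * (4 * a * ci * (p1 t * q2 t - p2 t * q1 t) - C * E t)) (at t within {0..})"
    if "t \<ge> 0" for t
    unfolding h_def[abs_def] E_def[abs_def]
    by (rule derivative_eq_intros refl d[OF that])+ (simp add: algebra_simps power2_eq_square)
  have neg: "4 * a * ci * (p1 t * q2 t - p2 t * q1 t) - C * E t \<le> 0" for t
  proof -
    have "\<bar>2 * (p1 t * q2 t - p2 t * q1 t)\<bar> \<le> E t"
    proof -
      have "0 \<le> (p1 t - q2 t)\<^sup>2" "0 \<le> (p1 t + q2 t)\<^sup>2" "0 \<le> (p2 t - q1 t)\<^sup>2" "0 \<le> (p2 t + q1 t)\<^sup>2" by simp_all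
      then have "2 * (p1 t * q2 t) \<le> (p1 t)\<^sup>2 + (q2 t)\<^sup>2" "- (2 * (p1 t * q2 t)) \<le> (p1 t)\<^sup>2 + (q2 t)\<^sup>2"
        "2 * (p2 t * q1 t) \<le> (p2 t)\<^sup>2 + (q1 t)\<^sup>2" "- (2 * (p2 t * q1 t)) \<le> (p2 t)\<^sup>2 + (q1 t)\<^sup>2"
        unfolding power2_sum power2_diff by simp_all
      then have "2 * (p1 t * q2 t - p2 t * q1 t) \<le> E t" "- (2 * (p1 t * q2 t - p2 t * q1 t)) \<le> E t"
        unfolding E_def right_diff_distrib by linarith+
      then show ?thesis by linarith
    qed
    then have "\<bar>2 * (a * ci)\<bar> * \<bar>2 * (p1 t * q2 t - p2 t * q1 t)\<bar> \<le> C * E t"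
      unfolding C_def by (simp add: mult_left_mono abs_mult)
    then have "2 * (a * ci) * (2 * (p1 t * q2 t - p2 t * q1 t)) \<le> C * E t"
      using abs_ge_self[of "2 * (a * ci) * (2 * (p1 t * q2 t - p2 t * q1 t))"] by (simp only: abs_mult)
    then show ?thesis by (simp add: mult_ac)
  qed
  have "h t \<le> h 0"
  proof (rule DERIV_nonpos_imp_decreasing_open[OF t])
    show "\<exists>y. (h has_real_derivative y) (at s) \<and> y \<le> 0" if "0 < s" "s < t" for s
    proof (intro exI conjI)
      have "at s within {0..} = at s" using that by (intro at_within_interior) simp
      then show "(h has_real_derivative exp (- C * s) * (4 * a * ci * (p1 s * q2 s - p2 s * q1 s) - C * E s)) (at s)"
        using hd[of s] that by simp
      show "exp (- C * s) * (4 * a * ci * (p1 s * q2 s - p2 s * q1 s) - C * E s) \<le> 0"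
        using neg[of s] by (simp add: mult_le_0_iff)
    qed
    have "continuous_on {0..} h"
      using hd by (auto simp: continuous_on_eq_continuous_within intro!: DERIV_continuous)
    then show "continuous_on {0..t} h" by (rule continuous_on_subset) auto
  qed
  also have "h 0 = 0" using init by (simp add: h_def E_def p1_def p2_def q1_def q2_def)
  finally have "E t \<le> 0" by (simp add: h_def mult_le_0_iff)
  moreover have "0 \<le> (p1 t)\<^sup>2" "0 \<le> (p2 t)\<^sup>2" "0 \<le> (q1 t)\<^sup>2" "0 \<le> (q2 t)\<^sup>2" by simp_all
  ultimately have "(p1 t)\<^sup>2 = 0 \<and> (p2 t)\<^sup>2 = 0 \<and> (q1 t)\<^sup>2 = 0 \<and> (q2 t)\<^sup>2 = 0" unfolding E_def by linarith
  then show ?thesis by (simp add: p1_def p2_def q1_def q2_def)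
qed

text \<open>For a > 0 this is the projection off the kernel of \<open>Lo a\<close>, which is
  nontrivial exactly at resonance.\<close>

definition red :: "real \<Rightarrow> ell2 \<Rightarrow> ell2" where
  "red a x = (if mm a 0 = pi\<^sup>2 then x - cf x 0 *\<^sub>R unitv 0 else x)"

lemma cf_red: "a > 0 \<Longrightarrow> cf (red a x) n = (if mm a n = pi\<^sup>2 then 0 else cf x n)"
  using mm_gt[of a n] by (cases n) (auto simp: red_def cf_unitv)

lemma inner_Lo_upper: "inner (Lo a x) x \<le> (norm x)\<^sup>2 / pi\<^sup>2"
proof -
  have "(\<Sum>k. dd a k * cf x k * cf x k) \<le> (\<Sum>k. 1 / pi\<^sup>2 * (cf x k)\<^sup>2)"
  proof (rule suminf_le)
    show "summable (\<lambda>k. 1 / pi\<^sup>2 * (cf x k)\<^sup>2)" by (intro summable_mult summable_cf_sq)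
    show "summable (\<lambda>k. dd a k * cf x k * cf x k)" by (rule inner_diagop(2)[OF bounded_dd])
    show "dd a k * cf x k * cf x k \<le> 1 / pi\<^sup>2 * (cf x k)\<^sup>2" for k
      using mult_right_mono[OF dd_le(1)[of a k], of "(cf x k)\<^sup>2"] by (simp add: power2_eq_square mult_ac)
  qed
  with suminf_mult[OF summable_cf_sq, of "1 / pi\<^sup>2" x] show ?thesis
    by (simp add: Lo_def inner_diagop(1)[OF bounded_dd] norm_ell2_sq)
qed

text \<open>The three positions of \<open>mm a 0\<close> relative to pi^2 give the three instances
  of the rotating flow. In the positive case the constant is stated explicitly, since infinitely
  many modes are of this kind and a common lower bound is wanted.\<close>

theorem mode_decay:
  fixes P Q :: "real \<Rightarrow> ell2"
  assumes u: "upair \<beta> \<alpha> cr ci u1 u2" and a: "0 < \<alpha>" "\<alpha> \<le> a"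
    and P: "\<And>t. t \<ge> 0 \<Longrightarrow> (P has_vector_derivative (- a) *\<^sub>R Aop \<beta> a (Q t)) (at t within {0..})"
    and Q: "\<And>t. t \<ge> 0 \<Longrightarrow> (Q has_vector_derivative a *\<^sub>R Aop \<beta> a (P t)) (at t within {0..})"
    and init: "\<And>cr ci u1 u2. upair \<beta> a cr ci u1 u2 \<Longrightarrow>
      inner (Lo a u1) (P 0) = 0 \<and> inner (Lo a u2) (P 0) = 0 \<and> inner (Lo a u1) (Q 0) = 0 \<and> inner (Lo a u2) (Q 0) = 0"
  shows "\<exists>\<delta>>0. (dd a 0 > 0 \<longrightarrow> \<delta> = dd a 0) \<and>
     (\<forall>t\<ge>0. \<delta> * ((norm (red a (P t)))\<^sup>2 + (norm (red a (Q t)))\<^sup>2) \<le> ((norm (P 0))\<^sup>2 + (norm (Q 0))\<^sup>2) / pi\<^sup>2)"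
    (is "?bound")
    and "((\<lambda>T. (1 / T) * integral {0..T} (\<lambda>t. (cf (red a (P t)) k)\<^sup>2 + (cf (red a (Q t)) k)\<^sup>2)) \<longlongrightarrow> 0) at_top"
    (is "?lim")
proof -
  have a0: "a > 0" using a by simp
  interpret Lo: bounded_linear "Lo a" by (rule bounded_linear_Lo)
  interpret A: bounded_linear "Aop \<beta> a" by (rule bounded_linear_Aop)
  have ub: "inner (Lo a (P 0)) (P 0) + inner (Lo a (Q 0)) (Q 0) \<le> ((norm (P 0))\<^sup>2 + (norm (Q 0))\<^sup>2) / pi\<^sup>2"
    using inner_Lo_upper[of a "P 0"] inner_Lo_upper[of a "Q 0"] by (simp add: add_divide_distrib)
  consider "mm a 0 < pi\<^sup>2" | "mm a 0 > pi\<^sup>2" | "mm a 0 = pi\<^sup>2" by linarith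
  then have "?bound \<and> ?lim"
  proof cases
    case 1
    obtain cr' ci' v1 v2 where v: "upair \<beta> a cr' ci' v1 v2" using exists_upair[OF u a 1] by blast
    obtain \<delta> where d: "\<delta> > 0" "\<And>x. inner (Lo a v1) x = 0 \<Longrightarrow> inner (Lo a v2) x = 0 \<Longrightarrow> \<delta> * (norm x)\<^sup>2 \<le> inner (Lo a x) x"
      using coercive_on_complement[OF v a0] by blast
    define H where "H = {x. \<forall>n\<in>{Lo a v1, Lo a v2}. inner n x = 0}"
    have Av: "Aop \<beta> a v1 = cr' *\<^sub>R v1 - ci' *\<^sub>R v2" "Aop \<beta> a v2 = ci' *\<^sub>R v1 + cr' *\<^sub>R v2"
      using v by (auto simp: upair_def)
    have inv: "P t \<in> H \<and> Q t \<in> H" if "t \<ge> 0" for t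
      using invariant_complement[OF v P Q _ _ _ _ that] init[OF v] by (simp add: H_def)
    interpret rotating_flow "Lo a" "Aop \<beta> a" "{Lo a v1, Lo a v2}" H \<delta> P Q a
    proof unfold_locales
      show "Aop \<beta> a x \<in> H" if "x \<in> H" for x
        using that unfolding H_def
        by (simp add: inner_Aop_sym[symmetric] Av Lo.diff Lo.add Lo.scaleR inner_diff_left inner_add_left)
      show "x = 0" if "Aop \<beta> a x = \<kappa> *\<^sub>R x" for x \<kappa>
        using no_neutral_mode[OF u a _ that] 1 by simp
    qed (use d a0 P Q inv in \<open>auto simp: H_def intro: inner_Lo_sym inner_Aop_sym\<close>)
    have "red a x = x" for x using 1 by (simp add: red_def)
    moreover have "\<not> dd a 0 > 0" using 1 by (simp add: dd_pos_iff)
    ultimately show ?thesis using d(1) flow_bound ub time_average_vanishes[of k]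
      by (auto simp: b_def intro!: exI[of _ \<delta>] intro: order_trans)
  next
    case 2
    have dp: "dd a 0 > 0" using 2 by (simp add: dd_pos_iff)
    interpret rotating_flow "Lo a" "Aop \<beta> a" "{}" UNIV "dd a 0" P Q a
    proof unfold_locales
      show "x = 0" if "Aop \<beta> a x = \<kappa> *\<^sub>R x" for x \<kappa>
        using no_neutral_mode[OF u a _ that] 2 by simp
      show "dd a 0 * (norm x)\<^sup>2 \<le> inner (Lo a x) x" for x by (rule inner_Lo_lower[OF a0]) auto
    qed (use dp a0 P Q in \<open>auto intro: inner_Lo_sym inner_Aop_sym\<close>)
    have "red a x = x" for x using 2 by (simp add: red_def)
    then show ?thesis using dp flow_bound ub time_average_vanishes[of k]
      by (auto simp: b_def intro!: exI[of _ "dd a 0"] intro: order_trans)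
  next
    case 3
    have d0: "dd a 0 = 0" and d1: "dd a 1 > 0" using 3 mm_gt[OF a0, of 1] by (simp_all add: dd_pos_iff)
    have r: "red a x = x - cf x 0 *\<^sub>R unitv 0" for x using 3 by (simp add: red_def)
    have blr: "bounded_linear (red a)" unfolding r[abs_def]
      by (intro bounded_linear_sub bounded_linear_ident bounded_linear_scaleR_const bounded_linear_cf)
    interpret r: bounded_linear "red a" by (rule blr)
    have Lr: "Lo a (red a x) = Lo a x" for x by (rule ell2_eqI) (simp add: cf_Lo r cf_unitv d0)
    have inr: "inner (red a x) y = inner x y" if "cf y 0 = 0" for x y
      using that by (simp add: r inner_diff_left)
    have H: "{x. \<forall>n\<in>{unitv 0}. inner n x = 0} = {x. cf x 0 = 0}" by simp
    have rH: "cf (red a x) 0 = 0" for x by (simp add: r cf_unitv)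
    have Ar: "Aop \<beta> a (red a x) = Aop \<beta> a x" for x by (simp add: Aop_def Lr)
    \<comment> \<open>L does not see the resonant component, so A x depends only on the reduced
      vector. Composing A with the projection therefore closes the reduced flow and keeps it
      symmetric for the energy.\<close>
    interpret rotating_flow "Lo a" "\<lambda>x. red a (Aop \<beta> a x)" "{unitv 0}" "{x. cf x 0 = 0}" "dd a 1"
      "\<lambda>t. red a (P t)" "\<lambda>t. red a (Q t)" a
    proof unfold_locales
      show "\<exists>K. \<forall>x. norm (red a (Aop \<beta> a x)) \<le> norm x * K"
        using bounded_linear.bounded[OF bounded_linear_compose[OF blr bounded_linear_Aop]] .
      show "inner (Lo a (red a (Aop \<beta> a x))) y = inner (Lo a x) (red a (Aop \<beta> a y))"
        if "x \<in> {x. cf x 0 = 0}" "y \<in> {x. cf x 0 = 0}" for x y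
      proof -
        have "inner (Lo a x) (red a (Aop \<beta> a y)) = inner (Aop \<beta> a y) (Lo a x)"
          unfolding inner_commute[of "Lo a x"] by (rule inr) (simp add: cf_Lo d0)
        then show ?thesis unfolding Lr inner_Aop_sym by (simp add: inner_commute)
      qed
      show "x = 0" if "x \<in> {x. cf x 0 = 0}" "red a (Aop \<beta> a x) = \<kappa> *\<^sub>R x" for x \<kappa>
      proof (rule no_neutral_mode_resonant[OF upair_beta[OF u a(1)] a0 3])
        show "cf (Aop \<beta> a x) n = \<kappa> * cf x n" if "n \<ge> 1" for n
          using arg_cong[OF \<open>red a (Aop \<beta> a x) = \<kappa> *\<^sub>R x\<close>, of "\<lambda>x. cf x n"] that by (simp add: r cf_unitv)
      qed (use that in simp)
      show "dd a 1 * (norm x)\<^sup>2 \<le> inner (Lo a x) x" if "x \<in> {x. cf x 0 = 0}" for x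
        using that by (intro inner_Lo_lower[OF a0]) auto
      show "((\<lambda>t. red a (P t)) has_vector_derivative (- a) *\<^sub>R red a (Aop \<beta> a (red a (Q t)))) (at t within {0..})"
        "((\<lambda>t. red a (Q t)) has_vector_derivative a *\<^sub>R red a (Aop \<beta> a (red a (P t)))) (at t within {0..})" if "t \<ge> 0" for t
        using r.has_vector_derivative[OF P[OF that]] r.has_vector_derivative[OF Q[OF that]]
        by (simp_all add: Ar r.scaleR r.neg)
    qed (use d1 a0 rH in \<open>auto simp: r.add r.scaleR A.add A.scaleR intro: inner_Lo_sym\<close>)
    have br: "b (red a x) (red a x) = inner (Lo a x) x" for x
    proof -
      have "b (red a x) (red a x) = inner (red a x) (Lo a x)" by (simp add: b_def Lr inner_commute)
      also have "\<dots> = inner x (Lo a x)" by (rule inr) (simp add: cf_Lo d0)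
      finally show ?thesis by (simp add: inner_commute)
    qed
    have "dd a 1 * ((norm (red a (P t)))\<^sup>2 + (norm (red a (Q t)))\<^sup>2) \<le> ((norm (P 0))\<^sup>2 + (norm (Q 0))\<^sup>2) / pi\<^sup>2"
      if "t \<ge> 0" for t
      by (rule order_trans[OF flow_bound[OF that, unfolded br] ub])
    then show ?thesis using d1 d0 time_average_vanishes[of k] by (intro conjI exI[of _ "dd a 1"]) auto
  qed
  then show ?bound ?lim by auto
qed

section \<open>Averages of the velocity\<close>

context wave
begin

lemma sum_symmetric:
  fixes F :: "int \<Rightarrow> real"
  shows "(\<Sum>l\<in>{1..N} \<union> uminus ` {1..N}. F l) = (\<Sum>l\<in>{1..N}. F l + F (- l))"
proof -
  have "sum F (uminus ` {1..N}) = (\<Sum>l\<in>{1..N}. F (- l))"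
    using sum.reindex[of uminus "{1..N}" F] by (simp add: inj_on_def o_def del: image_uminus_atLeastAtMost)
  then show ?thesis
    by (subst sum.union_disjoint) (auto simp: sum.distrib simp del: image_uminus_atLeastAtMost)
qed

lemma row_sums_le:
  assumes f: "L2 M f"
  shows "(\<Sum>l\<in>{1..N::int}. (norm (row f l))\<^sup>2 + (norm (row f (- l)))\<^sup>2) \<le> ips M f f"
proof (rule LIMSEQ_le_const2)
  have s: "(\<lambda>K. \<Sum>n<K. (cf x n)\<^sup>2) \<longlonglongrightarrow> (norm x)\<^sup>2" for x
    unfolding norm_ell2_sq by (rule summable_LIMSEQ[OF summable_cf_sq])
  show "(\<lambda>K. \<Sum>l\<in>{1..N}. (\<Sum>n<K. (cf (row f l) n)\<^sup>2) + (\<Sum>n<K. (cf (row f (- l)) n)\<^sup>2))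
     \<longlonglongrightarrow> (\<Sum>l\<in>{1..N}. (norm (row f l))\<^sup>2 + (norm (row f (- l)))\<^sup>2)"
    by (intro tendsto_sum tendsto_add s)
  have "(\<Sum>l\<in>{1..N}. (\<Sum>n<K. (cf (row f l) n)\<^sup>2) + (\<Sum>n<K. (cf (row f (- l)) n)\<^sup>2)) \<le> ips M f f" for K
  proof -
    have "(\<Sum>l\<in>{1..N}. (\<Sum>n<K. (cf (row f l) n)\<^sup>2) + (\<Sum>n<K. (cf (row f (- l)) n)\<^sup>2))
      = (\<Sum>l\<in>{1..N} \<union> uminus ` {1..N}. \<Sum>n<K. (co f (l, n))\<^sup>2)"
      unfolding sum_symmetric by (simp add: cf_row f)
    also have "\<dots> = (\<Sum>i\<in>({1..N} \<union> uminus ` {1..N}) \<times> {..<K}. (co f i)\<^sup>2)"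
      by (subst sum.cartesian_product) (auto intro!: sum.cong)
    also have "\<dots> \<le> ips M f f"
      by (rule has_sum_mono_neutral[OF has_sum_finite parseval[OF f]]) auto
    finally show ?thesis .
  qed
  then show "\<exists>k. \<forall>K\<ge>k. (\<Sum>l\<in>{1..N}. (\<Sum>n<K. (cf (row f l) n)\<^sup>2) + (\<Sum>n<K. (cf (row f (- l)) n)\<^sup>2)) \<le> ips M f f" by blast
qed

lemma norm_le_of_rows:
  assumes f: "L2 M f" and z: "row f 0 = 0"
    and le: "\<And>N. (\<Sum>l\<in>{1..N::int}. (norm (row f l))\<^sup>2 + (norm (row f (- l)))\<^sup>2) \<le> C"
  shows "ips M f f \<le> C"
proof -
  have "infsum (\<lambda>i. (co f i)\<^sup>2) UNIV \<le> C"
  proof (rule infsum_le_finite_sums)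
    show "(\<lambda>i. (co f i)\<^sup>2) summable_on UNIV" using has_sum_imp_summable[OF parseval[OF f]] .
    fix F :: "(int \<times> nat) set" assume F: "finite F"
    obtain N where N: "\<And>i. i \<in> F \<Longrightarrow> \<bar>fst i\<bar> \<le> N"
    proof -
      have "bdd_above ((\<lambda>i. \<bar>fst i\<bar>) ` F)" using F by (intro bdd_above_finite) simp
      then show ?thesis using that by (auto simp: bdd_above_def)
    qed
    obtain K where K: "\<And>i. i \<in> F \<Longrightarrow> snd i < K"
    proof -
      have "finite (snd ` F)" using F by simp
      then show ?thesis using that by (auto simp: finite_nat_set_iff_bounded)
    qed
    have "(\<Sum>i\<in>F. (co f i)\<^sup>2) \<le> (\<Sum>i\<in>({0} \<union> {1..N} \<union> uminus ` {1..N}) \<times> {..<K}. (co f i)\<^sup>2)"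
    proof (rule sum_mono2)
      show "F \<subseteq> ({0} \<union> {1..N} \<union> uminus ` {1..N}) \<times> {..<K}"
      proof
        fix i assume i: "i \<in> F"
        obtain l n where ln: "i = (l, n)" by (cases i)
        have "\<bar>l\<bar> \<le> N" "n < K" using N[OF i] K[OF i] by (simp_all add: ln)
        moreover have "l \<in> uminus ` {1..N}" if "l < 0"
          using that \<open>\<bar>l\<bar> \<le> N\<close> by (intro image_eqI[of _ _ "- l"]) auto
        ultimately show "i \<in> ({0} \<union> {1..N} \<union> uminus ` {1..N}) \<times> {..<K}"
          unfolding ln by (cases "l = 0"; cases "l < 0") auto
      qed
    qed auto
    also have "\<dots> = (\<Sum>l\<in>{0} \<union> {1..N} \<union> uminus ` {1..N}. \<Sum>n<K. (cf (row f l) n)\<^sup>2)"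
      by (subst sum.cartesian_product) (auto intro!: sum.cong simp: cf_row f)
    also have "\<dots> \<le> (\<Sum>l\<in>{0} \<union> {1..N} \<union> uminus ` {1..N}. (norm (row f l))\<^sup>2)"
      by (intro sum_mono sum_sq_le_norm)
    also have "\<dots> = (\<Sum>l\<in>{1..N}. (norm (row f l))\<^sup>2 + (norm (row f (- l)))\<^sup>2)"
    proof -
      have "(\<Sum>l\<in>{0} \<union> ({1..N} \<union> uminus ` {1..N}). (norm (row f l))\<^sup>2) = (\<Sum>l\<in>{1..N} \<union> uminus ` {1..N}. (norm (row f l))\<^sup>2)"
        using z by (subst sum.union_disjoint) auto
      also have "\<dots> = (\<Sum>l\<in>{1..N}. (norm (row f l))\<^sup>2 + (norm (row f (- l)))\<^sup>2)"
        by (rule sum_symmetric)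
      finally show ?thesis by (simp add: Un_assoc)
    qed
    also have "\<dots> \<le> C" by (rule le)
    finally show "(\<Sum>i\<in>F. (co f i)\<^sup>2) \<le> C" .
  qed
  then show ?thesis using infsumI[OF parseval[OF f]] by simp
qed

lemma finite_low_modes: "finite {i. m i \<le> R}"
proof -
  obtain N :: int where N: "R < (\<alpha> * N)\<^sup>2" "N > 0"
  proof -
    obtain N :: nat where "sqrt (\<bar>R\<bar> + 1) / \<alpha> < real N" using reals_Archimedean2 by blast
    then have lt: "sqrt (\<bar>R\<bar> + 1) < \<alpha> * real N" using alpha by (simp add: field_simps)
    then have "(sqrt (\<bar>R\<bar> + 1))\<^sup>2 < (\<alpha> * real N)\<^sup>2" by (intro power_strict_mono) auto
    moreover have "N > 0" using lt by (cases N) (auto dest: order_trans[OF real_sqrt_ge_zero, rotated])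
    ultimately show ?thesis by (intro that[of "int N"]) auto
  qed
  obtain K :: nat where K: "R < K" using reals_Archimedean2 by blast
  have "{i. m i \<le> R} \<subseteq> {- N..N} \<times> {..K}"
  proof
    fix i assume "i \<in> {i. m i \<le> R}"
    obtain l n where i: "i = (l, n)" by (cases i)
    have R: "m (l, n) \<le> R" using \<open>i \<in> _\<close> by (simp add: i)
    have "\<bar>l\<bar> \<le> N"
    proof (rule ccontr)
      assume "\<not> \<bar>l\<bar> \<le> N"
      then have "(\<alpha> * N)\<^sup>2 \<le> (\<alpha> * \<bar>l\<bar>)\<^sup>2" using N alpha by (intro power_mono mult_left_mono) auto
      then show False using m_parts(1)[of l n] R N(1) by (simp add: power_mult_distrib)
    qed
    moreover have "n \<le> K"
    proof (rule ccontr)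
      assume "\<not> n \<le> K"
      have "real (Suc n) * 1 \<le> real (Suc n) * (pi / 2)" using pi_gt3 by (intro mult_left_mono) auto
      then have "1 \<le> om n" "real n \<le> om n" by (simp_all add: om_def)
      then have "om n * 1 \<le> (om n)\<^sup>2" unfolding power2_eq_square by (intro mult_left_mono) auto
      then show False using \<open>\<not> n \<le> K\<close> \<open>real n \<le> om n\<close> K R m_parts(2)[of n l] by linarith
    qed
    ultimately show "i \<in> {- N..N} \<times> {..K}" by (auto simp: i)
  qed
  then show ?thesis by (rule finite_subset) auto
qed

text \<open>Above the threshold R the weight 1 / m is at most 1 / R, so those modes are controlled
  by the L^2 norm of the vorticity; finitely many modes remain.\<close>

lemma vel_sq_le:
  assumes g: "L2 M g" and R: "R > 0" and C: "ips M g g \<le> C"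
  shows "vel_sq p g \<le> (\<Sum>i | m i \<le> R. (co g i)\<^sup>2 / m i) + C / R" and "0 \<le> vel_sq p g"
proof -
  let ?F = "{i. m i \<le> R}"
  show "0 \<le> vel_sq p g" using vel_sq_eq[OF g] by (rule has_sum_nonneg) (simp add: m_pos less_imp_le)
  have s: "((\<lambda>i. if i \<in> ?F then (co g i)\<^sup>2 / m i else 0) has_sum (\<Sum>i\<in>?F. (co g i)\<^sup>2 / m i)) UNIV"
    by (rule has_sum_cong_neutral[THEN iffD1, OF _ _ _ has_sum_finite[OF finite_low_modes]]) auto
  have t: "((\<lambda>i. (co g i)\<^sup>2 / R) has_sum ips M g g / R) UNIV"
    using has_sum_cmult_right[OF parseval[OF g], of "1 / R"] by simp
  have "vel_sq p g \<le> (\<Sum>i\<in>?F. (co g i)\<^sup>2 / m i) + ips M g g / R"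
  proof (rule has_sum_mono[OF vel_sq_eq[OF g] has_sum_add[OF s t]])
    fix i
    show "(co g i)\<^sup>2 / m i \<le> (if i \<in> ?F then (co g i)\<^sup>2 / m i else 0) + (co g i)\<^sup>2 / R"
      using R by (auto intro!: divide_left_mono mult_pos_pos simp: m_pos)
  qed
  also have "\<dots> \<le> (\<Sum>i\<in>?F. (co g i)\<^sup>2 / m i) + C / R" using C R by (intro add_left_mono divide_right_mono) auto
  finally show "vel_sq p g \<le> (\<Sum>i | m i \<le> R. (co g i)\<^sup>2 / m i) + C / R" .
qed

lemma row_reduced:
  assumes "L2 M f" "L2 M g" "l \<noteq> 0" and "\<And>i. co g i = (if m i = pi\<^sup>2 then 0 else co f i)"
  shows "row g l = red (\<alpha> * \<bar>l\<bar>) (row f l)"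
  using assms alpha by (intro ell2_eqI) (auto simp: cf_row cf_red m_def abs_if mm_def power_mult_distrib)

text \<open>Only finitely many l have \<open>mm\<close> at most 2 pi^2. For the others
  \<open>dd\<close> is at least 1 / (2 pi^2), and the constant equals that entry.\<close>

lemma uniform_gap:
  fixes \<delta> :: "int \<Rightarrow> real"
  assumes "\<And>l::int. l \<ge> 1 \<Longrightarrow> \<delta> l > 0 \<and> (dd (\<alpha> * l) 0 > 0 \<longrightarrow> \<delta> l = dd (\<alpha> * l) 0)"
  obtains \<epsilon> where "\<epsilon> > 0" "\<And>l. l \<ge> 1 \<Longrightarrow> \<epsilon> \<le> \<delta> l"
proof -
  have fin: "finite {l::int. l \<ge> 1 \<and> mm (\<alpha> * l) 0 \<le> 2 * pi\<^sup>2}" (is "finite ?F")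
  proof (rule finite_subset)
    show "?F \<subseteq> fst ` {i. m i \<le> 2 * pi\<^sup>2}"
    proof
      fix l assume "l \<in> ?F"
      then show "l \<in> fst ` {i. m i \<le> 2 * pi\<^sup>2}" by (intro image_eqI[of _ _ "(l, 0)"]) (auto simp: m_def)
    qed
  qed (intro finite_imageI finite_low_modes)
  define \<epsilon> where "\<epsilon> = Min (insert (1 / (2 * pi\<^sup>2)) (\<delta> ` ?F))"
  have "\<epsilon> > 0" unfolding \<epsilon>_def using fin assms by (subst Min_gr_iff) auto
  moreover have "\<epsilon> \<le> \<delta> l" if l: "l \<ge> 1" for l
  proof (cases "l \<in> ?F")
    case True
    then show ?thesis unfolding \<epsilon>_def using fin by (intro Min_le) auto
  next
    case False
    then have mm: "mm (\<alpha> * l) 0 > 2 * pi\<^sup>2" using l by simp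
    then have "1 / mm (\<alpha> * l) 0 \<le> 1 / (2 * pi\<^sup>2)" by (intro divide_left_mono) (auto simp: mm_pos)
    then have d: "1 / (2 * pi\<^sup>2) \<le> dd (\<alpha> * l) 0" by (simp add: dd_def)
    then have "\<delta> l = dd (\<alpha> * l) 0" using assms[OF l] by (smt (verit) divide_pos_pos mult_pos_pos pi_gt_zero zero_less_power)
    moreover have "\<epsilon> \<le> 1 / (2 * pi\<^sup>2)" unfolding \<epsilon>_def using fin by (intro Min_le) auto
    ultimately show ?thesis using d by simp
  qed
  ultimately show ?thesis by (rule that)
qed

theorem velocity_average_vanishes:
  assumes u: "upair \<beta> \<alpha> cr ci u1 u2" and sol: "weak_sol \<beta> p \<omega>" and init: "\<omega> 0 \<in> Ec \<beta> p"
    and g: "\<And>t. t \<ge> 0 \<Longrightarrow> L2 M (g t)"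
    and co_g: "\<And>t i. t \<ge> 0 \<Longrightarrow> co (g t) i = (if m i = pi\<^sup>2 then 0 else co (\<omega> t) i)"
  shows "((\<lambda>T. (1 / T) * integral {0..T} (\<lambda>t. vel_sq p (g t))) \<longlongrightarrow> 0) at_top"
proof -
  note L = flow_coefficients(1)[OF sol]
  have z: "row (g t) 0 = 0" if "t \<ge> 0" for t
    using flow_coefficients(2)[OF sol that] inX_iff[OF L[OF that]]
    by (intro ell2_eqI) (simp add: cf_row g that co_g)
  have rg: "row (g t) l = red (\<alpha> * l) (row (\<omega> t) l)" "row (g t) (- l) = red (\<alpha> * l) (row (\<omega> t) (- l))" if "t \<ge> 0" "l > 0" for t l
    using row_reduced[OF L[OF that(1)] g[OF that(1)] _ co_g[OF that(1)], of l]
      row_reduced[OF L[OF that(1)] g[OF that(1)] _ co_g[OF that(1)], of "- l"] that by simp_all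
  have mode: "(\<exists>\<delta>>0. (dd (\<alpha> * l) 0 > 0 \<longrightarrow> \<delta> = dd (\<alpha> * l) 0) \<and> (\<forall>t\<ge>0. \<delta> * ((norm (row (g t) l))\<^sup>2 + (norm (row (g t) (- l)))\<^sup>2)
        \<le> ((norm (row (\<omega> 0) l))\<^sup>2 + (norm (row (\<omega> 0) (- l)))\<^sup>2) / pi\<^sup>2)) \<and>
      (\<forall>n. ((\<lambda>T. (1 / T) * integral {0..T} (\<lambda>t. (co (g t) (l, n))\<^sup>2 + (co (g t) (- l, n))\<^sup>2)) \<longlongrightarrow> 0) at_top)"
    if l: "l > 0" for l :: int
  proof -
    define a where "a = \<alpha> * l"
    have "\<alpha> * 1 \<le> \<alpha> * l" using l alpha by (intro mult_left_mono) auto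
    then have a: "\<alpha> \<le> a" by (simp add: a_def)
    have P: "((\<lambda>t. row (\<omega> t) l) has_vector_derivative (- a) *\<^sub>R Aop \<beta> a (row (\<omega> t) (- l))) (at t within {0..})"
      and Q: "((\<lambda>t. row (\<omega> t) (- l)) has_vector_derivative a *\<^sub>R Aop \<beta> a (row (\<omega> t) l)) (at t within {0..})" if "t \<ge> 0" for t
      using flow_coefficients(4)[OF sol that, of l] flow_coefficients(4)[OF sol that, of "- l"]
      by (simp_all add: a_def Aop_even)
    have orth: "inner (Lo a u1) (row (\<omega> 0) l) = 0 \<and> inner (Lo a u2) (row (\<omega> 0) l) = 0 \<and>
        inner (Lo a u1) (row (\<omega> 0) (- l)) = 0 \<and> inner (Lo a u2) (row (\<omega> 0) (- l)) = 0"
      if "upair \<beta> a cr ci u1 u2" for cr ci u1 u2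
      using Ec_rows_orthogonal[OF init l] that by (auto simp: a_def)
    note md = mode_decay[OF u alpha a P Q orth]
    have "((\<lambda>T. (1 / T) * integral {0..T} (\<lambda>t. (co (g t) (l, n))\<^sup>2 + (co (g t) (- l, n))\<^sup>2)) \<longlongrightarrow> 0) at_top" for n
    proof -
      have "integral {0..T} (\<lambda>t. (co (g t) (l, n))\<^sup>2 + (co (g t) (- l, n))\<^sup>2) =
          integral {0..T} (\<lambda>t. (cf (red a (row (\<omega> t) l)) n)\<^sup>2 + (cf (red a (row (\<omega> t) (- l))) n)\<^sup>2)" for T
        by (rule integral_cong) (simp add: co_of_row g rg l a_def)
      then show ?thesis using md(2)[where k = n] by simp
    qed
    moreover have "\<exists>\<delta>>0. (dd (\<alpha> * l) 0 > 0 \<longrightarrow> \<delta> = dd (\<alpha> * l) 0) \<and> (\<forall>t\<ge>0. \<delta> * ((norm (row (g t) l))\<^sup>2 + (norm (row (g t) (- l)))\<^sup>2)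
        \<le> ((norm (row (\<omega> 0) l))\<^sup>2 + (norm (row (\<omega> 0) (- l)))\<^sup>2) / pi\<^sup>2)"
      using md(1) by (simp add: rg l a_def)
    ultimately show ?thesis by blast
  qed
  then have "\<forall>l::int. \<exists>\<delta>. l \<ge> 1 \<longrightarrow> \<delta> > 0 \<and> (dd (\<alpha> * l) 0 > 0 \<longrightarrow> \<delta> = dd (\<alpha> * l) 0) \<and> (\<forall>t\<ge>0. \<delta> * ((norm (row (g t) l))\<^sup>2 + (norm (row (g t) (- l)))\<^sup>2)
        \<le> ((norm (row (\<omega> 0) l))\<^sup>2 + (norm (row (\<omega> 0) (- l)))\<^sup>2) / pi\<^sup>2)" by force
  then obtain \<delta> where d: "\<And>l::int. l \<ge> 1 \<Longrightarrow> \<delta> l > 0 \<and> (dd (\<alpha> * l) 0 > 0 \<longrightarrow> \<delta> l = dd (\<alpha> * l) 0) \<and> (\<forall>t\<ge>0. \<delta> l * ((norm (row (g t) l))\<^sup>2 + (norm (row (g t) (- l)))\<^sup>2)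
        \<le> ((norm (row (\<omega> 0) l))\<^sup>2 + (norm (row (\<omega> 0) (- l)))\<^sup>2) / pi\<^sup>2)" by metis
  obtain \<epsilon> where e: "\<epsilon> > 0" "\<And>l. l \<ge> 1 \<Longrightarrow> \<epsilon> \<le> \<delta> l" using uniform_gap[of \<delta>] d by blast
  \<comment> \<open>The energy at time 0 is at most the squared norm over pi^2, since every entry of
    L is at most 1 / pi^2; epsilon is the coercivity constant common to all modes.\<close>
  define C where "C = ips M (\<omega> 0) (\<omega> 0) / (\<epsilon> * pi\<^sup>2)"
  have gC: "ips M (g t) (g t) \<le> C" if t: "t \<ge> 0" for t
  proof (rule norm_le_of_rows[OF g[OF t] z[OF t]])
    fix N :: int
    have "\<epsilon> * pi\<^sup>2 * ((norm (row (g t) l))\<^sup>2 + (norm (row (g t) (- l)))\<^sup>2) \<le> (norm (row (\<omega> 0) l))\<^sup>2 + (norm (row (\<omega> 0) (- l)))\<^sup>2"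
      if l: "l \<in> {1..N}" for l
    proof -
      have "\<epsilon> * ((norm (row (g t) l))\<^sup>2 + (norm (row (g t) (- l)))\<^sup>2) \<le> \<delta> l * ((norm (row (g t) l))\<^sup>2 + (norm (row (g t) (- l)))\<^sup>2)"
        using e(2)[of l] l by (intro mult_right_mono) auto
      also have "\<dots> \<le> ((norm (row (\<omega> 0) l))\<^sup>2 + (norm (row (\<omega> 0) (- l)))\<^sup>2) / pi\<^sup>2" using d[of l] l t by auto
      finally show ?thesis by (simp add: field_simps)
    qed
    then have "(\<Sum>l\<in>{1..N}. \<epsilon> * pi\<^sup>2 * ((norm (row (g t) l))\<^sup>2 + (norm (row (g t) (- l)))\<^sup>2))
        \<le> (\<Sum>l\<in>{1..N}. (norm (row (\<omega> 0) l))\<^sup>2 + (norm (row (\<omega> 0) (- l)))\<^sup>2)" by (rule sum_mono)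
    also have "\<dots> \<le> ips M (\<omega> 0) (\<omega> 0)" by (rule row_sums_le) (simp add: L)
    finally show "(\<Sum>l\<in>{1..N}. (norm (row (g t) l))\<^sup>2 + (norm (row (g t) (- l)))\<^sup>2) \<le> C"
      using e(1) by (simp add: C_def sum_distrib_left[symmetric] pos_le_divide_eq mult.commute)
  qed
  have C0: "C \<ge> 0" using gC[of 0] ips_nonneg[of M "g 0"] by simp
  have cont: "continuous_on {0..T} (\<lambda>t. (co (g t) i)\<^sup>2)" for i T
  proof -
    obtain l n where i: "i = (l, n)" by (cases i)
    have "continuous_on {0..T} (\<lambda>t. if m i = pi\<^sup>2 then 0 else (cf (row (\<omega> t) l) n)\<^sup>2)"
      using bounded_linear.continuous_on[OF bounded_linear_cf continuous_on_subset[OF flow_coefficients(3)[OF sol, of l]], of "{0..T}" n]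
      by (cases "m i = pi\<^sup>2") (auto intro!: continuous_intros)
    then show ?thesis
      by (rule continuous_on_cong[THEN iffD1, OF refl, rotated]) (auto simp: co_g co_of_row[OF L] i)
  qed
  have int: "(\<lambda>t. (co (g t) i)\<^sup>2) integrable_on {0..T}" for i T
    by (rule integrable_continuous_interval[OF cont])
  have avg: "((\<lambda>T. (1 / T) * integral {0..T} (\<lambda>t. (co (g t) i)\<^sup>2)) \<longlongrightarrow> 0) at_top" for i
  proof -
    obtain l n where i: "i = (l, n)" by (cases i)
    consider "l = 0" | k where "k > 0" "l = k \<or> l = - k" by (metis linorder_neqE neg_0_less_iff_less minus_minus)
    then show ?thesis
    proof cases
      case 1
      have "integral {0..T} (\<lambda>t. (co (g t) i)\<^sup>2) = integral {0..T} (\<lambda>t. 0 :: real)" for T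
        by (rule integral_cong) (simp add: i 1 co_of_row g z)
      then show ?thesis by simp
    next
      case 2
      show ?thesis
      proof (rule tendsto_sandwich[OF _ _ tendsto_const])
        show "((\<lambda>T. (1 / T) * integral {0..T} (\<lambda>t. (co (g t) (k, n))\<^sup>2 + (co (g t) (- k, n))\<^sup>2)) \<longlongrightarrow> 0) at_top"
          using mode[OF 2(1)] by blast
        show "\<forall>\<^sub>F T in at_top. 0 \<le> (1 / T) * integral {0..T} (\<lambda>t. (co (g t) i)\<^sup>2)"
          using eventually_gt_at_top[of 0]
          by eventually_elim (intro mult_nonneg_nonneg Henstock_Kurzweil_Integration.integral_nonneg[OF int]; simp)
        show "\<forall>\<^sub>F T in at_top. (1 / T) * integral {0..T} (\<lambda>t. (co (g t) i)\<^sup>2) \<le>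
            (1 / T) * integral {0..T} (\<lambda>t. (co (g t) (k, n))\<^sup>2 + (co (g t) (- k, n))\<^sup>2)"
          using eventually_gt_at_top[of 0]
        proof eventually_elim
          case (elim T)
          have "integral {0..T} (\<lambda>t. (co (g t) i)\<^sup>2) \<le> integral {0..T} (\<lambda>t. (co (g t) (k, n))\<^sup>2 + (co (g t) (- k, n))\<^sup>2)"
            using 2(2) by (intro integral_le int integrable_add) (auto simp: i)
          then show ?case using elim by (intro mult_left_mono) auto
        qed
      qed
    qed
  qed
  show ?thesis
  proof (rule tendstoI)
    fix e :: real assume "e > 0"
    \<comment> \<open>Chosen so that the high modes contribute less than e / 2 at every
      time.\<close>
    define R where "R = 2 * (C + 1) / e"
    have R: "R > 0" "C / R < e / 2" using \<open>e > 0\<close> C0 by (simp_all add: R_def field_simps)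
    define S where "S T = (\<Sum>i | m i \<le> R. 1 / m i * ((1 / T) * integral {0..T} (\<lambda>t. (co (g t) i)\<^sup>2)))" for T
    have "(S \<longlongrightarrow> (\<Sum>i | m i \<le> R. 1 / m i * 0)) at_top" unfolding S_def by (intro tendsto_intros avg)
    then have "\<forall>\<^sub>F T in at_top. dist (S T) 0 < e / 2" using \<open>e > 0\<close> by (intro tendstoD) auto
    then show "\<forall>\<^sub>F T in at_top. dist ((1 / T) * integral {0..T} (\<lambda>t. vel_sq p (g t))) 0 < e"
      using eventually_gt_at_top[of 0]
    proof eventually_elim
      case (elim T)
      define h where "h t = (\<Sum>i | m i \<le> R. (co (g t) i)\<^sup>2 / m i) + C / R" for t
      have hi: "(h has_integral (\<Sum>i | m i \<le> R. integral {0..T} (\<lambda>t. (co (g t) i)\<^sup>2) / m i) + C / R * T) {0..T}"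
        unfolding h_def[abs_def]
        using has_integral_const_real[of "C / R" 0 T] elim
        by (intro has_integral_add has_integral_sum finite_low_modes has_integral_divide integrable_integral int) (simp_all add: mult.commute)
      have b: "0 \<le> vel_sq p (g t) \<and> vel_sq p (g t) \<le> h t" if "t \<in> {0..T}" for t
        using vel_sq_le[OF g R(1) gC] that by (simp add: h_def)
      have "0 \<le> integral {0..T} (\<lambda>t. vel_sq p (g t)) \<and> integral {0..T} (\<lambda>t. vel_sq p (g t)) \<le> integral {0..T} h"
      \<comment> \<open>Integrability of the velocity norm in t is not established here; in the
        other case the integral has the default value 0 and the comparison with h holds as
        well.\<close>
      proof (cases "(\<lambda>t. vel_sq p (g t)) integrable_on {0..T}")
        case True
        then show ?thesis using b hi by (auto intro!: integral_nonneg integral_le simp: has_integral_integrable)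
      next
        case False
        have "integral {0..T} h \<ge> 0" using b hi by (intro integral_nonneg) (force simp: has_integral_integrable)+
        then show ?thesis using False by (simp add: not_integrable_integral)
      qed
      moreover have "(1 / T) * integral {0..T} h = S T + C / R"
        using elim by (simp add: integral_unique[OF hi] S_def sum_distrib_left distrib_left mult_ac)
      ultimately have "0 \<le> (1 / T) * integral {0..T} (\<lambda>t. vel_sq p (g t))"
        "(1 / T) * integral {0..T} (\<lambda>t. vel_sq p (g t)) \<le> S T + C / R"
        using elim by (auto intro!: mult_nonneg_nonneg) (metis divide_right_mono less_imp_le times_divide_eq_left mult_1)
      moreover have "S T < e / 2" using elim(1) by (simp add: dist_real_def)
      ultimately show ?case using R(2) unfolding dist_real_def diff_0_right by linarith
    qed
  qed
qed

end

section \<open>Unstable wave numbers\<close>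

text \<open>Meant for phi', about which the boundary value problem speaks only in the open interval;
  its values at the endpoints enter the bound as separate constants.\<close>

lemma bounded_of_bounded_derivative:
  fixes f f' :: "real \<Rightarrow> 'a::real_normed_vector"
  assumes d: "\<And>y. y \<in> {a<..<b} \<Longrightarrow> (f has_vector_derivative f' y) (at y)"
    and B: "\<And>y. y \<in> {a<..<b} \<Longrightarrow> norm (f' y) \<le> B"
  shows "\<exists>C. \<forall>y\<in>{a..b}. norm (f y) \<le> C"
proof (cases "a < b")
  case True
  define c where "c = (a + b) / 2"
  have c: "c \<in> {a<..<b}" using True by (simp add: c_def)
  have B0: "B \<ge> 0" using B[OF c] norm_ge_zero[of "f' c"] by linarith
  have "norm (f y - f c) \<le> B * norm (y - c)" if "y \<in> {a<..<b}" for y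
  proof (rule differentiable_bound[where S = "{a<..<b}" and f' = "\<lambda>x h. h *\<^sub>R f' x"])
    show "(f has_derivative (\<lambda>h. h *\<^sub>R f' x)) (at x within {a<..<b})" if "x \<in> {a<..<b}" for x
      using d[OF that] unfolding has_vector_derivative_def by (rule has_derivative_at_withinI)
    show "onorm (\<lambda>h. h *\<^sub>R f' x) \<le> B" if "x \<in> {a<..<b}" for x
    proof (rule onorm_le)
      show "norm (h *\<^sub>R f' x) \<le> B * norm h" for h
        using mult_right_mono[OF B[OF that], of "\<bar>h\<bar>"] by (simp add: mult.commute)
    qed
  qed (use that c in auto)
  moreover have "B * norm (y - c) \<le> B * (b - a)" if "y \<in> {a<..<b}" for y
    using that c B0 by (intro mult_left_mono) auto
  ultimately have in': "norm (f y) \<le> norm (f c) + B * (b - a)" if "y \<in> {a<..<b}" for y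
    using that norm_triangle_sub[of "f y" "f c"] by (smt (verit, best))
  show ?thesis
  proof (intro exI ballI)
    fix y assume "y \<in> {a..b}"
    then consider "y \<in> {a<..<b}" | "y = a" | "y = b" by fastforce
    then show "norm (f y) \<le> max (norm (f c) + B * (b - a)) (max (norm (f a)) (norm (f b)))"
      using in'[of y] by cases (simp_all add: le_max_iff_disj)
  qed
next
  case False
  then have "{a..b} \<subseteq> {a}" by auto
  then show ?thesis by (intro exI[of _ "norm (f a)"]) auto
qed

text \<open>G is the Wronskian of phi and \<open>sn n\<close>. Although phi' has no prescribed limit
  at the walls, it is bounded there, so both terms of G vanish at the ends and G is continuous up to
  them; its derivative is the integrand.\<close>

lemma sine_mode_identity:
  fixes \<phi> \<phi>' \<phi>'' q :: "real \<Rightarrow> complex"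
  assumes c: "continuous_on {-1..1} \<phi>" "\<phi> (-1) = 0" "\<phi> 1 = 0" and q: "continuous_on {-1..1} q"
    and d: "\<And>y. y \<in> {-1<..<1} \<Longrightarrow> (\<phi> has_vector_derivative \<phi>' y) (at y)"
      "\<And>y. y \<in> {-1<..<1} \<Longrightarrow> (\<phi>' has_vector_derivative q y) (at y)"
  shows "((\<lambda>y. (q y + of_real ((om n)\<^sup>2) * \<phi> y) * of_real (sn n y)) has_integral 0) {-1..1}"
proof -
  define G where "G y = \<phi>' y * of_real (sn n y) - \<phi> y * of_real (om n * cs n y)" for y
  have dG: "(G has_vector_derivative (q y + of_real ((om n)\<^sup>2) * \<phi> y) * of_real (sn n y)) (at y)" if y: "y \<in> {-1<..<1}" for y
  proof -
    have s: "((\<lambda>y. complex_of_real (sn n y)) has_vector_derivative of_real (om n * cs n y)) (at y)"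
      using sn_deriv[of n y] by (intro has_vector_derivative_of_real) (simp add: has_real_derivative_iff_has_vector_derivative)
    have "((\<lambda>y. om n * cs n y) has_real_derivative om n * (- (om n * sn n y))) (at y)"
      by (rule DERIV_cmult[OF cs_deriv])
    then have t: "((\<lambda>y. complex_of_real (om n * cs n y)) has_vector_derivative of_real (om n * (- (om n * sn n y)))) (at y)"
      by (intro has_vector_derivative_of_real) (simp only: has_real_derivative_iff_has_vector_derivative)
    show ?thesis unfolding G_def[abs_def]
      by (rule has_vector_derivative_eq_rhs[OF has_vector_derivative_diff[OF has_vector_derivative_mult[OF d(2)[OF y] s] has_vector_derivative_mult[OF d(1)[OF y] t]]])
        (simp add: algebra_simps power2_eq_square)
  qed
  obtain B where B: "\<And>y. y \<in> {-1..1} \<Longrightarrow> norm (q y) \<le> B"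
    using compact_imp_bounded[OF compact_continuous_image[OF q compact_Icc]] unfolding bounded_iff by blast
  obtain C where C: "\<And>y. y \<in> {-1..1} \<Longrightarrow> norm (\<phi>' y) \<le> C"
  proof -
    have "\<exists>C. \<forall>y\<in>{-1..1}. norm (\<phi>' y) \<le> C"
    proof (rule bounded_of_bounded_derivative[OF d(2)])
      show "norm (q y) \<le> B" if "y \<in> {-1<..<1}" for y using B[of y] that by simp
    qed
    then show ?thesis using that by blast
  qed
  define bd where "bd y = C * \<bar>sn n y\<bar> + om n * norm (\<phi> y)" for y
  have bdc: "continuous_on {-1..1} bd" unfolding bd_def
    by (intro continuous_intros c continuous_on_subset[OF sn_cs_continuous(1)]) auto
  have Gb: "norm (G y) \<le> bd y" if "y \<in> {-1..1}" for y
  proof -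
    have "norm (G y) \<le> norm (\<phi>' y) * \<bar>sn n y\<bar> + norm (\<phi> y) * (om n * \<bar>cs n y\<bar>)"
      unfolding G_def using om_pos[of n]
      by (intro order_trans[OF norm_triangle_ineq4]) (simp add: norm_mult)
    also have "\<dots> \<le> C * \<bar>sn n y\<bar> + norm (\<phi> y) * (om n * 1)"
      using C[OF that] om_pos[of n] sn_cs_bound(2)[of n y] by (intro add_mono mult_right_mono mult_left_mono) auto
    finally show ?thesis by (simp add: bd_def mult.commute)
  qed
  have "continuous (at y within {-1..1}) G" if y: "y \<in> {-1..1}" for y
  proof -
    consider "y \<in> {-1<..<1}" | "y = -1" | "y = 1" using y by fastforce
    then show ?thesis
    proof cases
      case 1
      show ?thesis
        by (rule continuous_at_imp_continuous_within[OF has_vector_derivative_continuous[OF dG[OF 1]]])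
    next
      case 2
      have "(bd \<longlongrightarrow> bd y) (at y within {-1..1})" using bdc that by (simp add: continuous_on_def)
      then have "(bd \<longlongrightarrow> 0) (at y within {-1..1})" by (simp add: bd_def 2 sn_boundary c)
      then have "(G \<longlongrightarrow> 0) (at y within {-1..1})"
        by (rule Lim_null_comparison[rotated]) (use Gb in \<open>auto simp: eventually_at_filter\<close>)
      then show ?thesis by (simp add: continuous_within G_def 2 sn_boundary c)
    next
      case 3
      have "(bd \<longlongrightarrow> bd y) (at y within {-1..1})" using bdc that by (simp add: continuous_on_def)
      then have "(bd \<longlongrightarrow> 0) (at y within {-1..1})" by (simp add: bd_def 3 sn_boundary c)
      then have "(G \<longlongrightarrow> 0) (at y within {-1..1})"
        by (rule Lim_null_comparison[rotated]) (use Gb in \<open>auto simp: eventually_at_filter\<close>)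
      then show ?thesis by (simp add: continuous_within G_def 3 sn_boundary c)
    qed
  qed
  then have "continuous_on {-1..1} G" by (simp add: continuous_on_eq_continuous_within)
  from fundamental_theorem_of_calculus_interior[OF _ this dG] show ?thesis
    by (simp add: G_def sn_boundary c)
qed

section \<open>From the boundary value problem to an eigenpair\<close>

context wave
begin

text \<open>Independent of x and clamped beyond [-1, 1], hence continuous on the plane. Row 0 of
  such a function carries the one-dimensional sine coefficients up to a constant factor, so the
  facts about the channel apply to functions of y.\<close>

definition ext :: "(real \<Rightarrow> real) \<Rightarrow> real \<times> real \<Rightarrow> real" where
  "ext f z = f (max (-1) (min 1 (snd z)))"

lemma ext_continuous:
  assumes "continuous_on {-1..1} f"
  shows "continuous_on UNIV (ext f)"
proof -
  have "continuous_on (UNIV :: (real \<times> real) set) (\<lambda>z. max (-1) (min 1 (snd z)) :: real)" by (intro continuous_intros)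
  then show ?thesis unfolding ext_def[abs_def] by (rule continuous_on_compose2[OF assms]) auto
qed

lemma ext_L2: "continuous_on {-1..1} f \<Longrightarrow> L2 M (ext f)"
  by (intro continuous_L2 ext_continuous)

lemma const_slice: "(LINT x:{0..p}|lborel. k) = p * (k :: real)"
  using p_pos by (simp add: set_lebesgue_integral_def)

lemma co_ext_eq_0:
  assumes f: "continuous_on {-1..1} f" and z: "((\<lambda>y. f y * sn n y) has_integral 0) {-1..1}"
  shows "co (ext f) (0, n) = 0"
proof -
  define k where "k = p * tr 0 0"
  have "co (ext f) (0, n) = (LINT y:{-1..1}|lborel. LINT x:{0..p}|lborel. ext f (x, y) * eb (0, n) (x, y))"
    unfolding co_def ips_def by (intro fubini_continuous(2) continuous_on_mult ext_continuous f eb_continuous)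
  also have "\<dots> = (LINT y:{-1..1}|lborel. LINT x:{0..p}|lborel. tr 0 0 * (f y * sn n y))"
    by (rule set_lebesgue_integral_cong) (auto simp: ext_def eb_def tr_def mult_ac intro!: set_lebesgue_integral_cong)
  also have "\<dots> = k * (LINT y:{-1..1}|lborel. f y * sn n y)"
    unfolding const_slice k_def by (simp add: mult.assoc)
  also have "(LINT y:{-1..1}|lborel. f y * sn n y) = integral {-1..1} (\<lambda>y. f y * sn n y)"
    by (intro set_borel_integral_eq_integral borel_integrable_atLeastAtMost' continuous_on_mult f
        continuous_on_subset[OF sn_cs_continuous(1)]) auto
  finally show ?thesis using integral_unique[OF z] by simp
qed

text \<open>By \<open>inX_iff\<close> the x-average, which is p f, vanishes almost everywhere in the
  interval, and continuity removes the exceptional set.\<close>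

lemma ext_eq_0:
  assumes f: "continuous_on {-1..1} f" and z: "\<And>n. co (ext f) (0, n) = 0" and y: "y \<in> {-1<..<1}"
  shows "f y = 0"
proof -
  have "inX p (ext f)" using z by (simp add: inX_iff[OF ext_L2[OF f]])
  then have "AE y in lborel. y \<in> {-1..1} \<longrightarrow> (LINT x:{0..p}|lborel. ext f (x, y)) = 0" by (simp add: inX_def)
  then have ae: "AE y in lborel. y \<in> {-1<..<1} \<longrightarrow> ext f (0, y) = 0"
  proof eventually_elim
    case (elim y)
    show ?case
    proof
      assume "y \<in> {-1<..<1}"
      then have "(LINT x:{0..p}|lborel. ext f (0, y)) = 0" using elim by (simp add: ext_def)
      then show "ext f (0, y) = 0" using p_pos by (simp add: const_slice)
    qed
  qed
  have cont: "continuous_on UNIV (\<lambda>y. ext f (0, y))"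
    by (rule continuous_on_compose2[OF ext_continuous[OF f]]) (auto intro!: continuous_intros)
  have "y \<in> {y. ext f (0, y) = 0}"
  proof (rule mem_closed_if_AE_lebesgue_open[OF open_greaterThanLessThan _ _ y])
    show "closed {y. ext f (0, y) = 0}" using cont by (intro closed_Collect_eq) auto
    show "AE y\<in>{-1<..<1} in lebesgue. y \<in> {y. ext f (0, y) = 0}" using AE_completion[OF ae] by simp
  qed
  then show ?thesis using y by (simp add: ext_def)
qed

lemma row_cong:
  assumes "\<And>z. z \<in> Omega p \<Longrightarrow> f z = g z"
  shows "row f l = row g l"
proof -
  have "co f i = co g i" for i
    unfolding co_def ips_def using assms by (intro Bochner_Integration.integral_cong) (auto simp: space_M)
  then show ?thesis by (simp add: row_def)
qed

text \<open>The boundary value problem says that the vorticity omega = alpha^2 phi - phi'' satisfies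
  K (omega / pi^2 - phi) = z omega. Since phi solves the Dirichlet problem for omega, the bracket is
  L omega, and this is A omega = z omega.\<close>

theorem upair_of_unstable_wn:
  assumes "unstable_wn \<beta> \<alpha>"
  obtains cr ci u1 u2 where "upair \<beta> \<alpha> cr ci u1 u2"
proof -
  obtain c :: complex and \<phi> \<phi>' \<phi>'' y0 where c: "Im c > 0" and cont: "continuous_on {-1..1} \<phi>"
    and bd: "\<phi> (-1) = 0" "\<phi> 1 = 0" and y0: "y0 \<in> {-1<..<1}" "\<phi> y0 \<noteq> 0"
    and ode: "\<And>y. y \<in> {-1<..<1} \<Longrightarrow> (\<phi> has_vector_derivative \<phi>' y) (at y) \<and> (\<phi>' has_vector_derivative \<phi>'' y) (at y) \<and>
            - \<phi>'' y + complex_of_real (\<alpha>\<^sup>2) * \<phi> y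
              - (complex_of_real (\<beta> - Upp y) / (complex_of_real (U y) - c)) * \<phi> y = 0"
    using assms unfolding unstable_wn_def by blast
  \<comment> \<open>The wave speed in the frame moving with U_beta, where U - U_beta = (beta - U'')
    / pi^2; the shift is real, so the imaginary part is that of c.\<close>
  define z where "z = c - complex_of_real (1 / 2 - \<beta> / pi\<^sup>2)"
  have Uc: "complex_of_real (U y) - c = complex_of_real (Kf \<beta> y / pi\<^sup>2) - z" for y
    unfolding z_def Kf_eq U_def by (simp add: field_simps)
  have nz: "complex_of_real (Kf \<beta> y / pi\<^sup>2) - z \<noteq> 0" for y
  proof
    assume "complex_of_real (Kf \<beta> y / pi\<^sup>2) - z = 0"
    then have "Im (complex_of_real (Kf \<beta> y / pi\<^sup>2) - z) = 0" by simp
    then show False using c by (simp add: z_def)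
  qed
  define \<omega> where "\<omega> y = complex_of_real (Kf \<beta> y) / (complex_of_real (Kf \<beta> y / pi\<^sup>2) - z) * \<phi> y" for y
  have wc: "continuous_on {-1..1} \<omega>" unfolding \<omega>_def
    by (intro continuous_intros cont continuous_on_subset[OF Kf_continuous]) (use nz in auto)
  have alg: "complex_of_real (Kf \<beta> y) * (\<omega> y / complex_of_real (pi\<^sup>2) - \<phi> y) = z * \<omega> y" for y
  proof -
    have "complex_of_real (Kf \<beta> y) * \<phi> y = (complex_of_real (Kf \<beta> y / pi\<^sup>2) - z) * \<omega> y" unfolding \<omega>_def using nz[of y] by simp
    then show ?thesis by (simp add: algebra_simps)
  qed
  have int: "((\<lambda>y. (complex_of_real (\<alpha>\<^sup>2) * \<phi> y - \<omega> y + of_real ((om n)\<^sup>2) * \<phi> y) * of_real (sn n y)) has_integral 0) {-1..1}" for n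
  proof (rule sine_mode_identity[OF cont bd])
    show "continuous_on {-1..1} (\<lambda>y. complex_of_real (\<alpha>\<^sup>2) * \<phi> y - \<omega> y)" by (intro continuous_intros cont wc)
    show "(\<phi> has_vector_derivative \<phi>' y) (at y)" if "y \<in> {-1<..<1}" for y using ode[OF that] by blast
    show "(\<phi>' has_vector_derivative complex_of_real (\<alpha>\<^sup>2) * \<phi> y - \<omega> y) (at y)" if "y \<in> {-1<..<1}" for y
    proof -
      have "\<phi>'' y = complex_of_real (\<alpha>\<^sup>2) * \<phi> y - \<omega> y"
        using ode[OF that] unfolding Uc Kf_def[symmetric] \<omega>_def[symmetric] by (simp add: algebra_simps)
      then show ?thesis using ode[OF that] by metis
    qed
  qed
  define fr fi wr wi where "fr y = Re (\<phi> y)" and "fi y = Im (\<phi> y)" and "wr y = Re (\<omega> y)" and "wi y = Im (\<omega> y)" for y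
  have cr: "continuous_on {-1..1} fr" "continuous_on {-1..1} fi" "continuous_on {-1..1} wr" "continuous_on {-1..1} wi"
    unfolding fr_def fi_def wr_def wi_def by (intro continuous_intros cont wc)+
  have coeffs: "co (ext w) (0, n) = mm \<alpha> n * co (ext f) (0, n)"
    if "continuous_on {-1..1} f" "continuous_on {-1..1} w"
      and "((\<lambda>y. (\<alpha>\<^sup>2 * f y - w y + (om n)\<^sup>2 * f y) * sn n y) has_integral 0) {-1..1}" for f w n
  proof -
    have "co (ext (\<lambda>y. mm \<alpha> n * f y - w y)) (0, n) = 0"
    proof (rule co_ext_eq_0)
      show "continuous_on {-1..1} (\<lambda>y. mm \<alpha> n * f y - w y)" by (intro continuous_intros that)
      show "((\<lambda>y. (mm \<alpha> n * f y - w y) * sn n y) has_integral 0) {-1..1}"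
      proof -
        have "mm \<alpha> n = \<alpha>\<^sup>2 + (om n)\<^sup>2" by (simp add: mm_def om_def power_mult_distrib power_divide)
        then have e: "(mm \<alpha> n * f y - w y) * sn n y = (\<alpha>\<^sup>2 * f y - w y + (om n)\<^sup>2 * f y) * sn n y" for y
          by (simp add: algebra_simps)
        show ?thesis unfolding e by (rule that(3))
      qed
    qed
    moreover have "ext (\<lambda>y. mm \<alpha> n * f y - w y) = (\<lambda>z. mm \<alpha> n * ext f z - ext w z)" by (simp add: ext_def fun_eq_iff)
    ultimately show ?thesis by (simp add: co_diff L2_cmult ext_L2 that co_cmult)
  qed
  have cw: "co (ext wr) (0, n) = mm \<alpha> n * co (ext fr) (0, n)" "co (ext wi) (0, n) = mm \<alpha> n * co (ext fi) (0, n)" for n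
    using has_integral_Re[OF int[of n]] has_integral_Im[OF int[of n]]
    by (intro coeffs cr; simp add: fr_def fi_def wr_def wi_def)+
  have Lo_row: "Lo \<alpha> (row (ext w) 0) = row (\<lambda>z. 1 / pi\<^sup>2 * ext w z - ext f z) 0"
    if "continuous_on {-1..1} f" "continuous_on {-1..1} w" "\<And>n. co (ext w) (0, n) = mm \<alpha> n * co (ext f) (0, n)" for f w
  proof (rule ell2_eqI)
    fix n
    have "co (ext f) (0, n) = co (ext w) (0, n) / mm \<alpha> n" using that(3)[of n] mm_pos[of \<alpha> n] by simp
    moreover have "co (\<lambda>z. 1 / pi\<^sup>2 * ext w z - ext f z) (0, n) = 1 / pi\<^sup>2 * co (ext w) (0, n) - co (ext f) (0, n)"
      unfolding co_diff[OF L2_cmult[OF ext_L2[OF that(2)]] ext_L2[OF that(1)]] co_cmult ..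
    moreover have "L2 M (\<lambda>z. 1 / pi\<^sup>2 * ext w z - ext f z)" by (intro L2_diff L2_cmult ext_L2 that)
    from cf_row[OF this]
    have "cf (row (\<lambda>z. 1 / pi\<^sup>2 * ext w z - ext f z) 0) n = co (\<lambda>z. 1 / pi\<^sup>2 * ext w z - ext f z) (0, n)" .
    ultimately show "cf (Lo \<alpha> (row (ext w) 0)) n = cf (row (\<lambda>z. 1 / pi\<^sup>2 * ext w z - ext f z) 0) n"
      using cf_row[OF ext_L2[OF that(2)], of 0 n] by (simp only: cf_Lo dd_def left_diff_distrib) simp
  qed
  have Aop_row: "Aop \<beta> \<alpha> (row (ext w) 0) = row (\<lambda>z. Kf \<beta> (snd z) * (1 / pi\<^sup>2 * ext w z - ext f z)) 0"
    if "continuous_on {-1..1} f" "continuous_on {-1..1} w" "\<And>n. co (ext w) (0, n) = mm \<alpha> n * co (ext f) (0, n)" for f w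
    unfolding Aop_def Lo_row[OF that] by (intro row_Kf[symmetric] L2_diff L2_cmult ext_L2 that)
  have "row (\<lambda>z. Kf \<beta> (snd z) * (1 / pi\<^sup>2 * ext wr z - ext fr z)) 0 = row (\<lambda>x. Re z * ext wr x - Im z * ext wi x) 0"
    "row (\<lambda>z. Kf \<beta> (snd z) * (1 / pi\<^sup>2 * ext wi z - ext fi z)) 0 = row (\<lambda>x. Im z * ext wr x + Re z * ext wi x) 0"
  proof -
    have "Kf \<beta> y * (1 / pi\<^sup>2 * wr y - fr y) = Re z * wr y - Im z * wi y"
      "Kf \<beta> y * (1 / pi\<^sup>2 * wi y - fi y) = Im z * wr y + Re z * wi y" for y
      using arg_cong[OF alg[of y], of Re] arg_cong[OF alg[of y], of Im]
      by (simp_all add: fr_def fi_def wr_def wi_def)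
    then show "row (\<lambda>z. Kf \<beta> (snd z) * (1 / pi\<^sup>2 * ext wr z - ext fr z)) 0 = row (\<lambda>x. Re z * ext wr x - Im z * ext wi x) 0"
      "row (\<lambda>z. Kf \<beta> (snd z) * (1 / pi\<^sup>2 * ext wi z - ext fi z)) 0 = row (\<lambda>x. Im z * ext wr x + Re z * ext wi x) 0"
      by (intro row_cong; auto simp: ext_def Omega_def)+
  qed
  then have A: "Aop \<beta> \<alpha> (row (ext wr) 0) = Re z *\<^sub>R row (ext wr) 0 - Im z *\<^sub>R row (ext wi) 0"
    "Aop \<beta> \<alpha> (row (ext wi) 0) = Im z *\<^sub>R row (ext wr) 0 + Re z *\<^sub>R row (ext wi) 0"
    using Aop_row[OF cr(1,3) cw(1)] Aop_row[OF cr(2,4) cw(2)]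
    by (simp_all add: row_diff row_add row_cmult L2_cmult ext_L2 cr)
  have "row (ext wr) 0 \<noteq> 0 \<or> row (ext wi) 0 \<noteq> 0"
  proof (rule ccontr)
    assume "\<not> ?thesis"
    then have "co (ext wr) (0, n) = 0" "co (ext wi) (0, n) = 0" for n
      by (simp_all add: co_of_row ext_L2 cr)
    then have "co (ext fr) (0, n) = 0" "co (ext fi) (0, n) = 0" for n
      using cw[of n] mm_pos[of \<alpha> n] by simp_all
    then have "fr y0 = 0" "fi y0 = 0" using y0(1) cr by (auto intro: ext_eq_0)
    then show False using y0(2) by (simp add: fr_def fi_def complex_eq_iff)
  qed
  moreover have "Im z \<noteq> 0" using c by (simp add: z_def)
  ultimately show ?thesis using A that[of "Re z" "Im z"] by (auto simp: upair_def)
qed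

end

lemma sn_0: "sn 0 y = cos (pi * y / 2)"
proof -
  have "pi * (y + 1) / 2 = pi * y / 2 + pi / 2" by (simp add: field_simps)
  then have "sn 0 y = sin (pi * y / 2 + pi / 2)" unfolding sn_def by (simp only: of_nat_Suc of_nat_0 add_0_right mult_1)
  then show ?thesis by (simp add: sin_add)
qed

context wave
begin

text \<open>For l \<noteq> 0 every entry with n >= 1 exceeds pi^2, and for n = 0 the equation reads
  (alpha l)^2 = 3 pi^2 / 4.\<close>

lemma m_eq_pi_iff:
  assumes "l \<noteq> 0"
  shows "m (l, n) = pi\<^sup>2 \<longleftrightarrow> n = 0 \<and> \<bar>\<alpha> * l\<bar> = sqrt 3 * pi / 2"
proof -
  have e: "m (l, n) = mm \<bar>\<alpha> * l\<bar> n" by (simp add: m_def mm_def)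
  have "\<bar>\<alpha> * l\<bar> > 0" using assms alpha by simp
  then have "n = 0" if "mm \<bar>\<alpha> * l\<bar> n = pi\<^sup>2" using mm_gt[of "\<bar>\<alpha> * l\<bar>" n] that by (cases n) auto
  moreover have "mm \<bar>\<alpha> * l\<bar> 0 = pi\<^sup>2 \<longleftrightarrow> \<bar>\<alpha> * l\<bar> = sqrt 3 * pi / 2"
  proof -
    have "mm \<bar>\<alpha> * l\<bar> 0 = pi\<^sup>2 \<longleftrightarrow> \<bar>\<alpha> * l\<bar>\<^sup>2 = (sqrt 3 * pi / 2)\<^sup>2"
      by (auto simp: mm_def power_mult_distrib power_divide)
    also have "\<dots> \<longleftrightarrow> \<bar>\<alpha> * l\<bar> = sqrt 3 * pi / 2" by (intro power2_eq_iff_nonneg) auto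
    finally show ?thesis .
  qed
  ultimately show ?thesis unfolding e by blast
qed

text \<open>\<open>ekc\<close> and \<open>eks\<close> are the same multiple c of two unit basis
  functions, and c cancels in the quotients of \<open>P1\<close>.\<close>

lemma P1_eq:
  assumes l: "l > 0" "\<alpha> * l = sqrt 3 * pi / 2" and w: "L2 M w"
  shows "P1 p w = (\<lambda>z. co w (l, 0) * eb (l, 0) z + co w (- l, 0) * eb (- l, 0) z)"
proof -
  define c where "c = 1 / sqrt (\<alpha> / pi)"
  have s: "sqrt (\<alpha> / pi) > 0" using alpha by simp
  have e: "ekc = (\<lambda>z. c * eb (l, 0) z)" "eks = (\<lambda>z. c * eb (- l, 0) z)"
    unfolding ekc_def eks_def l(2)[symmetric] using l(1) s by (auto simp: eb_def tr_def sn_0 c_def fun_eq_iff)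
  have i: "ip p ekc ekc = c\<^sup>2" "ip p eks eks = c\<^sup>2"
    unfolding ip_eq e ips_cmult ips_cmult_right eb_orthonormal by (simp_all add: power2_eq_square)
  have j: "ip p w ekc = c * co w (l, 0)" "ip p w eks = c * co w (- l, 0)"
    unfolding ip_eq e ips_cmult_right co_def by simp_all
  have "c \<noteq> 0" using s alpha by (simp add: c_def)
  then show ?thesis unfolding P1_def i j by (simp add: e fun_eq_iff power2_eq_square)
qed

lemma averages:
  assumes u: "unstable_wn \<beta> \<alpha>" and sol: "weak_sol \<beta> p \<omega>" and init: "\<omega> 0 \<in> Ec \<beta> p"
  shows "(\<forall>l::int. \<bar>\<alpha> * l\<bar> \<noteq> sqrt 3 * pi / 2) \<Longrightarrow>
      ((\<lambda>T. (1 / T) * integral {0..T} (\<lambda>t. vel_sq p (\<omega> t))) \<longlongrightarrow> 0) at_top"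
    and "(\<exists>l::int. \<bar>\<alpha> * l\<bar> = sqrt 3 * pi / 2) \<Longrightarrow>
      ((\<lambda>T. (1 / T) * integral {0..T} (\<lambda>t. vel_sq p (\<lambda>z. \<omega> t z - P1 p (\<omega> t) z))) \<longlongrightarrow> 0) at_top"
proof -
  obtain cr ci u1 u2 where up: "upair \<beta> \<alpha> cr ci u1 u2" by (rule upair_of_unstable_wn[OF u])
  note L = flow_coefficients(1)[OF sol]
  have z: "co (\<omega> t) (0, n) = 0" if "t \<ge> 0" for t n
    using flow_coefficients(2)[OF sol that] inX_iff[OF L[OF that]] by blast
  show "((\<lambda>T. (1 / T) * integral {0..T} (\<lambda>t. vel_sq p (\<omega> t))) \<longlongrightarrow> 0) at_top"
    if nr: "\<forall>l::int. \<bar>\<alpha> * l\<bar> \<noteq> sqrt 3 * pi / 2"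
  proof (rule velocity_average_vanishes[OF up sol init L])
    fix t :: real and i :: "int \<times> nat" assume t: "t \<ge> 0"
    obtain l n where i: "i = (l, n)" by (cases i)
    \<comment> \<open>For l = 0 the entry \<open>m (0, 1)\<close> also equals pi^2, but there the
      coefficients vanish because the x-average is zero.\<close>
    show "co (\<omega> t) i = (if m i = pi\<^sup>2 then 0 else co (\<omega> t) i)"
      using z[OF t, of n] m_eq_pi_iff[of l n] nr by (cases "l = 0") (auto simp: i)
  qed
  show "((\<lambda>T. (1 / T) * integral {0..T} (\<lambda>t. vel_sq p (\<lambda>z. \<omega> t z - P1 p (\<omega> t) z))) \<longlongrightarrow> 0) at_top"
    if r: "\<exists>l::int. \<bar>\<alpha> * l\<bar> = sqrt 3 * pi / 2"
  proof -
    obtain l' :: int where l': "\<bar>\<alpha> * l'\<bar> = sqrt 3 * pi / 2" using r by blast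
    define k where "k = \<bar>l'\<bar>"
    have k: "\<alpha> * k = sqrt 3 * pi / 2" using l' alpha by (simp add: k_def abs_mult)
    have k0: "k > 0"
    proof (rule ccontr)
      assume "\<not> k > 0"
      then have "k = 0" by (simp add: k_def)
      then show False using k by simp
    qed
    have iff: "\<bar>\<alpha> * l\<bar> = sqrt 3 * pi / 2 \<longleftrightarrow> l = k \<or> l = - k" for l :: int
    proof -
      have "\<bar>\<alpha> * l\<bar> = sqrt 3 * pi / 2 \<longleftrightarrow> \<alpha> * \<bar>l\<bar> = \<alpha> * k" unfolding k using alpha by (simp add: abs_mult)
      also have "\<dots> \<longleftrightarrow> real_of_int \<bar>l\<bar> = real_of_int k" using alpha by simp
      also have "\<dots> \<longleftrightarrow> \<bar>l\<bar> = k" by (rule of_int_eq_iff)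
      finally show ?thesis using k0 by linarith
    qed
    show ?thesis
    proof (rule velocity_average_vanishes[OF up sol init])
      fix t :: real assume t: "t \<ge> 0"
      note P1 = P1_eq[OF k0 k L[OF t]]
      have LP: "L2 M (P1 p (\<omega> t))" unfolding P1 by (intro L2_add L2_cmult eb_L2)
      show "L2 M (\<lambda>z. \<omega> t z - P1 p (\<omega> t) z)" by (intro L2_diff L[OF t] LP)
      fix i :: "int \<times> nat"
      obtain l n where i: "i = (l, n)" by (cases i)
      have "co (\<lambda>z. \<omega> t z - P1 p (\<omega> t) z) i = co (\<omega> t) i - (co (\<omega> t) (k, 0) * co (eb (k, 0)) i + co (\<omega> t) (- k, 0) * co (eb (- k, 0)) i)"
        unfolding co_diff[OF L[OF t] LP] unfolding P1 co_add[OF L2_cmult[OF eb_L2] L2_cmult[OF eb_L2]] co_cmult ..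
      then show "co (\<lambda>z. \<omega> t z - P1 p (\<omega> t) z) i = (if m i = pi\<^sup>2 then 0 else co (\<omega> t) i)"
        using z[OF t, of n] m_eq_pi_iff[of l n] iff[of l] k0 by (cases "l = 0") (auto simp: i co_eb)
    qed
  qed
qed

end

theorem theorem6p2:
  fixes \<beta> \<alpha> :: real
  assumes "\<alpha> > 0" and "unstable_wn \<beta> \<alpha>"
  shows "((\<forall>l::int. \<bar>\<alpha> * of_int l\<bar> \<noteq> sqrt 3 * pi / 2) \<longrightarrow>
           (\<forall>\<omega>. weak_sol \<beta> (2 * pi / \<alpha>) \<omega> \<and> \<omega> 0 \<in> Ec \<beta> (2 * pi / \<alpha>) \<longrightarrow>
              ((\<lambda>T. (1 / T) * integral {0..T} (\<lambda>t. vel_sq (2 * pi / \<alpha>) (\<omega> t))) \<longlongrightarrow> 0) at_top)) \<and>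
         ((\<exists>l::int. \<bar>\<alpha> * of_int l\<bar> = sqrt 3 * pi / 2) \<longrightarrow>
           (\<forall>\<omega>. weak_sol \<beta> (2 * pi / \<alpha>) \<omega> \<and> \<omega> 0 \<in> Ec \<beta> (2 * pi / \<alpha>) \<longrightarrow>
              ((\<lambda>T. (1 / T) * integral {0..T}
                  (\<lambda>t. vel_sq (2 * pi / \<alpha>) (\<lambda>z. \<omega> t z - P1 (2 * pi / \<alpha>) (\<omega> t) z))) \<longlongrightarrow> 0) at_top))"
proof -
  interpret wave \<alpha> by unfold_locales (rule assms)
  show ?thesis
    using averages[OF assms(2)] unfolding p_def by blast
qed

end
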